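(* Let $G_1$ be a Carnot group with identity $e$, let $G_2$ be a step-$2$ Carnot group of topological dimension $\nu_2$, let $\Omega\subset G_1$ be open, let $q\ge2$, and let $f\in W^{1,q}(\Omega;G_2)$. Let $\eta_\varepsilon$ be the mollifiers on $G_1$ described in the context (smooth, supported in $B(e,\varepsilon)$, $\int_{G_1}\eta_\varepsilon=1$), and let $$f_\varepsilon(x)=(f*\eta_\varepsilon)(x)=\int_{G_1} f(y)\,\eta_\varepsilon(y^{-1}x)\,dy ,$$ which for $B(x_0,2r)\subset\Omega$ and $0<\varepsilon<r$ is defined on $B(x_0,r)$. Then, as $\varepsilon\to0$, $$D_Hf_\varepsilon\to D_Hf\quad\text{in } L^{\frac{q}{2}}_{loc}(\Omega;\mathbb{R}^{\nu_2}),$$ where the convergence is with respect to the Euclidean norm on $\mathbb{R}^{\nu_2}$; that is, for every left-invariant horizontal vector field $X$ on $G_1$, the $\mathbb{R}^{\nu_2}$-valued functions $D_Hf_\varepsilon(X)$ converge to $D_Hf(X)$ in $L^{q/2}_{loc}(\Omega)$.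
   Context: A Carnot group is a simply connected nilpotent Lie group $G$ whose Lie algebra is stratified, $\mathfrak g=\mathfrak g^{[1]}\oplus\cdots\oplus\mathfrak g^{[s]}$ with $[\mathfrak g^{[1]},\mathfrak g^{[k]}]=\mathfrak g^{[k+1]}$ ($\mathfrak g^{[k]}=0$ for $k>s$; $s$ is the step), with an inner product on $\mathfrak g$ making the layers orthogonal. It carries the left-invariant sub-Riemannian (Carnot–Carathéodory) distance $d$ (infimum of lengths of horizontal curves, i.e. curves tangent to $\mathfrak g^{[1]}$), with balls $B(x,r)$, and dilations $\delta_\lambda$ acting on $\mathfrak g^{[k]}$ by $\lambda^k$. The homogeneous dimension is $\sum_k k\dim\mathfrak g^{[k]}$. Integration is with respect to Haar measure. $f\in W^{1,q}(\Omega;G_2)$ is understood in the usual metric sense: for $z\in G_2$ the function $x\mapsto d(z,f(x))$ is in $L^q_{loc}(\Omega)$ with weak horizontal gradient bounded a.e. by one function $g\in L^q(\Omega)$ independent of $z$. $G_2$ is identified with $\mathbb{R}^{\nu_2}$ by exponential coordinates of the first kind, and $f*\eta_\varepsilon$ is computed coordinatewise. Mollifiers: with $\nu_1$ the homogeneous dimension of $G_1$, $\eta_\varepsilon(x)=\varepsilon^{-\nu_1}\eta(\delta_{1/\varepsilon}x)$ for a fixed smooth $\eta$ supported in $B(e,1)$ with $\int_{G_1}\eta=1$. Let $\theta_1,\dots,\theta_{\nu_2}$ be the left-invariant coframe of $G_2$ adapted to the stratification: the forms $dx_j$ for the first-layer coordinates $x_j$, and the contact forms $\omega$ (left-invariant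 one-forms dual to the second layer). For a smooth map $g$ into $G_2$ and a left-invariant horizontal $X$, $D_Hg(X)=\big((g^*\theta_a)(X)\big)_{a=1}^{\nu_2}$. For $f\in W^{1,q}(\Omega;G_2)$, $D_Hf(X)$ has components $Xf^{x_j}$ (weak derivatives of the first-layer coordinate functions $f^{x_j}$) for the first layer and $0$ for the contact forms. *)

theory Defs
  imports "HOL-Analysis.Analysis"
begin

section \<open>Smooth maps\<close>

text \<open>On an open set of a Euclidean space, \<open>Ck_on k\<close> is the usual class of \<open>k\<close> times
  continuously differentiable maps.\<close>

primrec Ck_on ::
  "nat \<Rightarrow> ('a::euclidean_space \<Rightarrow> 'b::real_normed_vector) \<Rightarrow> 'a set \<Rightarrow> bool" where
  "Ck_on 0 f S \<longleftrightarrow> continuous_on S f"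
| "Ck_on (Suc k) f S \<longleftrightarrow>
     (\<forall>x\<in>S. f differentiable (at x)) \<and>
     (\<forall>v. Ck_on k (\<lambda>x. frechet_derivative f (at x) v) S)"

definition smooth_on :: "('a::euclidean_space \<Rightarrow> 'b::real_normed_vector) \<Rightarrow> 'a set \<Rightarrow> bool" where
  "smooth_on f S \<longleftrightarrow> (\<forall>k. Ck_on k f S)"


section \<open>Carnot groups\<close>

text \<open>A Carnot group is presented in exponential coordinates of the first kind: the Euclidean space
  \<open>'a\<close> is at the same time the group manifold and the Lie algebra, i.e. the tangent space at the
  identity \<open>0\<close>, and the exponential map is the identity.  The inner product of \<open>'a\<close> is the inner
  product of the Lie algebra.  Layers are numbered from 1; \<open>layer G 0\<close> is not used.\<close>

record 'a carnot =
  mult :: "'a \<Rightarrow> 'a \<Rightarrow> 'a"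
  layer :: "nat \<Rightarrow> 'a set"
  step :: nat

text \<open>The left-invariant vector field with value \<open>u\<close> at the identity: \<open>u\<close> is pushed forward by the
  differential at \<open>0\<close> of the left translation by \<open>x\<close>.\<close>

definition left_field :: "('a::euclidean_space) carnot \<Rightarrow> 'a \<Rightarrow> 'a \<Rightarrow> 'a" where
  "left_field G u x = frechet_derivative (mult G x) (at 0) u"

text \<open>The Lie bracket of the left-invariant fields \<open>U\<close>, \<open>V\<close> is the vector field \<open>DV(U) - DU(V)\<close>,
  evaluated at the identity.\<close>

definition bracket :: "('a::euclidean_space) carnot \<Rightarrow> 'a \<Rightarrow> 'a \<Rightarrow> 'a" where
  "bracket G u v =
     frechet_derivative (left_field G v) (at 0) u - frechet_derivative (left_field G u) (at 0) v"

definition dilation :: "('a::euclidean_space) carnot \<Rightarrow> real \<Rightarrow> 'a \<Rightarrow> 'a" where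
  "dilation G r = (THE h. linear h \<and> (\<forall>k\<in>{1..step G}. \<forall>v\<in>layer G k. h v = r ^ k *\<^sub>R v))"

text \<open>In \<open>carnot_group\<close>, the assumption \<open>one_parameter\<close> says that \<open>exp\<close> is the identity map; as the
  manifold is the whole of \<open>'a\<close>, the group is simply connected, and it is nilpotent by the
  stratification.  \<open>dilation_mult\<close> says that the dilations of the Lie algebra are automorphisms of the
  group.  It does not restrict the class of groups: the dilations are automorphisms of the stratified
  Lie algebra, and on a simply connected group these integrate to group automorphisms, which in
  exponential coordinates are given by the same linear maps.\<close>

locale carnot_group = group "mult G" 0 uminus for G :: "('a::euclidean_space) carnot" +
  assumes smooth_mult: "smooth_on (\<lambda>p. mult G (fst p) (snd p)) UNIV"
    and one_parameter: "mult G (s *\<^sub>R x) (t *\<^sub>R x) = (s + t) *\<^sub>R x"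
    and subspace_layer: "1 \<le> k \<Longrightarrow> subspace (layer G k)"
    and orthogonal_layers:
      "\<lbrakk>1 \<le> j; 1 \<le> k; j \<noteq> k; u \<in> layer G j; v \<in> layer G k\<rbrakk> \<Longrightarrow> u \<bullet> v = 0"
    and span_layers: "span (\<Union>k\<in>{1..step G}. layer G k) = UNIV"
    and bracket_layers:
      "1 \<le> k \<Longrightarrow> layer G (Suc k) = span {bracket G u v | u v. u \<in> layer G 1 \<and> v \<in> layer G k}"
    and top_layer: "layer G (step G) \<noteq> {0}"
    and layers_above: "step G < k \<Longrightarrow> layer G k = {0}"
    and dilation_mult:
      "0 < r \<Longrightarrow> dilation G r (mult G x y) = mult G (dilation G r x) (dilation G r y)"

definition homogeneous_dim :: "('a::euclidean_space) carnot \<Rightarrow> nat" where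
  "homogeneous_dim G = (\<Sum>k=1..step G. k * dim (layer G k))"

text \<open>\<open>u\<close> is the velocity of the curve, translated back to the identity; its norm is the
  sub-Riemannian speed.  Values of \<open>u\<close> at the finitely many exceptional times do not matter.\<close>

definition horizontal_curve ::
  "('a::euclidean_space) carnot \<Rightarrow> (real \<Rightarrow> 'a) \<Rightarrow> (real \<Rightarrow> 'a) \<Rightarrow> bool" where
  "horizontal_curve G \<gamma> u \<longleftrightarrow>
     \<gamma> piecewise_C1_differentiable_on {0..1} \<and>
     (\<exists>S. finite S \<and> (\<forall>t\<in>{0..1} - S. u t \<in> layer G 1 \<and>
        (\<gamma> has_vector_derivative left_field G (u t) (\<gamma> t)) (at t)))"

text \<open>With \<open>has_integral\<close> rather than \<open>integral\<close>, curves of infinite length are excluded.\<close>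

definition cc_dist :: "('a::euclidean_space) carnot \<Rightarrow> 'a \<Rightarrow> 'a \<Rightarrow> real" where
  "cc_dist G x y = Inf {L. \<exists>\<gamma> u. horizontal_curve G \<gamma> u \<and> \<gamma> 0 = x \<and> \<gamma> 1 = y \<and>
     ((\<lambda>t. norm (u t)) has_integral L) {0..1}}"

definition cc_ball :: "('a::euclidean_space) carnot \<Rightarrow> 'a \<Rightarrow> real \<Rightarrow> 'a set" where
  "cc_ball G x r = {y. cc_dist G x y < r}"

definition haar_measure :: "('a::euclidean_space) carnot \<Rightarrow> 'a measure \<Rightarrow> bool" where
  "haar_measure G \<mu> \<longleftrightarrow>
     sets \<mu> = sets borel \<and>
     (\<forall>K. compact K \<longrightarrow> emeasure \<mu> K < \<infinity>) \<and>
     emeasure \<mu> UNIV \<noteq> 0 \<and>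
     (\<forall>x. distr \<mu> borel (mult G x) = \<mu>)"


section \<open>Lebesgue and Sobolev spaces\<close>

definition Lp_on :: "'a measure \<Rightarrow> real \<Rightarrow> 'a set \<Rightarrow> ('a \<Rightarrow> real) \<Rightarrow> bool" where
  "Lp_on \<mu> p A u \<longleftrightarrow>
     set_borel_measurable \<mu> A u \<and> set_integrable \<mu> A (\<lambda>x. \<bar>u x\<bar> powr p)"

definition Lp_loc :: "('a::euclidean_space) measure \<Rightarrow> real \<Rightarrow> 'a set \<Rightarrow> ('a \<Rightarrow> real) \<Rightarrow> bool" where
  "Lp_loc \<mu> p \<Omega> u \<longleftrightarrow> (\<forall>K. compact K \<and> K \<subseteq> \<Omega> \<longrightarrow> Lp_on \<mu> p K u)"

text \<open>Convergence in \<open>L\<^sup>p\<close> on compact subsets of \<open>\<Omega>\<close>, for functions with values in the finite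
  power \<open>\<real>\<^sup>B\<close> with its Euclidean norm \<open>L2_set\<close>.  For each compact set the functions have to be defined,
  and in \<open>L\<^sup>p\<close>, only eventually along the filter.\<close>

definition Lp_loc_tendsto ::
  "('a::euclidean_space) measure \<Rightarrow> real \<Rightarrow> 'a set \<Rightarrow> 'b set \<Rightarrow>
     ('i \<Rightarrow> 'a \<Rightarrow> 'b \<Rightarrow> real) \<Rightarrow> ('a \<Rightarrow> 'b \<Rightarrow> real) \<Rightarrow> 'i filter \<Rightarrow> bool" where
  "Lp_loc_tendsto \<mu> p \<Omega> B u w F \<longleftrightarrow>
     (\<forall>K. compact K \<and> K \<subseteq> \<Omega> \<longrightarrow>
        (\<forall>b\<in>B. Lp_on \<mu> p K (\<lambda>x. w x b)) \<and>
        (\<forall>\<^sub>F i in F. \<forall>b\<in>B. Lp_on \<mu> p K (\<lambda>x. u i x b)) \<and>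
        ((\<lambda>i. LINT x:K|\<mu>. L2_set (\<lambda>b. u i x b - w x b) B powr p) \<longlongrightarrow> 0) F)"

definition test_function :: "'a set \<Rightarrow> ('a::euclidean_space \<Rightarrow> real) \<Rightarrow> bool" where
  "test_function \<Omega> \<phi> \<longleftrightarrow>
     smooth_on \<phi> UNIV \<and> compact (closure {x. \<phi> x \<noteq> 0}) \<and> closure {x. \<phi> x \<noteq> 0} \<subseteq> \<Omega>"

definition lie_deriv ::
  "('a::euclidean_space) carnot \<Rightarrow> 'a \<Rightarrow> ('a \<Rightarrow> 'b::real_normed_vector) \<Rightarrow> 'a \<Rightarrow> 'b" where
  "lie_deriv G v g x = frechet_derivative g (at x) (left_field G v x)"

text \<open>\<open>w\<close> is the weak derivative of \<open>u\<close> along the left-invariant field of \<open>v\<close>.  Left-invariant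
  fields are divergence free with respect to Haar measure, so the formal adjoint is the negative.\<close>

definition weak_deriv ::
  "('a::euclidean_space) carnot \<Rightarrow> 'a measure \<Rightarrow> 'a set \<Rightarrow> 'a \<Rightarrow> ('a \<Rightarrow> real) \<Rightarrow> ('a \<Rightarrow> real) \<Rightarrow> bool" where
  "weak_deriv G \<mu> \<Omega> v u w \<longleftrightarrow>
     Lp_loc \<mu> 1 \<Omega> u \<and> Lp_loc \<mu> 1 \<Omega> w \<and>
     (\<forall>\<phi>. test_function \<Omega> \<phi> \<longrightarrow>
        (LINT x:\<Omega>|\<mu>. u x * lie_deriv G v \<phi> x) = - (LINT x:\<Omega>|\<mu>. w x * \<phi> x))"

definition weak_horizontal_gradient ::
  "('a::euclidean_space) carnot \<Rightarrow> 'a measure \<Rightarrow> 'a set \<Rightarrow> ('a \<Rightarrow> real) \<Rightarrow> ('a \<Rightarrow> 'a) \<Rightarrow> bool" where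
  "weak_horizontal_gradient G \<mu> \<Omega> u W \<longleftrightarrow>
     (\<forall>x\<in>\<Omega>. W x \<in> layer G 1) \<and>
     (\<forall>v\<in>layer G 1. weak_deriv G \<mu> \<Omega> v u (\<lambda>x. W x \<bullet> v))"

text \<open>Only the values of \<open>f\<close> on \<open>\<Omega>\<close> matter.\<close>

definition metric_sobolev ::
  "('a::euclidean_space) carnot \<Rightarrow> 'a measure \<Rightarrow> ('b::euclidean_space) carnot \<Rightarrow> real \<Rightarrow> 'a set \<Rightarrow>
     ('a \<Rightarrow> 'b) \<Rightarrow> bool" where
  "metric_sobolev G1 \<mu> G2 q \<Omega> f \<longleftrightarrow>
     (\<exists>g. Lp_on \<mu> q \<Omega> g \<and>
       (\<forall>z. Lp_loc \<mu> q \<Omega> (\<lambda>x. cc_dist G2 z (f x)) \<and>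
         (\<exists>W. weak_horizontal_gradient G1 \<mu> \<Omega> (\<lambda>x. cc_dist G2 z (f x)) W \<and>
              (AE x in \<mu>. x \<in> \<Omega> \<longrightarrow> norm (W x) \<le> g x))))"


section \<open>Horizontal differential\<close>

definition adapted_basis :: "('b::euclidean_space) carnot \<Rightarrow> 'b set \<Rightarrow> bool" where
  "adapted_basis G B \<longleftrightarrow>
     independent B \<and> span B = UNIV \<and> B \<subseteq> (\<Union>k\<in>{1..step G}. layer G k)"

text \<open>The left-invariant one-form at \<open>p\<close> which at the identity is the coordinate form of \<open>b \<in> B\<close>.
  In exponential coordinates it equals \<open>dx\<^sub>b\<close> if \<open>b\<close> is in the first layer; for \<open>b\<close> in the second
  layer it is a contact form.\<close>

definition coframe :: "('b::euclidean_space) carnot \<Rightarrow> 'b set \<Rightarrow> 'b \<Rightarrow> 'b \<Rightarrow> 'b \<Rightarrow> real" where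
  "coframe G B b p \<xi> = representation B (inv (\<lambda>u. left_field G u p) \<xi>) b"

text \<open>The horizontal differential of a smooth map \<open>g\<close>, on the left-invariant field of \<open>v\<close>.\<close>

definition DH ::
  "('a::euclidean_space) carnot \<Rightarrow> ('b::euclidean_space) carnot \<Rightarrow> 'b set \<Rightarrow> ('a \<Rightarrow> 'b) \<Rightarrow> 'a \<Rightarrow>
     'a \<Rightarrow> 'b \<Rightarrow> real" where
  "DH G1 G2 B g v x b = coframe G2 B b (g x) (lie_deriv G1 v g x)"

text \<open>\<open>D\<close> represents the horizontal differential of a Sobolev map \<open>f\<close> into a step-2 group, on the
  left-invariant field of \<open>v\<close>.  As the weak derivatives are unique only almost everywhere, this is a
  relation.\<close>

definition weak_DH ::
  "('a::euclidean_space) carnot \<Rightarrow> 'a measure \<Rightarrow> ('b::euclidean_space) carnot \<Rightarrow> 'b set \<Rightarrow> 'a set \<Rightarrow>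
     ('a \<Rightarrow> 'b) \<Rightarrow> 'a \<Rightarrow> ('a \<Rightarrow> 'b \<Rightarrow> real) \<Rightarrow> bool" where
  "weak_DH G1 \<mu> G2 B \<Omega> f v D \<longleftrightarrow>
     (\<forall>b\<in>B \<inter> layer G2 1.
        weak_deriv G1 \<mu> \<Omega> v (\<lambda>x. representation B (f x) b) (\<lambda>x. D x b)) \<and>
     (\<forall>b\<in>B \<inter> layer G2 2. \<forall>x\<in>\<Omega>. D x b = 0)"


section \<open>Mollification\<close>

definition mollifier :: "('a::euclidean_space) carnot \<Rightarrow> ('a \<Rightarrow> real) \<Rightarrow> real \<Rightarrow> 'a \<Rightarrow> real" where
  "mollifier G \<eta> \<epsilon> x = \<eta> (dilation G (1 / \<epsilon>) x) / \<epsilon> ^ homogeneous_dim G"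

text \<open>The inverse of \<open>y\<close> in the group is \<open>- y\<close>.  The Bochner integral in the Euclidean space \<open>'b\<close> is
  the coordinatewise integral.\<close>

definition conv_integrand ::
  "('a::euclidean_space) carnot \<Rightarrow> ('a \<Rightarrow> 'b::euclidean_space) \<Rightarrow> ('a \<Rightarrow> real) \<Rightarrow> 'a \<Rightarrow> 'a \<Rightarrow> 'b" where
  "conv_integrand G f k x y = k (mult G (- y) x) *\<^sub>R f y"

definition group_conv ::
  "('a::euclidean_space) carnot \<Rightarrow> 'a measure \<Rightarrow> ('a \<Rightarrow> 'b::euclidean_space) \<Rightarrow> ('a \<Rightarrow> real) \<Rightarrow>
     'a \<Rightarrow> 'b" where
  "group_conv G \<mu> f k x = (LINT y|\<mu>. conv_integrand G f k x y)"

end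

(* In exponential coordinates a step-two group has the product x . y = x + y + area x y, with area
   bilinear and depending on the first layer only.  Bounded sets of G1 are products of boundedly many
   horizontal elements, and a function with a weak derivative along a left-invariant field differs by
   the integral of that derivative along almost every flow line.  Applied to the distances to a dense
   sequence of points this bounds the metric difference quotients d(f x, f (x . delta_r z)) / r in L^q,
   uniformly in z.

   First layer: the upper gradient turns the coordinates of f into functions with weak derivatives
   dominated by g (Riesz representation, by minimising a quadratic functional on test functions); the
   difference quotients along delta_r z then converge to the horizontal gradient in L^p, uniformly in z,
   and integrating against X eta gives the convergence of the derivatives of f * eta_r.

   Contact forms: after left translation by the inverse of f x the form is bounded by 1/r times the
   average of d(f x, f (x . delta_r z))^2, whose L^(q/2) norm is O(r). *)
theory Submission
  imports Defs
begin

text \<open>The hypotheses see \<open>f\<close> only through the distances from fixed points to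
  \<open>f x\<close>. Measurability and local integrability of \<open>f\<close>, and the weak
  derivatives of its coordinates, all have to be extracted from these scalar functions. The group
  law of \<open>G1\<close> is abstract. In place of a product formula, structural facts come from
  homogeneity: an identity is conjugated by a dilation of factor r, and r tends to 0. This gives the
  triangular form of the product, hence the comparison of Haar measure with Lebesgue measure, and
  the link between commutators and brackets that makes horizontal elements generate the group. The
  hypothesis \<open>2 \<le> q\<close> enters three times. The contact estimate involves squares of
  distances, which halves the exponent, and Jensen's inequality requires q/2 to be at least 1.
  Coordinates in the second layer grow like the square of the distance, so \<open>f\<close> is
  locally integrable. Finally g^2 is integrable against a weight below 1 with finite integral, which
  admits a Hilbert space argument on sets of infinite measure.\<close>

abbreviation (input) "NN == nn_integral"
abbreviation (input) "ind == indicator"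
abbreviation (input) "BM == borel_measurable borel"
abbreviation (input) sR (infixr "*R" 75) where "x *R y == scaleR x y"
abbreviation (input) "en == ennreal"

context carnot_group begin

abbreviation (input) "mm == mult G"
abbreviation (input) "dl == dilation G"

end

section \<open>Calculus of k times continuously differentiable maps\<close>

lemma frechet_derivative_eqI:
 "(f has_derivative f') (at x) ==> frechet_derivative f (at x) = f'"
 using frechet_derivative_at by force

lemma has_derivative_cong_open:
 assumes "h differentiable (at x)" "open T" "x : T" "!!y. y : T ==> g y = h y"
 shows "(g has_derivative frechet_derivative h (at x)) (at x)"
proof -
 have "(h has_derivative frechet_derivative h (at x)) (at x)"
  using assms(1) by (rule frechet_derivative_works[THEN iffD1])
 then show ?thesis
  by (rule has_derivative_transform_within_open[OF _ assms(2,3)]) (simp add: assms(4))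
qed

lemma Ck_on_cong:
 assumes "Ck_on k h S" "open S" "!!x. x : S ==> g x = h x"
 shows "Ck_on k g S"
 using assms(1,3)
proof (induction k arbitrary: g h)
 case 0
 then show ?case by (metis Ck_on.simps(1) continuous_on_cong)
next
 case (Suc k)
 have h: "h differentiable (at x)" if "x : S" for x using Suc.prems(1) that by simp
 have d: "(g has_derivative frechet_derivative h (at x)) (at x)" if "x : S" for x
  using h[OF that] assms(2) that Suc.prems(2) by (rule has_derivative_cong_open)
 have e: "frechet_derivative g (at x) = frechet_derivative h (at x)" if "x : S" for x
  by (rule frechet_derivative_eqI[OF d[OF that]])
 have "Ck_on k (%x. frechet_derivative g (at x) v) S" for v
 proof (rule Suc.IH[of "%x. frechet_derivative h (at x) v"])
  show "Ck_on k (%x. frechet_derivative h (at x) v) S" using Suc.prems(1) by simp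
 qed (simp add: e)
 moreover have "g differentiable (at x)" if "x : S" for x
  using d[OF that] by (rule differentiableI)
 ultimately show ?case by simp
qed

text \<open>Accepts whatever family of derivatives the derivative rules produce in place of
  \<open>frechet_derivative\<close>; openness of \<open>S\<close> lets \<open>Ck_on_cong\<close>
  exchange the two under further differentiation.\<close>

lemma Ck_on_SucI:
 assumes "!!x. x : S ==> (f has_derivative f' x) (at x)" "!!v. Ck_on k (%x. f' x v) S" "open S"
 shows "Ck_on (Suc k) f S"
proof -
 have "Ck_on k (%x. frechet_derivative f (at x) v) S" for v
  by (rule Ck_on_cong[OF assms(2)[of v] assms(3)]) (simp add: frechet_derivative_eqI[OF assms(1)])
 moreover have "f differentiable (at x)" if "x : S" for x
  using assms(1)[OF that] by (rule differentiableI)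
 ultimately show ?thesis by simp
qed

lemma Ck_on_subset: "Ck_on k f S ==> T <= S ==> Ck_on k f T"
 by (induction k arbitrary: f) (auto intro: continuous_on_subset)

lemma Ck_on_derivE:
 assumes "Ck_on (Suc k) f UNIV"
 obtains f' where "!!x. (f has_derivative f' x) (at x)" "!!v. Ck_on k (%x. f' x v) UNIV"
 by (rule that[of "%x. frechet_derivative f (at x)"]) (use assms in \<open>simp_all flip: frechet_derivative_works\<close>)

lemma Ck_on_SucD: "Ck_on (Suc k) f S ==> Ck_on k f S"
proof (induction k arbitrary: f)
 case 0
 then show ?case
  by (auto intro!: differentiable_imp_continuous_on differentiable_at_imp_differentiable_on)
qed auto

lemma Ck_on_const: "Ck_on k (%x. c) UNIV"
 by (induction k arbitrary: c) auto

lemma Ck_on_linear: "bounded_linear f ==> Ck_on k f UNIV"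
proof (cases k)
 case 0
 then show "bounded_linear f ==> Ck_on k f UNIV" by (simp add: linear_continuous_on)
next
 case (Suc j)
 assume "bounded_linear f"
 then show ?thesis unfolding Suc
  by (intro Ck_on_SucI[where f' = "%_. f"])
   (auto intro: bounded_linear_imp_has_derivative Ck_on_const)
qed

lemma Ck_on_add: "Ck_on k f UNIV ==> Ck_on k g UNIV ==> Ck_on k (%x. f x + g x) UNIV"
proof (induction k arbitrary: f g)
 case 0
 then show ?case by (auto intro: continuous_intros)
next
 case (Suc k)
 obtain f' where d1: "!!x. (f has_derivative f' x) (at x)" "!!v. Ck_on k (%x. f' x v) UNIV"
  using Ck_on_derivE[OF Suc.prems(1)] by blast
 obtain g' where d2: "!!x. (g has_derivative g' x) (at x)" "!!v. Ck_on k (%x. g' x v) UNIV"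
  using Ck_on_derivE[OF Suc.prems(2)] by blast
 note d = d1 d2
 show ?case
  by (rule Ck_on_SucI[where f' = "%x v. f' x v + g' x v"])
   (auto intro!: has_derivative_add d Suc.IH)
qed

lemma Ck_on_sum:
 "finite I ==> (!!i. i : I ==> Ck_on k (f i) UNIV) ==> Ck_on k (%x. \<Sum>i\<in>I. f i x) UNIV"
 by (induction I rule: finite_induct) (auto intro: Ck_on_const Ck_on_add)

lemma Ck_on_bilinear:
 assumes B: "bounded_bilinear B"
 shows "Ck_on k f UNIV ==> Ck_on k g UNIV ==> Ck_on k (%x. B (f x) (g x)) UNIV"
proof (induction k arbitrary: f g)
 case 0
 then show ?case by (auto intro: bounded_bilinear.continuous_on[OF B])
next
 case (Suc k)
 obtain f' where d1: "!!x. (f has_derivative f' x) (at x)" "!!v. Ck_on k (%x. f' x v) UNIV"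
  using Ck_on_derivE[OF Suc.prems(1)] by blast
 obtain g' where d2: "!!x. (g has_derivative g' x) (at x)" "!!v. Ck_on k (%x. g' x v) UNIV"
  using Ck_on_derivE[OF Suc.prems(2)] by blast
 note d = d1 d2
 show ?case
  by (rule Ck_on_SucI[where f' = "%x v. B (f x) (g' x v) + B (f' x v) (g x)"])
   (auto intro!: bounded_bilinear.FDERIV[OF B] d Suc.IH Ck_on_add Ck_on_SucD[OF Suc.prems(1)]
   Ck_on_SucD[OF Suc.prems(2)])
qed

lemmas Ck_on_scaleR = Ck_on_bilinear[OF bounded_bilinear_scaleR]
lemmas Ck_on_mult = Ck_on_bilinear[OF bounded_bilinear_mult]

lemma linear_basis_sum:
 fixes f :: "'a::euclidean_space => 'b::real_vector"
 assumes "linear f"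
 shows "f v = (\<Sum>i\<in>Basis. (v \<bullet> i) *R f i)"
proof -
 have "f v = f (\<Sum>i\<in>Basis. (v \<bullet> i) *R i)" by (simp add: euclidean_representation)
 also have "... = (\<Sum>i\<in>Basis. f ((v \<bullet> i) *R i))" by (rule linear_sum[OF assms])
 also have "... = (\<Sum>i\<in>Basis. (v \<bullet> i) *R f i)" by (rule sum.cong) (simp_all add: linear_cmul[OF assms])
 finally show ?thesis .
qed

text \<open>The derivative \<open>F' (g x) (g' x v)\<close> depends on \<open>x\<close> through both
  arguments. Expanding the inner vector in \<open>Basis\<close> turns it into a sum of products of
  scalar C^k functions with the maps \<open>F' (g x) i\<close>, to which the induction hypothesis
  applies.\<close>

lemma Ck_on_compose:
 fixes g :: "'a::euclidean_space => 'b::euclidean_space" and F :: "'b => 'c::real_normed_vector"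
 shows "Ck_on k F UNIV ==> Ck_on k g UNIV ==> Ck_on k (%x. F (g x)) UNIV"
proof (induction k arbitrary: F)
 case 0
 then show ?case by (auto intro: continuous_on_compose2)
next
 case (Suc k)
 obtain F' where d1: "!!x. (F has_derivative F' x) (at x)" "!!v. Ck_on k (%x. F' x v) UNIV"
  using Ck_on_derivE[OF Suc.prems(1)] by blast
 obtain g' where d2: "!!x. (g has_derivative g' x) (at x)" "!!v. Ck_on k (%x. g' x v) UNIV"
  using Ck_on_derivE[OF Suc.prems(2)] by blast
 note d = d1 d2
 have lin: "linear (F' x)" for x using d(1) has_derivative_linear by blast
 have e: "F' (g x) w = (\<Sum>i\<in>Basis. (w \<bullet> i) *R F' (g x) i)" for x w
  by (rule linear_basis_sum[OF lin])
 show ?case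
 proof (rule Ck_on_SucI[where f' = "%x v. \<Sum>i\<in>Basis. (g' x v \<bullet> i) *R F' (g x) i"])
  fix x
  have "((%x. F (g x)) has_derivative (%v. F' (g x) (g' x v))) (at x)"
   using has_derivative_compose[OF d(3) d(1)] .
  then show "((%x. F (g x)) has_derivative (%v. \<Sum>i\<in>Basis. (g' x v \<bullet> i) *R F' (g x) i)) (at x)"
   by (subst (asm) e)
 next
  fix v
  have "Ck_on k (%x. g' x v \<bullet> i) UNIV" for i
   by (rule Ck_on_bilinear[OF bounded_bilinear_inner d(4) Ck_on_const])
  then show "Ck_on k (%x. \<Sum>i\<in>Basis. (g' x v \<bullet> i) *R F' (g x) i) UNIV"
   by (intro Ck_on_sum Ck_on_scaleR Suc.IH d Ck_on_SucD[OF Suc.prems(2)]) auto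
 qed simp
qed

lemma smooth_on_linear: "bounded_linear f ==> smooth_on f UNIV"
 by (simp add: smooth_on_def Ck_on_linear)

lemma smooth_on_const: "smooth_on (%x. c) UNIV"
 by (simp add: smooth_on_def Ck_on_const)

lemma smooth_on_add: "smooth_on f UNIV ==> smooth_on g UNIV ==> smooth_on (%x. f x + g x) UNIV"
 by (simp add: smooth_on_def Ck_on_add)

lemma smooth_on_mult:
 fixes f g :: "'a::euclidean_space => real"
 shows "smooth_on f UNIV ==> smooth_on g UNIV ==> smooth_on (%x. f x * g x) UNIV"
 by (simp add: smooth_on_def Ck_on_mult)

lemma smooth_on_compose:
 fixes g :: "'a::euclidean_space => 'b::euclidean_space" and F :: "'b => 'c::real_normed_vector"
 shows "smooth_on F UNIV ==> smooth_on g UNIV ==> smooth_on (%x. F (g x)) UNIV"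
 by (simp add: smooth_on_def Ck_on_compose)

lemma smooth_on_Pair:
 fixes f :: "'a::euclidean_space => 'b::euclidean_space" and g :: "'a => 'c::euclidean_space"
 assumes "smooth_on f UNIV" "smooth_on g UNIV"
 shows "smooth_on (%x. (f x, g x)) UNIV"
proof -
 have l: "bounded_linear (%y::'b. (y, 0::'c))" "bounded_linear (%y::'c. (0::'b, y))"
  by (auto intro!: bounded_linear_Pair bounded_linear_ident bounded_linear_zero)
 have "smooth_on (%x. (f x, 0::'c) + (0::'b, g x)) UNIV"
  using assms by (intro smooth_on_add smooth_on_compose[OF smooth_on_linear[OF l(1)]]
   smooth_on_compose[OF smooth_on_linear[OF l(2)]])
 then show ?thesis by simp
qed

lemma smooth_on_deriv:
 assumes "smooth_on f UNIV"
 shows smooth_on_has_derivative: "(f has_derivative frechet_derivative f (at x)) (at x)"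
  and smooth_on_frechet_derivative: "smooth_on (%x. frechet_derivative f (at x) v) UNIV"
  and smooth_on_continuous: "continuous_on UNIV f"
proof -
 from assms have *: "Ck_on (Suc k) f UNIV" for k by (simp add: smooth_on_def)
 from this[of 0] show "(f has_derivative frechet_derivative f (at x)) (at x)"
  by (simp add: frechet_derivative_works)
 show "smooth_on (%x. frechet_derivative f (at x) v) UNIV"
  unfolding smooth_on_def using * by simp
 show "continuous_on UNIV f" using assms unfolding smooth_on_def by (metis Ck_on.simps(1))
qed

text \<open>Smoothness in base point and direction jointly. \<open>smooth_on\<close> speaks of fixed
  directions only, and linearity in the direction reduces to these by expansion in
  \<open>Basis\<close>.\<close>

lemma smooth_on_frechet_derivative2:
 fixes f :: "'a::euclidean_space => 'b::real_normed_vector" and g h :: "'c::euclidean_space => 'a"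
 assumes "smooth_on f UNIV" "smooth_on g UNIV" "smooth_on h UNIV"
 shows "smooth_on (%x. frechet_derivative f (at (g x)) (h x)) UNIV"
proof -
 have "f differentiable (at x)" for x
  using smooth_on_has_derivative[OF assms(1)] by (auto simp: differentiable_def)
 note e = linear_basis_sum[OF linear_frechet_derivative[OF this]]
 have 1: "Ck_on k (%x. h x \<bullet> i) UNIV" for k i
  using assms(3) by (intro Ck_on_bilinear[OF bounded_bilinear_inner, where f = h] Ck_on_const) (simp add: smooth_on_def)
 have 2: "Ck_on k (%x. frechet_derivative f (at (g x)) i) UNIV" for k i
  using assms(2) smooth_on_frechet_derivative[OF assms(1), of i]
  by (intro Ck_on_compose[where g = g and F = "%y. frechet_derivative f (at y) i"]) (auto simp: smooth_on_def)
 have "Ck_on k (%x. \<Sum>i\<in>Basis. (h x \<bullet> i) *R frechet_derivative f (at (g x)) i) UNIV" for k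
  by (intro Ck_on_sum Ck_on_scaleR 1 2) simp
 moreover have "(%x. frechet_derivative f (at (g x)) (h x)) =
   (%x. \<Sum>i\<in>Basis. (h x \<bullet> i) *R frechet_derivative f (at (g x)) i)"
  by (rule ext, rule e)
 ultimately show ?thesis unfolding smooth_on_def by simp
qed

lemma has_vector_derivative_quotient:
 fixes f :: "real => 'a::real_normed_vector"
 assumes "(f has_vector_derivative D) (at 0)"
 shows "((%t. (1 / t) *R (f t - f 0)) \<longlongrightarrow> D) (at 0)"
proof -
 have "((%h. norm (f (0 + h) - f 0 - h *R D) / norm h) \<longlongrightarrow> 0) (at 0)"
  using assms by (simp add: has_vector_derivative_def has_derivative_at)
 moreover have "\<forall>\<^sub>F h in at 0. norm (f (0 + h) - f 0 - h *R D) / norm h =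
   norm ((1 / h) *R (f h - f 0) - D)"
  unfolding eventually_at
 proof (intro exI[of _ 1] conjI ballI impI)
  fix h :: real assume "h ~= 0 & dist h 0 < 1"
  then have "(1 / h) *R (f h - f 0) - D = (1 / h) *R (f h - f 0 - h *R D)"
   by (simp add: scaleR_diff_right)
  then show "norm (f (0 + h) - f 0 - h *R D) / norm h = norm ((1 / h) *R (f h - f 0) - D)"
   by (simp add: divide_inverse)
 qed simp
 ultimately have "((%h. norm ((1 / h) *R (f h - f 0) - D)) \<longlongrightarrow> 0) (at 0)"
  by (rule Lim_transform_eventually)
 then have "((%h. (1 / h) *R (f h - f 0) - D) \<longlongrightarrow> 0) (at 0)"
  by (rule tendsto_norm_zero_cancel)
 then show ?thesis by (rule LIM_zero_cancel)
qed

section \<open>Layer projections and dilations\<close>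

context carnot_group begin

definition layer_basis :: "nat => 'a set" where
 "layer_basis k = (SOME B. B <= layer G k & pairwise orthogonal B & (\<forall>x\<in>B. norm x = 1) &
   independent B & card B = dim (layer G k) & span B = layer G k)"

text \<open>The orthogonal projection onto layer k. Since the layers are mutually orthogonal and
  span the space, it is also the projection along the other layers.\<close>

definition proj :: "nat => 'a => 'a" where
 "proj k x = (\<Sum>e\<in>layer_basis k. (x \<bullet> e) *R e)"

lemma layer_basis:
 assumes "1 <= k"
 shows "layer_basis k <= layer G k" "pairwise orthogonal (layer_basis k)"
  "!!x. x : layer_basis k ==> norm x = 1" "independent (layer_basis k)"
  "card (layer_basis k) = dim (layer G k)" "span (layer_basis k) = layer G k"
  "finite (layer_basis k)"
proof -
 have "EX B. B <= layer G k & pairwise orthogonal B & (\<forall>x\<in>B. norm x = 1) &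
   independent B & card B = dim (layer G k) & span B = layer G k"
  using orthonormal_basis_subspace[OF subspace_layer[OF assms]] by metis
 from someI_ex[OF this, folded layer_basis_def]
 show "layer_basis k <= layer G k" "pairwise orthogonal (layer_basis k)"
  "!!x. x : layer_basis k ==> norm x = 1" "independent (layer_basis k)"
  "card (layer_basis k) = dim (layer G k)" "span (layer_basis k) = layer G k" by auto
 then show "finite (layer_basis k)" using independent_imp_finite by blast
qed

lemma bounded_linear_proj: "bounded_linear (proj k)"
 unfolding proj_def
 by (intro bounded_linear_sum bounded_linear_scaleR_const bounded_linear_inner_left)

lemma linear_proj: "linear (proj k)"
 using bounded_linear_proj by (rule bounded_linear.linear)

lemmas proj_simps = linear_add[OF linear_proj] linear_diff[OF linear_proj] linear_cmul[OF linear_proj]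
 linear_neg[OF linear_proj] linear_sum[OF linear_proj] linear_0[OF linear_proj]

lemma proj_in_layer: "1 <= k ==> proj k x : layer G k"
 unfolding proj_def using layer_basis(1)[of k] subspace_layer[of k]
 by (intro subspace_sum subspace_scale) auto

lemma proj_id: "1 <= k ==> x : layer G k ==> proj k x = x"
 unfolding proj_def by (intro orthonormal_basis_expand layer_basis) (auto simp: layer_basis(6))

lemma proj_other: "1 <= k ==> 1 <= j ==> j ~= k ==> x : layer G j ==> proj k x = 0"
 unfolding proj_def using layer_basis(1)[of k] orthogonal_layers[of j k x] by (intro sum.neutral) auto

lemma proj_proj: "1 <= k ==> 1 <= j ==> proj k (proj j x) = (if j = k then proj k x else 0)"
 using proj_in_layer[of j x] proj_id[of j "proj j x"] proj_other[of k j "proj j x"] by auto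

lemma sum_proj: "(\<Sum>k=1..step G. proj k x) = x"
proof -
 have "x : span (\<Union>k\<in>{1..step G}. layer G k)" using span_layers by simp
 then show ?thesis
 proof (rule linear_eq_on_span[of "%x. \<Sum>k=1..step G. proj k x" "%x. x" , rotated 3])
  show "linear (%x. \<Sum>k=1..step G. proj k x)"
   by (intro linear_compose_sum ballI linear_proj)
  fix x assume "x : (\<Union>k\<in>{1..step G}. layer G k)"
  then obtain j where j: "j : {1..step G}" "x : layer G j" by auto
  have "(\<Sum>k=1..step G. proj k x) = (\<Sum>k\<in>{1..step G}. if k = j then x else 0)"
   by (rule sum.cong) (use j proj_id proj_other in auto)
  then show "(\<Sum>k=1..step G. proj k x) = x" using j by simp
 qed (auto intro: linear_ident)
qed

lemma proj_above: "step G < k ==> proj k x = 0"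
 using proj_in_layer[of k x] layers_above[of k] by (cases "k = 0") auto

lemma eq_by_proj:
 assumes "!!k. 1 <= k ==> k <= step G ==> proj k x = proj k y"
 shows "x = y"
proof -
 have "(\<Sum>k=1..step G. proj k x) = (\<Sum>k=1..step G. proj k y)"
  by (rule sum.cong) (use assms in auto)
 then show ?thesis unfolding sum_proj .
qed

text \<open>Resolves the definite description: the sum is linear with the required values on each
  layer, and linear maps that agree on the layers are equal because the layers span.\<close>

lemma dilation_eq: "dl r = (%x. \<Sum>k=1..step G. r ^ k *R proj k x)"
 unfolding dilation_def
proof (rule the_equality)
 let ?h = "%x. \<Sum>k=1..step G. r ^ k *R proj k x"
 have lin: "linear ?h" by (intro linear_compose_sum linear_compose_scale_right ballI linear_proj)
 have e: "?h v = r ^ j *R v" if j: "j : {1..step G}" "v : layer G j" for j v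
 proof -
  have "?h v = (\<Sum>k\<in>{1..step G}. if k = j then r ^ j *R v else 0)"
   by (rule sum.cong) (use j proj_id proj_other in auto)
  then show ?thesis using j by simp
 qed
 show "linear ?h & (\<forall>k\<in>{1..step G}. \<forall>v\<in>layer G k. ?h v = r ^ k *R v)"
  using lin e by blast
 fix h assume h: "linear h & (\<forall>k\<in>{1..step G}. \<forall>v\<in>layer G k. h v = r ^ k *R v)"
 show "h = ?h"
 proof
  fix x :: 'a
  have "x : span (\<Union>k\<in>{1..step G}. layer G k)" using span_layers by simp
  then show "h x = ?h x"
   by (rule linear_eq_on_span[of h ?h, rotated 3]) (use h lin e in auto)
 qed
qed

lemma bounded_linear_dilation: "bounded_linear (dl r)"
 unfolding dilation_eq by (intro bounded_linear_sum bounded_linear_scaleR_right bounded_linear_const_scaleR bounded_linear_proj)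

lemma linear_dilation: "linear (dl r)"
 using bounded_linear_dilation by (rule bounded_linear.linear)

lemmas dilation_simps = linear_add[OF linear_dilation] linear_diff[OF linear_dilation]
 linear_cmul[OF linear_dilation] linear_neg[OF linear_dilation] linear_sum[OF linear_dilation]
 linear_0[OF linear_dilation]

lemma proj_dilation: "1 <= k ==> proj k (dl r x) = r ^ k *R proj k x"
proof (cases "k <= step G")
 case True
 assume "1 <= k"
 have "proj k (dl r x) = (\<Sum>j\<in>{1..step G}. if j = k then r ^ k *R proj k x else 0)"
  unfolding dilation_eq proj_simps
  by (rule sum.cong) (use True \<open>1 <= k\<close> proj_proj in auto)
 then show ?thesis using True \<open>1 <= k\<close> by simp
qed (simp add: proj_above)

lemma dilation_layer:
 assumes "1 <= k" "v : layer G k"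
 shows "dl r v = r ^ k *R v"
proof (rule eq_by_proj)
 fix j :: nat assume j: "1 <= j"
 show "proj j (dl r v) = proj j (r ^ k *R v)"
 proof (cases "j = k")
  case True
  then show ?thesis using j by (simp only: proj_dilation proj_simps)
 next
  case False
  then have "proj j v = 0" using proj_other[of j k v] j assms by simp
  then show ?thesis using j by (simp only: proj_dilation proj_simps) simp
 qed
qed

lemma dilation_dilation: "dl r (dl s x) = dl (r * s) x"
 by (rule eq_by_proj) (simp add: proj_dilation power_mult_distrib)

lemma dilation_one [simp]: "dl 1 x = x"
 by (rule eq_by_proj) (simp add: proj_dilation)

lemma dilation_inverse: "r ~= 0 ==> dl r (dl (1 / r) x) = x"
 "r ~= 0 ==> dl (1 / r) (dl r x) = x"
 by (simp_all add: dilation_dilation)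

lemma dilation_0 [simp]: "dl r 0 = 0"
 by (simp add: dilation_simps)

text \<open>The sum of the layers from j upwards, which is the j-th term of the lower central
  series.\<close>

definition upper :: "nat => 'a set" where
 "upper j = {w. ALL i. 1 <= i & i < j --> proj i w = 0}"

lemma subspace_upper: "subspace (upper j)"
 by (auto simp: subspace_def upper_def proj_simps)

lemma layer_subset_upper: "1 <= k ==> layer G k <= upper k"
 unfolding upper_def using proj_other[of _ k] by force

lemma upper_antimono: "i <= j ==> upper j <= upper i"
 by (auto simp: upper_def)

lemma upper_SucI: "w : upper j ==> proj j w = 0 ==> w : upper (Suc j)"
 by (auto simp: upper_def less_Suc_eq)

lemma upper_above: "upper (Suc (step G)) = {0}"
proof -
 have "w = 0" if "w : upper (Suc (step G))" for w
  by (rule eq_by_proj) (use that in \<open>auto simp: upper_def proj_simps\<close>)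
 then show ?thesis using subspace_0[OF subspace_upper] by auto
qed

lemma upper_1: "upper (Suc 0) = UNIV"
 by (auto simp: upper_def)

lemma dilation_upper: "x : upper k ==> dl r x : upper k"
 by (auto simp: upper_def proj_dilation)

text \<open>On \<open>upper j\<close> the lowest power of r in a dilation is r^j. Higher components
  keep a surplus power of r, so the rescaled limit isolates the leading component.\<close>

lemma tendsto_dilation_upper:
 fixes j :: nat
 assumes "1 <= j" "w : upper j"
 shows "((%r. (1 / r ^ j) *R dl r w) \<longlongrightarrow> proj j w) (at_right 0)"
proof -
 have "((%r. (1 / r ^ j) *R r ^ k *R proj k w) \<longlongrightarrow> (if k = j then proj j w else 0)) (at_right 0)"
  if k: "k : {1..step G}" for k
 proof -
  consider "k < j" | "k = j" | "k > j" by linarith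
  then show ?thesis
  proof cases
   case 1
   then have "proj k w = 0" using assms k by (auto simp: upper_def)
   then show ?thesis using 1 by simp
  next
   case 2
   have "\<forall>\<^sub>F r in at_right 0. proj j w = (1 / r ^ j) *R r ^ k *R proj k w"
   unfolding eventually_at_right_field using 2 by (intro exI[of _ 1]) auto
   then show ?thesis using 2 by (auto intro: Lim_transform_eventually)
  next
   case 3
   have "\<forall>\<^sub>F r in at_right 0. r ^ (k - j) *R proj k w = (1 / r ^ j) *R r ^ k *R proj k w"
   unfolding eventually_at_right_field using 3 by (intro exI[of _ 1]) (auto simp: power_diff)
   moreover have "((%r::real. r ^ (k - j) *R proj k w) \<longlongrightarrow> 0 ^ (k - j) *R proj k w) (at_right 0)"
   by (intro tendsto_intros)
   ultimately show ?thesis using 3 by (auto simp: power_0_left intro: Lim_transform_eventually)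
  qed
 qed
 then have "((%r. \<Sum>k=1..step G. (1 / r ^ j) *R r ^ k *R proj k w) \<longlongrightarrow>
   (\<Sum>k=1..step G. if k = j then proj j w else 0)) (at_right 0)"
  by (intro tendsto_sum) auto
 moreover have "(\<Sum>k=1..step G. if k = j then proj j w else 0) = proj j w"
  using assms proj_above[of j w] by simp
 ultimately show ?thesis by (simp add: dilation_eq scaleR_sum_right)
qed

section \<open>The differential of the group law\<close>

definition mulD :: "'a \<times> 'a => 'a \<times> 'a => 'a" where
 "mulD p v = frechet_derivative (%p. mm (fst p) (snd p)) (at p) v"

lemma mul_has_derivative: "((%p. mm (fst p) (snd p)) has_derivative mulD p) (at p)"
 unfolding mulD_def[abs_def] using smooth_on_has_derivative[OF smooth_mult] .

lemma linear_mulD: "linear (mulD p)"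
 using mul_has_derivative has_derivative_linear by blast

lemma smooth_mulD:
 assumes "smooth_on g UNIV" "smooth_on h UNIV"
 shows "smooth_on (%x. mulD (g x) (h x)) UNIV"
 unfolding mulD_def using smooth_on_frechet_derivative2[OF smooth_mult] assms .

lemma continuous_mul: "continuous_on UNIV (%p. mm (fst p) (snd p))"
 using smooth_on_continuous[OF smooth_mult] .

lemma continuous_on_mul [continuous_intros]:
 "continuous_on S f ==> continuous_on S g ==> continuous_on S (%x. mm (f x) (g x))"
 using continuous_on_compose2[OF continuous_mul, of S "%x. (f x, g x)"] by (simp add: continuous_on_Pair)

lemma tendsto_mul [tendsto_intros]:
 assumes "(f \<longlongrightarrow> a) F" "(g \<longlongrightarrow> b) F"
 shows "((%x. mm (f x) (g x)) \<longlongrightarrow> mm a b) F"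
 using continuous_on_tendsto_compose[OF continuous_mul tendsto_Pair[OF assms]] by simp

lemma continuous_mulD: "continuous_on UNIV (%q. mulD (fst q) (snd q))"
 by (intro smooth_on_continuous smooth_mulD smooth_on_linear bounded_linear_fst bounded_linear_snd)

lemma tendsto_mulD [tendsto_intros]:
 assumes "(f \<longlongrightarrow> a) F" "(g \<longlongrightarrow> b) F"
 shows "((%x. mulD (f x) (g x)) \<longlongrightarrow> mulD a b) F"
 using continuous_on_tendsto_compose[OF continuous_mulD tendsto_Pair[OF assms]] by simp

lemma mul_right_has_derivative: "((%y. mm x y) has_derivative (%v. mulD (x, y) (0, v))) (at y)"
proof -
 have "((%y. (x, y)) has_derivative (%v. (0, v))) (at y)"
  by (auto intro!: derivative_eq_intros)
 from has_derivative_compose[OF this mul_has_derivative] show ?thesis by simp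
qed

lemma mul_left_has_derivative: "((%x. mm x y) has_derivative (%v. mulD (x, y) (v, 0))) (at x)"
proof -
 have "((%x. (x, y)) has_derivative (%v. (v, 0))) (at x)"
  by (auto intro!: derivative_eq_intros)
 from has_derivative_compose[OF this mul_has_derivative] show ?thesis by simp
qed

lemma left_field_eq: "left_field G u x = mulD (x, 0) (0, u)"
 unfolding left_field_def using frechet_derivative_eqI[OF mul_right_has_derivative] by simp

lemma inverse_mul: "- mm x y = mm (- y) (- x)"
 using inverse_unique[of "mm x y" "mm (- y) (- x)"]
 by (metis assoc left_inverse inverse_inverse left_neutral)

text \<open>Inversion is \<open>uminus\<close> and reverses products. Differentiating
  \<open>- mm (- y) (- x)\<close> in \<open>x\<close> therefore expresses the differential in the
  left factor by the one in the right factor.\<close>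

lemma mulD_left: "mulD (x, y) (v, 0) = mulD (- y, - x) (0, v)"
proof -
 have "((%x. - mm (- y) (- x)) has_derivative (%v. - mulD (- y, - x) (0, - v))) (at x)"
  by (rule has_derivative_minus[OF has_derivative_compose[of uminus uminus x UNIV, OF _ mul_right_has_derivative]])
   (auto intro!: derivative_eq_intros)
 moreover have "(%x. - mm (- y) (- x)) = (%x. mm x y)"
  by (simp add: inverse_mul)
 ultimately have "(%v. - mulD (- y, - x) (0, - v)) = (%v. mulD (x, y) (v, 0))"
  using has_derivative_unique mul_left_has_derivative by metis
 from fun_cong[OF this, of v] have "mulD (x, y) (v, 0) = - mulD (- y, - x) (- (0, v))" by simp
 then show ?thesis by (simp only: linear_neg[OF linear_mulD]) simp
qed

lemma mulD_0_right [simp]: "mulD (0, y) (0, w) = w"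
proof -
 have "(%v. mulD (0, y) (0, v)) = (%v. v)"
  using has_derivative_unique[OF mul_right_has_derivative[of 0 y]] by simp
 then show ?thesis by metis
qed

lemma mulD_0_left [simp]: "mulD (x, 0) (v, 0) = v"
 by (simp add: mulD_left)

lemma mulD_dilation:
 assumes "0 < r"
 shows "dl r (mulD (x, y) (v, w)) =
  mulD (dl r x, dl r y) (dl r v, dl r w)"
proof -
 let ?d = "dl r"
 have 1: "((%p. ?d (mm (fst p) (snd p))) has_derivative (%v. ?d (mulD (x, y) v))) (at (x, y))"
  by (rule bounded_linear.has_derivative[OF bounded_linear_dilation mul_has_derivative])
 have "((%p. (?d (fst p), ?d (snd p))) has_derivative (%v. (?d (fst v), ?d (snd v)))) (at (x, y))"
  by (intro has_derivative_Pair bounded_linear.has_derivative[OF bounded_linear_dilation] derivative_eq_intros) auto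
 from has_derivative_compose[OF this mul_has_derivative]
 have "((%p. ?d (mm (fst p) (snd p))) has_derivative (%v. mulD (?d x, ?d y) (?d (fst v), ?d (snd v)))) (at (x, y))"
  using assms by (simp add: dilation_mult)
 from fun_cong[OF has_derivative_unique[OF 1 this], of "(v, w)"] show ?thesis by simp
qed

text \<open>Conjugating by the dilation of factor r and dividing by r^j leaves the left side
  unchanged. As r tends to 0, the base point tends to \<open>(0, 0)\<close>, where the differential
  is the identity in the second slot, and the rescaled vector tends to
  \<open>proj j w\<close>.\<close>

lemma proj_mulD:
 assumes "1 <= j" "w : upper j"
 shows "proj j (mulD (x, y) (0, w)) = proj j w"
proof -
 let ?d = "dl"
 have ev: "\<forall>\<^sub>F r in at_right 0. proj j (mulD (?d r x, ?d r y) (0, (1 / r ^ j) *R ?d r w)) =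
   proj j (mulD (x, y) (0, w))"
  unfolding eventually_at_right_field
 proof (intro exI[of _ 1] conjI allI impI)
  fix r :: real assume r: "0 < r"
  have "mulD (?d r x, ?d r y) (0, (1 / r ^ j) *R ?d r w) =
   mulD (?d r x, ?d r y) ((1 / r ^ j) *R (0, ?d r w))" by simp
  also have "... = (1 / r ^ j) *R mulD (?d r x, ?d r y) (0, ?d r w)"
   by (rule linear_cmul[OF linear_mulD])
  also have "... = (1 / r ^ j) *R ?d r (mulD (x, y) (0, w))"
   using mulD_dilation[OF r, of x y 0 w] by simp
  finally show "proj j (mulD (?d r x, ?d r y) (0, (1 / r ^ j) *R ?d r w)) = proj j (mulD (x, y) (0, w))"
   using assms r by (simp add: proj_simps proj_dilation)
 qed simp
 have lim0: "((%r. ?d r z) \<longlongrightarrow> 0) (at_right 0)" for z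
 proof -
  have "((%r. \<Sum>k=1..step G. r ^ k *R proj k z) \<longlongrightarrow> (\<Sum>k=1..step G. 0 ^ k *R proj k z)) (at_right 0)"
   by (intro tendsto_intros)
  moreover have "(\<Sum>k=1..step G. 0 ^ k *R proj k z) = 0"
   by (rule sum.neutral) auto
  ultimately show ?thesis by (simp add: dilation_eq)
 qed
 have "((%r. proj j (mulD (?d r x, ?d r y) (0, (1 / r ^ j) *R ?d r w))) \<longlongrightarrow>
   proj j (mulD (0, 0) (0, proj j w))) (at_right 0)"
  by (intro bounded_linear.tendsto[OF bounded_linear_proj] tendsto_intros lim0
   tendsto_dilation_upper assms)
 then have "((%r. proj j (mulD (x, y) (0, w))) \<longlongrightarrow> proj j (mulD (0, 0) (0, proj j w))) (at_right (0::real))"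
  using ev by (rule Lim_transform_eventually)
 then have "proj j (mulD (x, y) (0, w)) = proj j (mulD (0, 0) (0, proj j w))"
  using tendsto_const_iff[of "at_right (0::real)"] by (auto simp: trivial_limit_at_right_real)
 then show ?thesis using assms by (simp add: proj_proj)
qed

text \<open>Homogeneity makes the group law lower triangular with respect to the layers.\<close>

lemma proj_mul_add_right:
 assumes "1 <= j" "w : upper j"
 shows "proj j (mm x (y + w)) = proj j (mm x y) + proj j w"
proof -
 \<comment> \<open>By \<open>proj_mulD\<close> the derivative along the segment is the constant
   \<open>proj j w\<close>, so \<open>ph\<close> has derivative 0.\<close>
 define ph where "ph t = proj j (mm x (y + t *R w)) - t *R proj j w" for t :: real
 have "(ph has_vector_derivative 0) (at t)" for t
 proof -
  have "((%t. y + t *R w) has_derivative (%s. s *R w)) (at t)"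
   by (auto intro!: derivative_eq_intros)
  from bounded_linear.has_derivative[OF bounded_linear_proj has_derivative_compose[OF this mul_right_has_derivative]]
  have "((%t. proj j (mm x (y + t *R w))) has_derivative
   (%s. proj j (mulD (x, y + t *R w) (0, s *R w)))) (at t)" .
  moreover have "proj j (mulD (x, y + t *R w) (0, s *R w)) = s *R proj j w" for s
   using proj_mulD[OF assms(1), of "s *R w"] assms subspace_upper
   by (simp add: proj_simps subspace_scale)
  ultimately have "((%t. proj j (mm x (y + t *R w))) has_derivative (%s. s *R proj j w)) (at t)"
   by simp
  then show ?thesis unfolding ph_def has_vector_derivative_def
   by (auto intro!: derivative_eq_intros)
 qed
 then have "ph 1 = ph 0"
  using has_vector_derivative_zero_constant[of UNIV ph] by (metis UNIV_I convex_UNIV has_vector_derivative_at_within)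
 then show ?thesis by (simp add: ph_def algebra_simps)
qed

lemma proj_mul_add_left:
 assumes "1 <= j" "w : upper j"
 shows "proj j (mm (x + w) y) = proj j (mm x y) + proj j w"
proof -
 have "proj j (mm (x + w) y) = - proj j (mm (- y) (- x + - w))"
  using inverse_mul[of "x + w" y] by (metis minus_add_distrib minus_minus proj_simps(4))
 also have "... = - proj j (mm (- y) (- x)) + proj j w"
  using proj_mul_add_right[OF assms(1), of "- w"] assms subspace_upper
  by (simp add: proj_simps subspace_neg)
 also have "- proj j (mm (- y) (- x)) = proj j (mm x y)"
  by (metis inverse_mul minus_minus proj_simps(4))
 finally show ?thesis .
qed

lemma proj_mul:
 assumes "1 <= j" "y : upper j"
 shows "proj j (mm x y) = proj j x + proj j y"
 using proj_mul_add_right[OF assms, of x 0] by simp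

lemma mul_upper:
 assumes "x : upper k" "y : upper k"
 shows "mm x y : upper k"
proof -
 have "proj i (mm x y) = 0" if "1 <= i" "i < k" for i
  using proj_mul[of i y x] upper_antimono[of i k] that assms by (auto simp: upper_def)
 then show ?thesis by (auto simp: upper_def)
qed

section \<open>Conjugation, left-invariant fields and the Lie bracket\<close>

definition Ad :: "'a => 'a => 'a" where
 "Ad x y = mm (mm x y) (- x)"

lemma Ad_mul: "Ad x (mm y z) = mm (Ad x y) (Ad x z)"
proof -
 have "mm (- x) (mm x w) = w" for w by (metis assoc left_inverse left_neutral)
 then show ?thesis unfolding Ad_def by (simp add: assoc)
qed

lemma Ad_of_nat: "Ad x (real n *R y) = real n *R Ad x y"
proof (induction n)
 case 0
 then show ?case by (simp add: Ad_def)
next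
 case (Suc n)
 have "real (Suc n) *R y = mm (real n *R y) (1 *R y)"
  using one_parameter[of "real n" y 1] by (simp add: add.commute)
 then have "Ad x (real (Suc n) *R y) = mm (real n *R Ad x y) (1 *R Ad x y)"
  using Suc by (simp add: Ad_mul)
 then show ?case by (simp only: one_parameter) (simp add: add.commute)
qed

text \<open>Since \<open>exp\<close> is the identity, \<open>Ad x\<close> commutes with integer multiples, hence it coincides with
 its derivative at \<open>0\<close>.\<close>

lemma Ad_eq: "Ad x y = mulD (x, - x) (mulD (x, 0) (0, y), 0)"
proof -
 define L where "L y = mulD (x, - x) (mulD (x, 0) (0, y), 0)" for y
 have L: "(Ad x has_derivative L) (at 0)"
  unfolding Ad_def[abs_def] L_def[abs_def]
  using has_derivative_compose[OF mul_right_has_derivative[of x 0]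
   mul_left_has_derivative[where y = "- x" and x = "mm x 0"]] by simp
 then have lin: "linear L" by (rule has_derivative_linear)
 have "((%t. t *R y) has_derivative (%t. t *R y)) (at (0::real))"
  by (auto intro!: derivative_eq_intros)
 with L have "((%t. Ad x (t *R y)) has_derivative (%t. L (t *R y))) (at (0::real))"
  using has_derivative_compose[of "%t. t *R y" "%t. t *R y" 0 UNIV "Ad x" L] by simp
 then have "((%t. Ad x (t *R y)) has_vector_derivative L y) (at 0)"
  using lin by (simp add: has_vector_derivative_def linear_cmul)
 from has_vector_derivative_quotient[OF this]
 have "((%t. (1 / t) *R Ad x (t *R y)) \<longlongrightarrow> L y) (at 0)"
  by (simp add: Ad_def)
 moreover have "filterlim (%n. inverse (real (Suc n))) (at 0) sequentially"
  by (intro filterlim_atI LIMSEQ_inverse_real_of_nat) auto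
 ultimately have "(%n. (1 / inverse (real (Suc n))) *R Ad x (inverse (real (Suc n)) *R y)) \<longlonglongrightarrow> L y"
  by (rule filterlim_compose)
 moreover have "(1 / inverse (real (Suc n))) *R Ad x (inverse (real (Suc n)) *R y) = Ad x y" for n
 proof -
  have "Ad x y = Ad x (real (Suc n) *R (inverse (real (Suc n)) *R y))"
   by (simp del: of_nat_Suc)
  also have "... = real (Suc n) *R Ad x (inverse (real (Suc n)) *R y)" by (rule Ad_of_nat)
  finally show ?thesis by (simp add: inverse_eq_divide del: of_nat_Suc)
 qed
 ultimately show ?thesis unfolding L_def by (simp add: tendsto_const_iff)
qed

lemma linear_Ad: "linear (Ad x)"
proof -
 have "linear (%w. (w, 0) :: 'a \<times> 'a)" "linear (%w. (0, w) :: 'a \<times> 'a)"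
  by (auto intro!: linearI)
 then have l: "linear (%w. mulD p (w, 0))" "linear (%w. mulD p (0, w))" for p
  using linear_compose[OF _ linear_mulD[of p], of "%w. (w, 0)"]
   linear_compose[OF _ linear_mulD[of p], of "%w. (0, w)"]
  by (simp_all add: o_def)
 show ?thesis
  using linear_compose[OF l(2)[of "(x, 0)"] l(1)[of "(x, - x)"]] by (simp add: o_def Ad_eq[abs_def])
qed

lemma dilation_Ad: "0 < r ==> dl r (Ad x y) = Ad (dl r x) (dl r y)"
 by (simp add: Ad_def dilation_mult dilation_simps)

lemma smooth_left_field: "smooth_on (left_field G v) UNIV"
proof -
 have "smooth_on (%x::'a. (x, 0::'a)) UNIV"
  by (intro smooth_on_linear bounded_linear_Pair bounded_linear_ident bounded_linear_zero)
 then show ?thesis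
  unfolding left_field_eq[abs_def] by (intro smooth_mulD smooth_on_const)
qed

lemma left_field_0 [simp]: "left_field G v 0 = v"
 by (simp add: left_field_eq)

lemma left_field_add: "left_field G (u + v) x = left_field G u x + left_field G v x"
 using linear_add[OF linear_mulD, of "(x, 0)" "(0, u)" "(0, v)"] by (simp add: left_field_eq)

lemma left_field_scaleR: "left_field G (c *R v) x = c *R left_field G v x"
 using linear_cmul[OF linear_mulD, of "(x, 0)" c "(0, v)"] by (simp add: left_field_eq)

text \<open>The lines through 0 are one-parameter subgroups, hence integral curves of left-invariant
  fields: differentiate the product of \<open>t *R u\<close> and \<open>s *R u\<close> at s =
  0.\<close>

lemma left_field_line: "left_field G u (t *R u) = u"
proof -
 have "((%s. s *R u) has_derivative (%s. s *R u)) (at (0::real))"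
  by (auto intro!: derivative_eq_intros)
 from has_derivative_compose[OF this mul_right_has_derivative]
 have 1: "((%s. mm (t *R u) (s *R u)) has_derivative (%s. mulD (t *R u, 0) (0, s *R u))) (at (0::real))"
  by simp
 have "((%s. (t + s) *R u) has_derivative (%s. s *R u)) (at (0::real))"
  by (auto intro!: derivative_eq_intros)
 then have "((%s. mm (t *R u) (s *R u)) has_derivative (%s. s *R u)) (at (0::real))"
  by (simp add: one_parameter)
 from fun_cong[OF has_derivative_unique[OF 1 this], of 1] show ?thesis by (simp add: left_field_eq)
qed

lemma left_field_has_derivative:
 "(left_field G v has_derivative frechet_derivative (left_field G v) (at x)) (at x)"
 using smooth_on_has_derivative[OF smooth_left_field] .

text \<open>The bilinear map \<open>(u, v) \<mapsto> D V(u)\<close> at the identity vanishes on the diagonal, so the bracket is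
 twice this map.\<close>

lemma bracket_eq: "bracket G u v = 2 *R frechet_derivative (left_field G v) (at 0) u"
proof -
 define M where "M u v = frechet_derivative (left_field G v) (at 0) u" for u v
 have line: "((%t. left_field G v (t *R u)) has_derivative (%t. M (t *R u) v)) (at (0::real))" for u v
 proof -
  have "((%s. s *R u) has_derivative (%s. s *R u)) (at (0::real))"
   by (auto intro!: derivative_eq_intros)
  from has_derivative_compose[OF this left_field_has_derivative] show ?thesis by (simp add: M_def)
 qed
 have diag: "M u u = 0" for u
 proof -
  have "((%t::real. u) has_derivative (%t. M (t *R u) u)) (at 0)"
   using line[of u u] by (simp add: left_field_line)
  from fun_cong[OF has_derivative_unique[OF this has_derivative_const], of 1] show ?thesis by simp
 qed
 have lin1: "linear (%u. M u v)" for v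
  unfolding M_def by (rule has_derivative_linear[OF left_field_has_derivative])
 have add2: "M u (v + w) = M u v + M u w" for u v w
 proof -
  have "(left_field G (v + w) has_derivative (%u. M u v + M u w)) (at 0)"
   unfolding left_field_add[abs_def] M_def by (intro has_derivative_add left_field_has_derivative)
  from frechet_derivative_eqI[OF this] show ?thesis unfolding M_def by simp
 qed
 have "M (u + v) (u + v) = M u v + M v u"
  unfolding add2 linear_add[OF lin1] by (simp add: diag)
 with diag[of "u + v"] have "M u v + M v u = 0" by (rule trans[OF sym, rotated])
 then have "M v u = - M u v" by (simp add: eq_neg_iff_add_eq_0 add.commute)
 then show ?thesis unfolding bracket_def M_def by (simp add: scaleR_2)
qed

text \<open>\<open>Ad (t *R u) v\<close> is \<open>mulD (t *R u, - (t *R u))\<close> applied to the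
  left field of \<open>v\<close> at \<open>t *R u\<close>. Its increment splits into the change of
  the vector and the change of the base point. Each contributes \<open>M u\<close>, the derivative
  of the left field, and by \<open>bracket_eq\<close> the bracket is twice that.\<close>

lemma tendsto_Ad: "((%t. (1 / t) *R (Ad (t *R u) v - v)) \<longlongrightarrow> bracket G u v) (at 0)"
proof -
 define M where "M = frechet_derivative (left_field G v) (at 0)"
 define R where "R p = mulD p (v, 0)" for p
 define ph where "ph t = left_field G v (t *R u)" for t :: real
 have "smooth_on R UNIV"
  unfolding R_def by (intro smooth_mulD smooth_on_linear smooth_on_const bounded_linear_ident)
 then obtain R' where R': "(R has_derivative R') (at 0)"
  using smooth_on_has_derivative[of R 0] by metis
 have R'lin: "linear R'" by (rule has_derivative_linear[OF R'])
 have l: "((%t. t *R p) has_derivative (%t. t *R p)) (at (0::real))" for p :: "'z::real_normed_vector"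
  by (auto intro!: derivative_eq_intros)
 have lM: "((%t. left_field G v (t *R w)) has_derivative (%t. M (t *R w))) (at (0::real))" for w
  using has_derivative_compose[OF l left_field_has_derivative] by (simp add: M_def)
 have lR: "((%t. R (t *R p)) has_derivative (%t. R' (t *R p))) (at (0::real))" for p
  using has_derivative_compose[OF l, of R R' p] R' by simp
 have R1: "R' (u, 0) = 0"
 proof -
  have "((%t::real. v) has_derivative (%t. R' (t *R (u, 0)))) (at 0)"
   using lR[of "(u, 0)"] by (simp add: R_def)
  from fun_cong[OF has_derivative_unique[OF this has_derivative_const], of 1] show ?thesis
   by simp
 qed
 have R2: "R' (0, - u) = M u"
 proof -
  have "((%t::real. left_field G v (t *R u)) has_derivative (%t. R' (t *R (0, - u)))) (at 0)"
   using lR[of "(0, - u)"] by (simp add: R_def mulD_left left_field_eq)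
  from fun_cong[OF has_derivative_unique[OF this lM], of 1] show ?thesis
   by simp
 qed
 have R3: "R' (u, - u) = M u"
  using linear_add[OF R'lin, of "(u, 0)" "(0, - u)"] R1 R2 by simp
 have linM: "linear M" unfolding M_def by (rule has_derivative_linear[OF left_field_has_derivative])
 have "((%t. (1 / t) *R (R (t *R (u, - u)) - R (0 *R (u, - u)))) \<longlongrightarrow> M u) (at 0)"
  by (rule has_vector_derivative_quotient)
   (use lR[of "(u, - u)"] R3 linear_cmul[OF R'lin, of _ "(u, - u)"] in \<open>simp add: has_vector_derivative_def\<close>)
 moreover have "((%t. (1 / t) *R (ph t - ph 0)) \<longlongrightarrow> M u) (at 0)"
  unfolding ph_def by (rule has_vector_derivative_quotient)
   (use lM[of u] linear_cmul[OF linM, of _ u] in \<open>simp add: has_vector_derivative_def\<close>)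
 then have "((%t. mulD (t *R u, - (t *R u)) ((1 / t) *R (ph t - v), 0)) \<longlongrightarrow> mulD (0 *R u, - (0 *R u)) (M u, 0)) (at 0)"
  by (intro tendsto_intros tendsto_Pair) (simp_all add: ph_def)
 ultimately have lim: "((%t. mulD (t *R u, - (t *R u)) ((1 / t) *R (ph t - v), 0) +
   (1 / t) *R (R (t *R (u, - u)) - R (0 *R (u, - u)))) \<longlongrightarrow> mulD (0 *R u, - (0 *R u)) (M u, 0) + M u) (at 0)"
  by (intro tendsto_add)
 have e: "mulD (t *R u, - (t *R u)) ((1 / t) *R (ph t - v), 0) +
   (1 / t) *R (R (t *R (u, - u)) - R (0 *R (u, - u))) = (1 / t) *R (Ad (t *R u) v - v)" for t
 proof -
  have "mulD (t *R u, - (t *R u)) ((1 / t) *R (ph t - v), 0) =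
   (1 / t) *R (mulD (t *R u, - (t *R u)) (ph t, 0) - mulD (t *R u, - (t *R u)) (v, 0))"
   using linear_cmul[OF linear_mulD, of "(t *R u, - (t *R u))" "1 / t" "(ph t - v, 0)"]
   linear_diff[OF linear_mulD, of "(t *R u, - (t *R u))" "(ph t, 0)" "(v, 0)"] by simp
  moreover have "Ad (t *R u) v = mulD (t *R u, - (t *R u)) (ph t, 0)"
   by (simp add: Ad_eq ph_def left_field_eq)
  moreover have "R (0 *R (u, - u)) = v" by (simp add: R_def zero_prod_def)
  ultimately show ?thesis by (simp add: R_def algebra_simps)
 qed
 have "mulD (0 *R u, - (0 *R u)) (M u, 0) + M u = bracket G u v"
  by (simp add: bracket_eq M_def scaleR_2)
 then show ?thesis using lim by (simp only: e)
qed

end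

section \<open>Commutators and products of horizontal elements\<close>

context carnot_group begin

text \<open>Homogeneity again: for every r > 0 the j-th component equals r^(k+1-j) times that of the
  quotient \<open>Q r\<close>, and \<open>Q r\<close> tends to the bracket. For j at most k the
  positive power of r forces 0; for j = k + 1 the bracket remains.\<close>

lemma Ad_layer:
 assumes "1 <= k" "u : layer G 1" "v : layer G k"
 shows "Ad u v - v : upper (Suc k)" "proj (Suc k) (Ad u v - v) = bracket G u v"
proof -
 define Q where "Q t = (1 / t) *R (Ad (t *R u) v - v)" for t :: real
 have Q: "(Q \<longlongrightarrow> bracket G u v) (at_right 0)"
  unfolding Q_def by (rule filterlim_mono[OF tendsto_Ad]) (auto simp: at_le)
 have br: "bracket G u v : layer G (Suc k)"
  unfolding bracket_layers[OF assms(1)] by (rule span_base) (use assms in blast)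
 have scale: "proj j (Ad u v - v) = r ^ (Suc k - j) *R proj j (Q r)"
  if j: "1 <= j" "j <= Suc k" and r: "0 < r" for j r
 proof -
  have "dl r (Ad u v) = r ^ k *R Ad (r *R u) v"
   using dilation_Ad[OF r, of u v] dilation_layer[of 1 u r] dilation_layer[OF assms(1,3), of r] assms(2)
   by (simp add: linear_cmul[OF linear_Ad])
  then have "r ^ j *R proj j (Ad u v) = r ^ k *R proj j (Ad (r *R u) v)"
   using proj_dilation[OF j(1), of r "Ad u v"] by (simp add: proj_simps)
  moreover have "r ^ j *R proj j v = r ^ k *R proj j v"
   using proj_other[of j k v] j assms by (cases "j = k") auto
  moreover have "r *R Q r = Ad (r *R u) v - v" using r by (simp add: Q_def)
  ultimately have "r ^ j *R proj j (Ad u v - v) = r ^ k *R proj j (r *R Q r)"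
   by (simp only: proj_simps(2) scaleR_diff_right)
  also have "... = r ^ Suc k *R proj j (Q r)" by (simp add: proj_simps)
  also have "... = r ^ j *R r ^ (Suc k - j) *R proj j (Q r)"
   using j by (metis le_add_diff_inverse power_add scaleR_scaleR)
  finally show ?thesis using r by (simp only: scaleR_cancel_left) auto
 qed
 have lim: "proj j (Ad u v - v) = 0 ^ (Suc k - j) *R proj j (bracket G u v)"
  if j: "1 <= j" "j <= Suc k" for j
 proof (rule tendsto_unique)
  show "((%r. r ^ (Suc k - j) *R proj j (Q r)) \<longlongrightarrow> 0 ^ (Suc k - j) *R proj j (bracket G u v)) (at_right (0::real))"
   by (intro tendsto_intros bounded_linear.tendsto[OF bounded_linear_proj] Q)
  show "((%r. r ^ (Suc k - j) *R proj j (Q r)) \<longlongrightarrow> proj j (Ad u v - v)) (at_right (0::real))"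
  proof (rule Lim_transform_eventually[OF tendsto_const])
   show "\<forall>\<^sub>F r in at_right 0. proj j (Ad u v - v) = r ^ (Suc k - j) *R proj j (Q r)"
   unfolding eventually_at_right_field using scale[OF j] by (intro exI[of _ 1]) auto
  qed
 qed (simp add: trivial_limit_at_right_real)
 show "Ad u v - v : upper (Suc k)"
  unfolding upper_def using lim by (auto simp: power_0_left)
 show "proj (Suc k) (Ad u v - v) = bracket G u v"
  using lim[of "Suc k"] proj_id[OF _ br] by simp
qed

lemma Ad_upper:
 assumes "1 <= k" "u : layer G 1" "x : upper k"
 shows "Ad u x - x : upper (Suc k)" "proj (Suc k) (Ad u x - x) = bracket G u (proj k x)"
proof -
 have lin: "linear (%y. Ad u y - y)" by (intro linear_compose_sub linear_Ad linear_ident)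
 have e: "Ad u x - x = (\<Sum>i=1..step G. Ad u (proj i x) - proj i x)"
  using linear_sum[OF lin, of "%i. proj i x" "{1..step G}"] by (simp only: sum_proj)
 have mem: "Ad u (proj i x) - proj i x : upper (Suc (max i k))" if "i : {1..step G}" for i
 proof (cases "k <= i")
  case True
  then show ?thesis using Ad_layer(1)[of i u "proj i x"] that assms proj_in_layer by (auto simp: max_def)
 next
  case False
  then have "proj i x = 0" using assms(3) that by (auto simp: upper_def)
  then show ?thesis using linear_0[OF linear_Ad] subspace_0[OF subspace_upper] by simp
 qed
 have "upper (Suc (max i k)) <= upper (Suc k)" for i by (rule upper_antimono) simp
 with mem show "Ad u x - x : upper (Suc k)"
  unfolding e by (intro subspace_sum[OF subspace_upper]) auto
 have z: "proj (Suc k) (Ad u (proj i x) - proj i x) = (if i = k then bracket G u (proj k x) else 0)"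
  if i: "i : {1..step G}" for i
 proof (cases i k rule: linorder_cases)
  case less
  then have "proj i x = 0" using assms(3) i by (auto simp: upper_def)
  then show ?thesis using less linear_0[OF linear_Ad] by (simp add: proj_simps)
 next
  case equal
  then show ?thesis using Ad_layer(2)[OF assms(1,2) proj_in_layer[OF assms(1)]] by simp
 next
  case greater
  then show ?thesis using mem[OF i] by (auto simp: upper_def max_def)
 qed
 have "proj (Suc k) (Ad u x - x) = (\<Sum>i=1..step G. if i = k then bracket G u (proj k x) else 0)"
  unfolding e proj_simps(5) by (rule sum.cong) (auto simp: z)
 also have "... = bracket G u (proj k x)"
 proof (cases "k <= step G")
  case False
  have "bracket G u (proj k x) : layer G (Suc k)"
   unfolding bracket_layers[OF assms(1)]
   by (rule span_base) (use assms(2) proj_in_layer[OF assms(1)] in blast)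
  then have "bracket G u (proj k x) = 0" using layers_above[of "Suc k"] False by simp
  then show ?thesis using False by simp
 qed (use assms in auto)
 finally show "proj (Suc k) (Ad u x - x) = bracket G u (proj k x)" .
qed

text \<open>\<open>Ad u x\<close> is \<open>x + w\<close> with \<open>w\<close> in
  \<open>upper (Suc k)\<close>. By the triangular form of the product, \<open>w\<close> enters the
  components up to k + 1 additively, and \<open>x\<close> cancels against
  \<open>- x\<close>.\<close>

lemma commutator_upper:
 assumes "1 <= k" "u : layer G 1" "x : upper k"
 shows "mm (Ad u x) (- x) : upper (Suc k)"
  "proj (Suc k) (mm (Ad u x) (- x)) = bracket G u (proj k x)"
proof -
 define w where "w = Ad u x - x"
 have w: "w : upper (Suc k)" "proj (Suc k) w = bracket G u (proj k x)"
  using Ad_upper[OF assms] by (auto simp: w_def)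
 have *: "proj j (mm (Ad u x) (- x)) = proj j w" if "1 <= j" "j <= Suc k" for j
 proof -
  have "proj j (mm (x + w) (- x)) = proj j (mm x (- x)) + proj j w"
   using upper_antimono[of j "Suc k"] that w by (intro proj_mul_add_left) auto
  then show ?thesis by (simp add: w_def proj_simps)
 qed
 show "mm (Ad u x) (- x) : upper (Suc k)" using * w(1) by (auto simp: upper_def)
 show "proj (Suc k) (mm (Ad u x) (- x)) = bracket G u (proj k x)" using * w(2) by simp
qed

text \<open>At most \<open>N\<close> factors instead of exactly \<open>N\<close>, so that the sets
  increase with \<open>N\<close>; the empty word is 0.\<close>

definition words :: "nat => real => 'a set" where
 "words N C = {foldr mm vs 0 |vs. length vs <= N & (\<forall>v\<in>set vs. v : layer G 1 & norm v <= C)}"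

lemma foldr_mult: "foldr mm vs y = mm (foldr mm vs 0) y"
 by (induction vs) (auto simp: assoc)

lemma words_mono: "N <= N' ==> C <= C' ==> words N C <= words N' C'"
 unfolding words_def by force

lemma words_mult:
 assumes "x : words N C" "y : words N' C"
 shows "mm x y : words (N + N') C"
proof -
 obtain vs ws where "x = foldr mm vs 0" "length vs <= N" "\<forall>v\<in>set vs. v : layer G 1 & norm v <= C"
  "y = foldr mm ws 0" "length ws <= N'" "\<forall>v\<in>set ws. v : layer G 1 & norm v <= C"
  using assms by (auto simp: words_def)
 then show ?thesis unfolding words_def
  by (intro CollectI exI[of _ "vs @ ws"]) (auto simp: foldr_mult[of vs "foldr mm ws 0"])
qed

lemma words_0: "0 : words N C"
 unfolding words_def by (intro CollectI exI[of _ "[]"]) auto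

lemma words_layer: "v : layer G 1 ==> norm v <= C ==> v : words 1 C"
 unfolding words_def by (intro CollectI exI[of _ "[v]"]) auto

lemma words_uminus: "x : words N C ==> - x : words N C"
proof -
 assume "x : words N C"
 then obtain vs where vs: "x = foldr mm vs 0" "length vs <= N" "\<forall>v\<in>set vs. v : layer G 1 & norm v <= C"
  by (auto simp: words_def)
 have "- foldr mm vs 0 = foldr mm (rev (map uminus vs)) 0"
  by (induction vs) (auto simp: foldr_mult[of _ "- _"] inverse_mul)
 with vs show ?thesis unfolding words_def using subspace_neg[OF subspace_layer[of 1]]
  by (intro CollectI exI[of _ "rev (map uminus vs)"]) auto
qed

lemma words_dilation:
 assumes "x : words N C" "0 < r" "r <= R" "0 <= C"
 shows "dl r x : words N (R * C)"
proof -
 obtain vs where vs: "x = foldr mm vs 0" "length vs <= N" "\<forall>v\<in>set vs. v : layer G 1 & norm v <= C"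
  using assms by (auto simp: words_def)
 have "dl r (foldr mm vs 0) = foldr mm (map (dl r) vs) 0"
  using assms(2) by (induction vs) (auto simp: dilation_mult)
 moreover have "dl r v : layer G 1 & norm (dl r v) <= R * C" if "v : set vs" for v
 proof -
  have "norm (r *R v) <= R * C" using vs(3) that assms by (simp add: mult_mono)
  then show ?thesis
   using vs(3) that dilation_layer[of 1 v r] subspace_scale[OF subspace_layer[of 1]] by simp
 qed
 ultimately show ?thesis unfolding words_def using vs
  by (intro CollectI exI[of _ "map (dl r) vs"]) auto
qed

lemma compact_mul_image: "compact S ==> compact T ==> compact ((%p. mm (fst p) (snd p)) ` (S \<times> T))"
 by (intro compact_continuous_image continuous_on_subset[OF continuous_mul] compact_Times) auto

lemma bounded_words: "bounded (words N C)"
proof (induction N)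
 case 0
 have "words 0 C <= {0}" by (auto simp: words_def)
 then show ?case by (rule bounded_subset[rotated]) simp
next
 case (Suc N)
 then have "compact (closure (words N C))" by simp
 from compact_mul_image[OF compact_cball this, of 0 C]
 have "bounded (insert 0 ((%p. mm (fst p) (snd p)) ` (cball 0 C \<times> closure (words N C))))"
  by (simp add: compact_imp_bounded)
 moreover have "words (Suc N) C <= insert 0 ((%p. mm (fst p) (snd p)) ` (cball 0 C \<times> closure (words N C)))"
 proof
  fix x assume "x : words (Suc N) C"
  then obtain vs where vs: "x = foldr mm vs 0" "length vs <= Suc N" "\<forall>v\<in>set vs. v : layer G 1 & norm v <= C"
   by (auto simp: words_def)
  show "x : insert 0 ((%p. mm (fst p) (snd p)) ` (cball 0 C \<times> closure (words N C)))"
  proof (cases vs)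
   case Nil
   then show ?thesis using vs by simp
  next
   case (Cons a as)
   then have "foldr mm as 0 : words N C" unfolding words_def using vs by auto
   then have "(a, foldr mm as 0) : cball 0 C \<times> closure (words N C)"
   using vs Cons closure_subset by auto
   then have "mm (fst (a, foldr mm as 0)) (snd (a, foldr mm as 0)) \<in>
   (%p. mm (fst p) (snd p)) ` (cball 0 C \<times> closure (words N C))" by (rule imageI)
   then show ?thesis using vs(1) Cons by simp
  qed
 qed
 ultimately show ?case by (rule bounded_subset)
qed

lemma words_Max: "x : words N C ==> x : words N (max 0 C)"
 using words_mono[of N N C "max 0 C"] by auto

text \<open>The \<open>k\<close>-th coordinates of the words in the \<open>k\<close>-th term of the lower central series form a
 subspace, because this set of words is invariant under dilations.  It contains the brackets.\<close>

lemma words_proj_surj: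
 assumes "1 <= k" "v : layer G k"
 shows "EX x N C. x : upper k & x : words N C & proj k x = v"
 using assms
proof (induction k arbitrary: v rule: dec_induct)
 case base
 then show ?case
  using words_layer[of v "norm v"] proj_id[of 1 v] upper_1 by (metis One_nat_def UNIV_I order_refl)
next
 case (step k)
 define L where "L = {v. EX x N C. x : upper (Suc k) & x : words N C & proj (Suc k) x = v}"
 have LI: "proj (Suc k) x : L" if "x : upper (Suc k)" "x : words N C" for x N C
  using that unfolding L_def by blast
 have pos: "c *R v : L" if c: "0 < c" and v: "v : L" for c v
 proof -
  obtain x N C where x: "x : upper (Suc k)" "x : words N C" "proj (Suc k) x = v"
   using v unfolding L_def by blast
  \<comment> \<open>A dilation of factor r multiplies the component in layer k + 1 by r^(k+1), hence
    the root of \<open>c\<close>.\<close>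
  have r: "0 < root (Suc k) c" using c by simp
  have "dl (root (Suc k) c) x : words N (root (Suc k) c * max 0 C)"
   using words_dilation[OF words_Max[OF x(2)] r order_refl] by simp
  from LI[OF dilation_upper[OF x(1)] this] show ?thesis
   using c x(3) real_root_pow_pos2[of "Suc k" c] by (simp only: proj_dilation)
 qed
 have neg: "- v : L" if v: "v : L" for v
 proof -
  obtain x N C where x: "x : upper (Suc k)" "x : words N C" "proj (Suc k) x = v"
   using v unfolding L_def by blast
  from LI[OF subspace_neg[OF subspace_upper x(1)] words_uminus[OF x(2)]] show ?thesis
   using x(3) by (simp add: proj_simps)
 qed
 have "subspace L" unfolding subspace_def
 proof (intro conjI ballI allI)
  show z: "0 : L" using LI[OF subspace_0[OF subspace_upper] words_0] by (simp add: proj_simps)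
  fix v w assume "v : L" "w : L"
  then obtain x N C y N' C' where x: "x : upper (Suc k)" "x : words N C" "proj (Suc k) x = v"
   and y: "y : upper (Suc k)" "y : words N' C'" "proj (Suc k) y = w"
   unfolding L_def by blast
  have "mm x y : words (N + N') (max C C')"
   using words_mono[of N N C "max C C'"] words_mono[of N' N' C' "max C C'"] x y
   by (intro words_mult) auto
  from LI[OF mul_upper[OF x(1) y(1)] this] show "v + w : L"
   using proj_mul[of "Suc k" y x] x y by simp
 next
  fix c :: real and v assume v: "v : L"
  consider "c = 0" | "0 < c" | "0 < - c" by linarith
  then show "c *R v : L"
  proof cases
   case 1
   then show ?thesis using LI[OF subspace_0[OF subspace_upper] words_0] by (simp add: proj_simps)
  next
   case 3
   from pos[OF this neg[OF v]] show ?thesis by simp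
  qed (rule pos[OF _ v])
 qed
 moreover have "bracket G u w : L" if u: "u : layer G 1" and w: "w : layer G k" for u w
 proof -
  obtain x N C where x: "x : upper k" "x : words N C" "proj k x = w"
   using step.IH[OF w] by blast
  define C' where "C' = max (norm u) C"
  have "u : words 1 C'" using words_layer[OF u] by (simp add: C'_def)
  moreover have xw: "x : words N C'" using x(2) words_mono[of N N C C'] by (auto simp: C'_def)
  \<comment> \<open>The four factors of the commutator are \<open>u\<close>, \<open>x\<close>,
    \<open>- u\<close> and \<open>- x\<close>.\<close>
  ultimately have "mm (Ad u x) (- x) : words (1 + N + 1 + N) C'"
   unfolding Ad_def by (intro words_mult words_uminus)
  from LI[OF commutator_upper(1)[OF step(1) u x(1)] this] show ?thesis
   using commutator_upper(2)[OF step(1) u x(1)] x(3) by simp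
 qed
 ultimately have "layer G (Suc k) <= L"
  unfolding bracket_layers[OF step(1)] by (intro span_minimal) auto
 then show ?case using step.prems unfolding L_def by blast
qed

text \<open>One word for \<open>v\<close>, dilated by the k-th root of |a| and inverted when a is
  negative, serves all a. The number of letters is thus independent of a and their size depends on
  \<open>R\<close> only.\<close>

lemma words_proj_line:
 assumes k: "1 <= k" and v: "v : layer G k" and R: "0 <= R"
 shows "EX N C. 0 <= C & (ALL a. abs a <= R --> (EX h. h : upper k & h : words N C & proj k h = a *R v))"
proof -
 obtain x N C where x: "x : upper k" "x : words N C" "proj k x = v"
  using words_proj_surj[OF k v] by blast
 have "EX h. h : upper k & h : words N (root k R * max 0 C) & proj k h = a *R v" if a: "abs a <= R" for a
 proof (cases "a = 0")
  case True
  then show ?thesis using subspace_0[OF subspace_upper] words_0 by (intro exI[of _ 0]) (auto simp: proj_simps)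
 next
  case False
  define r where "r = root k (abs a)"
  have r: "0 < r" "r <= root k R" "r ^ k = abs a"
   using False k a by (auto simp: r_def real_root_pow_pos2)
  define y where "y = (if 0 < a then x else - x)"
  have "y : words N (max 0 C)" "y : upper k" "r ^ k *R proj k y = a *R v"
   using words_Max[OF x(2)] words_uminus[OF words_Max[OF x(2)]] x(1,3) subspace_neg[OF subspace_upper x(1)] r(3) False
   by (auto simp: y_def proj_simps)
  then show ?thesis
   using words_dilation[of y N "max 0 C" r "root k R"] r dilation_upper[of y k r] k
   by (intro exI[of _ "dl r y"]) (simp add: proj_dilation)
 qed
 then show ?thesis using R k by (intro exI[of _ N] exI[of _ "root k R * max 0 C"]) simp
qed

lemma words_proj_sum:
 assumes k: "1 <= k" and R: "0 <= R" and F: "finite F" "F <= layer G k"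
 shows "EX N C. 0 <= C & (ALL a. (\<forall>e\<in>F. abs (a e) <= R) -->
   (EX h. h : upper k & h : words N C & proj k h = (\<Sum>e\<in>F. a e *R e)))"
 using F
proof (induction F rule: finite_induct)
 case empty
 then show ?case
  using subspace_0[OF subspace_upper] words_0 by (intro exI[of _ 0]) (auto simp: proj_simps intro!: exI[of _ 0])
next
 case (insert e F)
 then obtain N C where NC: "0 <= C" "!!a. (\<forall>e\<in>F. abs (a e) <= R) ==>
   (EX h. h : upper k & h : words N C & proj k h = (\<Sum>e\<in>F. a e *R e))" by auto
 obtain N' C' where NC': "0 <= C'" "!!a. abs a <= R ==> (EX h. h : upper k & h : words N' C' & proj k h = a *R e)"
  using words_proj_line[OF k _ R, of e] insert.prems by auto
 show ?case
 proof (intro exI[of _ "N' + N"] exI[of _ "max C' C"] conjI allI impI)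
  fix a :: "'a => real" assume a: "\<forall>e\<in>insert e F. abs (a e) <= R"
  obtain h h' where h: "h : upper k" "h : words N C" "proj k h = (\<Sum>e\<in>F. a e *R e)"
   and h': "h' : upper k" "h' : words N' C'" "proj k h' = a e *R e"
   using NC(2)[of a] NC'(2)[of "a e"] a by auto
  have "mm h' h : words (N' + N) (max C' C)"
   using words_mono[of N N C "max C' C"] words_mono[of N' N' C' "max C' C"] h h' by (intro words_mult) auto
  then show "EX h. h : upper k & h : words (N' + N) (max C' C) & proj k h = (\<Sum>e\<in>insert e F. a e *R e)"
   using h h' insert.hyps mul_upper[OF h'(1) h(1)] proj_mul[OF k h(1), of h']
   by (intro exI[of _ "mm h' h"]) auto
 qed (use NC NC' in auto)
qed

text \<open>Descending induction on k. A bounded word removes the k-th component of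
  \<open>x\<close>; what remains lies in \<open>upper (Suc k)\<close> and in a compact set that
  depends only on the bounds, so the next stage applies uniformly.\<close>

lemma words_cover_upper:
 assumes "1 <= k" "k <= Suc (step G)"
 shows "ALL R. EX N C. 0 <= C & upper k \<inter> cball 0 R <= words N C"
 using assms(2,1)
proof (induction k rule: inc_induct)
 case base
 then show ?case using words_0 unfolding upper_above by fastforce
next
 case (step k)
 show ?case
 proof
  fix R :: real
  define R' where "R' = max 0 R"
  obtain N C where NC: "0 <= C" "!!a. (\<forall>e\<in>layer_basis k. abs (a e) <= R') ==>
   (EX h. h : upper k & h : words N C & proj k h = (\<Sum>e\<in>layer_basis k. a e *R e))"
   using words_proj_sum[OF step.prems _ layer_basis(7,1)[OF step.prems], of R'] by (auto simp: R'_def)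
  have "compact ((%p. mm (fst p) (snd p)) ` (uminus ` closure (words N C) \<times> cball 0 R))"
   by (intro compact_mul_image compact_cball compact_negations) (simp add: bounded_words)
  then obtain M where M: "!!h x. h : words N C ==> norm x <= R ==> norm (mm (- h) x) <= M"
   using closure_subset[of "words N C"] by (force dest!: compact_imp_bounded simp: bounded_iff)
  obtain N' C' where NC': "0 <= C'" "upper (Suc k) \<inter> cball 0 M <= words N' C'"
   using step.IH[rule_format, of M] step.prems by auto
  have "x : words (N + N') (max C C')" if x: "x : upper k" "norm x <= R" for x
  proof -
   have "abs (x \<bullet> e) <= R'" if "e : layer_basis k" for e
   using Cauchy_Schwarz_ineq2[of x e] layer_basis(3)[OF step.prems that] x(2) by (simp add: R'_def)
   then obtain h where h: "h : upper k" "h : words N C" "proj k h = proj k x"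
   using NC(2)[of "%e. x \<bullet> e"] unfolding proj_def by auto
   have hu: "- h : upper k" using h(1) subspace_neg[OF subspace_upper] by blast
   have "mm (- h) x : upper (Suc k)"
   using mul_upper[OF hu x(1)] proj_mul[OF step.prems x(1), of "- h"] h(3)
   by (intro upper_SucI) (auto simp: proj_simps)
   then have "mm (- h) x : words N' C'" using NC'(2) M[OF h(2) x(2)] by auto
   moreover have "x = mm h (mm (- h) x)" by (metis assoc right_inverse left_neutral)
   moreover have "words N C <= words N (max C C')" "words N' C' <= words N' (max C C')"
   by (rule words_mono; simp)+
   ultimately show ?thesis using h(2) words_mult by (metis subsetD)
  qed
  then show "EX N C. 0 <= C & upper k \<inter> cball 0 R <= words N C"
   using NC(1) by (intro exI[of _ "N + N'"] exI[of _ "max C C'"]) auto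
 qed
qed

theorem words_cover: "EX N C. 0 <= C & cball 0 R <= words N C"
 using words_cover_upper[of 1] upper_1 by simp

end

section \<open>The Carnot-Caratheodory distance\<close>

lemma has_vector_derivative_affine:
 fixes f :: "real => 'a::real_normed_vector"
 assumes "(f has_vector_derivative v) (at (m * t + c))"
 shows "((%t. f (m * t + c)) has_vector_derivative m *R v) (at t)"
proof -
 have "((%t. m * t + c) has_vector_derivative m) (at t)"
  unfolding has_real_derivative_iff_has_vector_derivative[symmetric]
  by (auto intro!: derivative_eq_intros)
 from vector_diff_chain_at[OF this assms] show ?thesis by (simp add: o_def)
qed

context carnot_group begin

definition lengths :: "'a => 'a => real set" where
 "lengths x y = {L. EX ga u. horizontal_curve G ga u & ga 0 = x & ga 1 = y &
   ((%t. norm (u t)) has_integral L) {0..1}}"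

abbreviation d :: "'a => 'a => real" where "d \<equiv> cc_dist G"

lemma cc_dist_eq: "d x y = Inf (lengths x y)"
 by (simp add: cc_dist_def lengths_def)

lemma lengths_nonneg: "L : lengths x y ==> 0 <= L"
 unfolding lengths_def by (auto intro: has_integral_nonneg)

lemma lengthsI:
 assumes "ga piecewise_C1_differentiable_on {0..1}" "finite S"
  "!!t. t : {0..1} - S ==> u t : layer G 1"
  "!!t. t : {0..1} - S ==> (ga has_vector_derivative left_field G (u t) (ga t)) (at t)"
  "((%t. norm (u t)) has_integral L) {0..1}" "ga 0 = x" "ga 1 = y"
 shows "L : lengths x y"
 unfolding lengths_def horizontal_curve_def using assms by blast

lemma lengthsE:
 assumes "L : lengths x y"
 obtains ga u S where "ga piecewise_C1_differentiable_on {0..1}" "finite S"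
  "!!t. t : {0..1} - S ==> u t : layer G 1"
  "!!t. t : {0..1} - S ==> (ga has_vector_derivative left_field G (u t) (ga t)) (at t)"
  "((%t. norm (u t)) has_integral L) {0..1}" "ga 0 = x" "ga 1 = y"
 using assms unfolding lengths_def horizontal_curve_def by blast

lemma smooth_compose_vector_derivative:
 fixes \<Phi> :: "'a => 'a" and ga :: "real => 'a"
 assumes "smooth_on \<Phi> UNIV" "(ga has_vector_derivative v) (at t)"
 shows "((%t. \<Phi> (ga t)) has_vector_derivative frechet_derivative \<Phi> (at (ga t)) v) (at t)"
proof -
 have "((%t. \<Phi> (ga t)) has_derivative (%s. frechet_derivative \<Phi> (at (ga t)) (s *R v))) (at t)"
  using has_derivative_compose[of ga "%s. s *R v" t UNIV, OF _ smooth_on_has_derivative[OF assms(1)]]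
   assms(2) by (simp add: has_vector_derivative_def)
 then show ?thesis
  using linear_cmul[OF has_derivative_linear[OF smooth_on_has_derivative[OF assms(1)]]]
  by (simp add: has_vector_derivative_def)
qed

lemma smooth_compose_piecewise_C1:
 fixes \<Phi> :: "'a => 'a" and ga :: "real => 'a"
 assumes "smooth_on \<Phi> UNIV" "ga piecewise_C1_differentiable_on {0..1}"
 shows "(%t. \<Phi> (ga t)) piecewise_C1_differentiable_on {0..1}"
proof -
 obtain S where S: "finite S" "ga C1_differentiable_on ({0..1} - S)" and c: "continuous_on {0..1} ga"
  using assms(2) by (auto simp: piecewise_C1_differentiable_on_def)
 obtain D where D: "!!t. t : {0..1} - S ==> (ga has_vector_derivative D t) (at t)" "continuous_on ({0..1} - S) D"
  using S(2) unfolding C1_differentiable_on_def by blast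
 have "continuous_on UNIV (%q. frechet_derivative \<Phi> (at (fst q)) (snd q))"
  by (intro smooth_on_continuous smooth_on_frechet_derivative2 assms smooth_on_linear bounded_linear_fst bounded_linear_snd)
 from continuous_on_compose2[OF this, of "{0..1} - S" "%t. (ga t, D t)"]
 have "continuous_on ({0..1} - S) (%t. frechet_derivative \<Phi> (at (ga t)) (D t))"
  using continuous_on_subset[OF c, of "{0..1} - S"] D(2) by (auto intro: continuous_on_Pair)
 then have "(%t. \<Phi> (ga t)) C1_differentiable_on ({0..1} - S)"
  unfolding C1_differentiable_on_def
  by (intro exI[of _ "%t. frechet_derivative \<Phi> (at (ga t)) (D t)"] conjI ballI
   smooth_compose_vector_derivative[OF assms(1)] D(1))
 moreover have "continuous_on {0..1} (%t. \<Phi> (ga t))"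
  by (rule continuous_on_compose2[OF smooth_on_continuous[OF assms(1)] c]) simp
 ultimately show ?thesis unfolding piecewise_C1_differentiable_on_def using S(1) by blast
qed

text \<open>A smooth map that carries the left field of \<open>u\<close> to that of
  \<open>r *R u\<close> maps horizontal curves to horizontal curves and multiplies lengths by
  \<open>r\<close>. Left translations are the case \<open>r = 1\<close>, dilations the general
  one.\<close>

lemma lengths_image:
 assumes \<Phi>: "smooth_on \<Phi> UNIV" and r: "0 <= r"
  and D: "!!x u. u : layer G 1 ==> frechet_derivative \<Phi> (at x) (left_field G u x) = left_field G (r *R u) (\<Phi> x)"
  and L: "L : lengths x y"
 shows "r * L : lengths (\<Phi> x) (\<Phi> y)"
proof -
 from L obtain ga u S where g: "ga piecewise_C1_differentiable_on {0..1}" "finite S"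
  "!!t. t : {0..1} - S ==> u t : layer G 1"
  "!!t. t : {0..1} - S ==> (ga has_vector_derivative left_field G (u t) (ga t)) (at t)"
  "((%t. norm (u t)) has_integral L) {0..1}" "ga 0 = x" "ga 1 = y"
  by (rule lengthsE) blast
 show ?thesis
 proof (rule lengthsI[where ga = "%t. \<Phi> (ga t)" and u = "%t. r *R u t" and S = S])
  show "(%t. \<Phi> (ga t)) piecewise_C1_differentiable_on {0..1}"
   by (rule smooth_compose_piecewise_C1[OF \<Phi> g(1)])
  fix t assume t: "t : {0..1} - S"
  show "r *R u t : layer G 1" using g(3)[OF t] subspace_scale[OF subspace_layer[of 1]] by simp
  show "((%t. \<Phi> (ga t)) has_vector_derivative left_field G (r *R u t) (\<Phi> (ga t))) (at t)"
   using smooth_compose_vector_derivative[OF \<Phi> g(4)[OF t]] D[OF g(3)[OF t], of "ga t"] by simp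
 next
  show "((%t. norm (r *R u t)) has_integral r * L) {0..1}"
   using has_integral_mult_right[OF g(5), of r] r by simp
 qed (use g in auto)
qed

lemma smooth_mul:
 assumes "smooth_on f UNIV" "smooth_on g UNIV"
 shows "smooth_on (%x. mm (f x) (g x)) UNIV"
 using smooth_on_compose[OF smooth_mult smooth_on_Pair[OF assms]] by simp

lemma smooth_ident: "smooth_on (%x. x) UNIV"
 by (rule smooth_on_linear) (rule bounded_linear_ident)

lemma left_field_mul: "mulD (a, x) (0, left_field G u x) = left_field G u (mm a x)"
proof -
 have "((%y. mm a (mm x y)) has_derivative (%v. mulD (a, mm x 0) (0, mulD (x, 0) (0, v)))) (at 0)"
  by (rule has_derivative_compose[OF mul_right_has_derivative mul_right_has_derivative])
 moreover have "((%y. mm (mm a x) y) has_derivative (%v. mulD (mm a x, 0) (0, v))) (at 0)"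
  by (rule mul_right_has_derivative)
 ultimately have "(%v. mulD (a, mm x 0) (0, mulD (x, 0) (0, v))) = (%v. mulD (mm a x, 0) (0, v))"
  by (simp add: assoc has_derivative_unique)
 from fun_cong[OF this, of u] show ?thesis by (simp add: left_field_eq)
qed

lemma lengths_translate: "L : lengths x y ==> L : lengths (mm a x) (mm a y)"
proof -
 assume L: "L : lengths x y"
 have "1 * L : lengths (mm a x) (mm a y)"
  by (rule lengths_image[OF _ _ _ L])
   (auto intro!: smooth_mul smooth_on_const smooth_ident
   simp: frechet_derivative_eqI[OF mul_right_has_derivative] left_field_mul)
 then show ?thesis by simp
qed

lemma lengths_dilation:
 assumes r: "0 < r" and L: "L : lengths x y"
 shows "r * L : lengths (dl r x) (dl r y)"
proof (rule lengths_image[OF _ _ _ L])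
 show "smooth_on (dl r) UNIV" by (rule smooth_on_linear[OF bounded_linear_dilation])
 fix x u assume u: "u : layer G 1"
 have "frechet_derivative (dl r) (at x) = dl r"
  by (rule frechet_derivative_eqI[OF bounded_linear_imp_has_derivative[OF bounded_linear_dilation]])
 then show "frechet_derivative (dl r) (at x) (left_field G u x) = left_field G (r *R u) (dl r x)"
  using mulD_dilation[OF r, of x 0 0 u] dilation_layer[of 1 u r] u by (simp add: left_field_eq)
qed (use r in simp)

lemma lengths_layer:
 assumes "v : layer G 1"
 shows "norm v : lengths 0 v"
proof (rule lengthsI[where ga = "%t. t *R v" and u = "%t. v" and S = "{}"])
 have "(%t. t *R v) C1_differentiable_on {0..1}"
  unfolding C1_differentiable_on_def by (intro exI[of _ "%t. v"]) (auto intro!: derivative_eq_intros)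
 then show "(%t. t *R v) piecewise_C1_differentiable_on {0..1}" by (rule C1_differentiable_imp_piecewise)
 show "((%t. t *R v) has_vector_derivative left_field G v (t *R v)) (at t)" for t
  by (auto intro!: derivative_eq_intros simp: left_field_line)
 show "((%t. norm v) has_integral norm v) {0..1::real}"
  using has_integral_const_real[of "norm v" 0 1] by simp
qed (use assms in auto)

lemma lengths_sym:
 assumes "L : lengths x y"
 shows "L : lengths y x"
proof -
 from assms obtain ga u S where g: "ga piecewise_C1_differentiable_on {0..1}" "finite S"
  "!!t. t : {0..1} - S ==> u t : layer G 1"
  "!!t. t : {0..1} - S ==> (ga has_vector_derivative left_field G (u t) (ga t)) (at t)"
  "((%t. norm (u t)) has_integral L) {0..1}" "ga 0 = x" "ga 1 = y"
  by (rule lengthsE) blast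
 show ?thesis
 proof (rule lengthsI[where ga = "%t. ga (1 - t)" and u = "%t. - u (1 - t)" and S = "(%t. 1 - t) ` S"])
  show "(%t. ga (1 - t)) piecewise_C1_differentiable_on {0..1}"
   using valid_path_imp_reverse[of ga] g(1) by (simp add: valid_path_def reversepath_def)
  fix t assume "t : {0..1} - (%t. 1 - t) ` S"
  then have t: "1 - t : {0..1} - S" by force
  show "- u (1 - t) : layer G 1" using g(3)[OF t] subspace_neg[OF subspace_layer[of 1]] by simp
  have "((%t. ga (1 - t)) has_vector_derivative (- 1) *R left_field G (u (1 - t)) (ga (1 - t))) (at t)"
   using has_vector_derivative_affine[of ga _ "- 1" t 1] g(4)[OF t] by simp
  then show "((%t. ga (1 - t)) has_vector_derivative left_field G (- u (1 - t)) (ga (1 - t))) (at t)"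
   using left_field_scaleR[of "- 1" "u (1 - t)"] by simp
 next
  show "((%t. norm (- u (1 - t))) has_integral L) {0..1}"
   using has_integral_affinity01[OF g(5), of "- 1" 1] by (simp add: image_add_atLeastAtMost image_image)
 qed (use g in auto)
qed

lemma lengths_join:
 assumes "L : lengths x y" "M : lengths y z"
 shows "L + M : lengths x z"
proof -
 from assms(1) obtain ga u S where g: "ga piecewise_C1_differentiable_on {0..1}" "finite S"
  "!!t. t : {0..1} - S ==> u t : layer G 1"
  "!!t. t : {0..1} - S ==> (ga has_vector_derivative left_field G (u t) (ga t)) (at t)"
  "((%t. norm (u t)) has_integral L) {0..1}" "ga 0 = x" "ga 1 = y"
  by (rule lengthsE) blast
 from assms(2) obtain \<beta> w T where b: "\<beta> piecewise_C1_differentiable_on {0..1}" "finite T"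
  "!!t. t : {0..1} - T ==> w t : layer G 1"
  "!!t. t : {0..1} - T ==> (\<beta> has_vector_derivative left_field G (w t) (\<beta> t)) (at t)"
  "((%t. norm (w t)) has_integral M) {0..1}" "\<beta> 0 = y" "\<beta> 1 = z"
  by (rule lengthsE) blast
 \<comment> \<open>Each curve is run in half the time, which doubles its velocity. Exceptional are
   the junction 1/2 and the rescaled exceptional times of both curves.\<close>
 define u' where "u' t = (if t <= 1/2 then 2 *R u (2 * t) else 2 *R w (2 * t - 1))" for t
 define S' where "S' = insert (1/2) ((%t. t / 2) ` S \<union> (%t. (t + 1) / 2) ` T)"
 have *: "t ~= 1/2 & 2 * t \<notin> S & 2 * t - 1 \<notin> T" if "t \<notin> S'" for t
  using that image_eqI[of t "%t. t / 2" "2 * t" S] image_eqI[of t "%t. (t + 1) / 2" "2 * t - 1" T]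
  by (auto simp: S'_def)
 have sc: "c *R v : layer G 1" if "v : layer G 1" for c v
  using that subspace_scale[OF subspace_layer[of 1]] by simp
 show ?thesis
 proof (rule lengthsI[where ga = "ga +++ \<beta>" and u = u' and S = S'])
  show "(ga +++ \<beta>) piecewise_C1_differentiable_on {0..1}"
   using valid_path_join[of ga \<beta>] g b by (simp add: valid_path_def pathfinish_def pathstart_def)
  show "finite S'" using g b by (simp add: S'_def)
  fix t assume t: "t : {0..1} - S'"
  show "u' t : layer G 1"
   using *[of t] t g(3)[of "2 * t"] b(3)[of "2 * t - 1"]
   by (auto simp: u'_def intro!: sc[unfolded One_nat_def])
  show "((ga +++ \<beta>) has_vector_derivative left_field G (u' t) ((ga +++ \<beta>) t)) (at t)"
  proof (cases "t < 1/2")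
   case True
   have "((%t. ga (2 * t)) has_vector_derivative 2 *R left_field G (u (2 * t)) (ga (2 * t))) (at t)"
   using has_vector_derivative_affine[of ga _ 2 t 0] g(4)[of "2 * t"] True t *[of t] by simp
   then have "((ga +++ \<beta>) has_vector_derivative 2 *R left_field G (u (2 * t)) (ga (2 * t))) (at t)"
   by (rule has_vector_derivative_transform_within_open[where S = "{..<1/2}"])
   (use True in \<open>auto simp: joinpaths_def\<close>)
   then show ?thesis using True by (simp add: u'_def joinpaths_def left_field_scaleR)
  next
   case False
   then have t2: "t > 1/2" using *[of t] t by auto
   have "((%t. \<beta> (2 * t - 1)) has_vector_derivative 2 *R left_field G (w (2 * t - 1)) (\<beta> (2 * t - 1))) (at t)"
   using has_vector_derivative_affine[of \<beta> _ 2 t "- 1"] b(4)[of "2 * t - 1"] t2 t *[of t] by simp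
   then have "((ga +++ \<beta>) has_vector_derivative 2 *R left_field G (w (2 * t - 1)) (\<beta> (2 * t - 1))) (at t)"
   by (rule has_vector_derivative_transform_within_open[where S = "{1/2<..}"])
   (use t2 in \<open>auto simp: joinpaths_def\<close>)
   then show ?thesis using t2 by (simp add: u'_def joinpaths_def left_field_scaleR)
  qed
 next
  have "((%t. norm (u (2 * t))) has_integral L / 2) {0..1/2}"
   using has_integral_affinity'[of "%t. norm (u t)" L 0 1 2 0] g(5) by (simp add: field_simps)
  from has_integral_mult_right[OF this, of 2]
  have 1: "((%t. 2 * norm (u (2 * t))) has_integral L) {0..1/2}" by simp
  have "((%t. norm (w (2 * t - 1))) has_integral M / 2) {1/2..1}"
   using has_integral_affinity'[of "%t. norm (w t)" M 0 1 2 "- 1"] b(5) by (simp add: field_simps)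
  from has_integral_mult_right[OF this, of 2]
  have 2: "((%t. 2 * norm (w (2 * t - 1))) has_integral M) {1/2..1}" by simp
  show "((%t. norm (u' t)) has_integral L + M) {0..1}"
  proof (rule has_integral_combine[of 0 "1/2"])
   show "((%t. norm (u' t)) has_integral L) {0..1/2}"
   by (rule has_integral_eq[OF _ 1]) (simp add: u'_def)
   show "((%t. norm (u' t)) has_integral M) {1/2..1}"
   by (rule has_integral_spike_finite[OF _ _ 2, of "{1/2}"]) (auto simp: u'_def)
  qed auto
 qed (use g b in \<open>auto simp: joinpaths_def\<close>)
qed

lemma lengths_words:
 assumes "x : words N C" "0 <= C"
 shows "\<exists>L\<in>lengths 0 x. L <= real N * C"
proof -
 have "\<exists>L\<in>lengths 0 (foldr mm vs 0). L <= real (length vs) * C"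
  if "\<forall>v\<in>set vs. v : layer G 1 & norm v <= C" for vs
  using that
 proof (induction vs)
  case Nil
  have "0 : layer G 1" using subspace_0[OF subspace_layer[of 1]] by simp
  from lengths_layer[OF this] show ?case by auto
 next
  case (Cons v vs)
  then obtain L where L: "L : lengths 0 (foldr mm vs 0)" "L <= real (length vs) * C" by auto
  have "norm v + L : lengths 0 (mm v (foldr mm vs 0))"
   using lengths_join[OF lengths_layer[of v]] lengths_translate[OF L(1), of v] Cons.prems by simp
  moreover have "norm v + L <= real (length (v # vs)) * C"
   using L(2) Cons.prems by (simp add: algebra_simps)
  ultimately show ?case by (auto intro: bexI)
 qed
 moreover obtain vs where "x = foldr mm vs 0" "length vs <= N" "\<forall>v\<in>set vs. v : layer G 1 & norm v <= C"
  using assms by (auto simp: words_def)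
 ultimately obtain L where "L : lengths 0 x" "L <= real (length vs) * C" "length vs <= N" by blast
 moreover from this have "real (length vs) * C <= real N * C" using assms(2) by (intro mult_right_mono) auto
 ultimately show ?thesis by (intro bexI[of _ L]) auto
qed

text \<open>Chow's connectivity theorem: the difference of the two points is a product of horizontal
  elements, and each factor is joined to 0 by a horizontal segment. It makes the infimum in the
  distance meaningful.\<close>

lemma lengths_nonempty: "lengths x y ~= {}"
proof -
 obtain N C where "0 <= C" "cball 0 (norm (mm (- x) y)) <= words N C" using words_cover by blast
 then have "mm (- x) y : words N C" by auto
 from lengths_words[OF this \<open>0 <= C\<close>] obtain L where "L : lengths 0 (mm (- x) y)" by blast
 from lengths_translate[OF this, of x] have "L : lengths x y"
  by (metis assoc right_inverse left_neutral right_neutral)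
 then show ?thesis by blast
qed

lemma lengths_bdd: "bdd_below (lengths x y)"
 using lengths_nonneg by (meson bdd_belowI)

lemma dist_le: "L : lengths x y ==> d x y <= L"
 unfolding cc_dist_eq by (rule cInf_lower[OF _ lengths_bdd])

lemma dist_less: "d x y < r ==> \<exists>L\<in>lengths x y. L < r"
 unfolding cc_dist_eq using cInf_lessD[OF lengths_nonempty] .

lemma dist_nonneg [simp]: "0 <= d x y"
 unfolding cc_dist_eq by (rule cInf_greatest[OF lengths_nonempty lengths_nonneg])

lemma dist_image:
 assumes "!!L. L : lengths x y ==> r * L : lengths x' y'" "0 <= r"
 shows "d x' y' <= r * d x y"
proof (cases "r = 0")
 case True
 then show ?thesis using assms(1) lengths_nonempty dist_le by (metis ex_in_conv mult_zero_left)
next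
 case False
 have "d x' y' / r <= d x y"
  unfolding cc_dist_eq[of x y]
  by (rule cInf_greatest[OF lengths_nonempty]) (use assms dist_le False in \<open>simp add: divide_le_eq mult.commute\<close>)
 then show ?thesis using assms(2) False by (simp add: divide_le_eq mult.commute)
qed

lemma dist_translate: "d (mm a x) (mm a y) = d x y"
proof (rule antisym)
 show "d (mm a x) (mm a y) <= d x y"
  using dist_image[of x y 1] lengths_translate by simp
 have "mm (- a) (mm a z) = z" for z by (metis assoc left_inverse left_neutral)
 then show "d x y <= d (mm a x) (mm a y)"
  using dist_image[of "mm a x" "mm a y" 1 x y] lengths_translate[of _ "mm a x" "mm a y" "- a"] by simp
qed

lemma dist_sym: "d x y = d y x"
 using dist_image[of x y 1 y x] dist_image[of y x 1 x y] lengths_sym by simp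

lemma dist_triangle: "d x z <= d x y + d y z"
proof (rule field_le_epsilon)
 fix e :: real assume "0 < e"
 then obtain L M where "L : lengths x y" "L < d x y + e / 2" "M : lengths y z" "M < d y z + e / 2"
  using dist_less[of x y "d x y + e / 2"] dist_less[of y z "d y z + e / 2"] by auto
 then show "d x z <= d x y + d y z + e"
  using dist_le[OF lengths_join] by force
qed

lemma dist_eq_0: "d x y = d 0 (mm (- x) y)"
 using dist_translate[of "- x" x y] by simp

lemma dist_self [simp]: "d x x = 0"
proof -
 have "0 : layer G 1" using subspace_0[OF subspace_layer[of 1]] by simp
 from dist_le[OF lengths_layer[OF this]] show ?thesis using dist_eq_0[of x x] dist_nonneg[of 0 0] by simp
qed

lemma dist_dilation:
 assumes r: "0 < r"
 shows "d (dl r x) (dl r y) = r * d x y"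
proof (rule antisym)
 show "d (dl r x) (dl r y) <= r * d x y"
  using r lengths_dilation[OF r] by (intro dist_image) auto
 have "d x y <= (1 / r) * d (dl r x) (dl r y)"
  using r lengths_dilation[of "1 / r" _ "dl r x" "dl r y"]
  by (intro dist_image) (auto simp: dilation_inverse)
 then show "r * d x y <= d (dl r x) (dl r y)"
  using r by (simp add: field_simps)
qed

lemma dist_words: "x : words N C ==> 0 <= C ==> d 0 x <= real N * C"
 using lengths_words dist_le by (meson order_trans)

text \<open>The distance is bounded on the Euclidean unit ball because words of bounded length cover
  it. A dilation of factor \<open>r\<close> multiplies this bound by \<open>r\<close>, and a
  sufficiently small Euclidean ball lies in the dilated unit ball.\<close>

lemma dist_continuous_0:
 assumes "0 < e"
 shows "\<exists>de>0. ALL x. norm x < de --> d 0 x < e"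
proof -
 obtain N C where C: "0 <= C" "cball 0 1 <= words N C" using words_cover by blast
 define r where "r = e / (real N * C + 1)"
 have pos: "0 < real N * C + 1" using C by (simp add: add_nonneg_pos)
 then have r: "0 < r" "r * (real N * C) < e" using assms by (simp_all add: r_def field_simps)
 obtain K where K: "0 < K" "!!x. norm (dl (1 / r) x) <= norm x * K"
  using bounded_linear.pos_bounded[OF bounded_linear_dilation] by blast
 have "d 0 x < e" if "norm x < 1 / K" for x
 proof -
  have "norm (dl (1 / r) x) <= 1" using K(2)[of x] that K(1) by (simp add: field_simps)
  then have "d 0 (dl (1 / r) x) <= real N * C" using C by (intro dist_words) auto
  then have "r * d 0 (dl (1 / r) x) <= r * (real N * C)" using r by simp
  moreover have "d 0 x = r * d 0 (dl (1 / r) x)"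
   using dist_dilation[OF r(1), of 0 "dl (1 / r) x"] r by (simp add: dilation_inverse)
  ultimately show ?thesis using r(2) by simp
 qed
 then show ?thesis using K(1) by (intro exI[of _ "1 / K"]) simp
qed

lemma tendsto_dist_0:
 assumes "(f \<longlongrightarrow> 0) F"
 shows "((%x. d 0 (f x)) \<longlongrightarrow> 0) F"
proof (rule tendstoI)
 fix e :: real assume "0 < e"
 then obtain de where de: "0 < de" "!!x. norm x < de ==> d 0 x < e" using dist_continuous_0 by blast
 show "\<forall>\<^sub>F x in F. dist (d 0 (f x)) 0 < e"
  by (rule eventually_mono[OF tendstoD[OF assms de(1)]]) (auto simp: de(2))
qed

lemma dist_diff_le: "abs (d x y - d x' y') <= d x x' + d y y'"
 using dist_triangle[of x y x'] dist_triangle[of x' y y'] dist_triangle[of x' y' x] dist_triangle[of x y' y]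
  dist_sym[of x x'] dist_sym[of y y'] by linarith

lemma tendsto_cc_dist [tendsto_intros]:
 assumes "(f \<longlongrightarrow> a) F" "(g \<longlongrightarrow> b) F"
 shows "((%x. d (f x) (g x)) \<longlongrightarrow> d a b) F"
proof -
 have *: "((%x. d a (f x)) \<longlongrightarrow> 0) F" if "(f \<longlongrightarrow> a) F" for f a
 proof -
  have "((%x. mm (- a) (f x)) \<longlongrightarrow> mm (- a) a) F" by (intro tendsto_intros that)
  then have "((%x. d 0 (mm (- a) (f x))) \<longlongrightarrow> 0) F" by (intro tendsto_dist_0) simp
  then show ?thesis by (simp add: dist_eq_0[of a])
 qed
 have "((%x. d a (f x) + d b (g x)) \<longlongrightarrow> 0 + 0) F" by (intro tendsto_add * assms)
 then have lim: "((%x. d a (f x) + d b (g x)) \<longlongrightarrow> 0) F" by simp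
 have "norm (d (f x) (g x) - d a b) <= d a (f x) + d b (g x)" for x
  using dist_diff_le[of "f x" "g x" a b] by (simp add: dist_sym[of "f x" a] dist_sym[of "g x" b])
 then have "((%x. d (f x) (g x) - d a b) \<longlongrightarrow> 0) F"
  by (intro Lim_null_comparison[OF _ lim]) simp
 then show ?thesis by (rule LIM_zero_cancel)
qed

lemma continuous_on_cc_dist [continuous_intros]:
 "continuous_on S f ==> continuous_on S g ==> continuous_on S (%x. d (f x) (g x))"
 unfolding continuous_on_def by (auto intro: tendsto_cc_dist)

lemma left_field_bound: "\<exists>M>0. ALL y u. norm y <= 1 --> norm (left_field G u y) <= M * norm u"
proof -
 have "EX K. ALL y. norm y <= 1 --> norm (left_field G i y) <= K" for i
 proof -
  have "compact (left_field G i ` cball 0 1)"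
   by (intro compact_continuous_image continuous_on_subset[OF smooth_on_continuous[OF smooth_left_field]]) auto
  then obtain K where "\<forall>z\<in>left_field G i ` cball 0 1. norm z <= K"
   using compact_imp_bounded bounded_iff by metis
  then show ?thesis by (intro exI[of _ K]) auto
 qed
 then obtain K where K: "!!i y. norm y <= 1 ==> norm (left_field G i y) <= K i" by metis
 have K0: "0 <= K i" for i using order_trans[OF norm_ge_zero K[of 0 i]] by simp
 have "norm (left_field G u y) <= (1 + (\<Sum>i\<in>Basis. K i)) * norm u" if y: "norm y <= 1" for y u
 proof -
  have "linear (%u. left_field G u y)" by (intro linearI left_field_add left_field_scaleR)
  from linear_basis_sum[OF this, of u]
  have "norm (left_field G u y) <= (\<Sum>i\<in>Basis. norm ((u \<bullet> i) *R left_field G i y))"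
   by (metis norm_sum)
  also have "... <= (\<Sum>i\<in>Basis. norm u * K i)"
   by (intro sum_mono) (auto intro!: mult_mono K y Basis_le_norm)
  also have "... <= (1 + (\<Sum>i\<in>Basis. K i)) * norm u" by (simp add: algebra_simps sum_distrib_left)
  finally show ?thesis .
 qed
 moreover have "0 < 1 + (\<Sum>i\<in>Basis. K i)" using K0 by (simp add: add_pos_nonneg sum_nonneg)
 ultimately show ?thesis by blast
qed

text \<open>A horizontal curve needs a definite length to leave the Euclidean unit ball.\<close>

lemma dist_small_bounded: "\<exists>c>0. ALL x. d 0 x < c --> norm x <= 1"
proof -
 obtain M where M: "0 < M" "!!y u. norm y <= 1 ==> norm (left_field G u y) <= M * norm u"
  using left_field_bound by blast
 have "norm x <= 1" if dx: "d 0 x < 1 / M" for x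
 proof (rule ccontr)
  assume x: "\<not> norm x <= 1"
  obtain L where L: "L : lengths 0 x" "L < 1 / M" using dist_less[OF dx] by blast
  from L(1) obtain ga u S where g: "ga piecewise_C1_differentiable_on {0..1}" "finite S"
   "!!t. t : {0..1} - S ==> u t : layer G 1"
   "!!t. t : {0..1} - S ==> (ga has_vector_derivative left_field G (u t) (ga t)) (at t)"
   "((%t. norm (u t)) has_integral L) {0..1}" "ga 0 = 0" "ga 1 = x"
   by (rule lengthsE) blast
  have cont: "continuous_on {0..1} ga" using g(1) by (simp add: piecewise_C1_differentiable_on_def)
  define E where "E = {0..1} \<inter> {t. 1 <= norm (ga t)}"
  have "closed ({0..1} \<inter> (%t. norm (ga t)) -` {1..})"
   by (intro continuous_closed_preimage continuous_on_norm cont) auto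
  moreover have "{0..1} \<inter> (%t. norm (ga t)) -` {1..} = E" by (auto simp: E_def)
  ultimately have "closed E" by simp
  then have "compact E" using compact_Int_closed[of "{0..1::real}" E] by (simp add: E_def Int_absorb1)
  moreover have "1 : E" using x g(7) by (simp add: E_def)
  \<comment> \<open>The first time at which the curve leaves the open unit ball; until then
    \<open>left_field_bound\<close> controls its Euclidean speed.\<close>
  ultimately obtain ta where ta: "ta : E" "!!t. t : E ==> ta <= t"
   using continuous_attains_inf[of E "%t. t"] by (auto intro: continuous_on_id)
  have t01: "0 <= ta" "ta <= 1" "1 <= norm (ga ta)" using ta(1) by (auto simp: E_def)
  \<comment> \<open>Resetting finitely many values to 0 leaves the integral unchanged and makes the
    bound hold at every time.\<close>
  define D where "D t = (if t : insert ta S then 0 else left_field G (u t) (ga t))" for t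
  have D: "(D has_integral (ga ta - ga 0)) {0..ta}"
  proof (rule fundamental_theorem_of_calculus_interior_strong[of "insert ta S"])
   show "continuous_on {0..ta} ga" using cont t01 by (auto intro: continuous_on_subset)
  qed (use g t01 in \<open>auto simp: D_def\<close>)
  have int: "(%t. norm (u t)) integrable_on {0..1}" "integral {0..1} (%t. norm (u t)) = L"
   using g(5) by (auto simp: has_integral_integral integral_unique)
  have int': "(%t. norm (u t)) integrable_on {0..ta}"
   by (rule integrable_on_subinterval[OF int(1)]) (use t01 in auto)
  have "norm (integral {0..ta} D) <= integral {0..ta} (%t. M * norm (u t))"
  proof (rule integral_norm_bound_integral)
   show "norm (D t) <= M * norm (u t)" if t: "t : {0..ta}" for t
   proof (cases "t : insert ta S")
   case False
   then have "t \<notin> E" using ta(2)[of t] t by auto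
   then have "norm (ga t) <= 1" using t t01 by (auto simp: E_def)
   then show ?thesis using False M(2) by (simp add: D_def)
   qed (use M in \<open>simp add: D_def\<close>)
  qed (use D integrable_on_mult_right[OF int', of M] in auto)
  also have "... = M * integral {0..ta} (%t. norm (u t))" by simp
  also have "... <= M * L"
   using integral_subset_le[OF _ int' int(1)] t01 int(2) M(1) by (intro mult_left_mono) auto
  also have "... < 1" using L(2) M(1) by (simp add: field_simps)
  finally show False using integral_unique[OF D] t01(3) g(6) by simp
 qed
 then show ?thesis using M(1) by (intro exI[of _ "1 / M"]) simp
qed

text \<open>The scale-invariant form of \<open>dist_small_bounded\<close>. The dilation of factor
  \<open>c / (2 * r)\<close> brings a point at distance at most \<open>r\<close> below the threshold
  \<open>c\<close>, and undoing it in layer k costs the power r^k.\<close>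

lemma proj_le_dist: "\<exists>C\<ge>0. ALL x. \<forall>k\<in>{1..step G}. norm (proj k x) <= C * d 0 x ^ k"
proof -
 obtain c where c: "0 < c" "!!x. d 0 x < c ==> norm x <= 1" using dist_small_bounded by blast
 have "\<exists>K>0. ALL x. norm (proj k x) <= norm x * K" for k
  using bounded_linear.pos_bounded[OF bounded_linear_proj] by blast
 then obtain K where K: "!!k. 0 < K k" "!!k x. norm (proj k x) <= norm x * K k" by metis
 define C where "C = (\<Sum>k=1..step G. K k * (2 / c) ^ k)"
 have C0: "0 <= C" unfolding C_def using K(1) c(1) by (intro sum_nonneg) (auto intro!: mult_nonneg_nonneg less_imp_le)
 have *: "norm (proj k x) <= C * r ^ k" if k: "k : {1..step G}" and r: "0 < r" "d 0 x <= r" for k x r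
 proof -
  define s where "s = c / (2 * r)"
  have s: "0 < s" using r c by (simp add: s_def)
  have "d 0 (dl s x) = s * d 0 x" using dist_dilation[OF s, of 0 x] by simp
  also have "... <= s * r" using r s by simp
  also have "... < c" using r c by (simp add: s_def)
  finally have "norm (dl s x) <= 1" by (rule c(2))
  then have "norm (proj k (dl s x)) <= K k"
   using K(2)[of k "dl s x"] K(1)[of k] by (smt (verit) mult_right_le_one_le norm_ge_zero mult_left_le_one_le)
  then have "s ^ k * norm (proj k x) <= K k" using proj_dilation[of k s x] k s by simp
  then have "norm (proj k x) <= K k * (1 / s) ^ k" using s by (simp add: field_simps)
  also have "1 / s = (2 / c) * r" using r c by (simp add: s_def)
  also have "K k * ((2 / c) * r) ^ k = (K k * (2 / c) ^ k) * r ^ k" by (simp add: power_mult_distrib power_divide)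
  also have "... <= C * r ^ k"
  proof (rule mult_right_mono)
   show "K k * (2 / c) ^ k <= C" unfolding C_def
   by (rule member_le_sum[of k "{1..step G}" "%k. K k * (2 / c) ^ k"])
   (use k K(1) c in \<open>auto intro!: mult_nonneg_nonneg less_imp_le\<close>)
  qed (use r in simp)
  finally show ?thesis .
 qed
 have "norm (proj k x) <= C * d 0 x ^ k" if k: "k : {1..step G}" for k x
 proof (cases "d 0 x = 0")
  case False
  then have "0 < d 0 x" using dist_nonneg[of 0 x] by linarith
  from *[OF k this order_refl] show ?thesis .
 next
  \<comment> \<open>That distance 0 forces \<open>x = 0\<close> is part of what is being proved, so
    the bound is taken for all r > 0 and r tends to 0.\<close>
  case True
  have "((%r. C * r ^ k) \<longlongrightarrow> C * 0 ^ k) (at_right (0::real))" by (intro tendsto_intros)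
  moreover have "\<forall>\<^sub>F r in at_right 0. norm (proj k x) <= C * r ^ k"
   unfolding eventually_at_right_field using *[OF k] True by (intro exI[of _ 1]) auto
  ultimately have "norm (proj k x) <= C * 0 ^ k"
   by (intro tendsto_lowerbound) (auto simp: trivial_limit_at_right_real)
  then show ?thesis using True by simp
 qed
 with C0 show ?thesis by blast
qed

lemma norm_le_sum_proj: "norm x <= (\<Sum>k=1..step G. norm (proj k x))"
 using norm_sum[of "%k. proj k x" "{1..step G}"] by (simp only: sum_proj)

lemma bounded_cc_ball: "bounded {x. d 0 x <= r}"
proof -
 obtain C where C: "0 <= C" "!!x k. k : {1..step G} ==> norm (proj k x) <= C * d 0 x ^ k"
  using proj_le_dist by blast
 have "norm x <= (\<Sum>k=1..step G. C * abs r ^ k)" if "d 0 x <= r" for x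
 proof -
  have "norm (proj k x) <= C * abs r ^ k" if "k : {1..step G}" for k
   using C(2)[OF that, of x] mult_left_mono[OF power_mono[of "d 0 x" "abs r" k] C(1)] \<open>d 0 x <= r\<close> by simp
  then have "(\<Sum>k=1..step G. norm (proj k x)) <= (\<Sum>k=1..step G. C * abs r ^ k)" by (rule sum_mono)
  with norm_le_sum_proj[of x] show ?thesis by (rule order_trans)
 qed
 then show ?thesis unfolding bounded_iff by blast
qed

lemma compact_cc_cball: "compact {y. d x y <= r}"
proof -
 have "closed {y. d x y <= r}"
  by (intro closed_Collect_le continuous_intros)
 moreover have "{y. d x y <= r} = (%z. mm x z) ` {z. d 0 z <= r}"
 proof (intro equalityI subsetI)
  fix y assume "y : {y. d x y <= r}"
  moreover have "y = mm x (mm (- x) y)" by (metis assoc right_inverse left_neutral)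
  ultimately show "y : (%z. mm x z) ` {z. d 0 z <= r}"
   using dist_eq_0[of x y] by auto
 qed (use dist_translate[of x 0] in auto)
 moreover have "closed {z. d 0 z <= r}"
  by (intro closed_Collect_le continuous_intros)
 then have "compact {z. d 0 z <= r}"
  using bounded_cc_ball[of r] by (simp add: compact_eq_bounded_closed)
 then have "compact ((%z. mm x z) ` {z. d 0 z <= r})"
  by (intro compact_continuous_image continuous_on_mul continuous_on_const continuous_on_id)
 ultimately show ?thesis by simp
qed

lemma open_cc_ball: "open (cc_ball G x r)"
 unfolding cc_ball_def by (intro open_Collect_less continuous_intros)

end

section \<open>Groups of step two\<close>

locale step2_group = carnot_group +
 assumes step2: "step G = 2"
begin

lemma proj_12: "proj 1 x + proj 2 x = x"
 using sum_proj[of x] by (simp add: step2 numeral_2_eq_2)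

text \<open>Half the Lie bracket of the horizontal parts. Read off from the product, it has to be
  shown bilinear and antisymmetric; associativity and homogeneity achieve this.\<close>

definition area :: "'a => 'a => 'a" where
 "area x y = proj 2 (mm (proj 1 x) (proj 1 y))"

lemma proj_area: "proj 1 (area x y) = 0" "proj 2 (area x y) = area x y"
 by (simp_all add: area_def proj_proj)

lemma upper_2: "proj 1 w = 0 ==> w : upper 2"
 by (metis One_nat_def Suc_1 UNIV_I upper_1 upper_SucI)

lemma mul_eq: "mm x y = x + y + area x y"
proof (rule eq_by_proj)
 fix k :: nat assume k: "1 <= k" "k <= step G"
 then consider "k = 1" | "k = 2" using step2 by linarith
 then show "proj k (mm x y) = proj k (x + y + area x y)"
 proof cases
  case 1
  have "proj 1 (mm x y) = proj 1 x + proj 1 y"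
   by (rule proj_mul) (use upper_1 in auto)
  then show ?thesis using 1 proj_area by (simp add: proj_simps)
 next
  case 2
  have u: "proj 2 w : upper 2" for w by (rule upper_2) (simp add: proj_proj)
  have "proj 2 (mm (proj 1 x + proj 2 x) (proj 1 y + proj 2 y)) =
   proj 2 (mm (proj 1 x + proj 2 x) (proj 1 y)) + proj 2 (proj 2 y)"
   by (rule proj_mul_add_right[OF _ u]) simp
  also have "proj 2 (mm (proj 1 x + proj 2 x) (proj 1 y)) =
   proj 2 (mm (proj 1 x) (proj 1 y)) + proj 2 (proj 2 x)"
   by (rule proj_mul_add_left[OF _ u]) simp
  finally have "proj 2 (mm x y) = area x y + proj 2 x + proj 2 y"
   unfolding proj_12 by (simp add: area_def proj_proj)
  then show ?thesis using 2 proj_area by (simp add: proj_simps)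
 qed
qed

lemma area_proj: "proj 1 x = proj 1 x' ==> proj 1 y = proj 1 y' ==> area x y = area x' y'"
 by (simp add: area_def)

lemma area_add_area [simp]: "area (x + area a b) y = area x y" "area x (y + area a b) = area x y"
 using proj_area by (auto intro!: area_proj simp: proj_simps)

lemma area_cocycle: "area a b + area (a + b) c = area b c + area a (b + c)"
proof -
 have "mm (mm a b) c = mm a (mm b c)" by (rule assoc)
 then show ?thesis unfolding mul_eq[of a b] mul_eq[of b c] unfolding mul_eq by simp
qed

lemma area_diag [simp]: "area x x = 0"
 using one_parameter[of 1 x 1] by (simp add: mul_eq scaleR_2)

lemma area_minus [simp]: "area x (- x) = 0"
 using right_inverse[of x] by (simp add: mul_eq)

lemma area_0 [simp]: "area x 0 = 0" "area 0 x = 0"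
 using right_neutral[of x] left_neutral[of x] by (simp_all add: mul_eq)

lemma Ad_area: "Ad x y = y + area x y - area y x"
proof -
 have "area y x + area (y + x) (- x) = 0" using area_cocycle[of y x "- x"] by simp
 then have "area (x + y) (- x) = - area y x" by (simp add: add.commute eq_neg_iff_add_eq_0)
 then show ?thesis unfolding Ad_def mul_eq[of x y] unfolding mul_eq by simp
qed

lemma area_double: "area (2 *R x) (2 *R y) = 4 *R area x y"
proof -
 have l: "proj 1 z : layer G 1" for z by (rule proj_in_layer) simp
 have "mm (proj 1 (2 *R x)) (proj 1 (2 *R y)) = mm (dl 2 (proj 1 x)) (dl 2 (proj 1 y))"
  using dilation_layer[OF _ l, of 2] by (simp add: proj_simps)
 also have "... = dl 2 (mm (proj 1 x) (proj 1 y))" by (simp add: dilation_mult)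
 finally show ?thesis unfolding area_def by (simp add: proj_dilation)
qed

text \<open>The square of xy, computed once as a power and once as x(yx)y, is combined with two
  cocycle identities and the factor 4 under doubling both arguments. The gain is that
  \<open>Ad x\<close> is known to be linear, so that linearity of \<open>area\<close>
  follows.\<close>

lemma area_eq_Ad: "2 *R area x y = Ad x y - y"
proof -
 have "mm (mm x y) (mm x y) = mm (mm x (mm y x)) y" by (simp add: assoc)
 moreover have "mm (mm x y) (mm x y) = 2 *R (x + y + area x y)"
  using one_parameter[of 1 "mm x y" 1] by (simp add: mul_eq)
 moreover have "mm (mm x (mm y x)) y = x + (y + x) + y + area y x + area x (y + x) + area (x + (y + x)) y"
 proof -
  have 1: "mm x (mm y x) = x + (y + x) + area y x + area x (y + x)"
   unfolding mul_eq[of y x] unfolding mul_eq by (simp add: add.assoc[symmetric])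
  have "area (x + (y + x) + area y x + area x (y + x)) y = area (x + (y + x)) y" by simp
  then show ?thesis unfolding 1 mul_eq[of "x + (y + x) + area y x + area x (y + x)" y]
   by (simp only:) (simp add: algebra_simps)
 qed
 ultimately have 1: "2 *R area x y = area y x + area x (x + y) + area (2 *R x + y) y"
  by (simp add: scaleR_2 algebra_simps)
 have 2: "area x x + area (x + x) y = area x y + area x (x + y)" by (rule area_cocycle)
 have 3: "area (x + x) y + area (x + x + y) y = area y y + area (x + x) (y + y)" by (rule area_cocycle)
 have "area (x + x) (y + y) = 4 *R area x y" using area_double[of x y] by (simp add: scaleR_2)
 with 1 2 3 have "2 *R area x y = area y x - area x y + 4 *R area x y"
  by (simp add: scaleR_2 algebra_simps)
 then have "2 *R area x y = area x y - area y x"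
  using scaleR_left_distrib[of 2 2 "area x y"] by (simp add: algebra_simps)
 then show ?thesis by (simp add: Ad_area)
qed

lemma area_antisym: "area y x = - area x y"
proof -
 have "2 *R area x y = area x y - area y x" using area_eq_Ad[of x y] by (simp add: Ad_area)
 then show ?thesis by (simp add: scaleR_2 algebra_simps eq_neg_iff_add_eq_0)
qed

lemma bounded_bilinear_area: "bounded_bilinear area"
proof -
 have r: "linear (area x)" for x
 proof -
  have e: "area x = (%y. (1/2) *R (Ad x y - y))"
   by (simp add: area_eq_Ad[symmetric])
  show ?thesis unfolding e by (intro linear_compose_scale_right linear_compose_sub linear_Ad linear_ident)
 qed
 have "linear (%x. area x y)" for y
  using linear_compose_neg[OF r[of y]] area_antisym[of _ y] by simp
 with r show ?thesis using bilinear_conv_bounded_bilinear unfolding bilinear_def by blast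
qed

lemmas area_simps = bounded_bilinear.add_left[OF bounded_bilinear_area] bounded_bilinear.add_right[OF bounded_bilinear_area]
 bounded_bilinear.diff_left[OF bounded_bilinear_area] bounded_bilinear.diff_right[OF bounded_bilinear_area]
 bounded_bilinear.minus_left[OF bounded_bilinear_area] bounded_bilinear.minus_right[OF bounded_bilinear_area]
 bounded_bilinear.scaleR_left[OF bounded_bilinear_area] bounded_bilinear.scaleR_right[OF bounded_bilinear_area]

lemma left_field_area: "left_field G u p = u + area p u"
proof -
 have "((%y. p + y + area p y) has_derivative (%v. 0 + v + area p v)) (at 0)"
  by (intro has_derivative_add has_derivative_const has_derivative_ident
   bounded_linear_imp_has_derivative bounded_bilinear.bounded_linear_right[OF bounded_bilinear_area])
 moreover have "mm p = (%y. p + y + area p y)" by (rule ext) (rule mul_eq)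
 ultimately show ?thesis unfolding left_field_def by (simp add: frechet_derivative_eqI)
qed

text \<open>\<open>area p\<close> has values in the second layer and vanishes there. It squares to
  0, so the inverse of the identity plus \<open>area p\<close> is the identity minus
  \<open>area p\<close>.\<close>

lemma inv_left_field: "inv (%u. left_field G u p) \<xi> = \<xi> - area p \<xi>"
proof (rule inv_f_eq)
 have a0: "area p (area p v) = 0" for v using area_proj[of p p "area p v" 0] proj_area by (simp add: proj_simps)
 show "inj (%u. left_field G u p)"
 proof (rule injI)
  fix u v assume "left_field G u p = left_field G v p"
  then have e: "u + area p u = v + area p v" by (simp add: left_field_area)
  then have "area p (u + area p u) = area p (v + area p v)" by (rule arg_cong)
  then have "area p u = area p v" by simp
  with e show "u = v" by simp
 qed
 show "left_field G (\<xi> - area p \<xi>) p = \<xi>" by (simp add: left_field_area area_simps a0)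
qed

lemma coframe_area: "coframe G B b p \<xi> = representation B (\<xi> - area p \<xi>) b"
 by (simp add: coframe_def inv_left_field)

end

section \<open>Adapted bases\<close>

context carnot_group begin

text \<open>Each member of \<open>B\<close> lies in one layer, so \<open>proj j\<close> either fixes
  it or kills it. Coordinates thus respect the layers although \<open>B\<close> need not be
  orthogonal.\<close>

lemma
 assumes "adapted_basis G B"
 shows adapted_finite: "finite B"
  and linear_representation: "linear (%x. representation B x b)"
  and representation_proj: "1 <= j ==> b : B ==>
   representation B (proj j x) b = (if b : layer G j then representation B x b else 0)"
proof -
 have B: "independent B" "span B = UNIV" "B <= (\<Union>k\<in>{1..step G}. layer G k)"
  using assms by (auto simp: adapted_basis_def)
 show fin: "finite B" using B(1) by (rule independent_imp_finite)
 show lin: "linear (%x. representation B x b)" for b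
  by (rule linearI) (simp_all add: B representation_add representation_scale)
 assume j: "1 <= j" and b: "b : B"
 have pj: "proj j c = (if c : layer G j then c else 0)" if c: "c : B" for c
 proof -
  obtain k where k: "k : {1..step G}" "c : layer G k" using B(3) c by blast
  show ?thesis
  proof (cases "c : layer G j")
   case False
   then have "j ~= k" using k by auto
   then show ?thesis using proj_other[of j k c] j k False by auto
  qed (simp add: proj_id[OF j])
 qed
 have e: "x = (\<Sum>c\<in>B. representation B x c *R c)"
  using sum_representation_eq[OF B(1), of x B] B(2) fin by simp
 have "proj j x = (\<Sum>c\<in>B. representation B x c *R proj j c)"
  by (subst e) (simp add: proj_simps)
 then have "representation B (proj j x) b = (\<Sum>c\<in>B. representation B x c * representation B (proj j c) b)"
  by (simp add: linear_sum[OF lin] linear_cmul[OF lin])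
 also have "... = (\<Sum>c\<in>B. if c = b then (if b : layer G j then representation B x b else 0) else 0)"
 proof (rule sum.cong[OF refl])
  fix c assume c: "c : B"
  have "representation B c b = (if c = b then 1 else 0)" using representation_basis[OF B(1) c] by simp
  then show "representation B x c * representation B (proj j c) b =
   (if c = b then (if b : layer G j then representation B x b else 0) else 0)"
   using pj[OF c] linear_0[OF lin[of b]] by auto
 qed
 also have "... = (if b : layer G j then representation B x b else 0)" using fin b by simp
 finally show "representation B (proj j x) b = (if b : layer G j then representation B x b else 0)" .
qed

lemma adapted_layers_disjoint:
 assumes "adapted_basis G B" "b : B" "1 <= j" "1 <= k" "j ~= k" "b : layer G j"
 shows "b \<notin> layer G k"
proof
 assume "b : layer G k"
 then have "b \<bullet> b = 0" using orthogonal_layers assms by blast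
 then have "0 : B" using assms by simp
 then show False using assms(1) dependent_zero by (auto simp: adapted_basis_def)
qed

lemma bounded_linear_representation:
 "adapted_basis G B ==> bounded_linear (%x. representation B x b)"
 using linear_representation linear_conv_bounded_linear by blast

end

section \<open>Lebesgue measure as a bi-invariant measure\<close>

lemma nn_integral_lborel_translate:
 fixes F :: "'a::euclidean_space => ennreal"
 assumes [measurable]: "F : BM"
 shows "(NN lborel (%y. F (c + y))) = (NN lborel (%y. F y))"
proof -
 have "(NN lborel (%y. F y)) = (NN (distr lborel borel ((+) c)) (%y. F y))"
  by (simp add: lborel_distr_plus)
 also have "... = (NN lborel (%y. F (c + y)))" by (rule nn_integral_distr) auto
 finally show ?thesis by simp
qed

lemma nn_integral_lborel_uminus:
 fixes F :: "'a::euclidean_space => ennreal"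
 assumes [measurable]: "F : BM"
 shows "(NN lborel (%y. F (- y))) = (NN lborel (%y. F y))"
proof -
 have "lborel = density (distr lborel borel (%x::'a. 0 + (-1) *R x)) (%_. ennreal (abs (- 1)^DIM('a)))"
  by (rule lborel_affine) simp
 then have "lborel = distr lborel borel (uminus :: 'a => 'a)" by (simp add: density_1)
 then have "(NN lborel (%y. F y)) = (NN (distr lborel borel uminus) (%y. F y))" by simp
 also have "... = (NN lborel (%y. F (- y)))" by (rule nn_integral_distr) auto
 finally show ?thesis by simp
qed

text \<open>Translating along the range of \<open>P\<close> and averaging against an arbitrary probability density
 reduces the invariance under a shear to translation invariance.\<close>

lemma nn_integral_lborel_shear:
 fixes F :: "'a::euclidean_space => ennreal" and h P :: "'a => 'a"
 assumes F[measurable]: "F : BM" and h[measurable]: "h : BM"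
  and P: "bounded_linear P" and Ph: "!!y. P (h y) = h y" and hP: "!!y w. h (y + P w) = h y"
 shows "(NN lborel (%y. F (y + h y))) = (NN lborel (%y. F y))"
proof -
 define rh :: "'a => ennreal" where "rh = ind (cbox 0 One)"
 have rh[measurable]: "rh : BM" by (simp add: rh_def)
 have rh1: "(NN lborel (%w. rh w)) = 1" by (simp add: rh_def emeasure_lborel_cbox_eq)
 have [measurable]: "P : BM"
  using P by (intro borel_measurable_continuous_onI linear_continuous_on)
 have hP': "h (P w + y) = h y" for w y using hP[of y w] by (simp add: add.commute)
 have "(NN lborel (%y. F (y + h y))) = (NN lborel (%w. rh w * (NN lborel (%y. F (y + h y)))))"
  by (simp add: nn_integral_multc rh1)
 also have "... = (NN lborel (%w. NN lborel (%y. rh w * F (P w + y + h y))))"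
  by (intro nn_integral_cong)
   (subst nn_integral_lborel_translate[of "%y. F (y + h y)" "P _", symmetric], simp,
   simp add: hP' nn_integral_cmult)
 also have "... = (NN lborel (%y. NN lborel (%w. rh w * F (P w + y + h y))))"
  by (rule lborel_pair.Fubini') simp
 \<comment> \<open>Shifting \<open>w\<close> by \<open>- h y\<close> absorbs the shear, because
   \<open>P\<close> fixes \<open>h y\<close>.\<close>
 also have "... = (NN lborel (%y. NN lborel (%w. rh (- h y + w) * F (P w + y))))"
 proof (rule nn_integral_cong)
  fix y
  have "P (- h y + w) + y + h y = P w + y" for w
   using linear_add[OF bounded_linear.linear[OF P], of "- h y" w]
   linear_neg[OF bounded_linear.linear[OF P], of "h y"] by (simp add: Ph)
  moreover have "(NN lborel (%w. rh w * F (P w + y + h y))) =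
   (NN lborel (%w. rh (- h y + w) * F (P (- h y + w) + y + h y)))"
   by (rule nn_integral_lborel_translate[symmetric]) measurable
  ultimately show "(NN lborel (%w. rh w * F (P w + y + h y))) = (NN lborel (%w. rh (- h y + w) * F (P w + y)))"
   by (simp only:)
 qed
 also have "... = (NN lborel (%w. NN lborel (%y. rh (- h y + w) * F (P w + y))))"
  by (rule lborel_pair.Fubini') simp
 also have "... = (NN lborel (%w. NN lborel (%y. rh (- h y + w) * F y)))"
 proof (rule nn_integral_cong)
  fix w
  have "(NN lborel (%y. rh (- h (P w + y) + w) * F (P w + y))) = (NN lborel (%y. rh (- h y + w) * F y))"
   by (rule nn_integral_lborel_translate) measurable
  then show "(NN lborel (%y. rh (- h y + w) * F (P w + y))) = (NN lborel (%y. rh (- h y + w) * F y))"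
   by (simp only: hP')
 qed
 also have "... = (NN lborel (%y. NN lborel (%w. rh (- h y + w) * F y)))"
  by (rule lborel_pair.Fubini') simp
 also have "... = (NN lborel (%y. F y))"
 proof (rule nn_integral_cong)
  fix y
  have "(NN lborel (%w. rh (- h y + w) * F y)) = (NN lborel (%w. rh (- h y + w))) * F y"
   by (rule nn_integral_multc) measurable
  also have "(NN lborel (%w. rh (- h y + w))) = 1"
   using nn_integral_lborel_translate[OF rh, of "- h y"] rh1 by (simp only:)
  finally show "(NN lborel (%w. rh (- h y + w) * F y)) = F y" by simp
 qed
 finally show ?thesis .
qed

text \<open>Uniqueness of Haar measure: the integral of \<open>g\<close> is replaced by that of its
  translate by \<open>i x\<close>, the integrals are exchanged, and invariance moves the translation
  onto \<open>F\<close>. With abstract \<open>m\<close> and \<open>i\<close> it covers both vector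
  addition and the group product.\<close>

lemma invariant_measure_unique:
 fixes ka \<nu> :: "'a::euclidean_space measure" and m :: "'a => 'a => 'a" and F g :: "'a => ennreal"
 assumes sets[measurable_cong]: "sets ka = sets borel" "sets \<nu> = sets borel"
  and sf: "sigma_finite_measure ka" "sigma_finite_measure \<nu>"
  and m[measurable]: "(%p. m (fst p) (snd p)) : borel_measurable (borel \<Otimes>\<^sub>M borel)"
  and i[measurable]: "i : BM"
  and left_\<nu>: "!!F x. F : BM ==> (NN \<nu> (%y. F (m x y))) = (NN \<nu> (%y. F y))"
  and left_ka: "!!F x. F : BM ==> (NN ka (%y. F (m x y))) = (NN ka (%y. F y))"
  and right_ka: "!!F x. F : BM ==> (NN ka (%y. F (m y x))) = (NN ka (%y. F y))"
  and law: "!!x y. m (i (m y x)) y = i x"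
  and F[measurable]: "F : BM" and g[measurable]: "g : BM"
 shows "(NN \<nu> (%x. F x)) * (NN ka (%x. g x)) = (NN ka (%x. F x)) * (NN \<nu> (%x. g (i x)))"
proof -
 interpret A: pair_sigma_finite ka \<nu> using sf by (rule pair_sigma_finite.intro)
 have [measurable]: "(%x. m (f x) (h x)) : borel_measurable M"
  if [measurable]: "f : borel_measurable M" "h : borel_measurable M" for f h and M :: "'z measure"
  using measurable_compose[OF measurable_Pair[OF that] m] by simp
 have [measurable]: "(%x. m (f x) (h x)) : borel_measurable M"
  if [measurable]: "f : borel_measurable M" "h : borel_measurable M" for f h and M :: "'a measure"
  using measurable_compose[OF measurable_Pair[OF that] m] by simp
 have [measurable]: "(%x. m (f x) (h x)) : borel_measurable M"
  if [measurable]: "f : borel_measurable M" "h : borel_measurable M" for f h and M :: "('a \<times> 'a) measure"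
  using measurable_compose[OF measurable_Pair[OF that] m] by simp
 have "(NN \<nu> (%x. F x)) * (NN ka (%x. g x)) = (NN \<nu> (%x. F x * (NN ka (%y. g y))))"
  by (simp add: nn_integral_multc)
 also have "... = (NN \<nu> (%x. NN ka (%y. F x * g (m (i x) y))))"
  by (simp add: nn_integral_cmult left_ka)
 also have "... = (NN ka (%y. NN \<nu> (%x. F x * g (m (i x) y))))"
  by (rule A.Fubini') simp
 also have "... = (NN ka (%y. NN \<nu> (%x. F (m y x) * g (i x))))"
 proof (rule nn_integral_cong)
  fix y
  have "(NN \<nu> (%x. F x * g (m (i x) y))) = (NN \<nu> (%x. F (m y x) * g (m (i (m y x)) y)))"
   by (rule left_\<nu>[symmetric]) measurable
  then show "(NN \<nu> (%x. F x * g (m (i x) y))) = (NN \<nu> (%x. F (m y x) * g (i x)))"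
   by (simp only: law)
 qed
 also have "... = (NN \<nu> (%x. NN ka (%y. F (m y x) * g (i x))))"
  by (rule A.Fubini'[symmetric]) simp
 also have "... = (NN ka (%x. F x)) * (NN \<nu> (%x. g (i x)))"
  by (simp add: nn_integral_multc right_ka nn_integral_cmult)
 finally show ?thesis .
qed

lemma sigma_finite_borel_compact:
 fixes \<nu> :: "'a::euclidean_space measure"
 assumes "sets \<nu> = sets borel" "!!K. compact K ==> emeasure \<nu> K < \<infinity>"
 shows "sigma_finite_measure \<nu>"
proof
 show "EX A. countable A & A <= sets \<nu> & \<Union> A = space \<nu> & (\<forall>a\<in>A. emeasure \<nu> a ~= \<infinity>)"
 proof (intro exI[of _ "range (%n. cball 0 (real n))"] conjI)
  show "\<Union> (range (%n. cball 0 (real n))) = space \<nu>"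
   using sets_eq_imp_space_eq[OF assms(1)] real_arch_simple by auto
 qed (use assms in \<open>auto simp: less_top\<close>)
qed

text \<open>The image of Lebesgue measure is translation invariant and finite on compact sets, hence
  a multiple of Lebesgue measure. The multiple, a determinant, stays implicit because it cancels
  where the lemma is applied.\<close>

lemma nn_integral_lborel_linear_iso:
 fixes R :: "'a::euclidean_space => 'a"
 assumes "bounded_linear R" "bounded_linear R'" "!!x. R' (R x) = x" "!!x. R (R' x) = x"
 shows "EX c. c ~= 0 & c ~= \<infinity> &
  (\<forall>F\<in>BM. (NN lborel (%x. F (R x))) = c * (NN lborel (%x. F x)))"
proof -
 have [measurable]: "R : BM" "R' : BM"
  using assms by (auto intro!: borel_measurable_continuous_onI linear_continuous_on)
 define \<nu> where "\<nu> = distr lborel borel R"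
 have sets: "sets \<nu> = sets borel" by (simp add: \<nu>_def)
 have nn: "(NN \<nu> (%x. F x)) = (NN lborel (%x. F (R x)))" if "F : BM" for F
  unfolding \<nu>_def using that by (intro nn_integral_distr) auto
 have fin: "emeasure \<nu> K < \<infinity>" if "compact K" for K
 proof -
  have "R -` K = R' ` K" by (auto simp: assms(4) image_iff) (metis assms(3))
  moreover have cK: "compact (R' ` K)"
   by (intro compact_continuous_image linear_continuous_on assms that)
  moreover have "emeasure \<nu> K = emeasure lborel (R -` K)"
   unfolding \<nu>_def using that by (subst emeasure_distr) (auto intro: borel_compact)
  ultimately show ?thesis using emeasure_bounded_finite[OF compact_imp_bounded[OF cK]] by simp
 qed
 define g :: "'a => ennreal" where "g = ind (cbox 0 One)"
 have [measurable]: "g : BM" by (simp add: g_def)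
 have g1: "(NN lborel (%w. g w)) = 1" by (simp add: g_def emeasure_lborel_cbox_eq)
 define c where "c = (NN \<nu> (%x. g (- x)))"
 have *: "(NN \<nu> (%x. F x)) = (NN lborel (%x. F x)) * c" if F[measurable]: "F : BM" for F
 proof -
  have "(NN \<nu> (%x. F x)) * (NN lborel (%x. g x)) = (NN lborel (%x. F x)) * (NN \<nu> (%x. g (- x)))"
  proof (rule invariant_measure_unique[where m = "(+)"])
   show "(NN \<nu> (%y. F (x + y))) = integral\<^sup>N \<nu> F" if [measurable]: "F : BM" for F x
   proof -
   have "x + R y = R (R' x + y)" for y
   using linear_add[OF bounded_linear.linear[OF assms(1)]] assms(4) by simp
   then show ?thesis
   using nn_integral_lborel_translate[of "%y. F (R y)" "R' x"] by (simp add: nn)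
   qed
   show "(NN lborel (%y. F (y + x))) = integral\<^sup>N lborel F" if "F : BM" for F and x :: 'a
   using nn_integral_lborel_translate[OF that, of x] by (simp add: add.commute)
   show "sigma_finite_measure \<nu>" by (rule sigma_finite_borel_compact[OF sets fin])
  qed (auto simp: sets nn_integral_lborel_translate sigma_finite_lborel)
  then show ?thesis by (simp add: g1 c_def)
 qed
 have um: "x : uminus ` A \<longleftrightarrow> - x : A" for x :: 'a and A
  by (auto intro: image_eqI[of x uminus "- x"])
 have "(%x. g (- x)) = ind (uminus ` cbox 0 One)"
  by (rule ext) (simp only: g_def indicator_def um)
 moreover have cu: "compact (uminus ` cbox (0::'a) One)" by (intro compact_negations) simp
 ultimately have "c = emeasure \<nu> (uminus ` cbox 0 One)"
  unfolding c_def using sets borel_compact[OF cu] by simp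
 with fin[OF cu] have "c ~= \<infinity>" by simp
 moreover have "c ~= 0"
 proof
  assume "c = 0"
  then have "(NN \<nu> (%x. 1)) = 0" using *[of "%_. 1"] by simp
  then have "emeasure lborel (UNIV :: 'a set) = 0" using nn[of "%_. 1"] by (simp add: space_lborel)
  then show False by simp
 qed
 ultimately show ?thesis using * nn by (intro exI[of _ c]) (auto simp: mult.commute)
qed

context carnot_group begin

lemma measurable_mul [measurable]:
 assumes "f : borel_measurable M" "g : borel_measurable M"
 shows "(%x. mm (f x) (g x)) : borel_measurable M"
 using assms continuous_mul by (rule borel_measurable_continuous_Pair)

lemma measurable_proj [measurable]: "proj k : BM"
 by (intro borel_measurable_continuous_onI linear_continuous_on bounded_linear_proj)

lemma measurable_dilation [measurable]: "dl r : BM"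
 by (intro borel_measurable_continuous_onI linear_continuous_on bounded_linear_dilation)

text \<open>A left translation is a composition of shears, one for each layer.\<close>

lemma nn_integral_lborel_left:
 assumes F: "F : BM"
 shows "(NN lborel (%y. F (mm x y))) = (NN lborel (%y. F y))"
proof -
 define h where "h k y = proj k (mm x y) - proj k y" for k y
 \<comment> \<open>\<open>T k\<close> adds the increments of the layers k up to the step: the
   identity for k beyond the step, the left translation for k = 1.\<close>
 define T where "T k y = y + (\<Sum>i=k..step G. h i y)" for k y
 have [measurable]: "h k : BM" for k
  unfolding h_def[abs_def] by measurable
 have hup: "h k (y + w) = h k y" if "1 <= k" "w : upper k" for k y w
  using proj_mul_add_right[OF that, of x y] by (simp add: h_def proj_simps)
 have hp: "proj j (h k y) = (if j = k then h k y else 0)" if "1 <= j" "1 <= k" for j k y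
  using that by (simp add: h_def proj_simps proj_proj)
 have "\<forall>F\<in>BM. (NN lborel (%y. F (T k y))) = (NN lborel (%y. F y))"
  if "k <= Suc (step G)" "1 <= k" for k
  using that
 proof (induction k rule: inc_induct)
  case base
  then show ?case by (simp add: T_def)
 next
  case (step k)
  show ?case
  proof
   fix F :: "'a => ennreal" assume F[measurable]: "F : BM"
   \<comment> \<open>\<open>h k\<close> ignores changes in the layers from k upwards, so it may be
     evaluated after the shears of the higher layers.\<close>
   have "T k y = T (Suc k) y + h k (T (Suc k) y)" for y
   proof -
   have "(\<Sum>i=Suc k..step G. h i y) : upper k"
   using step hp by (auto simp: upper_def proj_simps intro!: sum.neutral)
   from hup[OF step.prems this, of y] have "h k (T (Suc k) y) = h k y" by (simp add: T_def)
   moreover have "(\<Sum>i=k..step G. h i y) = h k y + (\<Sum>i=Suc k..step G. h i y)"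
   using step by (intro sum.atLeast_Suc_atMost) simp
   ultimately show ?thesis by (simp add: T_def algebra_simps)
   qed
   then have "(NN lborel (%y. F (T k y))) = (NN lborel (%y. F (T (Suc k) y + h k (T (Suc k) y))))" by simp
   also have "... = (NN lborel (%y. F (y + h k y)))"
   using step.IH[THEN bspec, of "%y. F (y + h k y)"] step.prems by simp
   also have "... = (NN lborel (%y. F y))"
   proof (rule nn_integral_lborel_shear[OF _ _ bounded_linear_proj[of k]])
   show "h k (y + proj k w) = h k y" for y w
   using hup[OF step.prems, of "proj k w" y] proj_in_layer[OF step.prems] layer_subset_upper[OF step.prems] by blast
   qed (use hp step.prems in auto)
   finally show "(NN lborel (%y. F (T k y))) = (NN lborel (%y. F y))" .
  qed
 qed
 from this[of 1] have "(NN lborel (%y. F (T 1 y))) = (NN lborel (%y. F y))" using F by simp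
 moreover have "T 1 y = mm x y" for y
  unfolding T_def h_def sum_subtractf sum_proj by simp
 ultimately show ?thesis by simp
qed

lemma nn_integral_lborel_right:
 assumes [measurable]: "F : BM"
 shows "(NN lborel (%y. F (mm y x))) = (NN lborel (%y. F y))"
proof -
 have "(NN lborel (%y. F (mm y x))) = (NN lborel (%y. F (mm (- y) x)))"
  by (rule nn_integral_lborel_uminus[symmetric]) measurable
 also have "... = (NN lborel (%y. F (- mm (- x) y)))" by (simp add: inverse_mul)
 also have "... = (NN lborel (%y. F (- y)))" by (rule nn_integral_lborel_left) measurable
 also have "... = (NN lborel (%y. F y))" by (rule nn_integral_lborel_uminus) measurable
 finally show ?thesis .
qed

lemma layer_basis_union:
 defines "E \<equiv> (\<Union>k\<in>{1..step G}. layer_basis k)"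
 shows "finite E" "pairwise orthogonal E" "!!e. e : E ==> norm e = 1" "span E = UNIV" "card E = DIM('a)"
proof -
 show fin: "finite E" unfolding E_def using layer_basis(7) by auto
 show n: "norm e = 1" if "e : E" for e using that layer_basis(3) by (auto simp: E_def)
 show o: "pairwise orthogonal E"
 proof (rule pairwiseI)
  fix x y assume xy: "x : E" "y : E" "x ~= y"
  then obtain j k where jk: "j : {1..step G}" "k : {1..step G}" "x : layer_basis j" "y : layer_basis k"
   by (auto simp: E_def)
  show "orthogonal x y"
  proof (cases "j = k")
   case True
   then show ?thesis using layer_basis(2)[of j] jk xy by (auto simp: pairwise_def)
  next
   case False
   then show ?thesis using orthogonal_layers[of j k x y] jk layer_basis(1)[of j] layer_basis(1)[of k]
   by (auto simp: orthogonal_def)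
  qed
 qed
 have "layer G k <= span E" if "k : {1..step G}" for k
 proof -
  have "span (layer_basis k) <= span E" by (rule span_mono) (use that in \<open>auto simp: E_def\<close>)
  then show ?thesis using layer_basis(6)[of k] that by simp
 qed
 then have "span (\<Union>k\<in>{1..step G}. layer G k) <= span E"
  by (intro span_minimal UN_least subspace_span)
 then show s: "span E = UNIV" using span_layers by auto
 have "0 \<notin> E" using n by force
 then have "independent E" using pairwise_orthogonal_independent[OF o] by simp
 then show "card E = DIM('a)" using s by (metis basis_card_eq_dim dim_UNIV subset_UNIV)
qed

lemma homogeneous_dim_eq:
 assumes "!!k e. k : {1..step G} ==> e : layer_basis k ==> wt e = k"
 shows "(\<Sum>e\<in>(\<Union>k\<in>{1..step G}. layer_basis k). wt e) = homogeneous_dim G"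
proof -
 have disj: "layer_basis j \<inter> layer_basis k = {}" if "j : {1..step G}" "k : {1..step G}" "j ~= k" for j k
  using assms[of j] assms[of k] that by force
 have "(\<Sum>e\<in>(\<Union>k\<in>{1..step G}. layer_basis k). wt e) = (\<Sum>k=1..step G. \<Sum>e\<in>layer_basis k. wt e)"
  using disj layer_basis(7) by (intro sum.UNION_disjoint) auto
 also have "... = (\<Sum>k=1..step G. k * card (layer_basis k))"
  by (rule sum.cong) (auto simp: assms mult.commute)
 also have "... = homogeneous_dim G"
  unfolding homogeneous_dim_def by (rule sum.cong) (auto simp: layer_basis(5))
 finally show ?thesis .
qed

text \<open>\<open>R\<close> carries the standard basis to an orthonormal basis adapted to the
  layers. In these coordinates the dilation is diagonal with entries r^k, and the product of the
  entries is r to the homogeneous dimension.\<close>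

lemma nn_integral_lborel_dilation:
 assumes F[measurable]: "F : BM" and r: "0 < r"
 shows "(NN lborel (%y. F (dl r y))) * en (r ^ homogeneous_dim G) = (NN lborel (%y. F y))"
proof -
 define E where "E = (\<Union>k\<in>{1..step G}. layer_basis k)"
 note E = layer_basis_union[folded E_def]
 define wt where "wt e = (SOME k. k : {1..step G} & e : layer_basis k)" for e
 have wt: "wt e = k" if k: "k : {1..step G}" "e : layer_basis k" for k e
 proof -
  have *: "wt e : {1..step G} & e : layer_basis (wt e)"
   unfolding wt_def by (rule someI[of _ k]) (use k in simp)
  show ?thesis
  proof (rule ccontr)
   assume "wt e ~= k"
   then have "e \<bullet> e = 0"
   using orthogonal_layers[of "wt e" k e e] * k layer_basis(1)[of k] layer_basis(1)[of "wt e"] by auto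
   then show False using layer_basis(3)[of k e] k by auto
  qed
 qed
 have dil: "dl r e = r ^ wt e *R e" if "e : E" for e
  using that wt dilation_layer[of _ e r] layer_basis(1) by (fastforce simp: E_def)
 obtain ph where ph: "bij_betw ph (Basis::'a set) E"
  using finite_same_card_bij[OF finite_Basis E(1)] E(5) by auto
 then have phE: "ph i : E" if "i : Basis" for i using that by (auto simp: bij_betw_def)
 have orth: "ph i \<bullet> ph j = (if i = j then 1 else 0)" if "i : Basis" "j : Basis" for i j
 proof (cases "i = j")
  case False
  then have "ph i ~= ph j" using ph that by (auto simp: bij_betw_def inj_on_def)
  then show ?thesis using E(2) phE that False by (auto simp: pairwise_def orthogonal_def)
 qed (use E(3)[OF phE[OF that(1)]] in \<open>simp add: dot_square_norm\<close>)
 define R where "R x = (\<Sum>i\<in>Basis. (x \<bullet> i) *R ph i)" for x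
 define R' where "R' x = (\<Sum>i\<in>Basis. (x \<bullet> ph i) *R i)" for x
 have lin: "bounded_linear R" "bounded_linear R'"
  unfolding R_def R'_def by (intro bounded_linear_sum bounded_linear_scaleR_const bounded_linear_inner_left)+
 have R'R: "R' (R x) = x" for x
 proof -
  have "R x \<bullet> ph j = x \<bullet> j" if "j : Basis" for j
  proof -
   have "R x \<bullet> ph j = (\<Sum>i\<in>Basis. if i = j then x \<bullet> j else 0)"
   unfolding R_def inner_sum_left by (rule sum.cong) (use orth that in auto)
   then show ?thesis using that by simp
  qed
  then show ?thesis unfolding R'_def by (simp add: euclidean_representation)
 qed
 have RR': "R (R' x) = x" for x
 proof -
  have "R' x \<bullet> i = x \<bullet> ph i" if "i : Basis" for i
   unfolding R'_def using that by (simp add: inner_sum_left inner_Basis if_distrib sum.If_cases cong: if_cong)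
  then have "R (R' x) = (\<Sum>i\<in>Basis. (x \<bullet> ph i) *R ph i)" unfolding R_def by simp
  also have "... = (\<Sum>e\<in>E. (x \<bullet> e) *R e)" using ph by (rule sum.reindex_bij_betw)
  also have "... = x" using E by (intro orthonormal_basis_expand) auto
  finally show ?thesis .
 qed
 obtain c where c: "c ~= 0" "c ~= \<infinity>"
  "!!F. F : BM ==> (NN lborel (%x. F (R x))) = c * (NN lborel (%x. F x))"
  using nn_integral_lborel_linear_iso[OF lin R'R RR'] by blast
 define S where "S x = 0 + (\<Sum>j\<in>Basis. (r ^ wt (ph j) * (x \<bullet> j)) *R j)" for x
 have [measurable]: "R : BM"
  using lin by (intro borel_measurable_continuous_onI linear_continuous_on)
 have [measurable]: "S : BM" unfolding S_def[abs_def] by measurable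
 have DR: "dl r (R x) = R (S x)" for x
 proof -
  have "S x \<bullet> i = r ^ wt (ph i) * (x \<bullet> i)" if "i : Basis" for i
   unfolding S_def using that by (simp add: inner_sum_left inner_Basis if_distrib sum.If_cases cong: if_cong)
  then show ?thesis unfolding R_def dilation_simps
   by (intro sum.cong) (auto simp: dil phE dilation_simps mult.commute)
 qed
 have "(\<Prod>j\<in>Basis. abs (r ^ wt (ph j))) = r ^ (\<Sum>j\<in>Basis. wt (ph j))"
  using r by (simp add: power_sum)
 also have "(\<Sum>j\<in>Basis. wt (ph j)) = (\<Sum>e\<in>E. wt e)" using ph by (rule sum.reindex_bij_betw)
 also have "... = homogeneous_dim G" unfolding E_def by (rule homogeneous_dim_eq) (rule wt)
 finally have "lborel = density (distr lborel borel S) (%_. ennreal (r ^ homogeneous_dim G))"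
  using lborel_affine_euclidean[of "%j. r ^ wt (ph j)" 0, folded S_def[abs_def]] r by simp
 then have S: "(NN lborel (%y. H y)) = (NN lborel (%y. H (S y))) * en (r ^ homogeneous_dim G)"
  if [measurable]: "H : BM" for H
 proof -
  assume e: "lborel = density (distr lborel borel S) (%_. ennreal (r ^ homogeneous_dim G))"
  have "(NN lborel (%y. H y)) = (NN (density (distr lborel borel S) (%_. ennreal (r ^ homogeneous_dim G))) (%y. H y))"
   using e by simp
  also have "... = (NN (distr lborel borel S) (%y. ennreal (r ^ homogeneous_dim G) * H y))"
   by (rule nn_integral_density) auto
  also have "... = (NN lborel (%y. ennreal (r ^ homogeneous_dim G) * H (S y)))"
   by (rule nn_integral_distr) auto
  finally show ?thesis by (simp add: nn_integral_cmult mult.commute[of _ "ennreal _"])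
 qed
 have "c * (NN lborel (%y. F y)) = (NN lborel (%y. F (R (S y)))) * en (r ^ homogeneous_dim G)"
  using S[of "%y. F (R y)"] c(3)[of F] by simp
 also have "(NN lborel (%y. F (R (S y)))) = c * (NN lborel (%y. F (dl r y)))"
  using c(3)[of "%y. F (dl r y)"] by (simp add: DR)
 finally have "c * (NN lborel (%y. F y)) = c * ((NN lborel (%y. F (dl r y))) * en (r ^ homogeneous_dim G))"
  by (simp add: mult.assoc)
 then show ?thesis using c(1,2) by (simp add: ennreal_mult_cancel_left)
qed

end

section \<open>Convexity inequalities for powers\<close>

lemma powr_ge_tangent:
 fixes a b r :: real
 assumes "0 <= a" "0 < b" "1 <= r"
 shows "b powr r + r * b powr (r - 1) * (a - b) <= a powr r"
proof (cases "a = 0")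
 case True
 have "b powr r = b powr (r - 1) * b" using assms by (simp add: powr_diff)
 then have "b powr r + r * b powr (r - 1) * (a - b) = (1 - r) * b powr r" using True by (simp add: algebra_simps)
 also have "... <= 0" using assms by (simp add: mult_nonpos_nonneg)
 finally show ?thesis using True by simp
next
 case False
 then have a: "0 < a" using assms by simp
 have "1 + r * (a / b - 1) <= (1 + (a / b - 1)) powr r"
 proof (cases "a / b = 1")
  case False
  have conv: "convex_on {0<..} (%x::real. x powr r)" using assms(3) by (rule powr_convex)
  have d: "((%x. x powr r) has_real_derivative r * 1 powr (r - 1)) (at 1)"
   by (auto intro!: derivative_eq_intros)
  from convex_on_imp_above_tangent[OF conv _ _ _ d[THEN has_field_derivative_at_within], of "a / b"]
  show ?thesis using a assms by (simp add: interior_open convex_connected)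
 qed simp
 then have "b powr r * (1 + r * (a / b - 1)) <= b powr r * (a / b) powr r"
  by (intro mult_left_mono) auto
 moreover have "b powr r * (a / b) powr r = a powr r" using a assms by (simp add: powr_divide)
 moreover have "b powr r * (1 + r * (a / b - 1)) = b powr r + r * b powr (r - 1) * (a - b)"
  using assms by (simp add: powr_diff field_simps)
 ultimately show ?thesis by simp
qed

text \<open>Jensen's inequality.  Stated for a lower bound \<open>y\<close> of the integral, it needs no integrability.\<close>

lemma powr_le_nn_integral:
 fixes h :: "'a => real"
 assumes [measurable]: "h : borel_measurable M" and h: "!!x. 0 <= h x" and r: "1 <= r"
  and m: "emeasure M (space M) = ennreal m" "0 < m"
  and y: "0 <= y" "ennreal y <= (NN M (%x. ennreal (h x)))"
 shows "en (y powr r) <= en (m powr (r - 1)) * (NN M (%x. ennreal (h x powr r)))"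
proof (cases "y = 0")
 case False
 \<comment> \<open>The tangent is taken at the mean value. \<open>A\<close> compensates the negative
   term of the tangent, so that all integrands are nonnegative; being finite, it cancels at the
   end.\<close>
 define b where "b = y / m"
 have b: "0 < b" using False y m by (simp add: b_def)
 define A where "A = r * b powr r * m"
 define I where "I = (NN M (%x. ennreal (h x powr r)))"
 have br: "b powr r = b powr (r - 1) * b" using b by (simp add: powr_diff)
 have "en (b powr r * m + A) = en (b powr r * m) + en (r * b powr (r - 1)) * ennreal y"
  using r b m y by (simp add: A_def b_def br[unfolded b_def] ennreal_mult[symmetric] ennreal_plus[symmetric] del: ennreal_plus)
 also have "... <= en (b powr r * m) + en (r * b powr (r - 1)) * (NN M (%x. ennreal (h x)))"
  using y by (intro add_left_mono mult_left_mono) auto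
 also have "... = (NN M (%x. ennreal (b powr r) + en (r * b powr (r - 1)) * en (h x)))"
  using m by (simp add: nn_integral_add nn_integral_cmult ennreal_mult)
 also have "... <= (NN M (%x. ennreal (h x powr r) + en (r * b powr r)))"
 proof (rule nn_integral_mono)
  fix x
  have "b powr r + r * b powr (r - 1) * h x <= h x powr r + r * b powr r"
   using powr_ge_tangent[OF h[of x] b r] by (simp add: br algebra_simps)
  then show "en (b powr r) + en (r * b powr (r - 1)) * en (h x) <= en (h x powr r) + en (r * b powr r)"
   using h r by (simp add: ennreal_mult[symmetric] ennreal_plus[symmetric] del: ennreal_plus)
 qed
 also have "... = I + ennreal A"
  using m r by (simp add: nn_integral_add A_def I_def ennreal_mult)
 finally have "en (b powr r * m) + ennreal A <= I + ennreal A"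
  using r m by (simp add: ennreal_plus A_def)
 then have "en (b powr r * m) <= I" by (simp add: ennreal_add_left_cancel_le add.commute)
 then have "en (m powr (r - 1)) * en (b powr r * m) <= en (m powr (r - 1)) * I"
  by (rule mult_left_mono) simp
 moreover have "m powr (r - 1) * (b powr r * m) = y powr r"
  using m y False by (simp add: b_def powr_divide powr_diff field_simps)
 ultimately show ?thesis using m unfolding I_def by (simp add: ennreal_mult[symmetric])
qed simp

lemma abs_add_powr_le:
 fixes a b r :: real
 assumes "0 <= r"
 shows "abs (a + b) powr r <= 2 powr r * (abs a powr r + abs b powr r)"
proof -
 have "abs (a + b) <= 2 * max (abs a) (abs b)" by linarith
 then have "abs (a + b) powr r <= (2 * max (abs a) (abs b)) powr r" using assms by (intro powr_mono2) auto
 also have "... = 2 powr r * (max (abs a) (abs b)) powr r" by (simp add: powr_mult)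
 also have "... <= 2 powr r * (abs a powr r + abs b powr r)" by (intro mult_left_mono) (auto simp: max_def)
 finally show ?thesis .
qed

section \<open>Integration against Haar measure\<close>

locale carnot_haar = carnot_group +
 fixes mu :: "'a measure"
 assumes haar: "haar_measure G mu"
begin

lemma sets_mu [simp, measurable_cong]: "sets mu = sets borel"
 using haar by (simp add: haar_measure_def)

lemma space_mu [simp]: "space mu = UNIV"
 using sets_eq_imp_space_eq[OF sets_mu] by simp

lemma compact_finite: "compact K ==> emeasure mu K < \<infinity>"
 using haar by (simp add: haar_measure_def)

lemma sigma_finite_mu: "sigma_finite_measure mu"
 by (rule sigma_finite_borel_compact[OF sets_mu compact_finite])

sublocale mu: sigma_finite_measure mu by (rule sigma_finite_mu)
sublocale mumu: pair_sigma_finite mu mu by (rule pair_sigma_finite.intro; rule sigma_finite_mu)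
sublocale mul: pair_sigma_finite mu lborel by (rule pair_sigma_finite.intro; unfold_locales)

lemma nn_left:
 assumes [measurable]: "F : BM"
 shows "(NN mu (%y. F (mm x y))) = (NN mu (%y. F y))"
proof -
 have "(NN mu (%y. F y)) = (NN (distr mu borel (mm x)) (%y. F y))"
  using haar by (simp add: haar_measure_def)
 also have "... = (NN mu (%y. F (mm x y)))" by (rule nn_integral_distr) auto
 finally show ?thesis by simp
qed

text \<open>Lebesgue measure is invariant under left and right group translations, so uniqueness
  makes \<open>mu\<close> a multiple of it. Right invariance, invariance under inversion and the
  scaling under dilations are inherited from there.\<close>

lemma mu_lborel:
 "EX c. c ~= 0 & c ~= \<infinity> & (\<forall>F\<in>BM. (NN mu (%x. F x)) = c * (NN lborel (%x. F x)))"
proof -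
 define g :: "'a => ennreal" where "g = ind (cbox 0 One)"
 have [measurable]: "g : BM" by (simp add: g_def)
 have g1: "(NN lborel (%w. g w)) = 1" by (simp add: g_def emeasure_lborel_cbox_eq)
 define c where "c = (NN mu (%x. g (- x)))"
 have *: "(NN mu (%x. F x)) = (NN lborel (%x. F x)) * c" if F[measurable]: "F : BM" for F
 proof -
  have "(NN mu (%x. F x)) * (NN lborel (%x. g x)) = (NN lborel (%x. F x)) * (NN mu (%x. g (- x)))"
  proof (rule invariant_measure_unique[where m = "mm"])
   show "mm (- mm y x) y = - x" for x y
   by (simp add: inverse_mul assoc)
   show "(%p. mm (fst p) (snd p)) : borel_measurable (borel \<Otimes>\<^sub>M borel)" by measurable
  qed (auto simp: nn_left nn_integral_lborel_left nn_integral_lborel_right sigma_finite_lborel sigma_finite_mu)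
  then show ?thesis by (simp add: g1 c_def)
 qed
 have um: "x : uminus ` A \<longleftrightarrow> - x : A" for x :: 'a and A
  by (auto intro: image_eqI[of x uminus "- x"])
 have "(%x. g (- x)) = ind (uminus ` cbox 0 One)"
  by (rule ext) (simp only: g_def indicator_def um)
 moreover have cu: "compact (uminus ` cbox (0::'a) One)" by (intro compact_negations) simp
 ultimately have "c = emeasure mu (uminus ` cbox 0 One)"
  unfolding c_def using borel_compact[OF cu] by simp
 with compact_finite[OF cu] have "c ~= \<infinity>" by simp
 moreover have "c ~= 0"
 proof
  assume "c = 0"
  then have "emeasure mu UNIV = 0" using *[of "%_. 1"] by simp
  then show False using haar by (simp add: haar_measure_def)
 qed
 ultimately show ?thesis using * by (intro exI[of _ c]) (auto simp: mult.commute)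
qed

lemma nn_right:
 assumes [measurable]: "F : BM"
 shows "(NN mu (%y. F (mm y x))) = (NN mu (%y. F y))"
 using mu_lborel nn_integral_lborel_right[OF assms, of x] by force

lemma nn_uminus:
 assumes [measurable]: "F : BM"
 shows "(NN mu (%y. F (- y))) = (NN mu (%y. F y))"
 using mu_lborel nn_integral_lborel_uminus[OF assms] by force

lemma nn_dilation:
 assumes [measurable]: "F : BM" and r: "0 < r"
 shows "(NN mu (%y. F (dl r y))) * en (r ^ homogeneous_dim G) = (NN mu (%y. F y))"
proof -
 obtain c where c: "!!F. F : BM ==> (NN mu (%x. F x)) = c * (NN lborel (%x. F x))"
  using mu_lborel by blast
 show ?thesis
  using c[of F] c[of "%y. F (dl r y)"] nn_integral_lborel_dilation[OF assms] by (simp add: mult.assoc)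
qed

lemma distr_eqI:
 assumes [measurable]: "T : BM"
  and "!!F. F : BM ==> (NN mu (%y. F (T y))) = (NN mu (%y. F y))"
 shows "distr mu borel T = mu"
proof (rule measure_eqI)
 fix A assume "A : sets (distr mu borel T)"
 then have A[measurable]: "A : sets borel" by simp
 have "emeasure (distr mu borel T) A = (NN (distr mu borel T) (%y. ind A y))" by simp
 also have "... = (NN mu (%y. ind A (T y)))" by (rule nn_integral_distr) auto
 also have "... = (NN mu (%y. ind A y))" by (rule assms(2)) simp
 finally show "emeasure (distr mu borel T) A = emeasure mu A" by simp
qed simp

lemma distr_right: "distr mu borel (%y. mm y x) = mu"
 by (rule distr_eqI) (auto intro: nn_right)

lemma distr_left: "distr mu borel (%y. mm x y) = mu"
 by (rule distr_eqI) (auto intro: nn_left)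

lemma distr_uminus: "distr mu borel uminus = mu"
 by (rule distr_eqI) (auto intro: nn_uminus)

lemma
 fixes F :: "'a => 'c::{banach, second_countable_topology}"
 assumes F[measurable]: "F : BM"
 shows integral_right: "(LINT y|mu. F (mm y x)) = (LINT y|mu. F y)"
  and integral_left: "(LINT y|mu. F (mm x y)) = (LINT y|mu. F y)"
  and integral_uminus: "(LINT y|mu. F (- y)) = (LINT y|mu. F y)"
  and integrable_right: "integrable mu (%y. F (mm y x)) \<longleftrightarrow> integrable mu F"
  and integrable_left: "integrable mu (%y. F (mm x y)) \<longleftrightarrow> integrable mu F"
  and integrable_uminus: "integrable mu (%y. F (- y)) \<longleftrightarrow> integrable mu F"
 using integral_distr[of "%y. mm y x" mu borel F] integral_distr[of "%y. mm x y" mu borel F]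
  integral_distr[of uminus mu borel F] integrable_distr_eq[of "%y. mm y x" mu borel F]
  integrable_distr_eq[of "%y. mm x y" mu borel F] integrable_distr_eq[of uminus mu borel F]
 by (simp_all add: distr_right distr_left distr_uminus)

lemma integral_dilation:
 fixes F :: "'a => 'c::{banach, second_countable_topology}"
 assumes F[measurable]: "F : BM" and r: "0 < r"
 shows "(LINT y|mu. F (dl r y)) = (1 / r ^ homogeneous_dim G) *R (LINT y|mu. F y)"
  "integrable mu (%y. F (dl r y)) \<longleftrightarrow> integrable mu F"
proof -
 define ka where "ka = r ^ homogeneous_dim G"
 have ka: "0 < ka" using r by (simp add: ka_def)
 have d: "mu = density (distr mu borel (dl r)) (%_. ennreal ka)"
 proof (rule measure_eqI)
  fix A assume "A : sets mu"
  then have A[measurable]: "A : sets borel" by simp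
  have "emeasure mu A = (NN mu (%y. ind A (dl r y))) * ennreal ka"
   using nn_dilation[of "ind A", OF _ r] by (simp add: ka_def)
  also have "(NN mu (%y. ind A (dl r y))) = (NN (distr mu borel (dl r)) (%y. ind A y))"
   by (rule nn_integral_distr[symmetric]) auto
  also have "... * ennreal ka = emeasure (density (distr mu borel (dl r)) (%_. ennreal ka)) A"
   by (subst emeasure_density) (auto simp: nn_integral_cmult mult.commute)
  finally show "emeasure mu A = emeasure (density (distr mu borel (dl r)) (%_. ennreal ka)) A" .
 qed simp
 have "(LINT y|mu. F y) = (LINT y|density (distr mu borel (dl r)) (%_. ennreal ka). F y)"
  using d by simp
 also have "... = (LINT y|distr mu borel (dl r). ka *R F y)"
  using ka by (intro integral_density) auto
 also have "... = ka *R (LINT y|mu. F (dl r y))"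
  by (subst integral_distr) auto
 finally show "(LINT y|mu. F (dl r y)) = (1 / r ^ homogeneous_dim G) *R (LINT y|mu. F y)"
  using r by (simp add: ka_def)
 have "integrable mu F \<longleftrightarrow> integrable (density (distr mu borel (dl r)) (%_. ennreal ka)) F"
  using d by simp
 also have "... \<longleftrightarrow> integrable (distr mu borel (dl r)) (%y. ka *R F y)"
  using ka by (intro integrable_density) auto
 also have "... \<longleftrightarrow> integrable mu (%y. F (dl r y))"
 proof (subst integrable_distr_eq)
  show "integrable mu (%y. ka *R F (dl r y)) \<longleftrightarrow> integrable mu (%y. F (dl r y))"
  proof
   assume "integrable mu (%y. ka *R F (dl r y))"
   then have "integrable mu (%y. (1 / ka) *R ka *R F (dl r y))" by (rule integrable_scaleR_right)
   then show "integrable mu (%y. F (dl r y))" using ka by simp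
  qed (rule integrable_scaleR_right)
 qed auto
 finally show "integrable mu (%y. F (dl r y)) \<longleftrightarrow> integrable mu F" by simp
qed

section \<open>Continuity of right translations in L^p\<close>

definition modulus :: "real => ('a => real) => 'a => ennreal" where
 "modulus p h z = (NN mu (%x. ennreal (abs (h (mm x z) - h x) powr p)))"

text \<open>Like \<open>modulus\<close>, the p-th power instead of the norm, with values in
  \<open>ennreal\<close>: estimates then carry no integrability conditions.\<close>

definition Lp_mass :: "real => ('a => real) => ennreal" where
 "Lp_mass p h = (NN mu (%x. ennreal (abs (h x) powr p)))"

text \<open>The constant 2^p stands in for Minkowski's inequality; it suffices because only
  smallness and finiteness are asked for.\<close>

lemma Lp_mass_add:
 assumes [measurable]: "f : BM" "g : BM" and p: "0 <= p"
 shows "Lp_mass p (%x. f x + g x) <= en (2 powr p) * (Lp_mass p f + Lp_mass p g)"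
proof -
 have "Lp_mass p (%x. f x + g x) <= (NN mu (%x. ennreal (2 powr p) * (en (abs (f x) powr p) + en (abs (g x) powr p))))"
  unfolding Lp_mass_def
  by (intro nn_integral_mono) (use abs_add_powr_le[OF p] in \<open>simp add: ennreal_mult[symmetric] ennreal_plus[symmetric] del: ennreal_plus\<close>)
 also have "... = en (2 powr p) * (Lp_mass p f + Lp_mass p g)"
  unfolding Lp_mass_def by (simp add: nn_integral_cmult nn_integral_add)
 finally show ?thesis .
qed

lemma Lp_mass_right:
 assumes [measurable]: "h : BM"
 shows "Lp_mass p (%x. h (mm x z)) = Lp_mass p h"
 unfolding Lp_mass_def by (rule nn_right[of "%x. ennreal (abs (h x) powr p)"]) measurable

lemma Lp_mass_uminus: "Lp_mass p (%x. - h x) = Lp_mass p h"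
 by (simp add: Lp_mass_def)

lemma modulus_le:
 assumes [measurable]: "h : BM" and p: "0 <= p"
 shows "modulus p h z <= en (2 powr p) * (Lp_mass p h + Lp_mass p h)"
proof -
 have "modulus p h z = Lp_mass p (%x. h (mm x z) + (- h x))" by (simp add: modulus_def Lp_mass_def)
 also have "... <= en (2 powr p) * (Lp_mass p (%x. h (mm x z)) + Lp_mass p (%x. - h x))"
  by (rule Lp_mass_add) (use p in auto)
 finally show ?thesis by (simp add: Lp_mass_right Lp_mass_uminus)
qed

lemma modulus_0 [simp]: "modulus p h 0 = 0"
 by (simp add: modulus_def)

lemma ennreal_tendsto_0I:
 fixes f :: "'z => ennreal"
 assumes "!!e. 0 < e ==> \<forall>\<^sub>F x in F. f x <= ennreal e"
 shows "(f \<longlongrightarrow> 0) F"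
proof (rule order_tendstoI)
 fix a :: ennreal assume "0 < a"
 then obtain e :: real where e: "0 < e" "ennreal e < a"
  by (metis dense ennreal_cases ennreal_0 less_le not_less_zero ennreal_less_top top.not_eq_extremum infinity_ennreal_def
   ennreal_less_zero_iff)
 show "\<forall>\<^sub>F x in F. f x < a" by (rule eventually_mono[OF assms[OF e(1)]]) (use e in auto)
qed simp

lemma ennreal_tendsto_0D:
 fixes f :: "'z => ennreal"
 assumes "(f \<longlongrightarrow> 0) F" "0 < e"
 shows "\<forall>\<^sub>F x in F. f x <= ennreal e"
 using order_tendstoD(2)[OF assms(1), of "ennreal e"] assms(2) by (auto elim: eventually_mono)

text \<open>A function that is approximated in \<open>L\<^sup>p\<close> by functions with small modulus has small modulus.\<close>

lemma modulus_approx: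
 assumes [measurable]: "h : BM" and p: "0 <= p"
  and *: "!!e. 0 < e ==> \<exists>g\<in>BM. Lp_mass p (%x. h x - g x) <= ennreal e & (modulus p g \<longlongrightarrow> 0) (at 0)"
 shows "(modulus p h \<longlongrightarrow> 0) (at 0)"
proof (rule ennreal_tendsto_0I)
 fix e :: real assume e: "0 < e"
 define P where "P = 2 powr p"
 \<comment> \<open>Chosen such that two nested applications of \<open>Lp_mass_add\<close> to three
   errors of size \<open>e'\<close> add up to exactly \<open>e\<close>.\<close>
 define e' where "e' = e / (P * (1 + P + P))"
 have pos: "0 < P * (1 + P + P)" unfolding P_def by (intro mult_pos_pos add_pos_pos) auto
 then have e'0: "0 < e'" "e' * (P * (1 + P + P)) = e" using e by (auto simp: e'_def)
 then have e': "0 < e'" "2 powr p * (e' + 2 powr p * (e' + e')) = e"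
  unfolding P_def by (simp_all add: algebra_simps)
 obtain g where [measurable]: "g : BM"
  and g: "Lp_mass p (%x. h x - g x) <= ennreal e'" "(modulus p g \<longlongrightarrow> 0) (at 0)"
  using *[OF e'(1)] by blast
 show "\<forall>\<^sub>F z in at 0. modulus p h z <= ennreal e"
 proof (rule eventually_mono[OF ennreal_tendsto_0D[OF g(2) e'(1)]])
  fix z assume z: "modulus p g z <= ennreal e'"
  define k where "k x = h x - g x" for x
  have [measurable]: "k : BM" unfolding k_def[abs_def] by measurable
  have km: "Lp_mass p k <= ennreal e'" using g(1) by (simp add: k_def[abs_def])
  have "modulus p h z = Lp_mass p (%x. k (mm x z) + (- k x + (g (mm x z) - g x)))"
   by (simp add: modulus_def Lp_mass_def k_def)
  also have "... <= en (2 powr p) * (Lp_mass p (%x. k (mm x z)) + Lp_mass p (%x. - k x + (g (mm x z) - g x)))"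
   by (rule Lp_mass_add) (use p in auto)
  also have "... <= en (2 powr p) * (ennreal e' + en (2 powr p) * (ennreal e' + ennreal e'))"
  proof (intro mult_left_mono add_mono)
   have "Lp_mass p (%x. - k x + (g (mm x z) - g x)) <=
   en (2 powr p) * (Lp_mass p (%x. - k x) + Lp_mass p (%x. g (mm x z) - g x))"
   by (rule Lp_mass_add) (use p in auto)
   also have "... <= en (2 powr p) * (ennreal e' + ennreal e')"
   using z km by (intro mult_left_mono add_mono) (auto simp: Lp_mass_uminus Lp_mass_def modulus_def)
   finally show "Lp_mass p (%x. - k x + (g (mm x z) - g x)) <= en (2 powr p) * (ennreal e' + ennreal e')" .
  qed (use km in \<open>auto simp: Lp_mass_right\<close>)
  also have "... = ennreal e"
   using e'(1) by (simp add: e'(2)[symmetric] ennreal_mult[symmetric] ennreal_plus[symmetric] del: ennreal_plus)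
  finally show "modulus p h z <= ennreal e" .
 qed
qed

text \<open>\<open>A\<close> and its translate have the same finite measure, so the symmetric
  difference has twice the measure of the points of \<open>A\<close> that the translation moves out
  of \<open>A\<close>. As \<open>A\<close> is open, no point leaves under small translations, and
  dominated convergence applies.\<close>

lemma modulus_open:
 assumes A: "open A" "emeasure mu A < \<infinity>"
 shows "(modulus 1 (ind A) \<longlongrightarrow> 0) (at 0)"
proof -
 have [measurable]: "A : sets borel" using A(1) by simp
 define D where "D z = (NN mu (%x. ind A x * ind (- A) (mm x z)))" for z :: 'a
 have e: "modulus 1 (ind A) z = 2 * D z" for z
 proof -
  have i: "(NN mu (%x. ind A (mm x z))) = emeasure mu A"
   using nn_right[of "ind A" z] by simp
  have "modulus 1 (ind A) z + emeasure mu A =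
   (NN mu (%x. ennreal (abs (ind A (mm x z) - ind A x) powr 1) + ind A x))"
   unfolding modulus_def by (subst nn_integral_add) auto
  also have "... = (NN mu (%x. 2 * (ind A x * ind (- A) (mm x z)) + ind A (mm x z)))"
   by (rule nn_integral_cong) (auto simp: indicator_def)
  also have "... = 2 * D z + emeasure mu A"
   unfolding D_def by (subst nn_integral_add) (auto simp: nn_integral_cmult i)
  finally show ?thesis using A(2) by (auto simp: add.commute[of _ "emeasure mu A"] ennreal_add_left_cancel)
 qed
 have "(D \<longlongrightarrow> 0) (at 0)"
  unfolding tendsto_at_iff_sequentially
 proof (intro allI impI)
  fix X :: "nat => 'a" assume X: "ALL i. X i : UNIV - {0}" "X \<longlonglongrightarrow> 0"
  have "(%i. NN mu (%x. ind A x * ind (- A) (mm x (X i)))) \<longlonglongrightarrow> (NN mu (%x. 0))"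
  proof (rule nn_integral_dominated_convergence[where w = "ind A"])
   show "AE x in mu. (%i. ind A x * ind (- A) (mm x (X i)) :: ennreal) \<longlonglongrightarrow> 0"
   proof (rule AE_I2)
   fix x
   have "(%i. mm x (X i)) \<longlonglongrightarrow> mm x 0" by (intro tendsto_intros X)
   then have "x : A ==> \<forall>\<^sub>F i in sequentially. mm x (X i) : A"
   using A(1) topological_tendstoD by fastforce
   then have "\<forall>\<^sub>F i in sequentially. ind A x * ind (- A) (mm x (X i)) = (0::ennreal)"
   by (cases "x : A") (auto elim: eventually_mono)
   then show "(%i. ind A x * ind (- A) (mm x (X i)) :: ennreal) \<longlonglongrightarrow> 0"
   by (rule tendsto_eventually)
   qed
   show "AE x in mu. ind A x * ind (- A) (mm x (X i)) <= (ind A x :: ennreal)" for i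
   by (rule AE_I2) (auto simp: indicator_def)
  qed (use A(2) in auto)
  then show "(D \<circ> X) \<longlonglongrightarrow> 0" by (simp add: D_def o_def)
 qed
 then have "((%z. 2 * D z) \<longlongrightarrow> 2 * 0) (at 0)"
  by (intro tendsto_intros) auto
 then show ?thesis using e by (simp add: ext[of "modulus 1 (ind A)" "%z. 2 * D z"])
qed

lemma modulus_diff:
 assumes [measurable]: "f : BM" "g : BM" and p: "0 <= p"
  and lim: "(modulus p f \<longlongrightarrow> 0) (at 0)" "(modulus p g \<longlongrightarrow> 0) (at 0)"
 shows "(modulus p (%x. f x + c * g x) \<longlongrightarrow> 0) (at 0)"
proof (rule tendsto_sandwich[OF _ _ tendsto_const])
 show "\<forall>\<^sub>F z in at 0. modulus p (%x. f x + c * g x) z <=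
   en (2 powr p) * (modulus p f z + en (abs c powr p) * modulus p g z)"
 proof (rule always_eventually, rule allI)
  fix z
  have "modulus p (%x. f x + c * g x) z = Lp_mass p (%x. (f (mm x z) - f x) + c * (g (mm x z) - g x))"
   by (simp add: modulus_def Lp_mass_def algebra_simps)
  also have "... <= en (2 powr p) * (Lp_mass p (%x. f (mm x z) - f x) + Lp_mass p (%x. c * (g (mm x z) - g x)))"
   by (rule Lp_mass_add) (use p in auto)
  also have "Lp_mass p (%x. c * (g (mm x z) - g x)) = en (abs c powr p) * modulus p g z"
   unfolding Lp_mass_def modulus_def
   by (subst nn_integral_cmult[symmetric]) (auto simp: abs_mult powr_mult ennreal_mult)
  finally show "modulus p (%x. f x + c * g x) z <= en (2 powr p) * (modulus p f z + en (abs c powr p) * modulus p g z)"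
   by (simp add: modulus_def Lp_mass_def)
 qed
 have "((%z. ennreal (2 powr p) * (modulus p f z + en (abs c powr p) * modulus p g z)) \<longlongrightarrow>
   en (2 powr p) * (0 + en (abs c powr p) * 0)) (at 0)"
  by (intro ennreal_tendsto_cmult tendsto_add lim) auto
 then show "((%z. ennreal (2 powr p) * (modulus p f z + en (abs c powr p) * modulus p g z)) \<longlongrightarrow> 0) (at 0)" by simp
qed simp

end

context carnot_haar begin

lemma emeasure_cball_finite [simp]: "emeasure mu (cball x r) < \<infinity>"
 by (rule compact_finite) simp

lemma emeasure_bounded_finite: "bounded A ==> A : sets borel ==> emeasure mu A < \<infinity>"
proof -
 assume b: "bounded A" and A: "A : sets borel"
 obtain r where "A <= cball 0 r" using bounded_subset_ballD[OF b, of 0] ball_subset_cball by (meson order_trans)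
 then have "emeasure mu A <= emeasure mu (cball 0 r)" by (rule emeasure_mono) simp
 also have "... < \<infinity>" by (rule emeasure_cball_finite)
 finally show ?thesis .
qed

lemma Lp_mass_indicator:
 assumes [measurable]: "A : sets borel"
 shows "Lp_mass 1 (ind A) = emeasure mu A"
proof -
 have "Lp_mass 1 (ind A) = (NN mu (%x. ind A x))"
  unfolding Lp_mass_def by (rule nn_integral_cong) (auto simp: indicator_def)
 then show ?thesis by simp
qed

lemma modulus_cmult:
 assumes [measurable]: "g : BM" and "0 <= p" "(modulus p g \<longlongrightarrow> 0) (at 0)"
 shows "(modulus p (%x. c * g x) \<longlongrightarrow> 0) (at 0)"
proof -
 have "modulus p (%_. 0) = (%z. 0)" by (rule ext) (simp add: modulus_def)
 then show ?thesis using modulus_diff[of "%_. 0" g p c] assms by simp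
qed

lemma emeasure_decreasing_small:
 assumes "!!n. B n : sets borel" "decseq B" "(\<Inter>n. B n) = {}" "emeasure mu (B 0) < \<infinity>" "0 < e"
 shows "EX n. emeasure mu (B n) <= ennreal e"
proof -
 have "emeasure mu (B n) ~= \<infinity>" for n
  using emeasure_mono[of "B n" "B 0" mu] assms(1,4) decseqD[OF assms(2), of 0 n] by (auto simp: top_unique less_top)
 then have "(%n. emeasure mu (B n)) \<longlonglongrightarrow> emeasure mu (\<Inter>n. B n)"
  using assms(1,2) by (intro Lim_emeasure_decseq) auto
 then have "(%n. emeasure mu (B n)) \<longlonglongrightarrow> 0" by (simp add: assms(3))
 from ennreal_tendsto_0D[OF this assms(5)] show ?thesis by (auto simp: eventually_sequentially)
qed

text \<open>Open sets are stable under intersection and generate the Borel sets, so it suffices to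
  pass to complements and disjoint unions. The bounded set \<open>U\<close> keeps all measures
  finite: complements become differences, and tails of unions become small.\<close>

lemma modulus_Int_open:
 assumes A: "A : sets borel" and U: "open U" "bounded U"
 shows "(modulus 1 (ind (A \<inter> U)) \<longlongrightarrow> 0) (at 0)"
proof -
 have [measurable]: "U : sets borel" using U by simp
 have A': "A : sigma_sets UNIV {S. open S}" using A by (simp add: borel_def sets_measure_of)
 have msets: "A : sets borel" if "A : sigma_sets UNIV {S. open S}" for A :: "'a set"
  using that by (simp add: borel_def sets_measure_of)
 have fin: "emeasure mu (B \<inter> U) < \<infinity>" if "B : sets borel" for B
  using that U by (intro emeasure_bounded_finite bounded_Int) auto
 show ?thesis
 proof (rule sigma_sets_induct_disjoint[OF _ _ A', of "%A. (modulus 1 (ind (A \<inter> U)) \<longlongrightarrow> 0) (at 0)"])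
  show "Int_stable {S. open S}" by (auto simp: Int_stable_def)
  fix A :: "'a set" assume "A : {S. open S}"
  then show "(modulus 1 (ind (A \<inter> U)) \<longlongrightarrow> 0) (at 0)"
   using U fin[of A] by (intro modulus_open) auto
 next
  have "modulus 1 (ind ({} \<inter> U)) = (%z. 0)" by (rule ext) (simp add: modulus_def)
  then show "(modulus 1 (ind ({} \<inter> U)) \<longlongrightarrow> 0) (at 0)" by simp
 next
  fix A assume A: "A : sigma_sets UNIV {S. open S}" and lim: "(modulus 1 (ind (A \<inter> U)) \<longlongrightarrow> 0) (at 0)"
  have [measurable]: "A : sets borel" using msets[OF A] .
  have "ind ((UNIV - A) \<inter> U) = (%x. ind U x + (- 1) * ind (A \<inter> U) x :: real)"
   by (auto simp: indicator_def fun_eq_iff)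
  moreover have "(modulus 1 (%x. ind U x + (- 1) * ind (A \<inter> U) x) \<longlongrightarrow> 0) (at 0)"
   using U emeasure_bounded_finite[of U] by (intro modulus_diff[OF _ _ _ modulus_open lim]) auto
  ultimately show "(modulus 1 (ind ((UNIV - A) \<inter> U)) \<longlongrightarrow> 0) (at 0)" by simp
 next
  fix A :: "nat => 'a set" assume disj: "disjoint_family A" and A: "range A <= sigma_sets UNIV {S. open S}"
   and lim: "!!i. (modulus 1 (ind (A i \<inter> U)) \<longlongrightarrow> 0) (at 0)"
  have [measurable]: "A i : sets borel" for i using A msets by auto
  define g where "g n = (%x. ind ((\<Union>i<n. A i) \<inter> U) x :: real)" for n
  have gm[measurable]: "g n : BM" for n unfolding g_def by measurable
  have glim: "(modulus 1 (g n) \<longlongrightarrow> 0) (at 0)" for n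
  proof (induction n)
   case 0
   have "modulus 1 (g 0) = (%z. 0)" by (rule ext) (simp add: modulus_def g_def)
   then show ?case by simp
  next
   case (Suc n)
   have dj: "A n \<inter> A i = {}" if "i < n" for i
   using disjoint_family_onD[OF disj, of n i] that by simp
   have "g (Suc n) = (%x. g n x + 1 * ind (A n \<inter> U) x)"
   proof
   fix x
   show "g (Suc n) x = g n x + 1 * ind (A n \<inter> U) x"
   proof (cases "x : A n")
   case True
   then have "x \<notin> (\<Union>i<n. A i)" using dj by blast
   with True show ?thesis by (auto simp: g_def indicator_def)
   next
   case False
   then have "x : (\<Union>i<Suc n. A i) \<longleftrightarrow> x : (\<Union>i<n. A i)" by (auto simp: less_Suc_eq)
   with False show ?thesis by (simp add: g_def indicator_def)
   qed
   qed
   moreover have "(modulus 1 (%x. g n x + 1 * ind (A n \<inter> U) x) \<longlongrightarrow> 0) (at 0)"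
   by (rule modulus_diff[OF _ _ _ Suc lim]) auto
   ultimately show ?case by simp
  qed
  show "(modulus 1 (ind ((\<Union>i. A i) \<inter> U)) \<longlongrightarrow> 0) (at 0)"
  proof (rule modulus_approx)
   fix e :: real assume e: "0 < e"
   define B where "B n = ((\<Union>i. A i) - (\<Union>i<n. A i)) \<inter> U" for n
   have [measurable]: "B n : sets borel" for n unfolding B_def by measurable
   have "EX n. emeasure mu (B n) <= ennreal e"
   proof (rule emeasure_decreasing_small)
   show "decseq B" unfolding B_def decseq_def by fastforce
   show "(\<Inter>n. B n) = {}" unfolding B_def by auto
   show "emeasure mu (B 0) < \<infinity>" unfolding B_def by (rule fin) measurable
   qed (use e in auto)
   then obtain n where n: "emeasure mu (B n) <= ennreal e" by blast
   have "(%x. ind ((\<Union>i. A i) \<inter> U) x - g n x) = ind (B n)"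
   unfolding g_def B_def by (auto simp: indicator_def fun_eq_iff)
   then show "\<exists>g\<in>BM. Lp_mass 1 (%x. ind ((\<Union>i. A i) \<inter> U) x - g x) <= ennreal e &
   (modulus 1 g \<longlongrightarrow> 0) (at 0)"
   using n glim[of n] by (intro bexI[OF _ gm[of n]]) (simp add: Lp_mass_indicator)
  qed (auto)
 qed auto
qed

text \<open>Sets of finite measure are cut off by large balls to reach
  \<open>modulus_Int_open\<close>; linearity and dominated limits lead from indicators to integrable
  functions.\<close>

lemma modulus_L1:
 fixes h :: "'a => real"
 assumes "integrable mu h"
 shows "(modulus 1 h \<longlongrightarrow> 0) (at 0)"
 using assms
proof (induction h rule: integrable_induct)
 case (base A c)
 then have [measurable]: "A : sets borel" by simp
 have "(modulus 1 (ind A) \<longlongrightarrow> 0) (at 0)"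
 proof (rule modulus_approx)
  fix e :: real assume e: "0 < e"
  define B where "B n = A - ball 0 (real n)" for n
  have "EX n. emeasure mu (B n) <= ennreal e"
  proof (rule emeasure_decreasing_small)
   show "decseq B" unfolding B_def decseq_def by force
   show "(\<Inter>n. B n) = {}" unfolding B_def using reals_Archimedean2 by auto
   show "emeasure mu (B 0) < \<infinity>" unfolding B_def using base by simp
  qed (use e in \<open>auto simp: B_def\<close>)
  then obtain n where n: "emeasure mu (B n) <= ennreal e" by blast
  have [measurable]: "B n : sets borel" unfolding B_def by measurable
  have "(%x. ind A x - ind (A \<inter> ball 0 (real n)) x) = (ind (B n) :: _ => real)"
   unfolding B_def by (auto simp: indicator_def fun_eq_iff)
  then show "\<exists>g\<in>BM. Lp_mass 1 (%x. ind A x - g x) <= ennreal e &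
   (modulus 1 g \<longlongrightarrow> 0) (at 0)"
   using n modulus_Int_open[of A "ball 0 (real n)"]
   by (intro bexI[of _ "ind (A \<inter> ball 0 (real n))"] borel_measurable_indicator)
   (simp_all add: Lp_mass_indicator)
 qed auto
 from modulus_cmult[OF _ _ this, of c] show ?case by (simp add: mult.commute)
next
 case (add f g)
 then have [measurable]: "f : BM" "g : BM"
  using borel_measurable_integrable by force+
 show ?case using modulus_diff[of f g 1 1] add by simp
next
 case (lim f s)
 then have [measurable]: "f : BM" "!!i. s i : BM"
  using borel_measurable_integrable by force+
 show ?case
 proof (rule modulus_approx)
  fix e :: real assume e: "0 < e"
  have "(%i. NN mu (%x. ennreal (abs (f x - s i x)))) \<longlonglongrightarrow> (NN mu (%x. 0))"
  proof (rule nn_integral_dominated_convergence[where w = "%x. ennreal (3 * abs (f x))"])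
   show "(NN mu (%x. ennreal (3 * abs (f x)))) < \<infinity>"
   proof -
   have "(NN mu (%x. ennreal (3 * abs (f x)))) = ennreal 3 * (NN mu (%x. ennreal (abs (f x))))"
   by (simp add: ennreal_mult nn_integral_cmult)
   also have "... < \<infinity>" using lim(4) by (simp add: integrable_iff_bounded ennreal_mult_less_top)
   finally show ?thesis .
   qed
   show "AE x in mu. ennreal (abs (f x - s i x)) <= en (3 * abs (f x))" for i
   proof (rule AE_I2)
   fix x
   show "en (abs (f x - s i x)) <= en (3 * abs (f x))"
   using lim(3)[of x i] by (intro ennreal_leI) auto
   qed
   show "AE x in mu. (%i. ennreal (abs (f x - s i x))) \<longlonglongrightarrow> 0"
   proof (rule AE_I2)
   fix x
   have "(%i. abs (f x - s i x)) \<longlonglongrightarrow> abs (f x - f x)" using lim(2)[of x] by (intro tendsto_intros) auto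
   from tendsto_ennrealI[OF this] show "(%i. ennreal (abs (f x - s i x))) \<longlonglongrightarrow> 0" by simp
   qed
  qed auto
  then have "(%i. Lp_mass 1 (%x. f x - s i x)) \<longlonglongrightarrow> 0" by (simp add: Lp_mass_def)
  from ennreal_tendsto_0D[OF this e] obtain i where "Lp_mass 1 (%x. f x - s i x) <= ennreal e"
   by (auto simp: eventually_sequentially)
  then show "\<exists>g\<in>BM. Lp_mass 1 (%x. f x - g x) <= ennreal e & (modulus 1 g \<longlongrightarrow> 0) (at 0)"
   using lim(5)[of i] by (intro bexI[of _ "s i"]) auto
 qed auto
qed

text \<open>\<open>h\<close> is close in L^p to its truncation at height \<open>M\<close>. The
  increments of the truncation are at most \<open>2 * M\<close>, so their p-th power is at most
  (2M)^(p-1) times the increment of \<open>h\<close>, and the case p = 1 applies.\<close>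

lemma modulus_Lp:
 fixes h :: "'a => real"
 assumes int: "integrable mu h" and p: "1 <= p" and fin: "Lp_mass p h < \<infinity>"
 shows "(modulus p h \<longlongrightarrow> 0) (at 0)"
proof (rule modulus_approx)
 have [measurable]: "h : BM" using borel_measurable_integrable[OF int] by simp
 then show "h : BM" .
 fix e :: real assume e: "0 < e"
 define c where "c M x = max (- M) (min M (h x))" for M x
 have cm[measurable]: "c M : BM" for M unfolding c_def[abs_def] by measurable
 have "(%n. NN mu (%x. ennreal (abs (h x - c (real n) x) powr p))) \<longlonglongrightarrow> (NN mu (%x. 0))"
 proof (rule nn_integral_dominated_convergence[where w = "%x. ennreal (abs (h x) powr p)"])
  show "(NN mu (%x. ennreal (abs (h x) powr p))) < \<infinity>" using fin by (simp add: Lp_mass_def)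
  show "AE x in mu. ennreal (abs (h x - c (real n) x) powr p) <= en (abs (h x) powr p)" for n
   by (rule AE_I2) (use p in \<open>auto intro!: ennreal_leI powr_mono2 simp: c_def\<close>)
  show "AE x in mu. (%n. ennreal (abs (h x - c (real n) x) powr p)) \<longlonglongrightarrow> 0"
  proof (rule AE_I2)
   fix x
   obtain N where N: "abs (h x) < real N" using reals_Archimedean2 by blast
   have "\<forall>\<^sub>F n in sequentially. ennreal (abs (h x - c (real n) x) powr p) = 0"
   unfolding eventually_sequentially
   proof (intro exI[of _ N] allI impI)
   fix n assume "N <= n"
   then have "abs (h x) < real n" using N by linarith
   then have "c (real n) x = h x" by (auto simp: c_def)
   then show "en (abs (h x - c (real n) x) powr p) = 0" by simp
   qed
   then show "(%n. ennreal (abs (h x - c (real n) x) powr p)) \<longlonglongrightarrow> 0" by (rule tendsto_eventually)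
  qed
 qed auto
 then have "(%n. Lp_mass p (%x. h x - c (real n) x)) \<longlonglongrightarrow> 0" by (simp add: Lp_mass_def)
 from ennreal_tendsto_0D[OF this e] obtain n where n: "Lp_mass p (%x. h x - c (real n) x) <= ennreal e"
  by (auto simp: eventually_sequentially)
 define M where "M = real n"
 have "(modulus p (c M) \<longlongrightarrow> 0) (at 0)"
 proof (rule tendsto_sandwich[OF _ _ tendsto_const])
  show "\<forall>\<^sub>F z in at 0. modulus p (c M) z <= en ((2 * M) powr (p - 1)) * modulus 1 h z"
  proof (rule always_eventually, rule allI)
   fix z
   have "modulus p (c M) z <= (NN mu (%x. ennreal ((2 * M) powr (p - 1)) * en (abs (h (mm x z) - h x) powr 1)))"
   unfolding modulus_def
   proof (rule nn_integral_mono)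
   fix x
   define D where "D = abs (c M (mm x z) - c M x)"
   have D: "0 <= D" "D <= 2 * M" "D <= abs (h (mm x z) - h x)" by (auto simp: D_def c_def M_def)
   have "D powr p <= (2 * M) powr (p - 1) * abs (h (mm x z) - h x)"
   proof (cases "D = 0")
   case False
   then have "D powr p = D powr (p - 1) * D" using D(1) by (simp add: powr_diff)
   also have "... <= (2 * M) powr (p - 1) * abs (h (mm x z) - h x)"
   using D p by (intro mult_mono powr_mono2) auto
   finally show ?thesis .
   qed simp
   then show "en (abs (c M (mm x z) - c M x) powr p) <=
   en ((2 * M) powr (p - 1)) * en (abs (h (mm x z) - h x) powr 1)"
   by (simp add: D_def ennreal_mult[symmetric] ennreal_leI)
   qed
   also have "... = en ((2 * M) powr (p - 1)) * modulus 1 h z"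
   unfolding modulus_def by (rule nn_integral_cmult) measurable
   finally show "modulus p (c M) z <= en ((2 * M) powr (p - 1)) * modulus 1 h z" .
  qed
  have "((%z. ennreal ((2 * M) powr (p - 1)) * modulus 1 h z) \<longlongrightarrow> en ((2 * M) powr (p - 1)) * 0) (at 0)"
   by (intro ennreal_tendsto_cmult modulus_L1[OF int]) simp
  then show "((%z. ennreal ((2 * M) powr (p - 1)) * modulus 1 h z) \<longlongrightarrow> 0) (at 0)" by simp
 qed simp
 then show "\<exists>g\<in>BM. Lp_mass p (%x. h x - g x) <= ennreal e & (modulus p g \<longlongrightarrow> 0) (at 0)"
  using n cm by (intro bexI[of _ "c M"]) (auto simp: M_def)
qed (use p in simp)

text \<open>The modulus vanishes at 0, so its limit there is continuity, and translations equal to 0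
  are allowed along \<open>F\<close>.\<close>

lemma modulus_sequence:
 fixes h :: "'a => real"
 assumes "integrable mu h" "1 <= p" "Lp_mass p h < \<infinity>" "(z \<longlongrightarrow> 0) F"
 shows "((%n. modulus p h (z n)) \<longlongrightarrow> 0) F"
proof -
 have "continuous (at 0) (modulus p h)"
  using modulus_Lp[OF assms(1-3)] by (simp add: continuous_at)
 from isCont_tendsto_compose[OF this assms(4)] show ?thesis by simp
qed

lemma borel_measurable_modulus [measurable]:
 assumes [measurable]: "h : BM"
 shows "modulus p h : BM"
 unfolding modulus_def[abs_def] by measurable

lemma tendsto_dilation_0: "((%r. dl r x) \<longlongrightarrow> 0) (at_right 0)"
proof -
 have "((%r. \<Sum>k=1..step G. r ^ k *R proj k x) \<longlongrightarrow> (\<Sum>k=1..step G. 0 ^ k *R proj k x)) (at_right 0)"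
  by (intro tendsto_intros)
 moreover have "(\<Sum>k=1..step G. 0 ^ k *R proj k x) = 0" by (rule sum.neutral) auto
 ultimately show ?thesis by (simp add: dilation_eq)
qed

lemma measurable_dilation2 [measurable]:
 assumes [measurable]: "f : borel_measurable M" "g : borel_measurable M"
 shows "(%x. dl (f x) (g x)) : borel_measurable M"
 unfolding dilation_eq by measurable

text \<open>Averages of small translates converge in \<open>L\<^sup>p\<close>.\<close>

lemma averaged_modulus:
 fixes h k :: "'a => real"
 assumes h: "integrable mu h" "1 <= p" "Lp_mass p h < \<infinity>" and k: "integrable mu k"
  and lim: "X \<longlonglongrightarrow> 0" "!!n. 0 < X n"
 shows "(%n. NN mu (%x. NN mu (%ze. ennreal (abs (h (mm x (- dl (X n) ze)) - h x) powr p) * en (abs (k ze))))) \<longlonglongrightarrow> 0"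
proof -
 have [measurable]: "h : BM" "k : BM"
  using borel_measurable_integrable h k by force+
 have "(NN mu (%x. NN mu (%ze. ennreal (abs (h (mm x (- dl (X n) ze)) - h x) powr p) * en (abs (k ze))))) =
   (NN mu (%ze. modulus p h (- dl (X n) ze) * en (abs (k ze))))" for n
  unfolding modulus_def by (subst mumu.Fubini') (simp_all add: nn_integral_multc)
 moreover have "(%n. NN mu (%ze. modulus p h (- dl (X n) ze) * en (abs (k ze)))) \<longlonglongrightarrow> (NN mu (%ze. 0))"
 proof (rule nn_integral_dominated_convergence[where w = "%ze. ennreal (2 powr p) * (Lp_mass p h + Lp_mass p h) * en (abs (k ze))"])
  show "(NN mu (%ze. ennreal (2 powr p) * (Lp_mass p h + Lp_mass p h) * en (abs (k ze)))) < \<infinity>"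
   using h(3) k by (simp add: nn_integral_cmult integrable_iff_bounded ennreal_mult_less_top)
  show "AE ze in mu. modulus p h (- dl (X n) ze) * en (abs (k ze)) <=
   en (2 powr p) * (Lp_mass p h + Lp_mass p h) * en (abs (k ze))" for n
   by (intro AE_I2 mult_right_mono modulus_le) (use h in auto)
  show "AE ze in mu. (%n. modulus p h (- dl (X n) ze) * en (abs (k ze))) \<longlonglongrightarrow> 0"
  proof (rule AE_I2)
   fix ze
   have "filterlim X (at_right 0) sequentially"
   using lim(1) less_imp_neq[OF lim(2)] lim(2) by (auto simp: filterlim_at intro!: always_eventually)
   then have "(%n. - dl (X n) ze) \<longlonglongrightarrow> - 0"
   by (intro tendsto_minus filterlim_compose[OF tendsto_dilation_0])
   then have "(%n. modulus p h (- dl (X n) ze)) \<longlonglongrightarrow> 0"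
   by (intro modulus_sequence h) simp
   from ennreal_tendsto_cmult[OF _ this, of "en (abs (k ze))"]
   show "(%n. modulus p h (- dl (X n) ze) * en (abs (k ze))) \<longlonglongrightarrow> 0" by (simp add: mult.commute)
  qed
 qed measurable
 ultimately show ?thesis by simp
qed

end

section \<open>Parameter integrals, thickenings of compact sets and convolutions\<close>

context carnot_haar begin

lemma integrable_bounded_mult:
 fixes f :: "'a => 'c::{banach, second_countable_topology}"
 assumes f: "integrable mu f" "!!y. y \<notin> K ==> f y = 0" and K: "compact K"
  and h: "continuous_on UNIV (h :: 'a => real)"
 shows "integrable mu (%y. h y *R f y)"
proof -
 have "compact (h ` K)" using K h by (intro compact_continuous_image continuous_on_subset[OF h]) auto
 then obtain B where B: "!!y. y : K ==> abs (h y) <= B"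
  using compact_imp_bounded[of "h ` K"] unfolding bounded_iff by auto
 show ?thesis
 proof (rule Bochner_Integration.integrable_bound)
  show "integrable mu (%y. abs B *R f y)" using f(1) by (rule integrable_scaleR_right)
  have [measurable]: "h : BM" using h by (rule borel_measurable_continuous_onI)
  have [measurable]: "f : BM" using borel_measurable_integrable[OF f(1)] by simp
  show "(%y. h y *R f y) : borel_measurable mu" by simp
  show "AE y in mu. norm (h y *R f y) <= norm (abs B *R f y)"
  proof (rule AE_I2)
   fix y
   show "norm (h y *R f y) <= norm (abs B *R f y)"
   using f(2)[of y] B[of y] by (cases "y : K") (auto intro!: mult_right_mono)
  qed
 qed
qed

context
 fixes H :: "'p::euclidean_space \<times> 'a => real" and f :: "'a => 'c::euclidean_space" and K :: "'a set"
 assumes f: "integrable mu f" "!!y. y \<notin> K ==> f y = 0" and K: "compact K"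
begin

lemma parameter_integrable:
 assumes "smooth_on H UNIV"
 shows "integrable mu (%y. H (x, y) *R f y)"
 by (rule integrable_bounded_mult[OF f K])
   (auto intro!: continuous_on_compose2[OF smooth_on_continuous[OF assms]] continuous_intros)

lemma parameter_derivative_bound:
 assumes H: "smooth_on H UNIV"
 shows "EX B. ALL z y v. z : cball x 1 --> y : K --> abs (frechet_derivative H (at (z, y)) (v, 0)) <= B * norm v"
proof -
 let ?D = "frechet_derivative H"
 define b where "b p = (\<Sum>i\<in>Basis. abs (?D (at p) (i, 0)))" for p
 have cb: "continuous_on UNIV b"
  unfolding b_def by (intro continuous_intros smooth_on_continuous smooth_on_frechet_derivative H)
 have "compact (cball x 1 \<times> K)" by (intro compact_Times compact_cball K)
 then have "compact (b ` (cball x 1 \<times> K))"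
  by (rule compact_continuous_image[OF continuous_on_subset[OF cb subset_UNIV]])
 then obtain B where B: "!!p. p : cball x 1 \<times> K ==> abs (b p) <= B"
  using compact_imp_bounded[of "b ` (cball x 1 \<times> K)"] unfolding bounded_iff by auto
 have "abs (?D (at (z, y)) (v, 0)) <= B * norm v" if z: "z : cball x 1" "y : K" for z y v
 proof -
  have "linear (%v. ?D (at (z, y)) (v, 0))"
   using linear_compose[OF _ has_derivative_linear[OF smooth_on_has_derivative[OF H, of "(z, y)"]], of "%v. (v, 0)"]
   by (simp add: o_def linear_iff)
  from linear_basis_sum[OF this, of v]
  have "abs (?D (at (z, y)) (v, 0)) = abs (\<Sum>i\<in>Basis. (v \<bullet> i) * ?D (at (z, y)) (i, 0))" by simp
  also have "... <= (\<Sum>i\<in>Basis. abs ((v \<bullet> i) * ?D (at (z, y)) (i, 0)))" by (rule sum_abs)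
  also have "... <= (\<Sum>i\<in>Basis. norm v * abs (?D (at (z, y)) (i, 0)))"
   by (intro sum_mono) (auto simp: abs_mult intro!: mult_right_mono Basis_le_norm)
  also have "... = norm v * b (z, y)" by (simp add: b_def sum_distrib_left)
  also have "... <= norm v * B" using B[of "(z, y)"] z by (intro mult_left_mono) auto
  finally show ?thesis by (simp add: mult.commute)
 qed
 then show ?thesis by blast
qed

text \<open>Dominated convergence for the normalised remainder \<open>R h y\<close>. As
  \<open>f\<close> vanishes outside the compact \<open>K\<close>, the derivative of \<open>H\<close>
  in the parameter is bounded there, and the mean value inequality bounds the remainder by twice
  that constant.\<close>

lemma parameter_has_derivative:
 assumes H: "smooth_on H UNIV"
 shows "((%x. LINT y|mu. H (x, y) *R f y) has_derivative
  (%v. LINT y|mu. frechet_derivative H (at (x, y)) (v, 0) *R f y)) (at x)"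
proof -
 let ?D = "frechet_derivative H"
 have sD: "smooth_on (%p. ?D (at p) w) UNIV" for w by (rule smooth_on_frechet_derivative[OF H])
 have intD: "integrable mu (%y. ?D (at (x, y)) w *R f y)" for w
  by (rule integrable_bounded_mult[OF f K])
   (auto intro!: continuous_on_compose2[OF smooth_on_continuous[OF sD]] continuous_intros)
 note intH = parameter_integrable[OF H]
 have linD: "linear (?D (at p))" for p by (rule has_derivative_linear[OF smooth_on_has_derivative[OF H]])
 have [measurable]: "f : BM" using borel_measurable_integrable[OF f(1)] by simp
 have Hm[measurable]: "(%y. H (z, y)) : BM" for z
  by (intro borel_measurable_continuous_onI) (auto intro!: continuous_on_compose2[OF smooth_on_continuous[OF H]] continuous_intros)
 have Dm[measurable]: "(%y. ?D (at (x, y)) w) : BM" for w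
  by (intro borel_measurable_continuous_onI) (auto intro!: continuous_on_compose2[OF smooth_on_continuous[OF sD]] continuous_intros)
 define L where "L v = (LINT y|mu. ?D (at (x, y)) (v, 0) *R f y)" for v
 have "linear L"
 proof (rule linearI)
  fix v w c
  have "?D (at (x, y)) (v + w, 0) = ?D (at (x, y)) (v, 0) + ?D (at (x, y)) (w, 0)" for y
   using linear_add[OF linD, of "(x, y)" "(v, 0)" "(w, 0)"] by simp
  then show "L (v + w) = L v + L w"
   unfolding L_def by (simp add: scaleR_add_left Bochner_Integration.integral_add[OF intD intD])
  have "?D (at (x, y)) (c *R v, 0) = c * ?D (at (x, y)) (v, 0)" for y
   using linear_cmul[OF linD, of "(x, y)" c "(v, 0)"] by simp
  then have "L (c *R v) = (LINT y|mu. c *R ?D (at (x, y)) (v, 0) *R f y)" unfolding L_def by simp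
  then show "L (c *R v) = c *R L v" unfolding L_def by (simp only: integral_scaleR_right)
 qed
 then have bl: "bounded_linear L" by (simp add: linear_conv_bounded_linear)
 obtain B where B: "!!z y v. z : cball x 1 ==> y : K ==> abs (?D (at (z, y)) (v, 0)) <= B * norm v"
  using parameter_derivative_bound[OF H, of x] by blast
 have dH: "((%z. H (z, y)) has_derivative (%v. ?D (at (z, y)) (v, 0))) (at z)" for z y
 proof -
  have "((%z. (z, y)) has_derivative (%v. (v, 0))) (at z)" by (auto intro!: derivative_eq_intros)
  from has_derivative_compose[OF this smooth_on_has_derivative[OF H]] show ?thesis .
 qed
 have lip: "abs (H (x + h, y) - H (x, y)) <= abs B * norm h" if h: "norm h <= 1" and y: "y : K" for h y
 proof -
  have "norm (H (x + h, y) - H (x, y)) <= abs B * norm ((x + h) - x)"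
  proof (rule differentiable_bound[of "cball x 1" "%z. H (z, y)"])
   fix z assume z: "z : cball x 1"
   show "((%z. H (z, y)) has_derivative (%v. ?D (at (z, y)) (v, 0))) (at z within cball x 1)"
   using dH by (rule has_derivative_at_withinI)
   have "abs (?D (at (z, y)) (v, 0)) <= abs B * norm v" for v
   using B[OF z y, of v] by (rule order_trans) (auto intro!: mult_right_mono)
   then show "onorm (%v. ?D (at (z, y)) (v, 0)) <= abs B" by (intro onorm_bound) auto
  qed (use h in \<open>auto simp: dist_norm\<close>)
  then show ?thesis by simp
 qed
 define R where "R h y = (H (x + h, y) - H (x, y) - ?D (at (x, y)) (h, 0)) / norm h" for h y
 have "((%h. norm ((LINT y|mu. H (x + h, y) *R f y) - (LINT y|mu. H (x, y) *R f y) - L h) / norm h) \<longlongrightarrow> 0) (at 0)"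
  unfolding tendsto_at_iff_sequentially
 proof (intro allI impI)
  fix X :: "nat => 'p" assume X: "ALL i. X i : UNIV - {0}" "X \<longlonglongrightarrow> 0"
  have e: "(LINT y|mu. H (x + h, y) *R f y) - (LINT y|mu. H (x, y) *R f y) - L h = norm h *R (LINT y|mu. R h y *R f y)"
   if h: "h ~= 0" for h
  proof -
   have "(LINT y|mu. H (x + h, y) *R f y) - (LINT y|mu. H (x, y) *R f y) - L h =
   (LINT y|mu. H (x + h, y) *R f y - H (x, y) *R f y - ?D (at (x, y)) (h, 0) *R f y)"
   unfolding L_def by (simp add: Bochner_Integration.integral_diff intH intD)
   also have "... = (LINT y|mu. norm h *R (R h y *R f y))"
   by (rule Bochner_Integration.integral_cong[OF refl]) (use h in \<open>simp add: R_def scaleR_diff_left\<close>)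
   finally show ?thesis by (simp only: integral_scaleR_right)
  qed
  \<comment> \<open>The Lipschitz bound holds for increments of norm at most 1; dropping
    \<open>N\<close> terms makes it available along the whole sequence.\<close>
  obtain N where N: "!!i. N <= i ==> norm (X i) <= 1"
  proof -
   have "\<forall>\<^sub>F i in sequentially. dist (X i) 0 < 1" by (rule tendstoD[OF X(2)]) simp
   then show ?thesis using that by (auto simp: eventually_sequentially intro: less_imp_le)
  qed
  have "(%i. LINT y|mu. R (X (i + N)) y *R f y) \<longlonglongrightarrow> (LINT y|mu. 0)"
  proof (rule integral_dominated_convergence[where w = "%y. (2 * abs B) * norm (f y)"])
   show "integrable mu (%y. (2 * abs B) * norm (f y))" using f(1) by simp
   show "AE y in mu. (%i. R (X (i + N)) y *R f y) \<longlonglongrightarrow> 0"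
   proof (rule AE_I2)
   fix y
   have "((%h. norm (H (x + h, y) - H (x, y) - ?D (at (x, y)) (h, 0)) / norm h) \<longlongrightarrow> 0) (at 0)"
   using dH[where z = x and y = y] by (simp add: has_derivative_at)
   then have "((%h. R h y) \<longlongrightarrow> 0) (at 0)"
   by (intro tendsto_norm_zero_cancel[of "%h. R h y"]) (simp add: R_def)
   then have "((%h. R h y) \<circ> X) \<longlonglongrightarrow> 0" using X unfolding tendsto_at_iff_sequentially by blast
   then have "(%i. R (X i) y) \<longlonglongrightarrow> 0" by (simp add: o_def)
   from LIMSEQ_ignore_initial_segment[OF this, of N] have "(%i. R (X (i + N)) y *R f y) \<longlonglongrightarrow> 0 *R f y"
   by (intro tendsto_scaleR tendsto_const)
   then show "(%i. R (X (i + N)) y *R f y) \<longlonglongrightarrow> 0" by simp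
   qed
   show "AE y in mu. norm (R (X (i + N)) y *R f y) <= (2 * abs B) * norm (f y)" for i
   proof (rule AE_I2)
   fix y
   define h where "h = X (i + N)"
   have h: "h ~= 0" "norm h <= 1" using X(1) N[of "i + N"] by (auto simp: h_def)
   show "norm (R (X (i + N)) y *R f y) <= (2 * abs B) * norm (f y)"
   proof (cases "y : K")
   case True
   have "abs (?D (at (x, y)) (h, 0)) <= B * norm h" by (rule B) (use True in auto)
   also have "... <= abs B * norm h" by (intro mult_right_mono) auto
   finally have "abs (H (x + h, y) - H (x, y) - ?D (at (x, y)) (h, 0)) <= 2 * abs B * norm h"
   using lip[OF h(2) True] by linarith
   then have "abs (R h y) <= 2 * abs B" using h by (simp add: R_def divide_le_eq)
   then show ?thesis by (simp add: h_def mult_right_mono)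
   qed (use f(2) in simp)
   qed
   show "(%y. R (X (i + N)) y *R f y) : borel_measurable mu" for i
   unfolding R_def by measurable
  qed simp
  then have "(%i. LINT y|mu. R (X i) y *R f y) \<longlonglongrightarrow> 0" by (simp add: LIMSEQ_offset[of _ N])
  then have "(%i. norm (LINT y|mu. R (X i) y *R f y)) \<longlonglongrightarrow> 0" by (rule tendsto_norm_zero)
  moreover have "norm ((LINT y|mu. H (x + X i, y) *R f y) - (LINT y|mu. H (x, y) *R f y) - L (X i)) / norm (X i) =
   norm (LINT y|mu. R (X i) y *R f y)" for i
   using X(1) by (subst e) auto
  ultimately show "((%h. norm ((LINT y|mu. H (x + h, y) *R f y) - (LINT y|mu. H (x, y) *R f y) - L h) / norm h) \<circ> X) \<longlonglongrightarrow> 0"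
   by (simp add: o_def)
 qed
 then show ?thesis using bl by (simp add: has_derivative_at L_def[abs_def])
qed

end

text \<open>The derivative in a fixed direction is an integral of the same form, with
  \<open>H\<close> replaced by its directional derivative, so the induction runs over all smooth
  \<open>H\<close>.\<close>

lemma parameter_smooth:
 fixes H :: "'p::euclidean_space \<times> 'a => real" and f :: "'a => 'c::euclidean_space"
 assumes f: "integrable mu f" "!!y. y \<notin> K ==> f y = 0" and K: "compact K" and "smooth_on H UNIV"
 shows "smooth_on (%x. LINT y|mu. H (x, y) *R f y) UNIV"
proof -
 have "Ck_on k (%x. LINT y|mu. H (x, y) *R f y) UNIV" if "smooth_on H UNIV"
  for k and H :: "'p \<times> 'a => real"
  using that
 proof (induction k arbitrary: H)
  case 0
  have "continuous (at x) (%x. LINT y|mu. H (x, y) *R f y)" for x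
   by (rule has_derivative_continuous[OF parameter_has_derivative[OF f K 0]])
  then show ?case by (auto simp: continuous_on_eq_continuous_at)
 next
  case (Suc k)
  show ?case
  proof (rule Ck_on_SucI[where f' = "%x v. LINT y|mu. frechet_derivative H (at (x, y)) (v, 0) *R f y"])
   show "((%x. LINT y|mu. H (x, y) *R f y) has_derivative
   (%v. LINT y|mu. frechet_derivative H (at (x, y)) (v, 0) *R f y)) (at x)" for x
   by (rule parameter_has_derivative[OF f K Suc.prems])
   fix v :: 'p
   have "smooth_on (%p. frechet_derivative H (at p) (v, 0)) UNIV"
   by (rule smooth_on_frechet_derivative[OF Suc.prems])
   from Suc.IH[OF this] show "Ck_on k (%x. LINT y|mu. frechet_derivative H (at (x, y)) (v, 0) *R f y) UNIV" .
  qed auto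
 qed
 then show ?thesis using assms by (simp add: smooth_on_def)
qed

text \<open>Compact sets have compact thickenings by right translations.\<close>

definition fatten :: "'a set => real => 'a set" where
 "fatten K R = (%p. mm (fst p) (snd p)) ` (K \<times> cball 0 R)"

lemma compact_fatten: "compact K ==> compact (fatten K R)"
 unfolding fatten_def by (rule compact_mul_image) auto

lemma fattenI: "x : K ==> norm z <= R ==> mm x z : fatten K R"
 unfolding fatten_def by (rule image_eqI[of _ _ "(x, z)"]) auto

lemma fattenE: "y : fatten K R ==> (!!x z. x : K ==> norm z <= R ==> y = mm x z ==> P) ==> P"
 unfolding fatten_def by auto

lemma subset_fatten: "0 <= R ==> K <= fatten K R"
 using fattenI[of _ K 0 R] by auto

lemma fatten_subset_open:
 assumes K: "compact K" and Om: "open Om" "K <= Om"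
 shows "\<exists>R>0. fatten K R <= Om"
proof -
 obtain e where e: "0 < e" "!!x y. x : K ==> y : - Om ==> e <= dist x y"
 proof -
  have "closed (- Om)" "K \<inter> - Om = {}" using Om by auto
  from separate_compact_closed[OF K this] show ?thesis using that by blast
 qed
 have "uniformly_continuous_on (K \<times> cball 0 1) (%p. mm (fst p) (snd p))"
  using K by (intro compact_uniformly_continuous continuous_on_subset[OF continuous_mul] compact_Times) auto
 then obtain de where de: "0 < de" "!!p q. p : K \<times> cball 0 1 ==> q : K \<times> cball 0 1 ==> dist q p < de ==>
   dist (mm (fst q) (snd q)) (mm (fst p) (snd p)) < e"
  unfolding uniformly_continuous_on_def using e(1) by metis
 define R where "R = min 1 (de / 2)"
 have "mm x z : Om" if x: "x : K" and z: "norm z <= R" for x z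
 proof (rule ccontr)
  assume n: "mm x z \<notin> Om"
  have "dist (x, z) (x, 0) < de" using z de(1) by (simp add: dist_Pair_Pair dist_norm R_def)
  then have "dist (mm x z) x < e" using de(2)[of "(x, 0)" "(x, z)"] x z by (auto simp: R_def)
  moreover have "e <= dist x (mm x z)" using n by (intro e(2)[OF x]) auto
  ultimately show False by (simp add: dist_commute)
 qed
 then have "fatten K R <= Om" by (auto elim!: fattenE)
 moreover have "0 < R" using de(1) by (simp add: R_def)
 ultimately show ?thesis by blast
qed

text \<open>The open counterpart of \<open>fatten\<close>, lying between \<open>K\<close> and
  \<open>fatten K R\<close> for positive \<open>R\<close>.\<close>

definition openfat :: "'a set => real => 'a set" where
 "openfat K R = (\<Union>x\<in>K. {y. norm (mm (- x) y) < R})"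

lemma open_openfat: "open (openfat K R)"
 unfolding openfat_def by (intro open_UN ballI open_Collect_less continuous_intros)

lemma mul_cancel_left [simp]: "mm (- x) (mm x y) = y" "mm x (mm (- x) y) = y"
 by (metis assoc left_inverse left_neutral, metis assoc right_inverse left_neutral)

lemma mul_cancel_right [simp]: "mm (mm y x) (- x) = y" "mm (mm y (- x)) x = y"
 by (simp_all add: assoc)

lemma subset_openfat: "0 < R ==> K <= openfat K R"
 unfolding openfat_def by force

text \<open>For r at most 1 every power r^k with positive k is at most r, so dilations contract at
  least linearly in the Euclidean norm.\<close>

lemma dilation_bound: "\<exists>C>0. \<forall>r\<in>{0<..1}. ALL x. norm (dl r x) <= r * C * norm x"
proof -
 have "\<exists>K>0. ALL x. norm (proj k x) <= norm x * K" for k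
  using bounded_linear.pos_bounded[OF bounded_linear_proj] by blast
 then obtain K where K: "!!k. 0 < K k" "!!k x. norm (proj k x) <= norm x * K k" by metis
 define C where "C = 1 + (\<Sum>k=1..step G. K k)"
 have C: "0 < C" unfolding C_def using K(1) by (intro add_pos_nonneg sum_nonneg) (auto intro: less_imp_le)
 have "norm (dl r x) <= r * C * norm x" if r: "r : {0<..1}" for r x
 proof -
  have "norm (dl r x) <= (\<Sum>k=1..step G. norm (r ^ k *R proj k x))"
   unfolding dilation_eq by (rule norm_sum)
  also have "... <= (\<Sum>k=1..step G. r * (norm x * K k))"
  proof (rule sum_mono)
   fix k assume k: "k : {1..step G}"
   have "r ^ k <= r" using power_decreasing[of 1 k r] r k by simp
   then show "norm (r ^ k *R proj k x) <= r * (norm x * K k)"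
   using r K(2)[of k x] by (auto intro!: mult_mono)
  qed
  also have "... = r * (\<Sum>k=1..step G. K k) * norm x" by (simp add: sum_distrib_left sum_distrib_right mult_ac)
  also have "... <= r * C * norm x" unfolding C_def using r by (intro mult_right_mono) auto
  finally show ?thesis .
 qed
 then show ?thesis using C by blast
qed

lemma measurable_set_integrable_loc:
 assumes "Lp_loc mu 1 Om u" "compact K" "K <= Om"
 shows "integrable mu (%x. ind K x * u x)"
proof -
 have 1: "(%x. ind K x *R u x) : borel_measurable mu" "integrable mu (%x. ind K x *R (abs (u x) powr 1))"
  using assms unfolding Lp_loc_def Lp_on_def set_borel_measurable_def set_integrable_def by auto
 show ?thesis
  by (rule Bochner_Integration.integrable_bound[OF 1(2)]) (use 1(1) in \<open>auto simp: indicator_def\<close>)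
qed

lemma Lp_loc_1I:
 assumes "!!K. compact K ==> K <= Om ==> integrable mu (%x. ind K x * u x)"
 shows "Lp_loc mu 1 Om u"
 unfolding Lp_loc_def Lp_on_def set_borel_measurable_def set_integrable_def
proof (intro allI impI conjI)
 fix K assume K: "compact K & K <= Om"
 then have i: "integrable mu (%x. ind K x * u x)" using assms by blast
 from borel_measurable_integrable[OF i] show "(%x. ind K x *R u x) : borel_measurable mu" by simp
 have "(%x. ind K x *R (abs (u x)) powr 1) = (%x. abs (ind K x * u x))"
  by (auto simp: indicator_def fun_eq_iff)
 then show "integrable mu (%x. ind K x *R (abs (u x)) powr 1)" using integrable_abs[OF i] by simp
qed

text \<open>The substitution \<open>y = x z\<^sup>-\<^sup>1\<close> in a convolution.\<close>

lemma conv_subst: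
 fixes u :: "'a => 'c::{banach, second_countable_topology}"
 assumes [measurable]: "k : BM" "u : BM"
 shows "(LINT y|mu. k (mm (- y) x) *R u y) = (LINT z|mu. k z *R u (mm x (- z)))"
proof -
 have "(LINT y|mu. k (mm (- y) x) *R u y) = (LINT y|mu. k (mm (- mm x y) x) *R u (mm x y))"
  by (rule integral_left[symmetric]) measurable
 also have "... = (LINT z|mu. k (mm (- mm x (- z)) x) *R u (mm x (- z)))"
  by (rule integral_uminus[symmetric]) measurable
 finally show ?thesis by (simp add: inverse_mul assoc)
qed

end

lemma open_sigma_compact:
 fixes S :: "'a::euclidean_space set"
 assumes "open S"
 shows "EX C. (\<forall>n::nat. compact (C n)) & (ALL n. C n <= S) & \<Union> (range C) = S"
proof (rule open_Union_compact_subsets[OF assms])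
 fix C :: "nat => 'a set"
 assume "!!n. compact (C n)" "!!n. C n <= S" "\<Union> (range C) = S"
 then show ?thesis by (intro exI[of _ C]) simp
qed

section \<open>Test functions and Lie derivatives\<close>

context carnot_haar begin

lemma integrable_compact_support:
 fixes h :: "'a => real"
 assumes h: "continuous_on UNIV h" and K: "compact K" "!!y. y \<notin> K ==> h y = 0"
 shows "integrable mu h"
proof -
 have "integrable mu (ind K :: 'a => real)"
  using compact_finite[OF K(1)] K(1) by (intro integrable_real_indicator) (auto intro: borel_compact)
 from integrable_bounded_mult[OF this _ K(1) h] have "integrable mu (%y. h y *R (ind K y :: real))" by simp
 moreover have "(%y. h y *R (ind K y :: real)) = h" using K(2) by (auto simp: indicator_def fun_eq_iff)
 ultimately show ?thesis by simp
qed

lemma conv_subst_dilation: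
 fixes u :: "'a => 'c::{banach, second_countable_topology}"
 assumes [measurable]: "k : BM" "u : BM" and r: "0 < r"
 shows "(LINT y|mu. k (dl (1 / r) (mm (- y) x)) *R u y) =
  r ^ homogeneous_dim G *R (LINT z|mu. k z *R u (mm x (- dl r z)))"
proof -
 have "(LINT y|mu. k (dl (1 / r) (mm (- y) x)) *R u y) =
   (LINT z|mu. k (dl (1 / r) z) *R u (mm x (- z)))"
  by (rule conv_subst[where k = "%z. k (dl (1 / r) z)"]) measurable
 also have "... = r ^ homogeneous_dim G *R (LINT z|mu. k (dl (1 / r) (dl r z)) *R u (mm x (- dl r z)))"
  using integral_dilation(1)[of "%z. k (dl (1 / r) z) *R u (mm x (- z))" r] r by simp
 also have "... = r ^ homogeneous_dim G *R (LINT z|mu. k z *R u (mm x (- dl r z)))"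
  using r by (simp add: dilation_inverse(2))
 finally show ?thesis .
qed

lemma test_functionI:
 assumes "smooth_on ph UNIV" "compact K" "K <= Om" "!!x. x \<notin> K ==> ph x = 0"
 shows "test_function Om ph"
proof -
 have "closure {x. ph x ~= 0} <= K"
  using assms(2,4) by (intro closure_minimal) (auto intro: compact_imp_closed)
 moreover from this have "compact (closure {x. ph x ~= 0})"
  using compact_Int_closed[OF assms(2) closed_closure, of "{x. ph x ~= 0}"] by (simp add: Int_absorb1)
 ultimately show ?thesis using assms(1,3) by (auto simp: test_function_def)
qed

lemma test_functionE:
 assumes "test_function Om ph"
 obtains K where "smooth_on ph UNIV" "compact K" "K <= Om" "!!x. x \<notin> K ==> ph x = 0"
 using assms closure_subset[of "{x. ph x ~= 0}"] unfolding test_function_def by blast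

text \<open>Trades the open set for a compact one: with the cutoff attached to \<open>F\<close>, a
  locally integrable function becomes globally integrable.\<close>

lemma set_integral_support:
 fixes F ph :: "'a => real"
 assumes "K <= Om" "!!x. x \<notin> K ==> ph x = 0"
 shows "(LINT x:Om|mu. F x * ph x) = (LINT x|mu. (ind K x * F x) * ph x)"
 unfolding set_lebesgue_integral_def
 by (rule Bochner_Integration.integral_cong) (use assms in \<open>auto simp: indicator_def\<close>)

lemma lie_deriv_support:
 fixes ph :: "'a => real"
 assumes "compact K" "!!x. x \<notin> K ==> ph x = 0" "x \<notin> K"
 shows "lie_deriv G v ph x = 0"
proof -
 have "(ph has_derivative (%h. 0)) (at x)"
  by (rule has_derivative_transform_within_open[of "%_. 0" _ x UNIV "- K"])
   (use assms compact_imp_closed in \<open>auto intro: has_derivative_const\<close>)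
 then show ?thesis unfolding lie_deriv_def by (simp add: frechet_derivative_eqI)
qed

text \<open>The curve \<open>mm y (t *R v)\<close> starts at \<open>y\<close> with the velocity of
  the left field. This turns Lie derivatives into derivatives in one real variable, which can be
  compared under translations and dilations.\<close>

lemma line_has_vector_derivative:
 assumes "smooth_on ph UNIV"
 shows "((%t. ph (mm y (t *R v))) has_vector_derivative lie_deriv G v ph y) (at 0)"
proof -
 have l: "((%t. t *R v) has_derivative (%t. t *R v)) (at (0::real))" by (auto intro!: derivative_eq_intros)
 have "((%t. mm y (t *R v)) has_derivative (%t. mulD (y, 0 *R v) (0, t *R v))) (at (0::real))"
  by (rule has_derivative_compose[OF l mul_right_has_derivative])
 from has_derivative_compose[OF this smooth_on_has_derivative[OF assms]]
 have "((%t. ph (mm y (t *R v))) has_derivative (%t. frechet_derivative ph (at y) (mulD (y, 0) (0, t *R v)))) (at (0::real))"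
  by simp
 moreover have "frechet_derivative ph (at y) (mulD (y, 0) (0, t *R v)) = t *R lie_deriv G v ph y" for t
  using linear_cmul[OF linear_mulD, of "(y, 0)" t "(0, v)"]
   linear_cmul[OF has_derivative_linear[OF smooth_on_has_derivative[OF assms]]]
  by (simp add: lie_deriv_def left_field_eq)
 ultimately show ?thesis by (simp add: has_vector_derivative_def)
qed

lemma smooth_lie_deriv:
 assumes "smooth_on ph UNIV"
 shows "smooth_on (lie_deriv G v ph) UNIV"
 unfolding lie_deriv_def[abs_def]
 by (intro smooth_on_frechet_derivative2 assms smooth_ident smooth_left_field)

end

section \<open>Mollifier kernels as test functions\<close>

locale carnot_mollifier = carnot_haar +
 fixes et :: "'a => real"
 assumes smooth_et: "smooth_on et UNIV"
  and support_et: "{x. et x ~= 0} <= cc_ball G 0 1"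
  and integral_et: "(LINT x|mu. et x) = 1"
begin

lemma et_bounded_support: "\<exists>rh>0. ALL z. et z ~= 0 --> norm z <= rh"
proof -
 obtain rh where rh: "!!z. d 0 z <= 1 ==> norm z <= rh" using bounded_cc_ball[of 1] unfolding bounded_iff by auto
 have "norm z <= max 1 rh" if "et z ~= 0" for z
 proof -
  have "d 0 z <= 1" using support_et that by (auto simp: cc_ball_def)
  from rh[OF this] show ?thesis by simp
 qed
 then show ?thesis by (intro exI[of _ "max 1 rh"]) auto
qed

definition rh :: real where "rh = (SOME rh. 0 < rh & (ALL z. et z ~= 0 --> norm z <= rh))"

lemma rh: "0 < rh" "!!z. et z ~= 0 ==> norm z <= rh"
 using someI_ex[OF et_bounded_support] unfolding rh_def by auto

lemma et_zero: "z \<notin> cball 0 rh ==> et z = 0"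
 using rh(2)[of z] by auto

lemma continuous_et: "continuous_on UNIV et"
 by (rule smooth_on_continuous[OF smooth_et])

lemma measurable_et [measurable]: "et : BM"
 by (rule borel_measurable_continuous_onI[OF continuous_et])

lemma integrable_et: "integrable mu et"
 by (rule integrable_compact_support[OF continuous_et compact_cball et_zero])

text \<open>\<open>et\<close> may change sign, so this norm can exceed 1; it is the price of testing
  absolute values with kernels built from \<open>et\<close>.\<close>

definition Cet :: real where "Cet = (LINT z|mu. abs (et z))"

lemma Cet_nonneg: "0 <= Cet" unfolding Cet_def by simp

text \<open>The mollifier at \<open>x\<close> as a function of \<open>y\<close>, without the
  normalising power of r: that factor would appear on both sides of the tested inequality.\<close>

definition kernel :: "real => 'a => 'a => real" where
 "kernel r x y = et (dl (1 / r) (mm (- y) x))"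

lemma smooth_uminus: "smooth_on (uminus :: 'a => 'a) UNIV"
 by (intro smooth_on_linear bounded_linear_minus bounded_linear_ident)

lemma smooth_kernel: "smooth_on (kernel r x) UNIV"
 unfolding kernel_def[abs_def]
 by (rule smooth_on_compose[OF smooth_et smooth_on_compose[OF smooth_on_linear[OF bounded_linear_dilation]
   smooth_mul[OF smooth_uminus smooth_on_const]]])

lemma kernel_support:
 "\<exists>C>0. ALL r x y. 0 < r --> r <= 1 --> kernel r x y ~= 0 --> y : fatten {x} (r * C)"
proof -
 obtain C where C: "0 < C" "!!r x. r : {0<..1} ==> norm (dl r x) <= r * C * norm x"
  using dilation_bound by blast
 have "y : fatten {x} (r * (C * rh))" if r: "0 < r" "r <= 1" and k: "kernel r x y ~= 0" for r x y
 proof -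
  define z where "z = mm (- y) x"
  have "norm z = norm (dl r (dl (1 / r) z))" using r by (simp add: dilation_inverse(1))
  also have "... <= r * C * norm (dl (1 / r) z)" using r by (intro C(2)) auto
  also have "... <= r * C * rh" using k rh(2) r C(1) by (intro mult_left_mono) (auto simp: kernel_def z_def)
  finally have "mm x (- z) : fatten {x} (r * (C * rh))" by (intro fattenI) (auto simp: mult.assoc)
  then show ?thesis by (simp add: z_def inverse_mul)
 qed
 then show ?thesis using C(1) rh(1) by (intro exI[of _ "C * rh"]) auto
qed

lemma test_kernel:
 assumes Om: "open Om" and K: "compact K" "K <= Om"
 shows "\<exists>K' r0. compact K' & K' <= Om & K <= K' & 0 < r0 & r0 <= 1 &
  (ALL r x. 0 < r --> r <= r0 --> x : K --> test_function Om (kernel r x) & (ALL y. y \<notin> K' --> kernel r x y = 0))"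
proof -
 obtain C where C: "0 < C" "!!r x y. 0 < r ==> r <= 1 ==> kernel r x y ~= 0 ==> y : fatten {x} (r * C)"
  using kernel_support by blast
 obtain R where R: "0 < R" "fatten K R <= Om" using fatten_subset_open[OF K(1) Om K(2)] by blast
 define r0 where "r0 = min 1 (R / C)"
 have r0: "0 < r0" "r0 <= 1" using R C by (auto simp: r0_def)
 have z: "kernel r x y = 0" if r: "0 < r" "r <= r0" and x: "x : K" and y: "y \<notin> fatten K R" for r x y
 proof (rule ccontr)
  assume "kernel r x y ~= 0"
  then have "y : fatten {x} (r * C)" using C(2) r r0 by simp
  moreover have "r * C <= R" using r C(1) by (simp add: r0_def field_simps)
  ultimately have "y : fatten K R" using x by (auto elim!: fattenE intro!: fattenI)
  then show False using y by simp
 qed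
 have "test_function Om (kernel r x)" if "0 < r" "r <= r0" "x : K" for r x
  by (rule test_functionI[OF smooth_kernel compact_fatten[OF K(1)] R(2)]) (use z that in auto)
 then show ?thesis using z r0 compact_fatten[OF K(1), of R] R subset_fatten[of R K]
  by (intro exI[of _ "fatten K R"] exI[of _ r0]) auto
qed

text \<open>Testing with mollifier kernels and letting their support shrink.\<close>

lemma weak_bound:
 assumes Om: "open Om" and F: "Lp_loc mu 1 Om F" and g: "Lp_loc mu 1 Om g" "!!x. 0 <= g x"
  and le: "!!ph. test_function Om ph ==> abs (LINT x:Om|mu. F x * ph x) <= (LINT x:Om|mu. g x * abs (ph x))"
 shows "AE x in mu. x : Om --> abs (F x) <= Cet * g x"
proof -
 have loc: "AE x in mu. x : K --> abs (F x) <= Cet * g x" if K: "compact K" "K <= Om" for K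
 proof -
  obtain K' r0 where K': "compact K'" "K' <= Om" "K <= K'" and r0: "0 < r0" "r0 <= 1"
   and ker: "!!r x. 0 < r ==> r <= r0 ==> x : K ==> test_function Om (kernel r x)"
   "!!r x y. 0 < r ==> r <= r0 ==> x : K ==> y \<notin> K' ==> kernel r x y = 0"
   using test_kernel[OF Om K] by blast
  have [measurable]: "K : sets borel" using K(1) by (rule borel_compact)
  define F' g' where "F' x = ind K' x * F x" and "g' x = ind K' x * g x" for x
  have iF: "integrable mu F'" and ig: "integrable mu g'"
   using measurable_set_integrable_loc[OF F K'(1,2)] measurable_set_integrable_loc[OF g(1) K'(1,2)]
   by (simp_all add: F'_def[abs_def] g'_def[abs_def])
  have [measurable]: "F' : BM" "g' : BM"
   using borel_measurable_integrable[OF iF] borel_measurable_integrable[OF ig] by simp_all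
  define X where "X n = r0 * inverse (real (Suc n))" for n
  have X: "X \<longlonglongrightarrow> 0" "!!n. 0 < X n" "!!n. X n <= r0"
  proof -
   have "X \<longlonglongrightarrow> r0 * 0" unfolding X_def by (intro tendsto_intros LIMSEQ_inverse_real_of_nat)
   then show "X \<longlonglongrightarrow> 0" by simp
   show "0 < X n" for n using r0 by (simp add: X_def)
   show "X n <= r0" for n using r0 by (simp add: X_def field_simps)
  qed
  define A where "A h n x = (NN mu (%ze. ennreal (abs (h (mm x (- dl (X n) ze)) - h x) powr 1) * en (abs (et ze))))" for h n x
  have [measurable]: "A F' n : BM" "A g' n : BM" for n
   unfolding A_def[abs_def] by measurable
  have av: "(%n. NN mu (%x. A h n x)) \<longlonglongrightarrow> 0" if "integrable mu h" for h
   unfolding A_def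
   by (rule averaged_modulus) (use that X integrable_et in \<open>auto simp: Lp_mass_def integrable_iff_bounded\<close>)
  \<comment> \<open>After rescaling, the inequality tested with the kernel at \<open>x\<close>
    differs from the desired pointwise one only by the averaged oscillations of \<open>F'\<close>
    and \<open>g'\<close>, whose integrals tend to 0.\<close>
  have key: "en (abs (F' x) - Cet * g' x) <= A F' n x + A g' n x" if x: "x : K" for x n
  proof (cases "A F' n x + A g' n x = \<infinity>")
   case False
   define Y where "Y ze = mm x (- dl (X n) ze)" for ze
   have [measurable]: "Y : BM" unfolding Y_def[abs_def] by measurable
   define D E where "D ze = (F' (Y ze) - F' x) * et ze" and "E ze = (g' (Y ze) - g' x) * abs (et ze)" for ze
   have nD: "(NN mu (%ze. norm (D ze))) = A F' n x" and nE: "(NN mu (%ze. norm (E ze))) = A g' n x"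
   unfolding A_def D_def E_def Y_def
   by (rule nn_integral_cong; simp add: abs_mult ennreal_mult)+
   have iD: "integrable mu D" and iE: "integrable mu E"
   unfolding integrable_iff_bounded nD nE using False by (auto simp: D_def[abs_def] E_def[abs_def] less_top)
   have bD: "en (abs (LINT ze|mu. D ze)) <= A F' n x" and bE: "en (abs (LINT ze|mu. E ze)) <= A g' n x"
   using integral_norm_bound_ennreal[OF iD] integral_norm_bound_ennreal[OF iE] unfolding nD nE by simp_all
   have P: "(LINT ze|mu. et ze * F' (Y ze)) = (LINT ze|mu. D ze) + F' x"
   proof -
   have "(LINT ze|mu. et ze * F' (Y ze)) = (LINT ze|mu. D ze + F' x * et ze)"
   by (rule Bochner_Integration.integral_cong) (auto simp: D_def algebra_simps)
   also have "... = (LINT ze|mu. D ze) + (LINT ze|mu. F' x * et ze)"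
   using iD integrable_et by (intro Bochner_Integration.integral_add) auto
   finally show ?thesis using integral_et by simp
   qed
   have Q: "(LINT ze|mu. abs (et ze) * g' (Y ze)) = (LINT ze|mu. E ze) + Cet * g' x"
   proof -
   have "(LINT ze|mu. abs (et ze) * g' (Y ze)) = (LINT ze|mu. E ze + g' x * abs (et ze))"
   by (rule Bochner_Integration.integral_cong) (auto simp: E_def algebra_simps)
   also have "... = (LINT ze|mu. E ze) + (LINT ze|mu. g' x * abs (et ze))"
   using iE integrable_et by (intro Bochner_Integration.integral_add) auto
   finally show ?thesis by (simp add: Cet_def mult.commute)
   qed
   define c where "c = X n ^ homogeneous_dim G"
   have c: "0 < c" using X(2) by (simp add: c_def)
   note kz = ker(2)[OF X(2) X(3) x]
   have "(LINT y:Om|mu. F y * kernel (X n) x y) = (LINT y|mu. kernel (X n) x y *R F' y)"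
   using set_integral_support[OF K'(2), of "kernel (X n) x" F] kz by (simp add: F'_def mult.commute)
   also have "... = c * (LINT ze|mu. et ze * F' (Y ze))"
   unfolding kernel_def c_def Y_def by (subst conv_subst_dilation) (use X(2) in auto)
   finally have 1: "(LINT y:Om|mu. F y * kernel (X n) x y) = c * (LINT ze|mu. et ze * F' (Y ze))" .
   have "(LINT y:Om|mu. g y * abs (kernel (X n) x y)) = (LINT y|mu. abs (kernel (X n) x y) *R g' y)"
   using set_integral_support[OF K'(2), of "%y. abs (kernel (X n) x y)" g] kz by (simp add: g'_def mult.commute)
   also have "... = c * (LINT ze|mu. abs (et ze) * g' (Y ze))"
   unfolding kernel_def c_def Y_def by (subst conv_subst_dilation[where k = "%z. abs (et z)"]) (use X(2) in auto)
   finally have 2: "(LINT y:Om|mu. g y * abs (kernel (X n) x y)) = c * (LINT ze|mu. abs (et ze) * g' (Y ze))" .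
   have "abs (LINT y:Om|mu. F y * kernel (X n) x y) <= (LINT y:Om|mu. g y * abs (kernel (X n) x y))"
   by (rule le[OF ker(1)[OF X(2) X(3) x]])
   then have "c * abs (LINT ze|mu. et ze * F' (Y ze)) <= c * (LINT ze|mu. abs (et ze) * g' (Y ze))"
   unfolding 1 2 using c by (simp add: abs_mult)
   then have "abs (LINT ze|mu. et ze * F' (Y ze)) <= (LINT ze|mu. abs (et ze) * g' (Y ze))" using c by simp
   then have "abs (F' x) - Cet * g' x <= abs (LINT ze|mu. D ze) + abs (LINT ze|mu. E ze)" unfolding P Q by linarith
   then have "en (abs (F' x) - Cet * g' x) <= en (abs (LINT ze|mu. D ze) + abs (LINT ze|mu. E ze))" by (rule ennreal_leI)
   also have "... <= A F' n x + A g' n x" using add_mono[OF bD bE] by simp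
   finally show ?thesis .
  next
   case True
   show ?thesis unfolding True by simp
  qed
  \<comment> \<open>\<open>ennreal\<close> sends negative numbers to 0, so this is the integral of
    the positive part of the defect over \<open>K\<close>.\<close>
  define I where "I = (NN mu (%x. ind K x * en (abs (F' x) - Cet * g' x)))"
  have "I <= (NN mu (%x. A F' n x)) + (NN mu (%x. A g' n x))" for n
  proof -
   have "I <= (NN mu (%x. A F' n x + A g' n x))"
   unfolding I_def by (rule nn_integral_mono) (use key in \<open>auto simp: indicator_def\<close>)
   then show ?thesis by (simp add: nn_integral_add)
  qed
  moreover have "(%n. (NN mu (%x. A F' n x)) + (NN mu (%x. A g' n x))) \<longlonglongrightarrow> 0 + 0"
   by (intro tendsto_add av iF ig)
  ultimately have "I <= 0 + 0" by (intro LIMSEQ_le_const) auto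
  then have "I = 0" by simp
  then have "AE x in mu. ind K x * en (abs (F' x) - Cet * g' x) = 0"
   unfolding I_def by (subst (asm) nn_integral_0_iff_AE) auto
  then show ?thesis
  proof (rule AE_mp, intro AE_I2 impI)
   fix x assume z: "ind K x * en (abs (F' x) - Cet * g' x) = 0" and x: "x : K"
   then have "abs (F' x) <= Cet * g' x" by (simp add: ennreal_eq_0_iff)
   then show "abs (F x) <= Cet * g x" using x K'(3) by (auto simp: F'_def g'_def)
  qed
 qed
 obtain C where C: "!!n::nat. compact (C n)" "!!n. C n <= Om" "\<Union> (range C) = Om"
  using open_sigma_compact[OF Om] by metis
 have "AE x in mu. ALL n. x : C n --> abs (F x) <= Cet * g x"
  unfolding AE_all_countable using loc[OF C(1) C(2)] by (rule allI)
 then show ?thesis by (rule AE_mp) (use C(3) in auto)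
qed

end

section \<open>Weak derivatives along flow lines\<close>

context carnot_haar begin

text \<open>The joint integrability behind Fubini's theorem: by right invariance every slice in s
  has the same integral of |w|.\<close>

lemma integrable_line_average:
 fixes w :: "'a => real" and ph :: "'a => real"
 assumes w: "integrable mu w" and ph[measurable]: "ph : BM" and B: "!!y. abs (ph y) <= B"
 shows "integrable (mu \<Otimes>\<^sub>M lborel) (%(y, s). ind {0..1} s * w (mm y (s *R v)) * ph y)"
proof (rule integrableI_bounded)
 have [measurable]: "w : BM" using borel_measurable_integrable[OF w] by simp
 show "(%(y, s). ind {0..1} s * w (mm y (s *R v)) * ph y) : borel_measurable (mu \<Otimes>\<^sub>M lborel)"
  by measurable
 have B0: "0 <= B" using B[of 0] abs_ge_zero[of "ph 0"] by linarith
 have "(NN (mu \<Otimes>\<^sub>M lborel) (%p. ennreal (norm (case p of (y, s) => ind {0..1} s * w (mm y (s *R v)) * ph y)))) <=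
   (NN (mu \<Otimes>\<^sub>M lborel) (%p. (case p of (y, s) => ennreal B * (ind {0..1} s * en (abs (w (mm y (s *R v))))))))"
 proof (rule nn_integral_mono)
  fix p :: "'a \<times> real"
  obtain y s where p: "p = (y, s)" by fastforce
  have "abs (w (mm y (s *R v))) * abs (ph y) <= B * abs (w (mm y (s *R v)))"
   using mult_left_mono[OF B[of y], of "abs (w (mm y (s *R v)))"] by (simp add: mult.commute)
  then show "en (norm (case p of (y, s) => ind {0..1} s * w (mm y (s *R v)) * ph y)) <=
   (case p of (y, s) => ennreal B * (ind {0..1} s * en (abs (w (mm y (s *R v))))))"
   using B0 by (auto simp: p indicator_def abs_mult ennreal_mult[symmetric] intro!: ennreal_leI)
 qed
 also have "... = (NN lborel (%s. NN mu (%y. ennreal B * (ind {0..1} s * en (abs (w (mm y (s *R v))))))))"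
  by (subst mul.nn_integral_snd[symmetric]) auto
 also have "... = (NN lborel (%s. ennreal B * (ind {0..1::real} s * (NN mu (%y. ennreal (abs (w y)))))))"
 proof (rule nn_integral_cong)
  fix s
  have "(NN mu (%y. ennreal (abs (w (mm y (s *R v)))))) = (NN mu (%y. ennreal (abs (w y))))"
   by (rule nn_right[of "%y. ennreal (abs (w y))"]) measurable
  then show "(NN mu (%y. ennreal B * (ind {0..1} s * en (abs (w (mm y (s *R v))))))) =
   ennreal B * (ind {0..1} s * (NN mu (%y. ennreal (abs (w y)))))"
   by (simp add: nn_integral_cmult)
 qed
 also have "... = ennreal B * (NN mu (%y. ennreal (abs (w y))))"
  by (simp add: nn_integral_cmult nn_integral_multc)
 also have "... < \<infinity>" using w by (simp add: integrable_iff_bounded ennreal_mult_less_top)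
 finally show "(NN (mu \<Otimes>\<^sub>M lborel) (%p. ennreal (norm (case p of (y, s) => ind {0..1} s * w (mm y (s *R v)) * ph y)))) < \<infinity>" .
qed

lemma bounded_test:
 fixes ph :: "'a => real"
 assumes "continuous_on UNIV ph" "compact K" "!!x. x \<notin> K ==> ph x = 0"
 shows "\<exists>B\<ge>0. ALL x. abs (ph x) <= B"
proof -
 have "compact (ph ` K)" using assms(2) by (intro compact_continuous_image continuous_on_subset[OF assms(1)]) auto
 then obtain B where B: "!!y. y : K ==> abs (ph y) <= B"
  using compact_imp_bounded[of "ph ` K"] unfolding bounded_iff by auto
 have "abs (ph x) <= abs B" for x using B[of x] assms(3)[of x] by (cases "x : K") auto
 then show ?thesis by (intro exI[of _ "abs B"]) simp
qed

end

context carnot_mollifier begin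

text \<open>A weak derivative along a left-invariant field integrates to differences along the flow lines
 \<open>s \<mapsto> y exp(s v)\<close>, because the field commutes with right translations by \<open>exp(s v)\<close>.\<close>

lemma weak_deriv_line:
 assumes Om: "open Om" and wd: "weak_deriv G mu Om v u w" and U: "open U" and K': "compact K'" "K' <= Om"
  and seg: "!!y s. y : U ==> s : {0..1} ==> mm y (s *R v) : K'"
 defines "u' \<equiv> %x. ind K' x * u x" and "w' \<equiv> %x. ind K' x * w x"
 shows "AE y in mu. y : U --> u' (mm y v) - u' y = (LINT s|lborel. ind {0..1} s * w' (mm y (s *R v)))"
proof -
 have iu: "integrable mu u'" and iw: "integrable mu w'"
  using wd K' measurable_set_integrable_loc unfolding weak_deriv_def u'_def w'_def by blast+
 have [measurable]: "u' : BM" "w' : BM"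
  using borel_measurable_integrable[OF iu] borel_measurable_integrable[OF iw] by simp_all
 define W where "W y = (LINT s|lborel. ind {0..1} s * w' (mm y (s *R v)))" for y
 have iW: "integrable mu W"
  using mul.integrable_fst'[OF integrable_line_average[OF iw, of "%_. 1" 1 v]] by (simp add: W_def[abs_def])
 define F where "F y = u' (mm y v) - u' y - W y" for y
 have iuv: "integrable mu (%y. u' (mm y v))" using iu by (subst integrable_right) auto
 have iF: "integrable mu F" unfolding F_def[abs_def] using iu iuv iW by auto
 \<comment> \<open>With majorant 0, \<open>weak_bound\<close> asks only that the defect
   \<open>F\<close> of the identity annihilates all test functions on \<open>U\<close>.\<close>
 have "AE y in mu. y : U --> abs (F y) <= Cet * 0"
 proof (rule weak_bound[OF U])
  show "Lp_loc mu 1 U F"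
  proof (rule Lp_loc_1I)
   fix K :: "'a set" assume "compact K"
   then have "K : sets mu" by (simp add: borel_compact)
   from integrable_mult_indicator[OF this iF] show "integrable mu (%x. ind K x * F x)" by simp
  qed
  show "Lp_loc mu 1 U (%_. 0)" by (rule Lp_loc_1I) simp
  fix ph assume "test_function U ph"
  then obtain K where K: "smooth_on ph UNIV" "compact K" "K <= U" "!!x. x \<notin> K ==> ph x = 0"
   by (rule test_functionE) blast
  have cph: "continuous_on UNIV ph" by (rule smooth_on_continuous[OF K(1)])
  have [measurable]: "ph : BM" by (rule borel_measurable_continuous_onI[OF cph])
  obtain B where B: "0 <= B" "!!x. abs (ph x) <= B" using bounded_test[OF cph K(2,4)] by blast
  have im: "integrable mu (%y. h y * ph y)" if "integrable mu h" for h
  proof -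
   have [measurable]: "h : BM" using borel_measurable_integrable[OF that] by simp
   show ?thesis
   by (rule Bochner_Integration.integrable_bound[where f = "%y. h y * B"])
   (use that B in \<open>auto simp: abs_mult intro!: AE_I2 mult_left_mono\<close>)
  qed
  \<comment> \<open>The test function transported along the flow for time s; its derivative in s is
    minus its Lie derivative along \<open>v\<close>.\<close>
  define H where "H p = ph (mm (snd p) (- (fst p *R v)))" for p :: "real \<times> 'a"
  have "smooth_on (%p::real \<times> 'a. - (fst p *R v)) UNIV"
   by (intro smooth_on_linear bounded_linear_minus bounded_linear_scaleR_const bounded_linear_fst)
  then have sH: "smooth_on H UNIV"
   unfolding H_def[abs_def]
   by (intro smooth_on_compose[OF K(1)] smooth_on_compose[OF smooth_mult smooth_on_Pair, simplified]
   smooth_on_linear[OF bounded_linear_snd])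
  define ps where "ps s = (LINT y|mu. H (s, y) *R u' y)" for s
  define ps' where "ps' s = (LINT y|mu. frechet_derivative H (at (s, y)) (1, 0) *R u' y)" for s
  have uz: "y \<notin> K' ==> u' y = 0" for y by (simp add: u'_def)
  have lH: "linear (frechet_derivative H (at p))" for p
   by (rule has_derivative_linear[OF smooth_on_has_derivative[OF sH]])
  have dps: "(ps has_vector_derivative ps' s) (at s)" for s
  proof -
   have e: "frechet_derivative H (at (s, y)) (t, 0) = t * frechet_derivative H (at (s, y)) (1, 0)" for t y
   using linear_cmul[OF lH, of "(s, y)" t "(1, 0)"] by simp
   have "(LINT y|mu. frechet_derivative H (at (s, y)) (t, 0) *R u' y) =
   (LINT y|mu. t *R (frechet_derivative H (at (s, y)) (1, 0) *R u' y))" for t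
   by (rule Bochner_Integration.integral_cong[OF refl]) (simp only: e[of _ t] real_scaleR_def mult.assoc)
   then have *: "(%t. LINT y|mu. frechet_derivative H (at (s, y)) (t, 0) *R u' y) = (%t. t *R ps' s)"
   unfolding ps'_def integral_scaleR_right by (rule ext)
   show ?thesis
   using parameter_has_derivative[OF iu uz K'(1) sH, of s] unfolding has_vector_derivative_def ps_def[abs_def] * .
  qed
  have "smooth_on ps' UNIV"
   unfolding ps'_def[abs_def]
   by (rule parameter_smooth[OF iu uz K'(1) smooth_on_frechet_derivative[OF sH]])
  then have cps': "continuous_on {0..1} ps'" using smooth_on_continuous continuous_on_subset by blast
  have ps'w: "ps' s = (LINT y|mu. w' y * H (s, y))" if s: "s : {0..1}" for s
  proof -
   define phs where "phs y = H (s, y)" for y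
   \<comment> \<open>The transported support moves along segments that start in \<open>U\<close> and
     remain in \<open>K'\<close>, so \<open>phs\<close> is a test function on
     \<open>Om\<close>.\<close>
   have z: "phs y = 0" if "y \<notin> K'" for y
   proof (rule ccontr)
   assume "phs y ~= 0"
   then have "mm y (- (s *R v)) : U" using K(3,4) by (auto simp: phs_def H_def)
   from seg[OF this s] show False using that by simp
   qed
   have ss: "smooth_on phs UNIV"
   unfolding phs_def[abs_def] H_def fst_conv snd_conv
   by (intro smooth_on_compose[OF K(1)] smooth_mul smooth_ident smooth_on_const)
   have t: "test_function Om phs" by (rule test_functionI[OF ss K' z])
   have ld: "lie_deriv G v phs y = - frechet_derivative H (at (s, y)) (1, 0)" for y
   proof -
   have e: "phs (mm y (t *R v)) = H (s - t, y)" for t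
   proof -
   have "mm (t *R v) (- (s *R v)) = (t + - s) *R v"
   using one_parameter[of t v "- s"] by (simp only: scaleR_minus_left)
   also have "... = - ((s - t) *R v)" by (simp add: algebra_simps)
   finally show ?thesis unfolding phs_def H_def fst_conv snd_conv assoc by (simp only:)
   qed
   have "((%t. (s - t, y)) has_derivative (%t. (- t, 0))) (at 0)"
   by (auto intro!: derivative_eq_intros)
   from has_derivative_compose[OF this smooth_on_has_derivative[OF sH]]
   have "((%t. H (s - t, y)) has_derivative (%t. frechet_derivative H (at (s, y)) (- t, 0))) (at 0)" by simp
   moreover have "frechet_derivative H (at (s, y)) (- t, 0) = t *R (- frechet_derivative H (at (s, y)) (1, 0))" for t
   using linear_cmul[OF lH, of "(s, y)" "- t" "(1, 0)"] by simp
   ultimately have "((%t. phs (mm y (t *R v))) has_vector_derivative - frechet_derivative H (at (s, y)) (1, 0)) (at 0)"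
   by (simp add: has_vector_derivative_def e)
   with line_has_vector_derivative[OF ss, of y v] show ?thesis by (rule vector_derivative_unique_at)
   qed
   have "(LINT x:Om|mu. u x * lie_deriv G v phs x) = - (LINT x:Om|mu. w x * phs x)"
   using wd t by (simp add: weak_deriv_def)
   moreover have "(LINT x:Om|mu. u x * lie_deriv G v phs x) = (LINT x|mu. u' x * lie_deriv G v phs x)"
   unfolding u'_def by (rule set_integral_support[OF K'(2) lie_deriv_support[OF K'(1) z]])
   moreover have "(LINT x:Om|mu. w x * phs x) = (LINT x|mu. w' x * phs x)"
   unfolding w'_def by (rule set_integral_support[OF K'(2) z])
   ultimately show ?thesis unfolding ps'_def ld by (simp add: phs_def mult.commute)
  qed
  have FTC: "ps 1 - ps 0 = (LINT s|lborel. ind {0..1} s * (LINT y|mu. w' y * H (s, y)))"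
  proof -
   have "(LINT s|lborel. ind {0..1} s *R ps' s) = ps 1 - ps 0"
   by (rule integral_FTC_Icc) (auto intro: has_vector_derivative_at_within[OF dps] cps')
   moreover have "(LINT s|lborel. ind {0..1} s *R ps' s) = (LINT s|lborel. ind {0..1} s * (LINT y|mu. w' y * H (s, y)))"
   by (rule Bochner_Integration.integral_cong) (auto simp: indicator_def ps'w)
   ultimately show ?thesis by simp
  qed
  have Wf: "(LINT y|mu. W y * ph y) = ps 1 - ps 0"
  proof -
   have "(LINT y|mu. W y * ph y) = (LINT y|mu. LINT s|lborel. ind {0..1} s * w' (mm y (s *R v)) * ph y)"
   unfolding W_def by (simp add: mult.assoc flip: integral_mult_left_zero)
   also have "... = (LINT s|lborel. LINT y|mu. ind {0..1} s * w' (mm y (s *R v)) * ph y)"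
   by (rule mul.Fubini_integral[symmetric]) (rule integrable_line_average[OF iw _ B(2)], measurable)
   also have "... = (LINT s|lborel. ind {0..1} s * (LINT y|mu. w' y * H (s, y)))"
   proof (rule Bochner_Integration.integral_cong[OF refl])
   fix s
   have "(LINT y|mu. w' (mm y (s *R v)) * ph (mm (mm y (s *R v)) (- (s *R v)))) = (LINT y|mu. w' y * ph (mm y (- (s *R v))))"
   by (rule integral_right[of "%y. w' y * ph (mm y (- (s *R v)))"]) measurable
   then have "(LINT y|mu. w' (mm y (s *R v)) * ph y) = (LINT y|mu. w' y * H (s, y))"
   by (simp add: H_def)
   then show "(LINT y|mu. ind {0..1} s * w' (mm y (s *R v)) * ph y) = ind {0..1} s * (LINT y|mu. w' y * H (s, y))"
   by (simp add: mult.assoc)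
   qed
   finally show ?thesis using FTC by simp
  qed
  have "(LINT y|mu. u' (mm y v) * ph (mm (mm y v) (- v))) = (LINT y|mu. u' y * ph (mm y (- v)))"
   by (rule integral_right[of "%y. u' y * ph (mm y (- v))"]) measurable
  then have u1: "(LINT y|mu. u' (mm y v) * ph y) = ps 1" by (simp add: ps_def H_def mult.commute)
  have u0: "(LINT y|mu. u' y * ph y) = ps 0" by (simp add: ps_def H_def mult.commute)
  have "(LINT y:U|mu. F y * ph y) = (LINT y|mu. F y * ph y)"
   unfolding set_lebesgue_integral_def
   by (rule Bochner_Integration.integral_cong) (use K(3,4) in \<open>auto simp: indicator_def\<close>)
  also have "... = (LINT y|mu. u' (mm y v) * ph y) - (LINT y|mu. u' y * ph y) - (LINT y|mu. W y * ph y)"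
   unfolding F_def using im[OF iuv] im[OF iu] im[OF iW] by (simp add: left_diff_distrib)
  also have "... = 0" unfolding u1 u0 Wf by simp
  finally show "abs (LINT x:U|mu. F x * ph x) <= (LINT x:U|mu. 0 * abs (ph x))" by simp
 qed auto
 then show ?thesis by (rule AE_mp) (auto simp: F_def W_def)
qed

end

section \<open>Recovering a map from its distances to fixed points\<close>

context carnot_group begin

text \<open>By \<open>proj_le_dist\<close> a small distance bounds every layer component; below
  distance 1 all its powers are at most the distance itself.\<close>

lemma dist_topology:
 assumes U: "open U" "p : U"
 shows "\<exists>e>0. ALL y. d p y < e --> y : U"
proof -
 obtain C where C: "0 <= C" "!!x k. k : {1..step G} ==> norm (proj k x) <= C * d 0 x ^ k"
  using proj_le_dist by blast
 have "((%z. mm p z) \<longlongrightarrow> mm p 0) (at 0)" by (intro tendsto_intros)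
 then have "\<forall>\<^sub>F z in at 0. mm p z : U" using U by (intro topological_tendstoD) auto
 then obtain de where de: "0 < de" "!!z. z ~= 0 ==> norm z < de ==> mm p z : U"
  by (auto simp: eventually_at dist_norm)
 define M where "M = real (step G) * C + 1"
 have M: "0 < M" using C(1) by (simp add: M_def add_nonneg_pos)
 define e where "e = min 1 (de / M)"
 have e: "0 < e" using de(1) M by (simp add: e_def)
 have "y : U" if y: "d p y < e" for y
 proof -
  define z where "z = mm (- p) y"
  have dz: "d 0 z < e" using y by (simp add: z_def dist_eq_0[of p])
  have "norm z <= (\<Sum>k=1..step G. norm (proj k z))" by (rule norm_le_sum_proj)
  also have "... <= (\<Sum>k=1..step G. C * d 0 z)"
  proof (rule sum_mono)
   fix k assume k: "k : {1..step G}"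
   have "d 0 z ^ k <= d 0 z" using power_decreasing[of 1 k "d 0 z"] k dz by (simp add: e_def)
   then show "norm (proj k z) <= C * d 0 z" using C(2)[OF k, of z] mult_left_mono[OF _ C(1)] by (meson order_trans)
  qed
  also have "... <= M * d 0 z" by (simp add: M_def algebra_simps)
  also have "... < M * e" using dz M by simp
  also have "... <= de" using M by (simp add: e_def min_def field_simps)
  finally have "norm z < de" .
  then have "mm p z : U" using de(2)[of z] U(2) by (cases "z = 0") auto
  moreover have "mm p z = y" unfolding z_def by (metis assoc right_inverse left_neutral)
  ultimately show ?thesis by simp
 qed
 with e show ?thesis by blast
qed

lemma open_dist_less: "open {z. d z p < e}"
 by (intro open_Collect_less continuous_intros)

text \<open>Taking \<open>z\<close> arbitrarily close to \<open>p\<close> makes the difference of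
  the two distances approach \<open>d p p'\<close>; countably many test points thus determine the
  distance.\<close>

lemma dist_le_dense:
 assumes D: "!!X. open X ==> X ~= {} ==> \<exists>z\<in>D. z : X"
  and le: "!!z. z : D ==> abs (d z p - d z p') <= M"
 shows "d p p' <= M"
proof (rule field_le_epsilon)
 fix e :: real assume e: "0 < e"
 have "{z. d z p < e / 2} ~= {}" using e by (auto intro: exI[of _ p])
 then obtain z where z: "z : D" "d z p < e / 2" using D[OF open_dist_less] by blast
 show "d p p' <= M + e"
  using dist_triangle[of p p' z] le[OF z(1)] z(2) dist_sym[of p z] by linarith
qed

lemma measurable_cc_dist [measurable]:
 assumes "f : borel_measurable M" "g : borel_measurable M"
 shows "(%x. d (f x) (g x)) : borel_measurable M"
proof -
 have "continuous_on UNIV (%x. d (fst x) (snd x))" by (intro continuous_intros)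
 with assms show ?thesis by (rule borel_measurable_continuous_Pair)
qed

end

locale sobolev_map = carnot_mollifier G mu et + T: step2_group H
 for G :: "('a::euclidean_space) carnot" and mu et and H :: "('b::euclidean_space) carnot" +
 fixes Om :: "'a set" and q :: real and f :: "'a => 'b"
 assumes open_Om: "open Om" and q: "2 <= q" and sobolev: "metric_sobolev G mu H q Om f"
begin

lemma measurable_loc:
 fixes u :: "'a => real"
 assumes "!!K. compact K ==> K <= Om ==> (%x. ind K x * u x) : BM"
 shows "(%x. ind Om x * u x) : BM"
proof -
 obtain C where C: "!!n::nat. compact (C n)" "!!n. C n <= Om" "\<Union> (range C) = Om"
  using open_sigma_compact[OF open_Om] by metis
 define B where "B n = (\<Union>i\<le>n. C i)" for n
 have B: "compact (B n)" "B n <= Om" for n using C by (auto simp: B_def intro: compact_UN)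
 have "(%n. ind (B n) x * u x) \<longlonglongrightarrow> ind Om x * u x" for x
 proof (cases "x : Om")
  case True
  then obtain N where "x : C N" using C(3) by blast
  then have "\<forall>n\<ge>N. x : B n" by (auto simp: B_def)
  then have "\<forall>\<^sub>F n in sequentially. ind (B n) x * u x = ind Om x * u x"
   unfolding eventually_sequentially using True by (intro exI[of _ N]) auto
  then show ?thesis by (rule tendsto_eventually)
 next
  case False
  then have "x \<notin> B n" for n using B(2) by blast
  then show ?thesis using False by simp
 qed
 then show ?thesis by (rule borel_measurable_LIMSEQ_real) (use assms B in auto)
qed

lemma Lp_loc_measurable:
 assumes "Lp_loc mu p Om u"
 shows "(%x. ind Om x * u x) : BM"
 by (rule measurable_loc) (use assms in \<open>auto simp: Lp_loc_def Lp_on_def set_borel_measurable_def\<close>)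

lemma weak_deriv_cong:
 assumes w: "weak_deriv G mu Om v u w" and m: "(%x. ind Om x * w' x) : BM"
  and ae: "AE x in mu. x : Om --> w' x = w x"
 shows "weak_deriv G mu Om v u w'"
proof -
 have mK: "(%x. ind K x * w' x) : BM" if "compact K" "K <= Om" for K
 proof -
  have [measurable]: "K : sets borel" using that(1) by (rule borel_compact)
  have "(%x. ind K x * w' x) = (%x. ind K x * (ind Om x * w' x))"
   using that(2) by (auto simp: indicator_def fun_eq_iff)
  then show ?thesis using m by simp
 qed
 have L: "Lp_loc mu 1 Om w" using w by (simp add: weak_deriv_def)
 have aeK: "AE x in mu. ind K x * w x = ind K x * w' x" if "K <= Om" for K
  by (rule AE_mp[OF ae]) (use that in \<open>auto simp: indicator_def\<close>)
 have "Lp_loc mu 1 Om w'"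
 proof (rule Lp_loc_1I)
  fix K assume K: "compact K" "K <= Om"
  show "integrable mu (%x. ind K x * w' x)"
   by (rule integrable_cong_AE_imp[OF measurable_set_integrable_loc[OF L K]]) (use mK[OF K] aeK[OF K(2)] in \<open>auto elim!: AE_mp\<close>)
 qed
 moreover have "(LINT x:Om|mu. w' x * ph x) = (LINT x:Om|mu. w x * ph x)" if t: "test_function Om ph" for ph
 proof -
  obtain K where K: "smooth_on ph UNIV" "compact K" "K <= Om" "!!x. x \<notin> K ==> ph x = 0"
   using t by (rule test_functionE) blast
  have [measurable]: "ph : BM"
   by (rule borel_measurable_continuous_onI[OF smooth_on_continuous[OF K(1)]])
  note [measurable] = mK[OF K(2,3)] borel_measurable_integrable[OF measurable_set_integrable_loc[OF L K(2,3)]]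
  have "(LINT x|mu. (ind K x * w' x) * ph x) = (LINT x|mu. (ind K x * w x) * ph x)"
   by (rule integral_cong_AE, measurable, rule AE_mp[OF aeK[OF K(3)]], auto)
  then show ?thesis
   using set_integral_support[OF K(3,4), where F = w'] set_integral_support[OF K(3,4), where F = w] by simp
 qed
 ultimately show ?thesis using w by (simp add: weak_deriv_def)
qed

text \<open>Normalises the Sobolev data: \<open>g\<close> is made nonnegative and extended by 0, and
  each derivative is set to 0 where the bound fails. This changes it only on a null set and turns
  the bound into one at every point of \<open>Om\<close>.\<close>

lemma upper_gradient:
 "EX g. g : BM & (ALL x. 0 <= g x) & Lp_mass q g < \<infinity> &
   (ALL z. \<forall>v\<in>layer G 1. EX w. weak_deriv G mu Om v (%x. T.d z (f x)) w & (\<forall>x\<in>Om. abs (w x) <= norm v * g x))"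
proof -
 obtain g0 where g0: "Lp_on mu q Om g0"
  and W: "!!z. EX W. weak_horizontal_gradient G mu Om (%x. T.d z (f x)) W & (AE x in mu. x : Om --> norm (W x) <= g0 x)"
  using sobolev unfolding metric_sobolev_def by blast
 define g where "g x = abs (ind Om x * g0 x)" for x
 have "(%x. ind Om x *R g0 x) : borel_measurable mu"
  using g0 by (simp add: Lp_on_def set_borel_measurable_def)
 then have [measurable]: "(%x. ind Om x * g0 x) : BM" by simp
 have [measurable]: "g : BM" unfolding g_def[abs_def] by measurable
 have "Lp_mass q g = (NN mu (%x. ennreal (norm (ind Om x *R (abs (g0 x)) powr q))))"
  unfolding Lp_mass_def by (rule nn_integral_cong) (auto simp: g_def indicator_def)
 also have "... < \<infinity>" using g0 unfolding Lp_on_def set_integrable_def integrable_iff_bounded by simp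
 finally have "Lp_mass q g < \<infinity>" .
 moreover have "EX w. weak_deriv G mu Om v (%x. T.d z (f x)) w & (\<forall>x\<in>Om. abs (w x) <= norm v * g x)"
  if v: "v : layer G 1" for z v
 proof -
  obtain W where W: "weak_horizontal_gradient G mu Om (%x. T.d z (f x)) W" "AE x in mu. x : Om --> norm (W x) <= g0 x"
   using W by blast
  then have wd: "weak_deriv G mu Om v (%x. T.d z (f x)) (%x. W x \<bullet> v)"
   using v by (simp add: weak_horizontal_gradient_def)
  define h where "h x = ind Om x * (W x \<bullet> v)" for x
  have [measurable]: "h : BM"
   using wd Lp_loc_measurable unfolding weak_deriv_def h_def[abs_def] by blast
  define w where "w x = (if (abs (h x)) <= norm v * g x then h x else 0)" for x
  have [measurable]: "w : BM" unfolding w_def[abs_def] by measurable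
  have [measurable]: "Om : sets borel" using open_Om by simp
  have "(%x. ind Om x * w x) : BM" by measurable
  moreover have "AE x in mu. x : Om --> w x = W x \<bullet> v"
  proof (rule AE_mp[OF W(2)], intro AE_I2 impI)
   fix x assume x: "x : Om --> norm (W x) <= g0 x" "x : Om"
   have "abs (W x \<bullet> v) <= norm (W x) * norm v" by (rule Cauchy_Schwarz_ineq2)
   also have "... <= g x * norm v" using x by (intro mult_right_mono) (auto simp: g_def)
   finally show "w x = W x \<bullet> v" using x(2) by (simp add: w_def h_def mult.commute)
  qed
  ultimately have "weak_deriv G mu Om v (%x. T.d z (f x)) w" using weak_deriv_cong[OF wd] by blast
  moreover have "abs (w x) <= norm v * g x" for x by (simp add: w_def g_def)
  ultimately show ?thesis by blast
 qed
 ultimately show ?thesis by (intro exI[of _ g]) (auto simp: g_def[abs_def])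
qed

definition g :: "'a => real" where
 "g = (SOME g. g : BM & (ALL x. 0 <= g x) & Lp_mass q g < \<infinity> &
   (ALL z. \<forall>v\<in>layer G 1. EX w. weak_deriv G mu Om v (%x. T.d z (f x)) w & (\<forall>x\<in>Om. abs (w x) <= norm v * g x)))"

lemma measurable_g [measurable]: "g : BM"
 and g_nonneg [simp]: "0 <= g x"
 and g_mass: "Lp_mass q g < \<infinity>"
 and g_deriv: "v : layer G 1 ==> EX w. weak_deriv G mu Om v (%x. T.d z (f x)) w & (\<forall>x\<in>Om. abs (w x) <= norm v * g x)"
 using someI_ex[OF upper_gradient, folded g_def] by blast+

lemma dist_Lp_loc: "Lp_loc mu q Om (%x. T.d z (f x))"
 using sobolev unfolding metric_sobolev_def by blast

text \<open>Extension by 0, so that translates and global integrals make sense; on \<open>Om\<close>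
  it is \<open>f\<close>.\<close>

definition ft :: "'a => 'b" where "ft x = ind Om x *R f x"

lemma ft_eq: "x : Om ==> ft x = f x"
 by (simp add: ft_def)

text \<open>Only the distances to fixed points are known to be measurable. An open set is a
  countable union of distance balls with rational radii and centres in a countable dense set, and
  the preimage of a ball is a sublevel set of such a distance.\<close>

lemma measurable_ft [measurable]: "ft : BM"
proof (rule borel_measurableI)
 fix U :: "'b set" assume U: "open U"
 obtain D :: "'b set" where D: "countable D" "!!X. open X ==> X ~= {} ==> \<exists>z\<in>D. z : X"
  using countable_dense_setE by blast
 define Q where "Q = {p : D \<times> \<rat>. ALL y. T.d (fst p) y < snd p --> y : U}"
 have cQ: "countable Q" unfolding Q_def
  by (rule countable_subset[of _ "D \<times> \<rat>"]) (auto intro: D(1) countable_rat)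
 have m[measurable]: "(%x. ind Om x * T.d z (f x)) : BM" for z
  by (rule Lp_loc_measurable[OF dist_Lp_loc])
 have [measurable]: "Om : sets borel" using open_Om by simp
 define S where "S p = {x : Om. ind Om x * T.d (fst p) (f x) < snd p}" for p
 have "S p : sets borel" for p unfolding S_def by measurable
 then have "(\<Union>p\<in>Q. S p) : sets borel" using cQ by (intro sets.countable_UN') auto
 moreover have "(\<Union>p\<in>Q. S p) = {x : Om. f x : U}"
 proof (intro equalityI subsetI)
  fix x assume "x : {x : Om. f x : U}"
  then have x: "x : Om" "f x : U" by auto
  obtain e where e: "0 < e" "!!y. T.d (f x) y < e ==> y : U" using T.dist_topology[OF U x(2)] by blast
  obtain r where r: "r : \<rat>" "0 < r" "r < e / 2" using Rats_dense_in_real[of 0 "e / 2"] e(1) by auto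
  have "{z. T.d z (f x) < r} ~= {}" using r by (auto intro: exI[of _ "f x"])
  then obtain z where z: "z : D" "T.d z (f x) < r" using D(2)[OF T.open_dist_less] by blast
  have "y : U" if "T.d z y < r" for y
   using e(2)[of y] T.dist_triangle[of "f x" y z] T.dist_sym[of "f x" z] z(2) that r(3) by linarith
  then have "(z, r) : Q" using z r by (auto simp: Q_def)
  moreover have "x : S (z, r)" using x z by (simp add: S_def)
  ultimately show "x : (\<Union>p\<in>Q. S p)" by blast
 qed (auto simp: Q_def S_def)
 ultimately have fU: "{x : Om. f x : U} : sets borel" by simp
 have "x : ft -` U \<inter> space borel \<longleftrightarrow> x : {x : Om. f x : U} \<union> (if 0 : U then - Om else {})" for x
  by (cases "x : Om") (auto simp: ft_def)
 then have "ft -` U \<inter> space borel = {x : Om. f x : U} \<union> (if 0 : U then - Om else {})" by blast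
 then show "ft -` U \<inter> space borel : sets borel" using fU by auto
qed

text \<open>For each \<open>z\<close> the distance from \<open>z\<close> to \<open>f\<close> has
  increments bounded by the integral of \<open>g\<close>. Countably many \<open>z\<close> share one
  null set, off which \<open>dist_le_dense\<close> passes to the distance between the two
  values.\<close>

lemma metric_line:
 assumes v: "v : layer G 1" and U: "open U" and K': "compact K'" "K' <= Om"
  and seg: "!!y s. y : U ==> s : {0..1} ==> mm y (s *R v) : K'"
 shows "AE y in mu. y : U --> en (T.d (ft y) (ft (mm y v))) <=
  (NN lborel (%s. ind {0..1} s * en (norm v * (ind K' (mm y (s *R v)) * g (mm y (s *R v))))))"
proof -
 have [measurable]: "K' : sets borel" using K'(1) by (rule borel_compact)
 define I where "I y = (NN lborel (%s. ind {0..1} s * en (norm v * (ind K' (mm y (s *R v)) * g (mm y (s *R v))))))" for y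
 obtain D :: "'b set" where D: "countable D" "!!X. open X ==> X ~= {} ==> \<exists>z\<in>D. z : X"
  using countable_dense_setE by blast
 have "AE y in mu. y : U --> en (abs (T.d z (ft y) - T.d z (ft (mm y v)))) <= I y" for z
 proof -
  obtain w where w: "weak_deriv G mu Om v (%x. T.d z (f x)) w" "!!x. x : Om ==> abs (w x) <= norm v * g x"
   using g_deriv[OF v] by blast
  have iw: "integrable mu (%x. ind K' x * w x)"
   using w(1) K' measurable_set_integrable_loc unfolding weak_deriv_def by blast
  have [measurable]: "(%x. ind K' x * w x) : BM"
   using borel_measurable_integrable[OF iw] by simp
  have "AE y in mu. y : U --> ind K' (mm y v) * T.d z (f (mm y v)) - ind K' y * T.d z (f y) =
   (LINT s|lborel. ind {0..1} s * (ind K' (mm y (s *R v)) * w (mm y (s *R v))))"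
   by (rule weak_deriv_line[OF open_Om w(1) U K']) (rule seg)
  then show ?thesis
  proof (rule AE_mp, intro AE_I2 impI)
   fix y
   define y' where "y' s = mm y (s *R v)" for s
   assume a: "y : U --> ind K' (mm y v) * T.d z (f (mm y v)) - ind K' y * T.d z (f y) =
   (LINT s|lborel. ind {0..1} s * (ind K' (mm y (s *R v)) * w (mm y (s *R v))))" and y: "y : U"
   have k: "y : K'" "mm y v : K'" using seg[OF y, of 0] seg[OF y, of 1] by auto
   have [measurable]: "(%s. ind K' (y' s) * w (y' s)) : BM"
   by (rule measurable_compose[of y' borel borel "%x. ind K' x * w x"]) (auto simp: y'_def[abs_def])
   have "abs (T.d z (ft y) - T.d z (ft (mm y v))) = abs (LINT s|lborel. ind {0..1} s * (ind K' (y' s) * w (y' s)))"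
   proof -
   have "ft y = f y" "ft (mm y v) = f (mm y v)" using k K'(2) by (auto intro: ft_eq)
   then have "T.d z (ft (mm y v)) - T.d z (ft y) = (LINT s|lborel. ind {0..1} s * (ind K' (y' s) * w (y' s)))"
   using a y k by (simp add: y'_def)
   then show ?thesis by (simp add: abs_minus_commute)
   qed
   also have "en ... <= (NN lborel (%s. ennreal (norm (ind {0..1} s * (ind K' (y' s) * w (y' s))))))"
   proof (cases "integrable lborel (%s. ind {0..1} s * (ind K' (y' s) * w (y' s)))")
   case True
   from integral_norm_bound_ennreal[OF this] show ?thesis by simp
   qed (simp add: not_integrable_integral_eq)
   also have "... <= I y"
   unfolding I_def y'_def
   by (rule nn_integral_mono) (use w(2) K'(2) in \<open>auto simp: indicator_def intro!: ennreal_leI\<close>)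
   finally show "en (abs (T.d z (ft y) - T.d z (ft (mm y v)))) <= I y" .
  qed
 qed
 then have "AE y in mu. \<forall>z\<in>D. y : U --> en (abs (T.d z (ft y) - T.d z (ft (mm y v)))) <= I y"
  unfolding AE_ball_countable[OF D(1)] by (rule ballI)
 then show ?thesis unfolding I_def[symmetric]
 proof (rule AE_mp, intro AE_I2 impI)
  fix y assume a: "\<forall>z\<in>D. y : U --> en (abs (T.d z (ft y) - T.d z (ft (mm y v)))) <= I y" and y: "y : U"
  show "en (T.d (ft y) (ft (mm y v))) <= I y"
  proof (cases "I y = \<infinity>")
   case False
   then obtain M where M: "I y = ennreal M" "0 <= M" by (cases "I y") auto
   have "T.d (ft y) (ft (mm y v)) <= M"
   by (rule T.dist_le_dense[OF D(2)]) (use a y M in auto)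
   then show ?thesis using M by (simp add: ennreal_leI)
  qed simp
 qed
qed

end

section \<open>Metric difference quotients along dilated words\<close>

lemma powr_le_nn_integral_01:
 fixes h :: "real => real"
 assumes [measurable]: "h : BM" and h: "!!s. 0 <= h s" and r: "1 <= r"
  and y: "0 <= y" "ennreal y <= (NN lborel (%s. ind {0..1} s * en (h s)))"
 shows "en (y powr r) <= (NN lborel (%s. ind {0..1} s * en (h s powr r)))"
proof -
 let ?M = "restrict_space lborel {0..1::real}"
 have [measurable]: "h : borel_measurable ?M" by (rule measurable_restrict_space1) simp
 have e: "(NN ?M (%s. F s)) = (NN lborel (%s. ind {0..1} s * F s))" for F :: "real => ennreal"
  by (subst nn_integral_restrict_space) (auto simp: mult.commute)
 have "emeasure ?M (space ?M) = ennreal 1" by (simp add: emeasure_restrict_space space_restrict_space)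
 from powr_le_nn_integral[OF _ h r this _ y(1)] y(2) show ?thesis by (simp add: e)
qed

text \<open>Compare each term with the largest one. The constant depends only on the number of terms
  and the exponent.\<close>

lemma sum_powr_le:
 fixes a :: "'i => real"
 assumes A: "finite A" and a: "!!i. i : A ==> 0 <= a i" and p: "0 <= p"
 shows "(\<Sum>i\<in>A. a i) powr p <= real (card A) powr p * (\<Sum>i\<in>A. a i powr p)"
proof (cases "A = {}")
 case False
 then have "Max (a ` A) : a ` A" using A by (intro Max_in) auto
 then obtain j where j: "j : A" "a j = Max (a ` A)" by force
 have "(\<Sum>i\<in>A. a i) <= real (card A) * a j"
  by (rule sum_bounded_above) (simp add: j(2) A)
 then have "(\<Sum>i\<in>A. a i) powr p <= (real (card A) * a j) powr p"
  using a p by (intro powr_mono2 sum_nonneg) auto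
 also have "... = real (card A) powr p * a j powr p" using a j(1) by (simp add: powr_mult)
 also have "... <= real (card A) powr p * (\<Sum>i\<in>A. a i powr p)"
  using j(1) A by (intro mult_left_mono member_le_sum) auto
 finally show ?thesis .
qed simp

context carnot_group begin

lemma foldr_take_Suc:
 "i < length vs ==> foldr mm (take (Suc i) vs) 0 = mm (foldr mm (take i vs) 0) (vs ! i)"
 by (simp add: take_Suc_conv_app_nth foldr_mult[of "take i vs" "vs ! i"])

lemma foldr_take_words:
 "\<forall>v\<in>set vs. v : layer G 1 & norm v <= C ==> length vs <= N ==> foldr mm (take i vs) 0 : words N C"
 unfolding words_def by (intro CollectI exI[of _ "take i vs"]) (auto dest: in_set_takeD)

lemma proj_1_foldr:
 "\<forall>v\<in>set vs. v : layer G 1 ==> proj 1 (foldr mm vs 0) = sum_list vs"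
proof (induction vs)
 case (Cons v vs)
 have "proj 1 (mm v (foldr mm vs 0)) = proj 1 v + proj 1 (foldr mm vs 0)"
  by (rule proj_mul) (use upper_1 in auto)
 then show ?case using Cons proj_id[of 1 v] by simp
qed (simp add: proj_simps)

end

context carnot_haar begin

lemma small_segments:
 assumes Om: "open Om" and K: "compact K" "K <= Om"
 shows "\<exists>ta K' U. 0 < ta & compact K' & K' <= Om & open U & K <= U & U <= K' &
  (\<forall>x\<in>K. ALL w. norm w <= ta --> mm x w : U) & (\<forall>y\<in>U. ALL w. norm w <= ta --> mm y w : K')"
proof -
 obtain R where R: "0 < R" "fatten K R <= Om" using fatten_subset_open[OF K(1) Om K(2)] by blast
 obtain S where S: "0 < S" "fatten (fatten K R) S <= Om"
  using fatten_subset_open[OF compact_fatten[OF K(1)] Om R(2)] by blast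
 have U: "openfat K R <= fatten K R"
 proof
  fix y assume "y : openfat K R"
  then obtain x where x: "x : K" "norm (mm (- x) y) < R" by (auto simp: openfat_def)
  from fattenI[OF x(1) less_imp_le[OF x(2)]] show "y : fatten K R" by simp
 qed
 define ta where "ta = min S (R / 2)"
 have ta: "0 < ta" "ta <= S" "ta < R" using R S by (auto simp: ta_def)
 have "\<forall>y\<in>openfat K R. ALL w. norm w <= ta --> mm y w : fatten (fatten K R) S"
  using U ta(2) by (auto intro!: fattenI)
 moreover have "\<forall>x\<in>K. ALL w. norm w <= ta --> mm x w : openfat K R"
  using ta(3) by (auto simp: openfat_def intro!: bexI)
 moreover have "openfat K R <= fatten (fatten K R) S" using U subset_fatten[of S "fatten K R"] S(1) by auto
 moreover have "K <= openfat K R" by (rule subset_openfat[OF R(1)])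
 ultimately show ?thesis
  using S ta(1) compact_fatten[OF compact_fatten[OF K(1), of R], of S] open_openfat[of K R]
  by (intro exI[of _ ta] exI[of _ "fatten (fatten K R) S"] exI[of _ "openfat K R"]) auto
qed

lemma small_products:
 assumes C: "0 <= C" and de: "0 < de"
 shows "\<exists>r1>0. r1 <= 1 & (ALL r z v s. 0 < r --> r <= r1 --> z : words N C --> norm v <= C --> s : {0..1} -->
  norm (mm (dl r z) (s *R (r *R v))) < de)"
proof -
 obtain M where M: "!!x. x : words N C ==> norm x <= M" using bounded_words unfolding bounded_iff by blast
 obtain D where D: "0 < D" "!!r x. r : {0<..1} ==> norm (dl r x) <= r * D * norm x"
  using dilation_bound by blast
 have "isCont (%p. norm (mm (fst p) (snd p))) (0, 0)" (is "isCont ?F _")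
  using continuous_on_norm[OF smooth_on_continuous[OF smooth_mult]] by (simp add: continuous_on_eq_continuous_at)
 then have "(?F \<longlongrightarrow> ?F (0, 0)) (at (0, 0))" unfolding isCont_def .
 then have "((%p. norm (mm (fst p) (snd p))) \<longlongrightarrow> 0) (at (0, 0))" by simp
 from tendstoD[OF this de] obtain \<sigma> where \<sigma>: "0 < \<sigma>"
  "!!p. p ~= (0, 0) ==> dist p (0, 0) < \<sigma> ==> norm (mm (fst p) (snd p)) < de"
  by (auto simp: eventually_at)
 have small: "norm (mm z w) < de" if "norm z + norm w < \<sigma>" for z w
 proof (cases "(z, w) = (0, 0)")
  case False
  have "dist (z, w) (0, 0) <= norm z + norm w" by (simp add: dist_norm norm_Pair_le)
  then show ?thesis using \<sigma>(2)[OF False] that by simp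
 qed (use de in simp)
 define A where "A = D * abs M + C + 1"
 have A: "0 < A" using D(1) C by (auto simp: A_def intro!: add_nonneg_pos add_nonneg_nonneg)
 have main: "norm (mm (dl r z) (s *R (r *R v))) < de"
  if r: "0 < r" "r <= min 1 (\<sigma> / (2 * A))" and z: "z : words N C" and v: "norm v <= C" "s : {0..1}" for r z v s
 proof (rule small)
  have "norm (dl r z) <= r * D * norm z" using r by (intro D(2)) auto
  also have "... <= r * D * abs M" using r D M[OF z] by (intro mult_left_mono) auto
  finally have 1: "norm (dl r z) <= r * D * abs M" .
  have "norm (s *R (r *R v)) <= r * norm v" using r v by (simp add: mult_left_le_one_le mult.left_commute)
  also have "... <= r * C" using r v by simp
  finally have "norm (dl r z) + norm (s *R (r *R v)) <= r * (D * abs M + C)"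
   using 1 by (simp add: algebra_simps)
  also have "... <= r * A" using r by (simp add: A_def)
  also have "... <= \<sigma> / (2 * A) * A" using r A by (intro mult_right_mono) auto
  also have "... < \<sigma>" using A \<sigma>(1) by simp
  finally show "norm (dl r z) + norm (s *R (r *R v)) < \<sigma>" .
 qed
 have "0 < min 1 (\<sigma> / (2 * A))" using A \<sigma>(1) by simp
 then show ?thesis using main by (intro exI[of _ "min 1 (\<sigma> / (2 * A))"]) auto
qed

lemma zero_in_words: "0 : words N C"
 unfolding words_def by (intro CollectI exI[of _ "[]"]) auto

text \<open>Constants that serve all directions of norm at most \<open>rh\<close> at once: partial
  products of a dilated word applied to \<open>K\<close> stay in \<open>U\<close>, and each letter
  segment starting in \<open>U\<close> stays in \<open>K'\<close>. As \<open>N\<close> and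
  \<open>C\<close> are independent of the direction, so are the estimates built on them.\<close>

definition word_data :: "real => 'a set => 'a set => real => 'a set => 'a set => nat => real => bool" where
 "word_data rh Om K r0 K' U N C \<longleftrightarrow> 0 < r0 & r0 <= 1 & compact K' & K' <= Om & open U & K <= U & U <= K' & 0 <= C &
  (ALL ze. norm ze <= rh --> (EX vs. length vs <= N & ze = foldr mm vs 0 & (\<forall>v\<in>set vs. v : layer G 1 & norm v <= C) &
   (ALL r i x. 0 < r --> r <= r0 --> x : K --> mm x (dl r (foldr mm (take i vs) 0)) : U))) &
  (ALL r v y s. 0 < r --> r <= r0 --> norm v <= C --> y : U --> s : {0..1} --> mm y (s *R (r *R v)) : K')"

lemma word_dataD:
 assumes "word_data rh Om K r0 K' U N C"
 shows "0 < r0" "r0 <= 1" "compact K'" "K' <= Om" "open U" "K <= U" "U <= K'" "0 <= C"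
  "norm ze <= rh ==> EX vs. length vs <= N & ze = foldr mm vs 0 & (\<forall>v\<in>set vs. v : layer G 1 & norm v <= C) &
   (ALL r i x. 0 < r --> r <= r0 --> x : K --> mm x (dl r (foldr mm (take i vs) 0)) : U)"
  "0 < r ==> r <= r0 ==> norm v <= C ==> y : U ==> s : {0..1} ==> mm y (s *R (r *R v)) : K'"
 using assms unfolding word_data_def by simp_all

text \<open>Bounded sets are covered by words of bounded length in bounded horizontal letters; after a
 small dilation all partial products stay close to the identity.\<close>

lemma word_geometry:
 assumes Om: "open Om" and K: "compact K" "K <= Om"
 shows "\<exists>r0 K' U N C. word_data rh Om K r0 K' U N C"
proof -
 obtain N C where NC: "0 <= C" "cball 0 rh <= words N C" using words_cover by blast
 obtain ta K' U where ta: "0 < ta" and K': "compact K'" "K' <= Om" and U: "open U" "K <= U" "U <= K'"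
  and KU': "!!x w. x : K ==> norm w <= ta ==> mm x w : U"
  and UK': "!!y w. y : U ==> norm w <= ta ==> mm y w : K'"
  using small_segments[OF Om K] by metis
 obtain r0 where r0: "0 < r0" "r0 <= 1" and small: "!!r z v s. 0 < r ==> r <= r0 ==> z : words N C ==> norm v <= C ==>
   s : {0..1} ==> norm (mm (dl r z) (s *R (r *R v))) < ta"
  using small_products[OF NC(1) ta, of N] by blast
 have KU: "mm x (dl r (foldr mm (take i vs) 0)) : U"
  if "0 < r" "r <= r0" "x : K" "\<forall>v\<in>set vs. v : layer G 1 & norm v <= C" "length vs <= N" for r x i vs
  using small[OF that(1,2) foldr_take_words[OF that(4,5), of i], of 0 0] NC(1) by (intro KU' that(3)) simp
 have seg: "mm y (s *R (r *R v)) : K'"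
  if "0 < r" "r <= r0" "norm v <= C" "y : U" "s : {0..1}" for r v y s
  using small[OF that(1,2) zero_in_words that(3,5)] that(1) by (intro UK' that(4)) (simp add: dilation_simps)
 have words: "EX vs. length vs <= N & ze = foldr mm vs 0 & (\<forall>v\<in>set vs. v : layer G 1 & norm v <= C)"
  if "norm ze <= rh" for ze
 proof -
  have "ze : words N C" using NC(2) that by auto
  then show ?thesis unfolding words_def by blast
 qed
 show ?thesis unfolding word_data_def
 proof (intro exI conjI)
  show "0 < r0" "r0 <= 1" "0 <= C" by (fact r0 NC)+
  show "compact K'" "K' <= Om" "open U" "K <= U" "U <= K'" by (fact K' U)+
  show "ALL r v y s. 0 < r --> r <= r0 --> norm v <= C --> y : U --> s : {0..1} --> mm y (s *R (r *R v)) : K'"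
   using seg by blast
  show "ALL ze. norm ze <= rh --> (EX vs. length vs <= N & ze = foldr mm vs 0 & (\<forall>v\<in>set vs. v : layer G 1 & norm v <= C) &
   (ALL r i x. 0 < r --> r <= r0 --> x : K --> mm x (dl r (foldr mm (take i vs) 0)) : U))"
  proof (intro allI impI)
   fix ze :: 'a assume "norm ze <= rh"
   from words[OF this] obtain vs where vs: "length vs <= N" "ze = foldr mm vs 0" "\<forall>v\<in>set vs. v : layer G 1 & norm v <= C"
   by blast
   show "EX vs. length vs <= N & ze = foldr mm vs 0 & (\<forall>v\<in>set vs. v : layer G 1 & norm v <= C) &
   (ALL r i x. 0 < r --> r <= r0 --> x : K --> mm x (dl r (foldr mm (take i vs) 0)) : U)"
   using vs KU[OF _ _ _ vs(3,1)] by (intro exI[of _ vs]) auto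
  qed
 qed
qed

end

context sobolev_map begin

text \<open>Jensen's inequality along the segment, then Fubini: right invariance makes the integral
  of the p-th power of \<open>g\<close> the same at every point of the segment.\<close>

lemma metric_line_Lp:
 assumes v: "v : layer G 1" and U: "open U" and K': "compact K'" "K' <= Om"
  and seg: "!!y s. y : U ==> s : {0..1} ==> mm y (s *R v) : K'" and p: "1 <= p"
 shows "(NN mu (%y. ind U y * en (T.d (ft y) (ft (mm y v)) powr p))) <=
  en (norm v powr p) * Lp_mass p (%x. ind K' x * g x)"
proof -
 have [measurable]: "K' : sets borel" "U : sets borel" using K'(1) U by (auto intro: borel_compact)
 define k where "k x = ind K' x * g x" for x
 have [measurable]: "k : BM" unfolding k_def[abs_def] by measurable
 have k0: "0 <= k x" for x by (simp add: k_def)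
 have "AE y in mu. y : U --> en (T.d (ft y) (ft (mm y v))) <=
   (NN lborel (%s. ind {0..1} s * en (norm v * k (mm y (s *R v)))))"
  unfolding k_def by (rule metric_line[OF v U K']) (rule seg)
 then have "AE y in mu. ind U y * en (T.d (ft y) (ft (mm y v)) powr p) <=
   (NN lborel (%s. ind {0..1} s * en ((norm v * k (mm y (s *R v))) powr p)))"
 proof (rule AE_mp, intro AE_I2 impI)
  fix y assume a: "y : U --> en (T.d (ft y) (ft (mm y v))) <=
   (NN lborel (%s. ind {0..1} s * en (norm v * k (mm y (s *R v)))))"
  show "ind U y * en (T.d (ft y) (ft (mm y v)) powr p) <=
   (NN lborel (%s. ind {0..1} s * en ((norm v * k (mm y (s *R v))) powr p)))"
  proof (cases "y : U")
   case True
   have "en (T.d (ft y) (ft (mm y v)) powr p) <=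
   (NN lborel (%s. ind {0..1} s * en ((norm v * k (mm y (s *R v))) powr p)))"
   by (rule powr_le_nn_integral_01) (use a True p k0 in auto)
   then show ?thesis using True by simp
  qed simp
 qed
 then have "(NN mu (%y. ind U y * en (T.d (ft y) (ft (mm y v)) powr p))) <=
   (NN mu (%y. NN lborel (%s. ind {0..1} s * en ((norm v * k (mm y (s *R v))) powr p))))"
  by (rule nn_integral_mono_AE)
 also have "... = (NN lborel (%s. NN mu (%y. ind {0..1} s * en ((norm v * k (mm y (s *R v))) powr p))))"
  by (rule mul.Fubini'[symmetric]) simp
 also have "... = (NN lborel (%s. ind {0..1::real} s * (en (norm v powr p) * Lp_mass p k)))"
 proof (rule nn_integral_cong)
  fix s :: real
  have "(NN mu (%y. ennreal ((norm v * k (mm y (s *R v))) powr p))) = (NN mu (%y. ennreal ((norm v * k y) powr p)))"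
   by (rule nn_right[of "%y. ennreal ((norm v * k y) powr p)"]) measurable
  also have "... = en (norm v powr p) * Lp_mass p k"
   unfolding Lp_mass_def using k0 by (simp add: powr_mult ennreal_mult nn_integral_cmult)
  finally show "(NN mu (%y. ind {0..1} s * en ((norm v * k (mm y (s *R v))) powr p))) =
   ind {0..1} s * (en (norm v powr p) * Lp_mass p k)"
   by (simp add: nn_integral_cmult)
 qed
 also have "... = en (norm v powr p) * Lp_mass p k" by (simp add: nn_integral_multc)
 finally show ?thesis unfolding k_def[abs_def] .
qed

text \<open>The power g^p is at most 1 where g is at most 1, and at most g^q elsewhere; the constant
  1 is integrable on compact sets.\<close>

lemma Lp_mass_g_finite:
 assumes "compact K'" "1 <= p" "p <= q"
 shows "Lp_mass p (%x. ind K' x * g x) < \<infinity>"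
proof -
 have [measurable]: "K' : sets borel" using assms(1) by (rule borel_compact)
 have "Lp_mass p (%x. ind K' x * g x) <= (NN mu (%x. ind K' x + en (abs (g x) powr q)))"
  unfolding Lp_mass_def
 proof (rule nn_integral_mono)
  fix x
  have "abs (ind K' x * g x) powr p <= ind K' x + abs (g x) powr q"
  proof (cases "g x <= 1")
   case True
   then have "g x powr p <= 1" using assms(2) by (intro powr_le1) auto
   then show ?thesis by (auto simp: indicator_def add_increasing2)
  next
   case False
   then have "g x powr p <= g x powr q" using assms(3) by (intro powr_mono) auto
   then show ?thesis by (auto simp: indicator_def)
  qed
  then have "en (abs (ind K' x * g x) powr p) <= en (ind K' x + abs (g x) powr q)" by (rule ennreal_leI)
  then show "en (abs (ind K' x * g x) powr p) <= ind K' x + en (abs (g x) powr q)"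
   by (auto simp: indicator_def)
 qed
 also have "... = emeasure mu K' + Lp_mass q g" by (simp add: nn_integral_add Lp_mass_def)
 also have "... < \<infinity>" using compact_finite[OF assms(1)] g_mass by simp
 finally show ?thesis .
qed

text \<open>The metric difference quotients of \<open>f\<close> are bounded in \<open>L\<^sup>p\<close>, uniformly in the direction.\<close>

lemma metric_difference_Lp:
 assumes K: "compact K" "K <= Om"
 shows "\<exists>r0 K'. 0 < r0 & r0 <= 1 & compact K' & K' <= Om & K <= K' & (ALL r ze. 0 < r --> r <= r0 --> norm ze <= rh -->
  (\<forall>x\<in>K. mm x (dl r ze) : K')) &
  (\<forall>p\<in>{1..q}. \<exists>A<\<infinity>. ALL r ze. 0 < r --> r <= r0 --> norm ze <= rh -->
  (NN mu (%x. ind K x * en (T.d (ft x) (ft (mm x (dl r ze))) powr p))) <= en (r powr p) * A)"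
proof -
 obtain r0 K' U N C where W: "word_data rh Om K r0 K' U N C" using word_geometry[OF open_Om K] by blast
 note r0 = word_dataD(1,2)[OF W] and K' = word_dataD(3,4)[OF W] and U = word_dataD(5-7)[OF W] and C = word_dataD(8)[OF W]
  and words = word_dataD(9)[OF W] and seg = word_dataD(10)[OF W]
 have [measurable]: "K : sets borel" "U : sets borel" using K(1) U(1) by (auto intro: borel_compact)
 have main: "(NN mu (%x. ind K x * en (T.d (ft x) (ft (mm x (dl r ze))) powr p))) <=
   en (r powr p) * (en (real N powr p * real N * C powr p) * Lp_mass p (%x. ind K' x * g x))"
  if r: "0 < r" "r <= r0" and ze: "norm ze <= rh" and p: "p : {1..q}" for r ze p
 proof -
  obtain vs where vs: "length vs <= N" "ze = foldr mm vs 0" "\<forall>v\<in>set vs. v : layer G 1 & norm v <= C"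
   "!!r i x. 0 < r ==> r <= r0 ==> x : K ==> mm x (dl r (foldr mm (take i vs) 0)) : U"
   using words[OF ze] by blast
  define n where "n = length vs"
  \<comment> \<open>Dilated partial products. Dilations are automorphisms, so consecutive ones
    differ by one horizontal letter scaled by r, and the triangle inequality runs along
    them.\<close>
  define P where "P i = dl r (foldr mm (take i vs) 0)" for i
  have P0: "P 0 = 0" and Pn: "P n = dl r ze" by (simp_all add: P_def n_def vs(2))
  have v: "vs ! i : layer G 1" "norm (vs ! i) <= C" if "i < n" for i using vs(3) that by (auto simp: n_def)
  have PS: "P (Suc i) = mm (P i) (r *R vs ! i)" if "i < n" for i
   using that foldr_take_Suc[of i vs] dilation_layer[of 1 "vs ! i" r] v[OF that] r by (simp add: P_def n_def dilation_mult)
  define a where "a i x = T.d (ft (mm x (P i))) (ft (mm x (P (Suc i))))" for i x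
  have [measurable]: "a i : BM" for i unfolding a_def[abs_def] by measurable
  have tri: "T.d (ft x) (ft (mm x (P j))) <= (\<Sum>i<j. a i x)" for j x
  proof (induction j)
   case (Suc j)
   then show ?case using T.dist_triangle[of "ft x" "ft (mm x (P (Suc j)))" "ft (mm x (P j))"] by (simp add: a_def)
  qed (simp add: P0)
  have step: "(NN mu (%x. ind K x * en (a i x powr p))) <= en (r powr p) * (en (C powr p) * Lp_mass p (%x. ind K' x * g x))"
   if i: "i < n" for i
  proof -
   have "(NN mu (%x. ind K x * en (a i x powr p))) <=
   (NN mu (%x. ind U (mm x (P i)) * en (T.d (ft (mm x (P i))) (ft (mm (mm x (P i)) (r *R vs ! i))) powr p)))"
   proof (rule nn_integral_mono)
   fix x
   have "mm (mm x (P i)) (r *R vs ! i) = mm x (P (Suc i))" by (simp add: PS[OF i] assoc)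
   moreover have "x : K ==> mm x (P i) : U" using vs(4)[OF r] by (simp add: P_def)
   ultimately show "ind K x * en (a i x powr p) <= ind U (mm x (P i)) *
   en (T.d (ft (mm x (P i))) (ft (mm (mm x (P i)) (r *R vs ! i))) powr p)"
   by (cases "x : K") (simp_all add: a_def)
   qed
   also have "... = (NN mu (%y. ind U y * en (T.d (ft y) (ft (mm y (r *R vs ! i))) powr p)))"
   by (rule nn_right[of "%y. ind U y * en (T.d (ft y) (ft (mm y (r *R vs ! i))) powr p)"]) measurable
   also have "... <= en (norm (r *R vs ! i) powr p) * Lp_mass p (%x. ind K' x * g x)"
   by (rule metric_line_Lp[OF _ U(1) K']) (use p v[OF i] seg[OF r] subspace_scale[OF subspace_layer[of 1]] in auto)
   also have "... <= (en (r powr p) * en (C powr p)) * Lp_mass p (%x. ind K' x * g x)"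
   using r v(2)[OF i] p C
   by (intro mult_right_mono) (auto simp: powr_mult ennreal_mult[symmetric] intro!: ennreal_leI mult_left_mono powr_mono2)
   finally show ?thesis by (simp add: mult.assoc)
  qed
  have "(NN mu (%x. ind K x * en (T.d (ft x) (ft (mm x (dl r ze))) powr p))) <=
   (NN mu (%x. ennreal (real N powr p) * (\<Sum>i<n. ind K x * en (a i x powr p))))"
  proof (rule nn_integral_mono)
   fix x
   have "T.d (ft x) (ft (mm x (dl r ze))) powr p <= (\<Sum>i<n. a i x) powr p"
   using tri[of x n] p by (intro powr_mono2) (auto simp: Pn)
   also have "... <= real n powr p * (\<Sum>i<n. a i x powr p)"
   using sum_powr_le[of "{..<n}" "%i. a i x" p] p by (simp add: a_def)
   also have "... <= real N powr p * (\<Sum>i<n. a i x powr p)"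
   using vs(1) p by (intro mult_right_mono powr_mono2 sum_nonneg) (auto simp: n_def)
   finally have "en (T.d (ft x) (ft (mm x (dl r ze))) powr p) <= en (real N powr p) * (\<Sum>i<n. ennreal (a i x powr p))"
   by (simp add: ennreal_mult[symmetric] sum_nonneg ennreal_leI)
   then show "ind K x * en (T.d (ft x) (ft (mm x (dl r ze))) powr p) <=
   en (real N powr p) * (\<Sum>i<n. ind K x * en (a i x powr p))"
   by (auto simp: indicator_def)
  qed
  also have "... = en (real N powr p) * (\<Sum>i<n. NN mu (%x. ind K x * en (a i x powr p)))"
   by (subst nn_integral_cmult, measurable, subst nn_integral_sum, measurable)
  also have "... <= en (real N powr p) * (\<Sum>i<n. ennreal (r powr p) * (en (C powr p) * Lp_mass p (%x. ind K' x * g x)))"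
   by (intro mult_left_mono sum_mono step) auto
  also have "... = en (real N powr p) * (of_nat n * (en (r powr p) * (en (C powr p) * Lp_mass p (%x. ind K' x * g x))))"
   by simp
  also have "... <= en (real N powr p) * (of_nat N * (en (r powr p) * (en (C powr p) * Lp_mass p (%x. ind K' x * g x))))"
   using vs(1) by (intro mult_left_mono mult_right_mono) (auto simp: n_def)
  also have "... = en (r powr p) * (en (real N powr p * real N * C powr p) * Lp_mass p (%x. ind K' x * g x))"
   by (simp add: ennreal_mult ennreal_of_nat_eq_real_of_nat mult_ac)
  finally show ?thesis .
 qed
 have sub: "mm x (dl r ze) : K'" if t: "0 < r" "r <= r0" "norm ze <= rh" "x : K" for r ze x
 proof -
  obtain vs where "ze = foldr mm vs 0"
   "!!r i x. 0 < r ==> r <= r0 ==> x : K ==> mm x (dl r (foldr mm (take i vs) 0)) : U"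
   using words[OF t(3)] by blast
  from this(2)[OF t(1,2,4), of "length vs"] this(1) show ?thesis using U(3) by auto
 qed
 show ?thesis
 proof (intro exI[of _ r0] exI[of _ K'] conjI ballI)
  fix p assume p: "p : {1..q}"
  have "en (real N powr p * real N * C powr p) * Lp_mass p (%x. ind K' x * g x) < \<infinity>"
   using Lp_mass_g_finite[OF K'(1), of p] p by (simp add: ennreal_mult_less_top)
  then show "\<exists>A<\<infinity>. ALL r ze. 0 < r --> r <= r0 --> norm ze <= rh -->
   (NN mu (%x. ind K x * en (T.d (ft x) (ft (mm x (dl r ze))) powr p))) <= en (r powr p) * A"
   using main p by blast
 qed (use r0 K' U sub in auto)
qed

end

section \<open>Representation of functionals on test functions\<close>

lemma L1_complete:
 fixes ph :: "nat => 'a => real"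
 assumes int: "!!n. integrable M (ph n)"
  and a: "!!n. (NN M (%x. ennreal (abs (ph (Suc n) x - ph n x)))) <= en (a n)" "!!n. 0 <= a n" "summable a"
 shows "EX w. integrable M w & (ALL b B. b : borel_measurable M --> (ALL x. abs (b x) <= B) -->
  (%n. LINT x|M. b x * ph n x) \<longlonglongrightarrow> (LINT x|M. b x * w x))"
proof -
 define h where "h i x = ph (Suc i) x - ph i x" for i x
 have ih: "integrable M (h i)" for i unfolding h_def[abs_def] by (intro Bochner_Integration.integrable_diff int)
 have [measurable]: "h i : borel_measurable M" for i using ih by (rule borel_measurable_integrable)
 have nh: "(LINT x|M. abs (h i x)) <= a i" for i
 proof -
  have "en (LINT x|M. abs (h i x)) = (NN M (%x. ennreal (abs (h i x))))"
   by (rule nn_integral_eq_integral[symmetric]) (use ih[of i] in auto)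
  then have "en (LINT x|M. abs (h i x)) <= en (a i)" using a(1)[of i] by (simp only: h_def)
  then show ?thesis by (simp only: ennreal_le_iff[OF a(2)])
 qed
 have sh: "summable (%i. LINT x|M. abs (h i x))"
  by (rule summable_comparison_test'[OF a(3), of 0]) (use nh in auto)
 have "(NN M (%x. (\<Sum>i. ennreal (abs (h i x))))) = (\<Sum>i. NN M (%x. ennreal (abs (h i x))))"
  by (rule nn_integral_suminf) measurable
 also have "... <= (\<Sum>i. ennreal (a i))" by (rule suminf_le) (use a(1) in \<open>auto simp: h_def\<close>)
 also have "... < \<infinity>" using a(2,3) by (simp add: suminf_ennreal2)
 finally have "(NN M (%x. (\<Sum>i. ennreal (abs (h i x))))) ~= \<infinity>" by simp
 then have "AE x in M. (\<Sum>i. ennreal (abs (h i x))) ~= \<infinity>" by (rule nn_integral_PInf_AE[rotated]) measurable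
 then have ae: "AE x in M. summable (%i. abs (h i x))"
  by (rule AE_mp) (auto intro!: AE_I2 summable_suminf_not_top)
 \<comment> \<open>The limit is \<open>ph 0\<close> plus the sum of all increments, which converges
   absolutely almost everywhere and in L^1.\<close>
 define s where "s x = (\<Sum>i. h i x)" for x
 have [measurable]: "s : borel_measurable M" unfolding s_def[abs_def] by measurable
 have ints: "integrable M s" unfolding s_def[abs_def]
  by (rule integrable_suminf[OF ih]) (use ae sh in auto)
 have "(%n. LINT x|M. b x * ph n x) \<longlonglongrightarrow> (LINT x|M. b x * (ph 0 x + s x))"
  if [measurable]: "b : borel_measurable M" and B: "!!x. abs (b x) <= B" for b B
 proof -
  have im: "integrable M (%x. b x * k x)" if k: "integrable M k" for k :: "'a => real"
  proof (rule Bochner_Integration.integrable_bound[where f = "%x. B * k x"])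
   have [measurable]: "k : borel_measurable M" using k by (rule borel_measurable_integrable)
   show "(%x. b x * k x) : borel_measurable M" by measurable
   have "abs (b x) * abs (k x) <= abs B * abs (k x)" for x using B[of x] by (intro mult_right_mono) auto
   then show "AE x in M. norm (b x * k x) <= norm (B * k x)" by (simp add: abs_mult)
  qed (use k in simp)
  have ae': "AE x in M. summable (%i. norm (b x * h i x))"
  proof (rule AE_mp[OF ae], intro AE_I2 impI)
   fix x assume "summable (%i. abs (h i x))"
   then show "summable (%i. norm (b x * h i x))" by (simp add: abs_mult summable_mult)
  qed
  have "summable (%i. LINT x|M. norm (b x * h i x))"
  proof (rule summable_comparison_test'[OF summable_mult[OF sh, of "abs B"], of 0])
   fix i
   have "(LINT x|M. norm (b x * h i x)) <= (LINT x|M. abs B * abs (h i x))"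
   proof (rule integral_mono)
   show "integrable M (%x. norm (b x * h i x))" using im[OF ih[of i]] by (rule integrable_norm)
   show "integrable M (%x. abs B * abs (h i x))" using ih[of i] by simp
   fix x show "norm (b x * h i x) <= abs B * abs (h i x)"
   using B[of x] by (simp add: abs_mult mult_right_mono)
   qed
   then show "norm (LINT x|M. norm (b x * h i x)) <= abs B * (LINT x|M. abs (h i x))" by simp
  qed
  from sums_integral[OF im[OF ih] ae' this]
  have "(%n. \<Sum>i<n. LINT x|M. b x * h i x) \<longlonglongrightarrow> (LINT x|M. (\<Sum>i. b x * h i x))" by (simp add: sums_def)
  moreover have "(LINT x|M. (\<Sum>i. b x * h i x)) = (LINT x|M. b x * s x)"
  proof (rule integral_cong_AE)
   show "AE x in M. (\<Sum>i. b x * h i x) = b x * s x"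
   by (rule AE_mp[OF ae]) (auto intro!: AE_I2 suminf_mult summable_rabs_cancel simp: s_def)
  qed measurable
  moreover have "(\<Sum>i<n. LINT x|M. b x * h i x) = (LINT x|M. b x * ph n x) - (LINT x|M. b x * ph 0 x)" for n
  proof -
   have "(LINT x|M. b x * h i x) = (LINT x|M. b x * ph (Suc i) x) - (LINT x|M. b x * ph i x)" for i
   unfolding h_def right_diff_distrib by (rule Bochner_Integration.integral_diff) (rule im[OF int])+
   then show ?thesis using sum_lessThan_telescope[of "%i. LINT x|M. b x * ph i x" n] by simp
  qed
  ultimately have "(%n. (LINT x|M. b x * ph n x) - (LINT x|M. b x * ph 0 x)) \<longlonglongrightarrow> (LINT x|M. b x * s x)" by simp
  from tendsto_add[OF this tendsto_const[of "LINT x|M. b x * ph 0 x"]]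
  have "(%n. LINT x|M. b x * ph n x) \<longlonglongrightarrow> (LINT x|M. b x * s x) + (LINT x|M. b x * ph 0 x)" by simp
  moreover have "(LINT x|M. b x * (ph 0 x + s x)) = (LINT x|M. b x * s x) + (LINT x|M. b x * ph 0 x)"
   using im[OF int[of 0]] im[OF ints] by (simp add: distrib_left add.commute)
  ultimately show ?thesis by simp
 qed
 moreover have "integrable M (%x. ph 0 x + s x)" using int ints by auto
 ultimately show ?thesis by (intro exI[of _ "%x. ph 0 x + s x"]) auto
qed

lemma two_mult_le:
 fixes a b c :: real
 assumes "0 < c"
 shows "2 * (a * b) <= c * a^2 + b^2 / c"
proof -
 have "0 <= (c * a - b)^2 / c" using assms by simp
 also have "... = c * a^2 + b^2 / c - 2 * (a * b)" using assms by (simp add: power2_eq_square field_simps)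
 finally show ?thesis by simp
qed

context carnot_haar begin

text \<open>On the n-th spherical shell the weight is 2^n times one plus the measure of the ball of
  radius n, so the shell contributes at most 2^(-n) to the integral of the reciprocal.\<close>

lemma weight:
 "EX ka. ka : BM & (ALL x. 1 <= ka x) & (ALL R. EX B. ALL x. norm x <= R --> ka x <= B) &
  (NN mu (%x. ennreal (1 / ka x))) < \<infinity>"
proof -
 define c where "c n = 2 ^ n * (1 + measure mu (cball 0 (real n)))" for n :: nat
 have c1: "1 <= c n" for n
  using mult_mono[of 1 "2 ^ n" 1 "1 + measure mu (cball 0 (real n))"] by (simp add: c_def)
 have cm: "c m <= c n" if "m <= n" for m n
  unfolding c_def using that emeasure_cball_finite[of 0 "real n"]
  by (intro mult_mono add_left_mono measure_mono_fmeasurable power_increasing) (auto simp: fmeasurable_def)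
 define ka where "ka x = c (nat \<lceil>norm x\<rceil>)" for x :: 'a
 have [measurable]: "ka : BM" unfolding ka_def[abs_def] by measurable
 have "(NN mu (%x. ennreal (1 / ka x))) <= (NN mu (%x. (\<Sum>n. ennreal (1 / c n) * ind (cball 0 (real n)) x)))"
 proof (rule nn_integral_mono)
  fix x :: 'a
  let ?n = "nat \<lceil>norm x\<rceil>"
  have "en (1 / ka x) = en (1 / c ?n) * ind (cball 0 (real ?n)) x"
   by (simp add: ka_def real_nat_ceiling_ge)
  also have "... <= (\<Sum>n. ennreal (1 / c n) * ind (cball 0 (real n)) x)"
   using sum_le_suminf[of "%n. ennreal (1 / c n) * ind (cball 0 (real n)) x" "{?n}"] by simp
  finally show "en (1 / ka x) <= (\<Sum>n. ennreal (1 / c n) * ind (cball 0 (real n)) x)" .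
 qed
 also have "... = (\<Sum>n. ennreal (1 / c n) * emeasure mu (cball 0 (real n)))"
 proof -
  have e: "(NN mu (%x. ennreal (1 / c n) * ind (cball 0 (real n)) x)) = en (1 / c n) * emeasure mu (cball 0 (real n))" for n :: nat
   by (rule nn_integral_cmult_indicator) (simp add: borel_closed)
  have "(NN mu (%x. (\<Sum>n. ennreal (1 / c n) * ind (cball 0 (real n)) x))) = (\<Sum>n. NN mu (%x. ennreal (1 / c n) * ind (cball 0 (real n)) x))"
   by (rule nn_integral_suminf) (use borel_closed[OF closed_cball] in measurable)
  then show ?thesis unfolding e .
 qed
 also have "... <= (\<Sum>n. ennreal ((1 / 2) ^ n))"
 proof (rule suminf_le)
  fix n :: nat
  have "emeasure mu (cball 0 (real n)) = en (measure mu (cball 0 (real n)))"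
   using emeasure_cball_finite[of 0 "real n"] by (intro emeasure_eq_ennreal_measure) auto
  moreover have "1 / c n * measure mu (cball 0 (real n)) <= (1 / 2) ^ n"
  proof -
   define M where "M = measure mu (cball 0 (real n) :: 'a set)"
   have "0 <= M" by (simp add: M_def)
   then have "(1 / 2) ^ n * (M / (1 + M)) <= (1 / 2) ^ n * 1" by (intro mult_left_mono) auto
   moreover have "1 / c n * M = (1 / 2) ^ n * (M / (1 + M))" by (simp add: c_def M_def power_one_over)
   ultimately show ?thesis by (simp add: M_def)
  qed
  moreover have "0 <= 1 / c n" using c1[of n] by simp
  ultimately show "en (1 / c n) * emeasure mu (cball 0 (real n)) <= en ((1 / 2) ^ n)"
   by (simp only: ennreal_mult[symmetric] measure_nonneg ennreal_leI)
 qed auto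
 also have "... < \<infinity>" by (simp add: suminf_ennreal2)
 finally have "(NN mu (%x. ennreal (1 / ka x))) < \<infinity>" .
 moreover have "EX B. ALL x. norm x <= R --> ka x <= B" for R
  by (rule exI[of _ "c (nat \<lceil>R\<rceil>)"]) (auto simp: ka_def intro!: cm nat_mono ceiling_mono)
 ultimately show ?thesis using c1 by (intro exI[of _ ka]) (auto simp: ka_def)
qed

lemma integrable_bounded_compact:
 fixes b :: "'a => real"
 assumes [measurable]: "b : BM" and K: "compact K" "!!x. x \<notin> K ==> b x = 0" "!!x. x : K ==> abs (b x) <= B"
 shows "integrable mu b"
proof (rule Bochner_Integration.integrable_bound[where f = "%x. B * ind K x"])
 have "integrable mu (ind K :: 'a => real)"
  using compact_finite[OF K(1)] K(1) by (intro integrable_real_indicator) (auto intro: borel_compact)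
 then show "integrable mu (%x. B * ind K x)" by simp
 have "norm (b x) <= norm (B * ind K x :: real)" for x
  using K(2,3)[of x] by (cases "x : K") auto
 then show "AE x in mu. norm (b x) <= norm (B * ind K x :: real)" by simp
qed simp

lemma test_function_combine:
 assumes "test_function Om ph" "test_function Om ps"
 shows "test_function Om (%x. ph x + t * ps x)"
proof -
 obtain K where K: "smooth_on ph UNIV" "compact K" "K <= Om" "!!x. x \<notin> K ==> ph x = 0"
  using assms(1) by (rule test_functionE) blast
 obtain L where L: "smooth_on ps UNIV" "compact L" "L <= Om" "!!x. x \<notin> L ==> ps x = 0"
  using assms(2) by (rule test_functionE) blast
 show ?thesis
  by (rule test_functionI[of _ "K \<union> L"]) (use K L in \<open>auto intro!: smooth_on_add smooth_on_mult smooth_on_const\<close>)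
qed

text \<open>The Riesz representation theorem for the weighted space \<open>L^2(ka mu)\<close>, by minimising
 \<open>\<integral> ph^2 ka - 2 La ph\<close>.  As \<open>1 / ka\<close> is integrable, minimising sequences converge in \<open>L\<^sup>1(mu)\<close>.\<close>

lemma represent_functional:
 fixes La :: "('a => real) => real"
 assumes La: "!!ph ps t. test_function Om ph ==> test_function Om ps ==> La (%x. ph x + t * ps x) = La ph + t * La ps"
  and [measurable]: "g : BM" and g: "(NN mu (%x. ennreal ((g x)^2 / ka x))) < \<infinity>"
  and le: "!!ph. test_function Om ph ==> en (abs (La ph)) <= (NN mu (%x. ennreal (g x * abs (ph x))))"
  and ka[measurable]: "ka : BM" and ka1: "!!x. 1 <= ka x"
  and kaB: "!!R. EX B. ALL x. norm x <= R --> ka x <= B" and kaI: "(NN mu (%x. ennreal (1 / ka x))) < \<infinity>"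
 shows "EX w. Lp_loc mu 1 Om w & (ALL ph. test_function Om ph --> La ph = (LINT x:Om|mu. w x * ph x))"
proof -
 have ka0: "0 < ka x" for x using ka1[of x] by linarith
 have kaK: "EX B. \<forall>x\<in>K. abs (ka x) <= B" if cK: "compact K" for K
 proof -
  obtain R where "!!x. x : K ==> norm x <= R" using compact_imp_bounded[OF cK] unfolding bounded_iff by blast
  moreover obtain B where "!!x. norm x <= R ==> ka x <= B" using kaB by blast
  ultimately show ?thesis using ka0 by (intro exI[of _ B]) (auto simp: abs_of_pos)
 qed
 note test = test_function_combine
 have meas: "ph : BM" if "test_function Om ph" for ph
  by (rule borel_measurable_continuous_onI, rule smooth_on_continuous) (use that in \<open>simp add: test_function_def\<close>)
 have bdd: "EX K B. compact K & K <= Om & (ALL x. x \<notin> K --> ph x = 0) & (ALL x. abs (ph x) <= B) & (ALL x. abs (ph x * ka x) <= B)"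
  if t: "test_function Om ph" for ph
 proof -
  obtain K where K: "smooth_on ph UNIV" "compact K" "K <= Om" "!!x. x \<notin> K ==> ph x = 0"
   using t by (rule test_functionE) blast
  obtain B where B: "0 <= B" "!!x. abs (ph x) <= B" using bounded_test[OF smooth_on_continuous[OF K(1)] K(2,4)] by blast
  obtain B' where B': "!!x. x : K ==> abs (ka x) <= B'" using kaK[OF K(2)] by blast
  have "abs (ph x * ka x) <= B * abs B'" for x
   using B B'[of x] K(4)[of x] by (cases "x : K") (auto simp: abs_mult intro!: mult_mono)
  then have "abs (ph x * ka x) <= max B (B * abs B')" for x by (meson max.coboundedI2)
  moreover have "abs (ph x) <= max B (B * abs B')" for x using B(2)[of x] by simp
  ultimately show ?thesis using K(2-4) by blast
 qed
 have int1: "integrable mu ph" if t: "test_function Om ph" for ph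
  using bdd[OF t] integrable_bounded_compact[OF meas[OF t]] by blast
 have int2: "integrable mu (%x. ph x * ka x * ps x)" if t: "test_function Om ph" "test_function Om ps" for ph ps
 proof -
  note [measurable] = meas[OF t(1)] meas[OF t(2)]
  obtain K B where K: "compact K" "!!x. x \<notin> K ==> ph x = 0" "!!x. abs (ph x * ka x) <= B" using bdd[OF t(1)] by blast
  obtain B' where B': "!!x. abs (ps x) <= B'" using bdd[OF t(2)] by blast
  have "abs (ph x * ka x * ps x) <= B * B'" for x
   unfolding abs_mult[of "ph x * ka x"] using K(3)[of x] B'[of x] by (intro mult_mono) (auto intro: order_trans[OF abs_ge_zero])
  then show ?thesis by (intro integrable_bounded_compact[OF _ K(1)]) (use K(2) in auto)
 qed
 \<comment> \<open>\<open>I\<close> is the inner product of the weighted L^2 space; the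
   Euler-Lagrange equation of \<open>J\<close> reads \<open>I ph ps = La ps\<close>.\<close>
 define I where "I ph ps = (LINT x|mu. ph x * ka x * ps x)" for ph ps
 define J where "J ph = I ph ph - 2 * La ph" for ph
 have Jline: "J (%x. ph x + t * ps x) = J ph + 2 * t * (I ph ps - La ps) + t^2 * I ps ps"
  if t: "test_function Om ph" "test_function Om ps" for ph ps t
 proof -
  have "I (%x. ph x + t * ps x) (%x. ph x + t * ps x) =
   (LINT x|mu. ph x * ka x * ph x + (2 * t) * (ph x * ka x * ps x) + t^2 * (ps x * ka x * ps x))"
   unfolding I_def by (rule Bochner_Integration.integral_cong) (auto simp: algebra_simps power2_eq_square)
  also have "... = I ph ph + (2 * t) * I ph ps + t^2 * I ps ps"
   unfolding I_def using int2[OF t(1) t(1)] int2[OF t] int2[OF t(2) t(2)] by simp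
  finally show ?thesis unfolding J_def La[OF t] by (simp add: algebra_simps)
 qed
 have Q: "(NN mu (%x. ennreal (ka x * (ph x)^2))) = en (I ph ph)" "0 <= I ph ph" if t: "test_function Om ph" for ph
 proof -
  have e: "ka x * (ph x)^2 = ph x * ka x * ph x" for x by (simp add: power2_eq_square)
  have p: "0 <= ph x * ka x * ph x" for x using ka0[of x] unfolding e[symmetric] by simp
  show "(NN mu (%x. ennreal (ka x * (ph x)^2))) = en (I ph ph)"
   unfolding e I_def by (rule nn_integral_eq_integral[OF int2[OF t t]]) (simp add: p)
  show "0 <= I ph ph" unfolding I_def by (rule Bochner_Integration.integral_nonneg) (rule p)
 qed
 obtain A where A: "(NN mu (%x. ennreal ((g x)^2 / ka x))) = ennreal A" "0 <= A" using g by (cases "NN mu (%x. ennreal ((g x)^2 / ka x))") auto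
 obtain W where W: "(NN mu (%x. ennreal (1 / ka x))) = ennreal W" "0 <= W" using kaI by (cases "NN mu (%x. ennreal (1 / ka x))") auto
 \<comment> \<open>The weighted Young inequality bounds 2 g |ph| by ka ph^2 + g^2 / ka; the first
   term is absorbed by \<open>I ph ph\<close>.\<close>
 have Jlow: "- A <= J ph" if t: "test_function Om ph" for ph
 proof -
  note [measurable] = meas[OF t]
  have "2 * en (abs (La ph)) <= 2 * (NN mu (%x. ennreal (g x * abs (ph x))))" by (intro mult_left_mono le[OF t]) simp
  also have "... = (NN mu (%x. 2 * en (g x * abs (ph x))))" by (rule nn_integral_cmult[symmetric]) measurable
  also have "... <= (NN mu (%x. ennreal (ka x * (ph x)^2) + en ((g x)^2 / ka x)))"
  proof (rule nn_integral_mono)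
   fix x
   have "2 * (g x * abs (ph x)) <= ka x * (ph x)^2 + (g x)^2 / ka x"
   using two_mult_le[OF ka0[of x], of "abs (ph x)" "g x"] by (simp add: mult.commute)
   then have "en (2 * (g x * abs (ph x))) <= en (ka x * (ph x)^2) + en ((g x)^2 / ka x)"
   using less_imp_le[OF ka0[of x]] by (simp add: ennreal_plus[symmetric] ennreal_leI del: ennreal_plus)
   then show "2 * en (g x * abs (ph x)) <= en (ka x * (ph x)^2) + en ((g x)^2 / ka x)"
   by (simp add: ennreal_mult')
  qed
  also have "... = en (I ph ph) + ennreal A" by (subst nn_integral_add) (auto simp: Q(1)[OF t] A(1))
  finally have "en (2 * abs (La ph)) <= en (I ph ph + A)" using Q(2)[OF t] A(2) by (simp add: ennreal_mult)
  then have "2 * abs (La ph) <= I ph ph + A" using Q(2)[OF t] A(2) by (simp add: ennreal_le_iff del: ennreal_plus)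
  then show ?thesis by (simp add: J_def)
 qed
 define m where "m = (INF ph\<in>{ph. test_function Om ph}. J ph)"
 have t0: "test_function Om (%_. 0)" by (rule test_functionI[of _ "{}"]) (auto intro: smooth_on_const)
 have bb: "bdd_below (J ` {ph. test_function Om ph})" by (rule bdd_belowI[of _ "- A"]) (use Jlow in auto)
 have m: "m <= J ph" if "test_function Om ph" for ph unfolding m_def by (rule cINF_lower[OF bb]) (use that in simp)
 \<comment> \<open>The rate 16^(-n) yields increments of order 4^(-n) in the weighted norm, enough
   to absorb the factors 2^n in the passage to L^1.\<close>
 have "EX ph. test_function Om ph & J ph < m + (1 / 16) ^ n" for n
  using cINF_less_iff[OF _ bb, of "m + (1 / 16) ^ n"] t0 by (auto simp flip: m_def)
 then obtain ph where tph: "!!n. test_function Om (ph n)" and Jph: "!!n. J (ph n) < m + (1 / 16) ^ n" by metis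
 \<comment> \<open>Parallelogram argument: \<open>J\<close> is at least \<open>m\<close> at the
   midpoint, while both endpoints are close to \<open>m\<close>.\<close>
 have Qd: "I (%x. ph (Suc n) x + (- 1) * ph n x) (%x. ph (Suc n) x + (- 1) * ph n x) <= 4 * (1 / 16) ^ n" for n
 proof -
  define D where "D x = ph (Suc n) x + (- 1) * ph n x" for x
  have tD: "test_function Om D" unfolding D_def[abs_def] by (rule test[OF tph tph])
  have "J (ph (Suc n)) = J (ph n) + 2 * (I (ph n) D - La D) + I D D"
   using Jline[OF tph[of n] tD, of 1] by (simp add: D_def)
  moreover have "m <= J (ph n) + (I (ph n) D - La D) + I D D / 4"
   using m[OF test[OF tph[of n] tD, of "1 / 2"]] Jline[OF tph[of n] tD, of "1 / 2"] by (simp add: power2_eq_square)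
  moreover have "(1 / 16 :: real) ^ Suc n <= (1 / 16) ^ n" by simp
  ultimately have "I D D <= 4 * (1 / 16) ^ n" using Jph[of n] Jph[of "Suc n"] by argo
  then show ?thesis by (simp add: D_def[abs_def])
 qed
 \<comment> \<open>Near-minimality up to 16^(-n), tested with the steps 4^(-n) and -4^(-n), gives
   the Euler-Lagrange equation up to an error of order 4^(-n).\<close>
 have EL: "(%n. I (ph n) ps) \<longlonglongrightarrow> La ps" if t: "test_function Om ps" for ps
 proof -
  have b: "abs (I (ph n) ps - La ps) <= (1 + I ps ps) * (1 / 4) ^ n" for n
  proof -
   define s where "s = (1 / 4 :: real) ^ n"
   have s: "0 < s" "s^2 = (1 / 16) ^ n" by (simp_all add: s_def power2_eq_square flip: power_mult_distrib)
   define \<beta> where "\<beta> = I (ph n) ps - La ps"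
   have *: "- (s * s) <= 2 * ta * \<beta> + ta^2 * I ps ps" for ta
   using m[OF test[OF tph[of n] t, of ta]] Jline[OF tph[of n] t, of ta] Jph[of n] s(2) by (simp add: \<beta>_def power2_eq_square)
   have "0 <= s * (s + 2 * \<beta> + s * I ps ps)" "0 <= s * (s - 2 * \<beta> + s * I ps ps)"
   using *[of s] *[of "- s"] by (simp_all add: algebra_simps power2_eq_square)
   then have "0 <= s + 2 * \<beta> + s * I ps ps" "0 <= s - 2 * \<beta> + s * I ps ps"
   using s(1) by (simp_all add: zero_le_mult_iff)
   moreover have "0 <= s * I ps ps" using s Q(2)[OF t] by simp
   ultimately have "abs \<beta> <= s + s * I ps ps" using s(1) by linarith
   then show ?thesis by (simp add: \<beta>_def s_def algebra_simps)
  qed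
  have "(%n. (1 + I ps ps) * (1 / 4) ^ n) \<longlonglongrightarrow> (1 + I ps ps) * 0"
   by (intro tendsto_mult_left LIMSEQ_realpow_zero) auto
  then have lim: "(%n. (1 + I ps ps) * (1 / 4) ^ n) \<longlonglongrightarrow> 0" by simp
  have "\<forall>\<^sub>F n in sequentially. norm (I (ph n) ps - La ps) <= (1 + I ps ps) * (1 / 4) ^ n"
   using b by (intro always_eventually) simp
  from LIM_zero_cancel[OF Lim_null_comparison[OF this lim]] show ?thesis .
 qed
 \<comment> \<open>Majorant of the L^1 increments, from |D| <= 2^n ka D^2 / 2 + 2^(-n) / (2 ka): the
   first term contributes 2^n / 2 times 4 * 16^(-n).\<close>
 define a where "a n = 2 * (1 / 8) ^ n + W * (1 / 2) ^ n" for n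
 have "EX w. integrable mu w & (ALL b B. b : borel_measurable mu --> (ALL x. abs (b x) <= B) -->
  (%n. LINT x|mu. b x * ph n x) \<longlonglongrightarrow> (LINT x|mu. b x * w x))"
 proof (rule L1_complete)
  show "integrable mu (ph n)" for n by (rule int1[OF tph])
  show "0 <= a n" for n using W(2) by (simp add: a_def)
  show "summable a" unfolding a_def by (intro summable_add summable_mult summable_geometric) auto
  show "(NN mu (%x. ennreal (abs (ph (Suc n) x - ph n x)))) <= en (a n)" for n
  proof -
   define D where "D x = ph (Suc n) x + (- 1) * ph n x" for x
   have tD: "test_function Om D" unfolding D_def[abs_def] by (rule test[OF tph tph])
   note [measurable] = meas[OF tD]
   have "(NN mu (%x. ennreal (abs (ph (Suc n) x - ph n x)))) <=
   (NN mu (%x. ennreal (2 ^ n / 2) * en (ka x * (D x)^2) + en ((1 / 2) ^ n / 2) * en (1 / ka x)))"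
   proof (rule nn_integral_mono)
   fix x
   have "2 * (abs (D x) * 1) <= (2 ^ n * ka x) * abs (D x)^2 + 1^2 / (2 ^ n * ka x)"
   by (rule two_mult_le) (use ka0 in simp)
   then have "abs (D x) <= 2 ^ n / 2 * (ka x * (D x)^2) + (1 / 2) ^ n / 2 * (1 / ka x)"
   using ka0[of x] by (simp add: power_one_over field_simps)
   then show "en (abs (ph (Suc n) x - ph n x)) <=
   en (2 ^ n / 2) * en (ka x * (D x)^2) + en ((1 / 2) ^ n / 2) * en (1 / ka x)"
   using less_imp_le[OF ka0[of x]]
   by (simp add: D_def ennreal_mult[symmetric] ennreal_plus[symmetric] ennreal_leI del: ennreal_plus)
   qed
   also have "... = en (2 ^ n / 2) * en (I D D) + en ((1 / 2) ^ n / 2) * ennreal W"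
   by (subst nn_integral_add) (auto simp: nn_integral_cmult Q(1)[OF tD] W(1))
   also have "... = en (2 ^ n / 2 * I D D + (1 / 2) ^ n / 2 * W)"
   using Q(2)[OF tD] W(2) by (simp add: ennreal_mult[symmetric])
   also have "... <= en (a n)"
   proof (rule ennreal_leI)
   have "2 ^ n / 2 * I D D <= 2 ^ n / 2 * (4 * (1 / 16) ^ n)" using Qd[of n] by (intro mult_left_mono) (simp_all add: D_def[abs_def])
   also have "... = 2 * (2 * (1 / 16)) ^ n" by (simp only: power_mult_distrib)
   finally have "2 ^ n / 2 * I D D <= 2 * (1 / 8) ^ n" by simp
   moreover have "(1 / 2) ^ n / 2 * W <= W * (1 / 2) ^ n" using W(2) by (simp add: mult.commute)
   ultimately show "2 ^ n / 2 * I D D + (1 / 2) ^ n / 2 * W <= a n" unfolding a_def by linarith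
   qed
   finally show ?thesis .
  qed
 qed
 then obtain w where w: "integrable mu w"
  "!!b B. b : borel_measurable mu ==> (!!x. abs (b x) <= B) ==> (%n. LINT x|mu. b x * ph n x) \<longlonglongrightarrow> (LINT x|mu. b x * w x)" by blast
 have [measurable]: "w : BM" using borel_measurable_integrable[OF w(1)] by simp
 \<comment> \<open>\<open>w\<close> represents the functional in the weighted inner product, so its
   density with respect to \<open>mu\<close> is \<open>ka * w\<close>.\<close>
 have "Lp_loc mu 1 Om (%x. ka x * w x)"
 proof (rule Lp_loc_1I)
  fix K assume K: "compact K" "K <= Om"
  have [measurable]: "K : sets borel" using K(1) by (rule borel_compact)
  obtain B where B: "!!x. x : K ==> abs (ka x) <= B" using kaK[OF K(1)] by blast
  have "norm (ind K x * (ka x * w x)) <= norm (B * w x)" for x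
   using mult_right_mono[OF order_trans[OF B abs_ge_self[of B]], of x "abs (w x)"] by (auto simp: indicator_def abs_mult)
  then have "AE x in mu. norm (ind K x * (ka x * w x)) <= norm (B * w x)" by (rule AE_I2)
  with _ _ show "integrable mu (%x. ind K x * (ka x * w x))"
  proof (rule Bochner_Integration.integrable_bound)
   show "integrable mu (%x. B * w x)" using w(1) by simp
   show "(%x. ind K x * (ka x * w x)) : borel_measurable mu" by measurable
  qed
 qed
 moreover have "La ps = (LINT x:Om|mu. (ka x * w x) * ps x)" if t: "test_function Om ps" for ps
 proof -
  note [measurable] = meas[OF t]
  obtain K B where K: "K <= Om" "!!x. x \<notin> K ==> ps x = 0" and B: "!!x. abs (ps x * ka x) <= B" using bdd[OF t] by blast
  have "(%n. LINT x|mu. (ps x * ka x) * ph n x) \<longlonglongrightarrow> (LINT x|mu. (ps x * ka x) * w x)"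
   by (rule w(2)[OF _ B]) simp
  moreover have "(LINT x|mu. (ps x * ka x) * ph n x) = I (ph n) ps" for n unfolding I_def by (simp add: mult_ac)
  ultimately have "La ps = (LINT x|mu. (ps x * ka x) * w x)" using LIMSEQ_unique[OF EL[OF t]] by simp
  also have "... = (LINT x:Om|mu. (ka x * w x) * ps x)"
   unfolding set_lebesgue_integral_def
   by (rule Bochner_Integration.integral_cong) (use K in \<open>auto simp: indicator_def\<close>)
  finally show ?thesis .
 qed
 ultimately show ?thesis by blast
qed

end

section \<open>Weak derivatives of Lipschitz coordinates\<close>

context carnot_group begin

text \<open>\<open>proj 1\<close> is a homomorphism into the additive group, so a first-layer
  coordinate changes by that of the group difference; \<open>proj_le_dist\<close> with k = 1 bounds
  it linearly by the distance.\<close>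

lemma coordinate_lipschitz:
 assumes B: "adapted_basis G B" and b: "b : B" "b : layer G 1"
 shows "\<exists>L\<ge>0. \<forall>p p'. abs (representation B p b - representation B p' b) <= L * d p p'"
proof -
 note lin = linear_representation[OF B, of b]
 obtain C where C: "0 <= C" "!!x k. k : {1..step G} ==> norm (proj k x) <= C * d 0 x ^ k" using proj_le_dist by blast
 obtain N where N: "0 < N" "!!x. norm (representation B x b) <= norm x * N"
  using bounded_linear.pos_bounded[OF bounded_linear_representation[OF B, of b]] by blast
 have r1: "representation B (proj 1 x) b = representation B x b" for x
  using representation_proj[OF B, of 1 b x] b by simp
 have "abs (representation B p b - representation B p' b) <= (C * N) * d p p'" for p p'
 proof -
  define z where "z = mm (- p) p'"
  have s: "1 <= step G"
  proof (rule ccontr)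
   assume "\<not> 1 <= step G"
   then have "layer G 1 = {0}" by (intro layers_above) simp
   then show False using b B dependent_zero[of B] by (auto simp: adapted_basis_def)
  qed
  have "p' = mm p z" unfolding z_def by (metis assoc right_inverse left_neutral)
  then have "proj 1 p' = proj 1 p + proj 1 z"
   using proj_mul[of 1 z p] upper_1 by simp
  then have "representation B p' b = representation B p b + representation B (proj 1 z) b"
   using linear_add[OF lin, of "proj 1 p" "proj 1 z"] by (simp only: r1[of p, symmetric] r1[of p', symmetric])
  then have "abs (representation B p b - representation B p' b) = norm (representation B (proj 1 z) b)" by simp
  also have "... <= norm (proj 1 z) * N" by (rule N(2))
  also have "... <= (C * d 0 z ^ 1) * N" using C(2)[of 1 z] N(1) s by (intro mult_right_mono) auto
  also have "d 0 z = d p p'" by (simp add: z_def dist_eq_0[of p p'])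
  finally show ?thesis by (simp add: mult_ac)
 qed
 then show ?thesis using C(1) N(1) by (intro exI[of _ "C * N"]) auto
qed

lemma lie_deriv_combine:
 fixes ph ps :: "'a => real"
 assumes "smooth_on ph UNIV" "smooth_on ps UNIV"
 shows "lie_deriv G v (%x. ph x + t * ps x) x = lie_deriv G v ph x + t * lie_deriv G v ps x"
proof -
 have "((%x. ph x + t * ps x) has_derivative (%h. frechet_derivative ph (at x) h + t * frechet_derivative ps (at x) h)) (at x)"
  by (rule has_derivative_add[OF smooth_on_has_derivative[OF assms(1)] has_derivative_mult_right[OF smooth_on_has_derivative[OF assms(2)]]])
 from frechet_derivative_at[OF this] show ?thesis unfolding lie_deriv_def by metis
qed

end

context carnot_haar begin

lemma translate_has_derivative:
 assumes K: "smooth_on ph UNIV" and iu: "integrable mu (u' :: 'a => real)" and uz: "!!y. y \<notin> K' ==> u' y = 0" and K': "compact K'"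
 shows "((%s. LINT y|mu. ph (mm y (s *R v)) * u' y) has_vector_derivative (LINT y|mu. u' y * lie_deriv G v ph y)) (at 0)"
proof -
 define H0 where "H0 p = ph (mm (snd p) (fst p *R v))" for p :: "real \<times> 'a"
 have "smooth_on (%p::real \<times> 'a. fst p *R v) UNIV"
  by (intro smooth_on_linear bounded_linear_scaleR_const bounded_linear_fst)
 then have sH: "smooth_on H0 UNIV"
  unfolding H0_def[abs_def]
  by (intro smooth_on_compose[OF K] smooth_on_compose[OF smooth_mult smooth_on_Pair, simplified]
   smooth_on_linear[OF bounded_linear_snd])
 define ps where "ps s = (LINT y|mu. H0 (s, y) *R u' y)" for s
 define c where "c = (LINT y|mu. u' y * lie_deriv G v ph y)"
 have lH: "linear (frechet_derivative H0 (at p))" for p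
  by (rule has_derivative_linear[OF smooth_on_has_derivative[OF sH]])
 have ld: "lie_deriv G v ph y = frechet_derivative H0 (at (0, y)) (1, 0)" for y
 proof -
  have "((%t. (t, y)) has_derivative (%t. (t, 0))) (at 0)"
   by (auto intro!: derivative_eq_intros)
  from has_derivative_compose[OF this smooth_on_has_derivative[OF sH]]
  have d: "((%t. H0 (t, y)) has_derivative (%t. frechet_derivative H0 (at (0, y)) (t, 0))) (at 0)" by simp
  have e: "frechet_derivative H0 (at (0, y)) (t, 0) = t *R frechet_derivative H0 (at (0, y)) (1, 0)" for t
   using linear_cmul[OF lH, of "(0, y)" t "(1, 0)"] by simp
  have h: "(%t. H0 (t, y)) = (%t. ph (mm y (t *R v)))" by (simp add: H0_def)
  have "((%t. H0 (t, y)) has_vector_derivative frechet_derivative H0 (at (0, y)) (1, 0)) (at 0)"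
   unfolding has_vector_derivative_def e[symmetric] by (rule d)
  then have "((%t. ph (mm y (t *R v))) has_vector_derivative frechet_derivative H0 (at (0, y)) (1, 0)) (at 0)"
   unfolding h .
  with line_has_vector_derivative[OF K, of y v] show ?thesis by (rule vector_derivative_unique_at)
 qed
 have dps: "(ps has_vector_derivative c) (at 0)"
 proof -
  have e: "frechet_derivative H0 (at (0, y)) (t, 0) = t * lie_deriv G v ph y" for t y
   using linear_cmul[OF lH, of "(0, y)" t "(1, 0)"] by (simp add: ld)
  have "(LINT y|mu. frechet_derivative H0 (at (0, y)) (t, 0) *R u' y) = (LINT y|mu. t *R (u' y * lie_deriv G v ph y))" for t
   by (rule Bochner_Integration.integral_cong[OF refl]) (simp add: e[of _ t])
  then have *: "(%t. LINT y|mu. frechet_derivative H0 (at (0, y)) (t, 0) *R u' y) = (%t. t *R c)"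
   unfolding c_def integral_scaleR_right by (rule ext)
  show ?thesis
   using parameter_has_derivative[OF iu uz K' sH, of 0] unfolding has_vector_derivative_def ps_def[abs_def] * .
 qed
 then show ?thesis by (simp only: ps_def[abs_def] c_def H0_def fst_conv snd_conv real_scaleR_def)
qed

end

context sobolev_map begin

text \<open>In step two the Euclidean norm grows at most like the first and second powers of the
  distance to 0. As q is at least 2, both are bounded by 1 plus the q-th power, which is locally
  integrable.\<close>

lemma integrable_ft:
 assumes K: "compact K" "K <= Om"
 shows "integrable mu (%x. ind K x *R ft x)"
proof -
 have [measurable]: "K : sets borel" using K(1) by (rule borel_compact)
 obtain C where C: "0 <= C" "!!x k. k : {1..step H} ==> norm (T.proj k x) <= C * T.d 0 x ^ k" using T.proj_le_dist by blast
 have le: "norm y <= (2 * C) * (1 + T.d 0 y powr q)" for y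
 proof -
  have "T.d 0 y ^ k <= 1 + T.d 0 y powr q" if k: "k : {1..2}" for k
  proof (cases "T.d 0 y <= 1")
   case True
   then have "T.d 0 y ^ k <= 1" by (intro power_le_one) auto
   then show ?thesis by (rule order_trans) simp
  next
   case False
   then have "T.d 0 y ^ k = T.d 0 y powr real k" by (subst powr_realpow) auto
   also have "... <= T.d 0 y powr q" using False k q by (intro powr_mono) auto
   finally show ?thesis by simp
  qed
  then have "(\<Sum>k=1..step H. norm (T.proj k y)) <= (\<Sum>k=1..step H. C * (1 + T.d 0 y powr q))"
   using C by (intro sum_mono order_trans[OF C(2)] mult_left_mono) (auto simp: T.step2)
  then show ?thesis using T.norm_le_sum_proj[of y] by (simp add: T.step2)
 qed
 have "integrable mu (%x. ind K x *R (abs (T.d 0 (f x))) powr q)"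
  using dist_Lp_loc[of 0] K by (auto simp: Lp_loc_def Lp_on_def set_integrable_def)
 moreover have "integrable mu (ind K :: 'a => real)"
  using compact_finite[OF K(1)] by (intro integrable_real_indicator) auto
 ultimately have "integrable mu (%x. 2 * C * (ind K x + ind K x *R (abs (T.d 0 (f x))) powr q))" by auto
 then show ?thesis
 proof (rule Bochner_Integration.integrable_bound)
  show "AE x in mu. norm (ind K x *R ft x) <= norm (2 * C * (ind K x + ind K x *R (abs (T.d 0 (f x))) powr q))"
  proof (rule AE_I2)
   fix x
   have nn: "0 <= 1 + T.d 0 (f x) powr q" by (simp add: add_nonneg_nonneg)
   show "norm (ind K x *R ft x) <= norm (2 * C * (ind K x + ind K x *R (abs (T.d 0 (f x))) powr q))"
   using le[of "f x"] ft_eq[of x] K(2) C(1) nn by (cases "x : K") (auto simp: abs_mult abs_of_nonneg)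
  qed
 qed simp
qed

end

locale sobolev_coordinate = sobolev_map +
 fixes l :: "'b => real" and L :: real
 assumes linear_l: "bounded_linear l" and L: "0 <= L" "!!p p'. abs (l p - l p') <= L * T.d p p'"
begin

definition u :: "'a => real" where "u x = l (ft x)"

lemma measurable_u [measurable]: "u : BM"
 unfolding u_def[abs_def] by (rule measurable_compose[OF measurable_ft borel_measurable_continuous_onI])
  (intro linear_continuous_on linear_l)

lemma u_loc: "Lp_loc mu 1 Om u"
proof (rule Lp_loc_1I)
 fix K assume "compact K" "K <= Om"
 from integrable_bounded_linear[OF linear_l integrable_ft[OF this]]
 have "integrable mu (%x. l (ind K x *R ft x))" .
 moreover have "l (ind K x *R ft x) = ind K x * u x" for x
  unfolding u_def using linear_cmul[OF bounded_linear.linear[OF linear_l]] by simp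
 ultimately show "integrable mu (%x. ind K x * u x)" by simp
qed

text \<open>The difference quotient is moved from the test function to \<open>u\<close> by right
  invariance. There the Lipschitz bound on \<open>l\<close> and \<open>metric_line\<close> control
  it by the integral of \<open>g\<close> along the flow, and the step of the quotient tends to
  0.\<close>

lemma derivative_bound:
 assumes v: "v : layer G 1" and t: "test_function Om ph"
 shows "abs (LINT x:Om|mu. u x * lie_deriv G v ph x) <= (LINT x:Om|mu. (L * norm v * g x) * abs (ph x))"
proof -
 obtain K where K: "smooth_on ph UNIV" "compact K" "K <= Om" "!!x. x \<notin> K ==> ph x = 0"
  using t by (rule test_functionE) blast
 obtain ta K' U where ta: "0 < ta" and K': "compact K'" "K' <= Om" and U: "open U" "K <= U" "U <= K'"
  and seg: "!!y w. y : U ==> norm w <= ta ==> mm y w : K'"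
  using small_segments[OF open_Om K(2,3)] by metis
 have [measurable]: "K' : sets borel" "K : sets borel" "U : sets borel" using K'(1) K(2) U(1) by (auto intro: borel_compact)
 have cph: "continuous_on UNIV ph" by (rule smooth_on_continuous[OF K(1)])
 have [measurable]: "ph : BM" by (rule borel_measurable_continuous_onI[OF cph])
 obtain M where M: "0 <= M" "!!x. abs (ph x) <= M" using bounded_test[OF cph K(2,4)] by blast
 define u' k where "u' x = ind K' x * u x" and "k x = ind K' x * g x" for x
 have [measurable]: "u' : BM" "k : BM" unfolding u'_def[abs_def] k_def[abs_def] by measurable
 have iu: "integrable mu u'" unfolding u'_def by (rule measurable_set_integrable_loc[OF u_loc K'])
 have k0: "0 <= k x" for x by (simp add: k_def)
 have ik: "integrable mu k"
 proof (rule integrableI_bounded)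
  have "Lp_mass 1 k < \<infinity>" unfolding k_def[abs_def] by (rule Lp_mass_g_finite[OF K'(1)]) (use q in auto)
  then show "(NN mu (%x. ennreal (norm (k x)))) < \<infinity>" by (simp add: Lp_mass_def)
 qed simp
 have uz: "y \<notin> K' ==> u' y = 0" for y by (simp add: u'_def)
 define ps where "ps s = (LINT y|mu. ph (mm y (s *R v)) * u' y)" for s
 define c where "c = (LINT y|mu. u' y * lie_deriv G v ph y)"
 have dps: "(ps has_vector_derivative c) (at 0)"
  unfolding ps_def[abs_def] c_def by (rule translate_has_derivative[OF K(1) iu uz K'(1)])
 have cO: "(LINT x:Om|mu. u x * lie_deriv G v ph x) = c"
  unfolding c_def u'_def
  by (rule set_integral_support[OF K'(2) lie_deriv_support[OF K'(1)]]) (use K(4) U in blast)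
 have iphk: "integrable mu (%y. abs (ph y) * k y)"
 proof (rule Bochner_Integration.integrable_bound[where f = "%y. M * k y"])
  show "AE y in mu. norm (abs (ph y) * k y) <= norm (M * k y)" using M k0 by (intro AE_I2) (simp add: abs_mult mult_right_mono)
 qed (use ik in auto)
 define I where "I = (LINT y|mu. abs (ph y) * k y)"
 define Ik where "Ik = (LINT y|mu. k y)"
 have I0: "0 <= I" "0 <= Ik" unfolding I_def Ik_def using k0 by (auto intro!: Bochner_Integration.integral_nonneg)
 \<comment> \<open>\<open>e\<close> measures how much |ph| can grow along the short flow line when
   the segment average of \<open>g\<close> is shifted back to its starting point.\<close>
 have diff: "abs (ps t - ps 0) <= L * (abs t * norm v) * (I + e * Ik)"
  if t: "abs t * norm v <= ta" and e: "0 <= e" and uc: "!!y s. y : K' ==> s : {0..1} ==> abs (ph (mm y ((s * t) *R v))) <= abs (ph y) + e" for t e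
 proof -
  \<comment> \<open>Translating the test function by \<open>t *R v\<close> amounts to translating
    \<open>u\<close> by the inverse element.\<close>
  define w where "w = (- t) *R v"
  have w: "w : layer G 1" unfolding w_def using v by (intro subspace_scale[OF subspace_layer]) auto
  have nw: "norm w = abs t * norm v" by (simp add: w_def)
  have invw: "- w = t *R v" by (simp add: w_def)
  have segw: "mm y (s *R w) : K'" if y: "y : U" "s : {0..1}" for y s
  proof (rule seg[OF y(1)])
   show "norm (s *R w) <= ta" using y(2) t mult_left_le_one_le[of "norm w" s] by (simp add: nw)
  qed
  have im: "integrable mu (%y. ph y * h y)" if "integrable mu h" for h :: "'a => real"
  proof (rule Bochner_Integration.integrable_bound[where f = "%y. M * h y"])
   have [measurable]: "h : BM" using borel_measurable_integrable[OF that] by simp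
   show "(%y. ph y * h y) : borel_measurable mu" by measurable
   show "AE y in mu. norm (ph y * h y) <= norm (M * h y)" using M by (intro AE_I2) (simp add: abs_mult mult_right_mono)
  qed (use that in simp)
  have iuw: "integrable mu (%y. u' (mm y w))" using iu by (subst integrable_right) auto
  have "(LINT y|mu. ph (mm (mm y w) (- w)) * u' (mm y w)) = (LINT y|mu. ph (mm y (- w)) * u' y)"
   by (rule integral_right[of "%y. ph (mm y (- w)) * u' y"]) measurable
  then have "(LINT y|mu. ph y * u' (mm y w)) = (LINT y|mu. ph (mm y (- w)) * u' y)" by simp
  moreover have "ps t = (LINT y|mu. ph (mm y (- w)) * u' y)" unfolding invw by (simp add: ps_def)
  ultimately have "ps t = (LINT y|mu. ph y * u' (mm y w))" by simp
  moreover have "ps 0 = (LINT y|mu. ph y * u' y)" by (simp add: ps_def)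
  ultimately have "ps t - ps 0 = (LINT y|mu. ph y * (u' (mm y w) - u' y))"
   using im[OF iuw] im[OF iu] by (simp add: right_diff_distrib)
  moreover have "integrable mu (%y. ph y * (u' (mm y w) - u' y))" using iuw iu by (intro im) auto
  ultimately have "en (abs (ps t - ps 0)) <= (NN mu (%y. ennreal (abs (ph y * (u' (mm y w) - u' y)))))"
   using integral_norm_bound_ennreal[of mu "%y. ph y * (u' (mm y w) - u' y)"] by simp
  also have "... <= (NN mu (%y. ennreal (abs (ph y) * L) * (NN lborel (%s. ind {0..1} s * en (norm w * k (mm y (s *R w)))))))"
  proof (rule nn_integral_mono_AE)
   have "AE y in mu. y : U --> en (T.d (ft y) (ft (mm y w))) <=
   (NN lborel (%s. ind {0..1} s * en (norm w * k (mm y (s *R w)))))"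
   unfolding k_def by (rule metric_line[OF w U(1) K']) (rule segw)
   then show "AE y in mu. ennreal (abs (ph y * (u' (mm y w) - u' y))) <=
   en (abs (ph y) * L) * (NN lborel (%s. ind {0..1} s * en (norm w * k (mm y (s *R w)))))"
   proof (rule AE_mp, intro AE_I2 impI)
   fix y
   assume a: "y : U --> en (T.d (ft y) (ft (mm y w))) <=
   (NN lborel (%s. ind {0..1} s * en (norm w * k (mm y (s *R w)))))"
   show "en (abs (ph y * (u' (mm y w) - u' y))) <=
   en (abs (ph y) * L) * (NN lborel (%s. ind {0..1} s * en (norm w * k (mm y (s *R w)))))"
   proof (cases "y : K")
   case True
   then have y: "y : U" using U(2) by blast
   have "y : K'" "mm y w : K'" using segw[OF y, of 0] segw[OF y, of 1] by auto
   then have "abs (u' (mm y w) - u' y) <= L * T.d (ft y) (ft (mm y w))"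
   using L(2)[of "ft (mm y w)" "ft y"] T.dist_sym by (simp add: u'_def u_def)
   then have "abs (ph y * (u' (mm y w) - u' y)) <= (abs (ph y) * L) * T.d (ft y) (ft (mm y w))"
   unfolding abs_mult mult.assoc by (intro mult_left_mono) auto
   then have "en (abs (ph y * (u' (mm y w) - u' y))) <= en (abs (ph y) * L) * en (T.d (ft y) (ft (mm y w)))"
   using L(1) by (simp add: ennreal_mult[symmetric] ennreal_leI)
   also have "... <= en (abs (ph y) * L) * (NN lborel (%s. ind {0..1} s * en (norm w * k (mm y (s *R w)))))"
   using a y by (intro mult_left_mono) auto
   finally show ?thesis .
   qed (simp add: K(4))
   qed
  qed
  also have "... = (NN mu (%y. NN lborel (%s. ennreal (abs (ph y) * L) * (ind {0..1} s * en (norm w * k (mm y (s *R w)))))))"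
   by (rule nn_integral_cong, rule nn_integral_cmult[symmetric]) measurable
  also have "... = (NN lborel (%s. NN mu (%y. ennreal (abs (ph y) * L) * (ind {0..1} s * en (norm w * k (mm y (s *R w)))))))"
   by (rule mul.Fubini'[symmetric]) simp
  also have "... <= (NN lborel (%s. ind {0..1::real} s * en (L * norm w * (I + e * Ik))))"
  proof (rule nn_integral_mono)
   fix s :: real
   show "(NN mu (%y. ennreal (abs (ph y) * L) * (ind {0..1} s * en (norm w * k (mm y (s *R w)))))) <=
   ind {0..1} s * en (L * norm w * (I + e * Ik))"
   proof (cases "s : {0..1}")
   case True
   define F where "F y = en (abs (ph (mm y (- (s *R w)))) * L) * en (norm w * k y)" for y
   have [measurable]: "F : BM" unfolding F_def[abs_def] by measurable
   have "(NN mu (%y. ennreal (abs (ph y) * L) * (ind {0..1} s * en (norm w * k (mm y (s *R w)))))) =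
   (NN mu (%y. F (mm y (s *R w))))"
   by (rule nn_integral_cong) (use True in \<open>simp add: F_def\<close>)
   also have "... = (NN mu (%y. F y))" by (rule nn_right) measurable
   also have "... <= (NN mu (%y. ennreal (L * norm w * (abs (ph y) * k y + e * k y))))"
   proof (rule nn_integral_mono)
   fix y
   have "abs (ph (mm y (- (s *R w)))) * k y <= (abs (ph y) + e) * k y"
   proof (cases "y : K'")
   case True
   have "- (s *R w) = (s * t) *R v" by (simp add: w_def)
   then show ?thesis using uc[OF True \<open>s : {0..1}\<close>] k0 by (intro mult_right_mono) auto
   qed (simp add: k_def)
   then have "(L * norm w) * (abs (ph (mm y (- (s *R w)))) * k y) <= (L * norm w) * ((abs (ph y) + e) * k y)"
   using L(1) by (intro mult_left_mono) auto
   then show "F y <= en (L * norm w * (abs (ph y) * k y + e * k y))"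
   unfolding F_def using L(1) k0[of y] by (subst ennreal_mult[symmetric]) (auto intro!: ennreal_leI simp: algebra_simps)
   qed
   also have "... = en (LINT y|mu. L * norm w * (abs (ph y) * k y + e * k y))"
   using iphk ik L(1) k0 e by (intro nn_integral_eq_integral AE_I2) (auto intro!: mult_nonneg_nonneg add_nonneg_nonneg)
   also have "(LINT y|mu. L * norm w * (abs (ph y) * k y + e * k y)) = L * norm w * (I + e * Ik)"
   unfolding I_def Ik_def using iphk ik by simp
   finally show ?thesis using True by simp
   qed simp
  qed
  also have "... = en (L * norm w * (I + e * Ik))" by (simp add: nn_integral_multc)
  finally show ?thesis using L(1) I0 e by (simp add: nw ennreal_le_iff)
 qed
 \<comment> \<open>One small time \<open>t\<close> serves three purposes: differentiability of
   \<open>ps\<close> at 0 up to \<open>e\<close>, segments inside \<open>K'\<close>, and uniform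
   continuity of the test function up to \<open>e\<close>.\<close>
 have bound: "abs c <= L * norm v * (I + e * Ik) + e" if e: "0 < e" for e
 proof -
  have "compact (K' \<times> cball (0::'a) 1)" using K'(1) by (intro compact_Times) auto
  then have "uniformly_continuous_on (K' \<times> cball 0 1) (%p. ph (mm (fst p) (snd p)))"
   by (rule compact_uniformly_continuous[rotated])
   (auto intro!: continuous_on_compose2[OF cph] continuous_on_mul continuous_intros)
  then obtain de where de: "0 < de" "!!p p'. p : K' \<times> cball 0 1 ==> p' : K' \<times> cball 0 1 ==> dist p' p < de ==>
   dist (ph (mm (fst p') (snd p'))) (ph (mm (fst p) (snd p))) < e"
   unfolding uniformly_continuous_on_def using e by metis
  have uc: "abs (ph (mm y w)) <= abs (ph y) + e" if "y : K'" "norm w < de" "norm w <= 1" for y w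
   using de(2)[of "(y, 0)" "(y, w)"] that by (simp add: dist_norm dist_Pair_Pair)
  have "\<forall>\<^sub>F t in at 0. norm (ps t - ps 0 - t *R c) <= e * norm t"
  proof -
   have "\<exists>de>0. ALL y. norm (y - 0) < de --> norm (ps y - ps 0 - (y - 0) *R c) <= e * norm (y - 0)"
   using dps e unfolding has_vector_derivative_def has_derivative_at_alt by blast
   then show ?thesis unfolding eventually_at by (auto simp: dist_norm)
  qed
  moreover have "\<forall>\<^sub>F t in at 0. abs t * norm v < min ta (min de 1)"
  proof -
   have "((%t. abs t * norm v) \<longlongrightarrow> abs 0 * norm v) (at (0::real))" by (intro tendsto_intros)
   then show ?thesis using ta de(1) by (intro order_tendstoD) auto
  qed
  moreover have "\<forall>\<^sub>F t in at (0::real). t ~= 0" by (simp add: eventually_at_filter)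
  ultimately have "\<forall>\<^sub>F t in at (0::real). norm (ps t - ps 0 - t *R c) <= e * norm t & abs t * norm v < min ta (min de 1) & t ~= 0"
   by (intro eventually_conj)
  then obtain t :: real where t: "abs (ps t - ps 0 - t * c) <= e * abs t" "abs t * norm v < ta" "abs t * norm v < de" "abs t * norm v < 1" "t ~= 0"
   using eventually_happens'[OF at_neq_bot] by (fastforce simp: real_scaleR_def)
  have "abs (ps t - ps 0) <= L * (abs t * norm v) * (I + e * Ik)"
  proof (rule diff)
   fix y s assume "y : K'" "s : {0..1::real}"
   moreover from this have "norm ((s * t) *R v) <= abs t * norm v"
   using mult_left_le_one_le[of "abs t * norm v" s] by (simp add: abs_mult mult.assoc)
   ultimately show "abs (ph (mm y ((s * t) *R v))) <= abs (ph y) + e" using t by (intro uc) auto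
  qed (use t e in auto)
  moreover have "abs (t * c) <= abs (ps t - ps 0) + e * abs t" using t(1) by linarith
  ultimately have "abs t * abs c <= abs t * (L * norm v * (I + e * Ik) + e)" by (simp add: abs_mult algebra_simps)
  then show ?thesis using t(5) by simp
 qed
 have "abs c <= L * norm v * I"
 proof (rule field_le_epsilon)
  fix ep :: real assume ep: "0 < ep"
  define A where "A = L * norm v * Ik + 1"
  have A: "0 < A" using L(1) I0 by (simp add: A_def add_nonneg_pos)
  from bound[of "ep / A"] ep A have "abs c <= L * norm v * (I + ep / A * Ik) + ep / A" by simp
  also have "... = L * norm v * I + ep / A * A" by (simp add: A_def algebra_simps add_divide_distrib)
  finally show "abs c <= L * norm v * I + ep" using A by simp
 qed
 also have "... = (LINT x:Om|mu. (L * norm v * g x) * abs (ph x))"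
 proof -
  have "(LINT x:Om|mu. (L * norm v * g x) * abs (ph x)) = (LINT x|mu. (ind K' x * (L * norm v * g x)) * abs (ph x))"
   by (rule set_integral_support[OF K'(2)]) (use K(4) U in auto)
  also have "... = (LINT x|mu. L * norm v * (abs (ph x) * k x))" by (simp add: k_def mult_ac)
  finally show ?thesis by (simp add: I_def)
 qed
 finally show ?thesis unfolding cO .
qed

end

context carnot_group begin

lemma lie_deriv_linear:
 assumes "smooth_on ph UNIV"
 shows "linear (%v. lie_deriv G v ph x)"
proof -
 have l: "linear (frechet_derivative ph (at x))"
  by (rule has_derivative_linear[OF smooth_on_has_derivative[OF assms]])
 show ?thesis
  by (rule linearI) (simp_all add: lie_deriv_def left_field_add left_field_scaleR linear_add[OF l] linear_cmul[OF l])
qed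

lemma layer_basis_expand: "1 <= k ==> v : layer G k ==> (\<Sum>e\<in>layer_basis k. (v \<bullet> e) *R e) = v"
 using proj_id[of k v] by (simp add: proj_def)

end

context carnot_haar begin

lemma AE_right:
 assumes "AE y in mu. P y"
 shows "AE x in mu. P (mm x z)"
 using AE_distrD[of "%y. mm y z" mu borel P] assms unfolding distr_right by simp

lemma integrable_test:
 fixes u ps :: "'a => real"
 assumes u: "Lp_loc mu 1 Om u" and K: "compact K" "K <= Om" "!!x. x \<notin> K ==> ps x = 0" and c: "continuous_on UNIV ps"
 shows "integrable mu (%x. ind Om x *R (u x * ps x))"
proof -
 have "integrable mu (%x. ps x *R (ind K x * u x))"
  by (rule integrable_bounded_mult[OF measurable_set_integrable_loc[OF u K(1,2)] _ K(1) c]) simp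
 moreover have "(%x. ps x *R (ind K x * u x)) = (%x. ind Om x *R (u x * ps x))"
 proof
  fix x show "ps x *R (ind K x * u x) = ind Om x *R (u x * ps x)"
   using K(2,3) by (cases "x : K") auto
 qed
 ultimately show ?thesis by (simp only:)
qed

end

context sobolev_coordinate begin

text \<open>\<open>derivative_bound\<close> makes the distributional derivative a functional
  dominated by \<open>g\<close>. It is bounded in the weighted L^2 space because g^2 / ka is at most
  1 / ka + g^q, which uses that q is at least 2. The representing function inherits the pointwise
  bound through \<open>weak_bound\<close>.\<close>

lemma weak_derivative_exists:
 assumes v: "v : layer G 1"
 shows "EX w. weak_deriv G mu Om v u w & (AE x in mu. x : Om --> abs (w x) <= Cet * (L * norm v * g x))"
proof -
 obtain ka where ka: "ka : BM" "!!x. 1 <= ka x" "!!R. EX B. ALL x. norm x <= R --> ka x <= B"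
   "(NN mu (%x. ennreal (1 / ka x))) < \<infinity>" using weight by blast
 note [measurable] = ka(1)
 have ka0: "0 < ka x" for x using ka(2)[of x] by linarith
 define A where "A = L * norm v"
 have A: "0 <= A" using L(1) by (simp add: A_def)
 define La where "La ph = - (LINT x:Om|mu. u x * lie_deriv G v ph x)" for ph
 have il: "integrable mu (%x. ind Om x *R (u x * lie_deriv G v ph x))" if t: "test_function Om ph" for ph
 proof -
  obtain K where K: "smooth_on ph UNIV" "compact K" "K <= Om" "!!x. x \<notin> K ==> ph x = 0"
   using t by (rule test_functionE) blast
  show ?thesis
   by (rule integrable_test[OF u_loc K(2,3) lie_deriv_support[OF K(2,4)] smooth_on_continuous[OF smooth_lie_deriv[OF K(1)]]])
 qed
 have gl: "Lp_loc mu 1 Om (%x. A * g x)"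
 proof (rule Lp_loc_1I)
  fix K assume K: "compact K" "K <= Om"
  have [measurable]: "K : sets borel" using K(1) by (rule borel_compact)
  have "Lp_mass 1 (%x. ind K x * g x) < \<infinity>" by (rule Lp_mass_g_finite[OF K(1)]) (use q in auto)
  then have "integrable mu (%x. ind K x * g x)" by (intro integrableI_bounded) (auto simp: Lp_mass_def)
  then have "integrable mu (%x. A * (ind K x * g x))" by simp
  then show "integrable mu (%x. ind K x * (A * g x))" by (simp add: mult.left_commute)
 qed
 have bound: "abs (LINT x:Om|mu. u x * lie_deriv G v ph x) <= (LINT x:Om|mu. (A * g x) * abs (ph x))" if "test_function Om ph" for ph
  using derivative_bound[OF v that] by (simp add: A_def)
 have "EX w. Lp_loc mu 1 Om w & (ALL ph. test_function Om ph --> La ph = (LINT x:Om|mu. w x * ph x))"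
 proof (rule represent_functional[OF _ _ _ _ ka])
  show "La (%x. ph x + t * ps x) = La ph + t * La ps" if t: "test_function Om ph" "test_function Om ps" for ph ps t
  proof -
   have "smooth_on ph UNIV" "smooth_on ps UNIV" using t by (auto simp: test_function_def)
   note ld = lie_deriv_combine[OF this]
   have "(LINT x:Om|mu. u x * lie_deriv G v (%x. ph x + t * ps x) x) =
   (LINT x|mu. ind Om x *R (u x * lie_deriv G v ph x) + t * (ind Om x *R (u x * lie_deriv G v ps x)))"
   unfolding set_lebesgue_integral_def ld by (rule Bochner_Integration.integral_cong) (auto simp: algebra_simps)
   also have "... = (LINT x:Om|mu. u x * lie_deriv G v ph x) + t * (LINT x:Om|mu. u x * lie_deriv G v ps x)"
   unfolding set_lebesgue_integral_def using il[OF t(1)] il[OF t(2)] by simp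
   finally show ?thesis by (simp add: La_def)
  qed
  show "(%x. A * g x) : BM" by measurable
  show "(NN mu (%x. ennreal ((A * g x)^2 / ka x))) < \<infinity>"
  proof -
   have "(NN mu (%x. ennreal ((A * g x)^2 / ka x))) <= (NN mu (%x. ennreal (A^2) * (en (1 / ka x) + en (abs (g x) powr q))))"
   proof (rule nn_integral_mono)
   fix x
   have "(g x)^2 / ka x <= 1 / ka x + abs (g x) powr q"
   proof (cases "g x <= 1")
   case True
   then have "(g x)^2 <= 1" by (intro power_le_one) auto
   then have "(g x)^2 / ka x <= 1 / ka x" using ka0[of x] by (intro divide_right_mono) auto
   then show ?thesis by (rule order_trans) simp
   next
   case False
   have "(g x)^2 / ka x <= (g x)^2 / 1" using ka(2)[of x] by (intro divide_left_mono) auto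
   also have "... = g x powr 2" using False by (simp add: powr_numeral)
   also have "... <= g x powr q" using False q by (intro powr_mono) auto
   finally show ?thesis using ka0[of x] by (simp add: add_increasing less_imp_le)
   qed
   then have "A^2 * ((g x)^2 / ka x) <= A^2 * (1 / ka x + abs (g x) powr q)" by (intro mult_left_mono) auto
   then show "en ((A * g x)^2 / ka x) <= en (A^2) * (en (1 / ka x) + en (abs (g x) powr q))"
   using less_imp_le[OF ka0[of x]]
   by (simp add: ennreal_plus[symmetric] ennreal_mult[symmetric] ennreal_leI power_mult_distrib del: ennreal_plus)
   qed
   also have "... = en (A^2) * ((NN mu (%x. ennreal (1 / ka x))) + Lp_mass q g)"
   by (simp add: nn_integral_cmult nn_integral_add Lp_mass_def)
   also have "... < \<infinity>" using ka(4) g_mass by (simp add: ennreal_mult_less_top)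
   finally show ?thesis .
  qed
  show "en (abs (La ph)) <= (NN mu (%x. ennreal (A * g x * abs (ph x))))" if t: "test_function Om ph" for ph
  proof -
   obtain K where K: "smooth_on ph UNIV" "compact K" "K <= Om" "!!x. x \<notin> K ==> ph x = 0"
   using t by (rule test_functionE) blast
   have i: "integrable mu (%x. ind Om x *R ((A * g x) * abs (ph x)))"
   by (rule integrable_test[OF gl K(2,3)]) (use K(4) smooth_on_continuous[OF K(1)] in \<open>auto intro: continuous_on_rabs\<close>)
   have "en (abs (La ph)) <= en (LINT x:Om|mu. (A * g x) * abs (ph x))"
   using bound[OF t] by (intro ennreal_leI) (simp add: La_def)
   also have "... = (NN mu (%x. ennreal (ind Om x *R ((A * g x) * abs (ph x)))))"
   unfolding set_lebesgue_integral_def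
   by (rule nn_integral_eq_integral[OF i, symmetric]) (use A in \<open>auto simp: indicator_def\<close>)
   also have "... = (NN mu (%x. ennreal (A * g x * abs (ph x))))"
   proof (rule nn_integral_cong)
   fix x show "en (ind Om x *R ((A * g x) * abs (ph x))) = en (A * g x * abs (ph x))"
   using K(3) K(4)[of x] by (cases "x : K") auto
   qed
   finally show ?thesis .
  qed
 qed
 then obtain w where w: "Lp_loc mu 1 Om w" "!!ph. test_function Om ph ==> La ph = (LINT x:Om|mu. w x * ph x)" by blast
 have "weak_deriv G mu Om v u w"
  unfolding weak_deriv_def using u_loc w(1) w(2)[symmetric] by (simp add: La_def)
 moreover have "AE x in mu. x : Om --> abs (w x) <= Cet * (A * g x)"
 proof (rule weak_bound[OF open_Om w(1) gl])
  show "0 <= A * g x" for x using A by simp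
  show "abs (LINT x:Om|mu. w x * ph x) <= (LINT x:Om|mu. A * g x * abs (ph x))" if "test_function Om ph" for ph
   using bound[OF that] w(2)[OF that, symmetric] by (simp add: La_def)
 qed
 ultimately show ?thesis unfolding A_def by blast
qed

definition partial :: "'a => 'a => real" where
 "partial e = (SOME w. weak_deriv G mu Om e u w & (AE x in mu. x : Om --> abs (w x) <= Cet * (L * norm e * g x)))"

lemma partial:
 assumes "e : layer G 1"
 shows weak_deriv_partial: "weak_deriv G mu Om e u (partial e)"
  and partial_bound: "AE x in mu. x : Om --> abs (partial e x) <= Cet * (L * norm e * g x)"
 using someI_ex[OF weak_derivative_exists[OF assms], folded partial_def] by blast+

lemma integrable_partial: "e : layer G 1 ==> compact K ==> K <= Om ==> integrable mu (%x. ind K x * partial e x)"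
 using measurable_set_integrable_loc[of Om "partial e" K] weak_deriv_partial[of e] by (simp add: weak_deriv_def)

lemma Lp_mass_partial:
 assumes e: "e : layer G 1" and K: "compact K" "K <= Om" and p: "1 <= p" "p <= q"
 shows "Lp_mass p (%x. ind K x * partial e x) < \<infinity>"
proof -
 have [measurable]: "K : sets borel" using K(1) by (rule borel_compact)
 define M where "M = Cet * L * norm e"
 have M: "0 <= M" using Cet_nonneg L(1) by (simp add: M_def)
 have "Lp_mass p (%x. ind K x * partial e x) <= (NN mu (%x. ennreal (M powr p) * en (abs (ind K x * g x) powr p)))"
  unfolding Lp_mass_def
 proof (rule nn_integral_mono_AE, rule AE_mp[OF partial_bound[OF e]], intro AE_I2 impI)
  fix x assume a: "x : Om --> abs (partial e x) <= Cet * (L * norm e * g x)"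
  have "abs (ind K x * partial e x) <= M * abs (ind K x * g x)"
   using a K(2) by (cases "x : K") (auto simp: M_def mult_ac)
  then have "abs (ind K x * partial e x) powr p <= (M * abs (ind K x * g x)) powr p"
   using p by (intro powr_mono2) auto
  then show "en (abs (ind K x * partial e x) powr p) <= en (M powr p) * en (abs (ind K x * g x) powr p)"
   using M by (simp add: powr_mult ennreal_mult[symmetric] ennreal_leI)
 qed
 also have "... = en (M powr p) * Lp_mass p (%x. ind K x * g x)"
  by (simp add: nn_integral_cmult Lp_mass_def)
 also have "... < \<infinity>" using Lp_mass_g_finite[OF K(1) p] by (simp add: ennreal_mult_less_top)
 finally show ?thesis .
qed

section \<open>Horizontal gradient and first-order expansion\<close>

abbreviation "E \<equiv> layer_basis 1"

lemma E: "finite E" "e : E ==> e : layer G 1" "e : E ==> norm e = 1"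
 using layer_basis[of 1] by auto

text \<open>Each \<open>partial e\<close> is a separate choice up to null sets. Assembling the basis
  directions fixes one representative that is linear in the direction at every point.\<close>

definition grad :: "'a => 'a" where "grad x = (\<Sum>e\<in>E. partial e x *R e)"

lemma grad_inner: "grad x \<bullet> v = (\<Sum>e\<in>E. (v \<bullet> e) * partial e x)"
 by (simp add: grad_def inner_sum_left inner_commute[of v] mult.commute)

lemma integrable_grad:
 assumes "compact K" "K <= Om"
 shows "integrable mu (%x. ind K x * (grad x \<bullet> v))"
proof -
 have "integrable mu (%x. \<Sum>e\<in>E. (v \<bullet> e) * (ind K x * partial e x))"
  using integrable_partial[OF E(2) assms] by (intro Bochner_Integration.integrable_sum) auto
 then show ?thesis by (simp add: grad_inner sum_distrib_left mult_ac)
qed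

lemma weak_deriv_grad:
 assumes v: "v : layer G 1"
 shows "weak_deriv G mu Om v u (%x. grad x \<bullet> v)"
 unfolding weak_deriv_def
proof (intro conjI allI impI u_loc Lp_loc_1I integrable_grad)
 fix ph assume t: "test_function Om ph"
 obtain K where K: "smooth_on ph UNIV" "compact K" "K <= Om" "!!x. x \<notin> K ==> ph x = 0"
  using t by (rule test_functionE) blast
 note lin = lie_deriv_linear[OF K(1)]
 have ld: "lie_deriv G v ph x = (\<Sum>e\<in>E. (v \<bullet> e) * lie_deriv G e ph x)" for x
 proof -
  have "lie_deriv G (\<Sum>e\<in>E. (v \<bullet> e) *R e) ph x = (\<Sum>e\<in>E. (v \<bullet> e) * lie_deriv G e ph x)"
   using linear_sum[OF lin, of "%e. (v \<bullet> e) *R e" E] linear_cmul[OF lin] by simp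
  then show ?thesis using layer_basis_expand[of 1 v] v by simp
 qed
 have i1: "integrable mu (%x. ind Om x *R (u x * lie_deriv G e ph x))" for e
  by (rule integrable_test[OF u_loc K(2,3) lie_deriv_support[OF K(2,4)] smooth_on_continuous[OF smooth_lie_deriv[OF K(1)]]])
 have i2: "integrable mu (%x. ind Om x *R (partial e x * ph x))" if "e : E" for e
  using weak_deriv_partial[OF E(2)[OF that]] integrable_test[OF _ K(2,3,4) smooth_on_continuous[OF K(1)], of "partial e"]
  by (simp add: weak_deriv_def)
 have "(LINT x:Om|mu. u x * lie_deriv G v ph x) = (LINT x|mu. (\<Sum>e\<in>E. (v \<bullet> e) * (ind Om x *R (u x * lie_deriv G e ph x))))"
  unfolding set_lebesgue_integral_def ld
  by (rule Bochner_Integration.integral_cong) (auto simp: sum_distrib_left mult_ac)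
 also have "... = (\<Sum>e\<in>E. (v \<bullet> e) * (LINT x:Om|mu. u x * lie_deriv G e ph x))"
  unfolding set_lebesgue_integral_def using i1 by simp
 also have "... = (\<Sum>e\<in>E. (v \<bullet> e) * (- (LINT x:Om|mu. partial e x * ph x)))"
  by (rule sum.cong) (use weak_deriv_partial[OF E(2)] t in \<open>auto simp: weak_deriv_def\<close>)
 also have "... = - (LINT x|mu. (\<Sum>e\<in>E. (v \<bullet> e) * (ind Om x *R (partial e x * ph x))))"
  unfolding set_lebesgue_integral_def
  by (subst Bochner_Integration.integral_sum) (use i2 in \<open>auto simp: sum_negf\<close>)
 also have "(LINT x|mu. (\<Sum>e\<in>E. (v \<bullet> e) * (ind Om x *R (partial e x * ph x)))) = (LINT x:Om|mu. (grad x \<bullet> v) * ph x)"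
  unfolding set_lebesgue_integral_def grad_inner
  by (rule Bochner_Integration.integral_cong) (auto simp: sum_distrib_left sum_distrib_right mult_ac)
 finally show "(LINT x:Om|mu. u x * lie_deriv G v ph x) = - (LINT x:Om|mu. (grad x \<bullet> v) * ph x)" .
qed

text \<open>The difference quotient along one letter is the average of
  \<open>grad \<bullet> v\<close> over the segment. Its deviation from the value at \<open>x\<close>
  is an average of increments of the functions \<open>partial e\<close>, which Jensen and Fubini
  bound by their moduli.\<close>

lemma segment_estimate:
 assumes v: "v : layer G 1" "norm v <= C" and r: "0 < r" and U: "open U" and K': "compact K'" "K' <= Om"
  and K: "compact K" "K <= K'" and seg: "!!y s. y : U ==> s : {0..1} ==> mm y (s *R (r *R v)) : K'"
  and z0: "!!x. x : K ==> mm x z0 : U" and p: "1 <= p"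
  and small: "!!e s. e : E ==> s : {0..1} ==>
   modulus p (%x. ind K' x * partial e x) (mm z0 (s *R (r *R v))) <= ennreal ep"
 shows "(NN mu (%x. ind K x * en (abs ((u (mm x (mm z0 (r *R v))) - u (mm x z0)) / r - grad x \<bullet> v) powr p)))
  <= en (C powr p * real (card E) powr p) * (of_nat (card E) * ennreal ep)"
proof -
 have [measurable]: "K : sets borel" "K' : sets borel" using K(1) K'(1) by (auto intro: borel_compact)
 have C: "0 <= C" using norm_ge_zero[of v] v(2) by linarith
 define w where "w e x = ind K' x * partial e x" for e x
 have iw: "integrable mu (w e)" if "e : E" for e unfolding w_def[abs_def] by (rule integrable_partial[OF E(2)[OF that] K'])
 have mw: "w e : BM" if "e : E" for e using borel_measurable_integrable[OF iw[OF that]] by simp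
 define z where "z s = mm z0 (s *R (r *R v))" for s
 have mz[measurable]: "z : BM" unfolding z_def[abs_def] by measurable
 have rv: "r *R v : layer G 1" using v by (intro subspace_scale[OF subspace_layer]) auto
 define D where "D x = (u (mm x (z 1)) - u (mm x z0)) / r - grad x \<bullet> v" for x
 define h where "h x s = (\<Sum>e\<in>E. abs (w e (mm x (z s)) - w e x))" for x s
 have h0: "0 <= h x s" for x s by (simp add: h_def sum_nonneg)
 have mh: "(%s. h x s) : BM" for x
  unfolding h_def using mw
  by (intro borel_measurable_sum borel_measurable_abs borel_measurable_diff)
   (auto intro!: measurable_compose[of "%s. mm x (z s)" borel borel "w e" for e])
 have iwv: "integrable mu (%x. ind K' x * (grad x \<bullet> (r *R v)))" by (rule integrable_grad[OF K'])
 have "AE y in mu. y : U --> ind K' (mm y (r *R v)) * u (mm y (r *R v)) - ind K' y * u y =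
   (LINT s|lborel. ind {0..1} s * (ind K' (mm y (s *R (r *R v))) * (grad (mm y (s *R (r *R v))) \<bullet> (r *R v))))"
  by (rule weak_deriv_line[OF open_Om weak_deriv_grad[OF rv] U K']) (rule seg)
 moreover have "AE y in mu. integrable lborel (%s. ind {0..1} s * (ind K' (mm y (s *R (r *R v))) * (grad (mm y (s *R (r *R v))) \<bullet> (r *R v))))"
  using mul.AE_integrable_fst'[OF integrable_line_average[OF iwv, of "%_. 1" 1 "r *R v"]] by simp
 ultimately have "AE y in mu. (y : U --> ind K' (mm y (r *R v)) * u (mm y (r *R v)) - ind K' y * u y =
   (LINT s|lborel. ind {0..1} s * (ind K' (mm y (s *R (r *R v))) * (grad (mm y (s *R (r *R v))) \<bullet> (r *R v))))) &
   integrable lborel (%s. ind {0..1} s * (ind K' (mm y (s *R (r *R v))) * (grad (mm y (s *R (r *R v))) \<bullet> (r *R v))))"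
  by (rule AE_conjI)
 from AE_right[OF this, of z0]
 have line: "AE x in mu. (mm x z0 : U --> ind K' (mm x (z 1)) * u (mm x (z 1)) - ind K' (mm x z0) * u (mm x z0) =
   (LINT s|lborel. ind {0..1} s * (ind K' (mm x (z s)) * (grad (mm x (z s)) \<bullet> (r *R v))))) &
   integrable lborel (%s. ind {0..1} s * (ind K' (mm x (z s)) * (grad (mm x (z s)) \<bullet> (r *R v))))"
  by (simp add: z_def assoc)
 have pw: "AE x in mu. ind K x * en (abs (D x) powr p) <=
   (NN lborel (%s. ind {0..1} s * en (C powr p * real (card E) powr p * (\<Sum>e\<in>E. abs (w e (mm x (z s)) - w e x) powr p))))"
 proof (rule AE_mp[OF line], intro AE_I2 impI, elim conjE)
  fix x
  assume a: "mm x z0 : U --> ind K' (mm x (z 1)) * u (mm x (z 1)) - ind K' (mm x z0) * u (mm x z0) =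
   (LINT s|lborel. ind {0..1} s * (ind K' (mm x (z s)) * (grad (mm x (z s)) \<bullet> (r *R v))))"
   and i: "integrable lborel (%s. ind {0..1} s * (ind K' (mm x (z s)) * (grad (mm x (z s)) \<bullet> (r *R v))))"
  show "ind K x * en (abs (D x) powr p) <=
   (NN lborel (%s. ind {0..1} s * en (C powr p * real (card E) powr p * (\<Sum>e\<in>E. abs (w e (mm x (z s)) - w e x) powr p))))"
  proof (cases "x : K")
   case True
   then have xU: "mm x z0 : U" and xK': "x : K'" using z0 K(2) by auto
   have k: "mm x (z s) : K'" if "s : {0..1}" for s using seg[OF xU that] by (simp add: z_def assoc)
   have "mm x z0 : K'" "mm x (z 1) : K'" using k[of 0] k[of 1] by (simp_all add: z_def)
   then have e1: "u (mm x (z 1)) - u (mm x z0) =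
   (LINT s|lborel. ind {0..1} s * (ind K' (mm x (z s)) * (grad (mm x (z s)) \<bullet> (r *R v))))"
   using a xU by simp
   define F where "F s = ind {0..1} s * (\<Sum>e\<in>E. (v \<bullet> e) * (w e (mm x (z s)) - w e x))" for s :: real
   define Q where "Q s = ind {0..1} s * (ind K' (mm x (z s)) * (grad (mm x (z s)) \<bullet> (r *R v)))" for s :: real
   have iQ: "integrable lborel Q" using i by (simp only: Q_def[abs_def])
   have Feq: "F s = (1 / r) * Q s - ind {0..1} s * (grad x \<bullet> v)" for s
   using r xK' by (simp add: F_def Q_def grad_inner w_def sum_subtractf right_diff_distrib sum_distrib_left mult_ac)
   have iF: "integrable lborel F" unfolding Feq[abs_def] using iQ by auto
   have "(LINT s|lborel. F s) = (1 / r) * (LINT s|lborel. Q s) - grad x \<bullet> v"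
   unfolding Feq using iQ by simp
   then have "D x = (LINT s|lborel. F s)" using e1 by (simp add: D_def Q_def)
   moreover note iF
   ultimately have "en (abs (D x)) <= (NN lborel (%s. ennreal (norm (F s))))"
   using integral_norm_bound_ennreal[of lborel F] by simp
   also have "... <= (NN lborel (%s. ind {0..1} s * en (C * h x s)))"
   proof (rule nn_integral_mono)
   fix s :: real
   have "abs (\<Sum>e\<in>E. (v \<bullet> e) * (w e (mm x (z s)) - w e x)) <= (\<Sum>e\<in>E. abs ((v \<bullet> e) * (w e (mm x (z s)) - w e x)))"
   by (rule sum_abs)
   also have "... <= (\<Sum>e\<in>E. C * abs (w e (mm x (z s)) - w e x))"
   proof (rule sum_mono)
   fix e assume "e : E"
   then have "abs (v \<bullet> e) <= C" using Cauchy_Schwarz_ineq2[of v e] E(3)[of e] v(2) by simp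
   then show "abs ((v \<bullet> e) * (w e (mm x (z s)) - w e x)) <= C * abs (w e (mm x (z s)) - w e x)"
   by (simp add: abs_mult mult_right_mono)
   qed
   also have "... = C * h x s" by (simp add: h_def sum_distrib_left)
   finally show "en (norm (F s)) <= ind {0..1} s * en (C * h x s)"
   by (auto simp: F_def indicator_def intro: ennreal_leI)
   qed
   finally have "en (abs (D x) powr p) <= (NN lborel (%s. ind {0..1} s * en ((C * h x s) powr p)))"
   using mh C h0 p by (intro powr_le_nn_integral_01) auto
   also have "... <= (NN lborel (%s. ind {0..1} s * en (C powr p * real (card E) powr p * (\<Sum>e\<in>E. abs (w e (mm x (z s)) - w e x) powr p))))"
   proof (rule nn_integral_mono)
   fix s :: real
   have "(C * h x s) powr p = C powr p * h x s powr p" using C h0 by (simp add: powr_mult)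
   also have "... <= C powr p * (real (card E) powr p * (\<Sum>e\<in>E. abs (w e (mm x (z s)) - w e x) powr p))"
   unfolding h_def using E(1) p by (intro mult_left_mono sum_powr_le) auto
   finally show "ind {0..1} s * en ((C * h x s) powr p) <=
   ind {0..1} s * en (C powr p * real (card E) powr p * (\<Sum>e\<in>E. abs (w e (mm x (z s)) - w e x) powr p))"
   by (intro mult_left_mono ennreal_leI) (simp_all add: mult.assoc)
   qed
   finally show ?thesis using True by simp
  qed simp
 qed
 have m2: "(%(x, s). \<Sum>e\<in>E. abs (w e (mm x (z s)) - w e x) powr p) : borel_measurable (mu \<Otimes>\<^sub>M lborel)"
 proof -
  have "(%p'. abs (w e (mm (fst p') (z (snd p'))) - w e (fst p')) powr p) : borel_measurable (mu \<Otimes>\<^sub>M lborel)" if "e : E" for e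
  proof -
   note [measurable] = mw[OF that]
   show ?thesis by measurable
  qed
  then show ?thesis unfolding case_prod_beta by (intro borel_measurable_sum)
 qed
 have "(NN mu (%x. ind K x * en (abs (D x) powr p))) <=
   (NN mu (%x. NN lborel (%s. ind {0..1} s * en (C powr p * real (card E) powr p * (\<Sum>e\<in>E. abs (w e (mm x (z s)) - w e x) powr p)))))"
  by (rule nn_integral_mono_AE[OF pw])
 also have "... = (NN lborel (%s. NN mu (%x. ind {0..1} s * en (C powr p * real (card E) powr p * (\<Sum>e\<in>E. abs (w e (mm x (z s)) - w e x) powr p)))))"
  using m2 by (intro mul.Fubini'[symmetric]) (simp add: case_prod_beta)
 also have "... <= (NN lborel (%s. ind {0..1::real} s * (en (C powr p * real (card E) powr p) * (of_nat (card E) * ennreal ep))))"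
 proof (rule nn_integral_mono)
  fix s :: real
  show "(NN mu (%x. ind {0..1} s * en (C powr p * real (card E) powr p * (\<Sum>e\<in>E. abs (w e (mm x (z s)) - w e x) powr p)))) <=
   ind {0..1} s * (en (C powr p * real (card E) powr p) * (of_nat (card E) * ennreal ep))"
  proof (cases "s : {0..1}")
   case True
   have me: "(%x. ennreal (abs (w e (mm x (z s)) - w e x) powr p)) : borel_measurable mu" if "e : E" for e
   proof -
   note [measurable] = mw[OF that]
   show ?thesis by measurable
   qed
   have "(NN mu (%x. ennreal (C powr p * real (card E) powr p * (\<Sum>e\<in>E. abs (w e (mm x (z s)) - w e x) powr p)))) =
   (NN mu (%x. ennreal (C powr p * real (card E) powr p) * (\<Sum>e\<in>E. ennreal (abs (w e (mm x (z s)) - w e x) powr p))))"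
   by (simp add: ennreal_mult sum_nonneg)
   also have "... = en (C powr p * real (card E) powr p) * (\<Sum>e\<in>E. modulus p (w e) (z s))"
   proof -
   have ms: "(%x. \<Sum>e\<in>E. ennreal (abs (w e (mm x (z s)) - w e x) powr p)) : borel_measurable mu"
   using me by (intro borel_measurable_sum)
   show ?thesis unfolding modulus_def
   by (subst nn_integral_cmult[OF ms], subst nn_integral_sum) (simp_all only: me)
   qed
   also have "... <= en (C powr p * real (card E) powr p) * (\<Sum>e\<in>E. ennreal ep)"
   using small True by (intro mult_left_mono sum_mono) (auto simp: w_def[abs_def] z_def)
   finally show ?thesis using True by simp
  qed simp
 qed
 also have "... = en (C powr p * real (card E) powr p) * (of_nat (card E) * ennreal ep)"
  by (simp add: nn_integral_multc)
 finally show ?thesis unfolding D_def z_def by simp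
qed

end

context carnot_group begin

lemma proj_inner_basis:
 assumes k: "1 <= k" and e: "e : layer_basis k"
 shows "proj k x \<bullet> e = x \<bullet> e"
proof -
 have "e' \<bullet> e = (if e' = e then 1 else 0)" if "e' : layer_basis k" for e'
  using layer_basis(2)[OF k] layer_basis(3)[OF k, of e] e that
  by (auto simp: pairwise_def orthogonal_def norm_eq_1)
 then have "proj k x \<bullet> e = (\<Sum>e'\<in>layer_basis k. if e' = e then x \<bullet> e else 0)"
  unfolding proj_def inner_sum_left by (intro sum.cong) auto
 then show ?thesis using e layer_basis(7)[OF k] by simp
qed

end

context sobolev_coordinate begin

text \<open>Telescoping along a word: the difference quotients of the letters add up, and so do
  their linear parts, because the first-layer component of a product is the sum of the letters. The
  number and size of the letters are bounded uniformly, hence so is the error.\<close>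

lemma first_order:
 assumes K: "compact K" "K <= Om" and p: "1 <= p" "p <= q" and ep: "0 < ep"
 shows "\<exists>r1>0. ALL r ze. 0 < r --> r <= r1 --> norm ze <= rh -->
  (NN mu (%x. ind K x * en (abs ((u (mm x (dl r ze)) - u x) / r - grad x \<bullet> ze) powr p))) <= ennreal ep"
proof -
 obtain r0 K' U N C where W: "word_data rh Om K r0 K' U N C" using word_geometry[OF open_Om K] by blast
 note r0 = word_dataD(1,2)[OF W] and K' = word_dataD(3,4)[OF W] and U = word_dataD(5-7)[OF W] and C = word_dataD(8)[OF W]
  and words = word_dataD(9)[OF W] and seg = word_dataD(10)[OF W]
 have [measurable]: "K : sets borel" "K' : sets borel" using K(1) K'(1) by (auto intro: borel_compact)
 \<comment> \<open>The constants met below: N^p for the power of a sum of at most N terms, N for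
   adding the letter bounds, and the rest from \<open>segment_estimate\<close>.\<close>
 define c where "c = real N powr p * (real N * (C powr p * real (card E) powr p * real (card E)))"
 have c: "0 <= c" by (simp add: c_def)
 define ep' where "ep' = ep / (c + 1)"
 have ep': "0 < ep'" "c * ep' <= ep" using c ep by (auto simp: ep'_def field_simps)
 define w where "w e x = ind K' x * partial e x" for e x
 have "\<forall>\<^sub>F z in at 0. \<forall>e\<in>E. modulus p (w e) z <= ennreal ep'"
 proof (rule eventually_ball_finite[OF E(1)], rule ballI)
  fix e assume e: "e : E"
  have "(modulus p (w e) \<longlongrightarrow> 0) (at 0)"
   unfolding w_def[abs_def] by (rule modulus_Lp[OF integrable_partial[OF E(2)[OF e] K'] p(1) Lp_mass_partial[OF E(2)[OF e] K' p]])
  from ennreal_tendsto_0D[OF this ep'(1)] show "\<forall>\<^sub>F z in at 0. modulus p (w e) z <= ennreal ep'" .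
 qed
 then obtain de where de: "0 < de" "!!z. z ~= 0 ==> norm z < de ==> \<forall>e\<in>E. modulus p (w e) z <= ennreal ep'"
  by (auto simp: eventually_at dist_norm)
 have small: "modulus p (w e) z <= ennreal ep'" if "norm z < de" "e : E" for z e
  using de(2)[of z] that by (cases "z = 0") auto
 obtain r2 where r2: "0 < r2" and prod: "!!r z v s. 0 < r ==> r <= r2 ==> z : words N C ==> norm v <= C ==>
   s : {0..1} ==> norm (mm (dl r z) (s *R (r *R v))) < de"
  using small_products[OF C de(1), of N] by blast
 have main: "(NN mu (%x. ind K x * en (abs ((u (mm x (dl r ze)) - u x) / r - grad x \<bullet> ze) powr p))) <= ennreal ep"
  if r: "0 < r" "r <= min r0 r2" and ze: "norm ze <= rh" for r ze
 proof -
  have rr: "r <= r0" "r <= r2" using r by auto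
  obtain vs where vs: "length vs <= N" "ze = foldr mm vs 0" "\<forall>v\<in>set vs. v : layer G 1 & norm v <= C"
   "!!r i x. 0 < r ==> r <= r0 ==> x : K ==> mm x (dl r (foldr mm (take i vs) 0)) : U"
   using words[OF ze] by blast
  define n where "n = length vs"
  define P where "P i = dl r (foldr mm (take i vs) 0)" for i
  have P0: "P 0 = 0" and Pn: "P n = dl r ze" by (simp_all add: P_def n_def vs(2))
  have v: "vs ! i : layer G 1" "norm (vs ! i) <= C" if "i < n" for i using vs(3) that by (auto simp: n_def)
  have PS: "P (Suc i) = mm (P i) (r *R vs ! i)" if "i < n" for i
   using that foldr_take_Suc[of i vs] dilation_layer[of 1 "vs ! i" r] v[OF that] r by (simp add: P_def n_def dilation_mult)
  have PU: "mm x (P i) : U" if "x : K" for x i unfolding P_def by (rule vs(4)[OF r(1) rr(1) that])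
  \<comment> \<open>The factor \<open>ind K' x\<close> makes \<open>D i\<close> Borel measurable,
    since \<open>grad\<close> is controlled only on compact subsets of \<open>Om\<close>; on
    \<open>K\<close> it equals 1.\<close>
  define D where "D i x = (u (mm x (P (Suc i))) - u (mm x (P i))) / r - ind K' x * (grad x \<bullet> vs ! i)" for i x
  have mD[measurable]: "D i : BM" for i
   using borel_measurable_integrable[OF integrable_grad[OF K', of "vs ! i"]] unfolding D_def[abs_def] by measurable
  have step: "(NN mu (%x. ind K x * en (abs (D i x) powr p))) <= en (C powr p * real (card E) powr p) * (of_nat (card E) * ennreal ep')"
   if i: "i < n" for i
  proof -
   have "(NN mu (%x. ind K x * en (abs (D i x) powr p))) =
   (NN mu (%x. ind K x * en (abs ((u (mm x (mm (P i) (r *R vs ! i))) - u (mm x (P i))) / r - grad x \<bullet> vs ! i) powr p)))"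
   by (rule nn_integral_cong) (use U in \<open>auto simp: D_def PS[OF i] indicator_def\<close>)
   also have "... <= en (C powr p * real (card E) powr p) * (of_nat (card E) * ennreal ep')"
   proof (rule segment_estimate[OF v[OF i] r(1) U(1) K' K(1) _ _ PU p(1)])
   show "K <= K'" using U by blast
   show "mm y (s *R (r *R vs ! i)) : K'" if "y : U" "s : {0..1}" for y s
   by (rule seg[OF r(1) rr(1) v(2)[OF i] that])
   show "modulus p (%x. ind K' x * partial e x) (mm (P i) (s *R (r *R vs ! i))) <= ennreal ep'"
   if "e : E" "s : {0..1}" for e s
   using small[OF prod[OF r(1) rr(2) foldr_take_words[OF vs(3,1)] v(2)[OF i] that(2)] that(1)]
   unfolding w_def[abs_def] P_def .
   qed
   finally show ?thesis .
  qed
  have sum: "(u (mm x (dl r ze)) - u x) / r - grad x \<bullet> ze = (\<Sum>i<n. D i x)" if x: "x : K" for x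
  proof -
   have xK': "x : K'" using U x by blast
   have "(\<Sum>i<n. u (mm x (P (Suc i))) - u (mm x (P i))) = u (mm x (P n)) - u (mm x (P 0))"
   by (rule sum_lessThan_telescope)
   moreover have "grad x \<bullet> ze = (\<Sum>i<n. grad x \<bullet> vs ! i)"
   proof -
   have "grad x \<bullet> ze = grad x \<bullet> proj 1 ze"
   unfolding grad_inner using proj_inner_basis[of 1 _ ze] by (intro sum.cong) auto
   also have "proj 1 ze = sum_list vs" unfolding vs(2) by (rule proj_1_foldr) (use vs(3) in auto)
   also have "... = (\<Sum>i<n. vs ! i)" by (simp add: sum_list_sum_nth n_def atLeast0LessThan)
   finally show ?thesis by (simp add: inner_sum_right)
   qed
   ultimately show ?thesis using xK' by (simp add: D_def sum_subtractf Pn P0 flip: sum_divide_distrib)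
  qed
  have "(NN mu (%x. ind K x * en (abs ((u (mm x (dl r ze)) - u x) / r - grad x \<bullet> ze) powr p))) <=
   (NN mu (%x. ennreal (real N powr p) * (\<Sum>i<n. ind K x * en (abs (D i x) powr p))))"
  proof (rule nn_integral_mono)
   fix x
   show "ind K x * en (abs ((u (mm x (dl r ze)) - u x) / r - grad x \<bullet> ze) powr p) <=
   en (real N powr p) * (\<Sum>i<n. ind K x * en (abs (D i x) powr p))"
   proof (cases "x : K")
   case True
   have "abs (\<Sum>i<n. D i x) powr p <= (\<Sum>i<n. abs (D i x)) powr p" using p by (intro powr_mono2) auto
   also have "... <= real n powr p * (\<Sum>i<n. abs (D i x) powr p)"
   using sum_powr_le[of "{..<n}" "%i. abs (D i x)" p] p by simp
   also have "... <= real N powr p * (\<Sum>i<n. abs (D i x) powr p)"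
   using vs(1) p by (intro mult_right_mono powr_mono2 sum_nonneg) (auto simp: n_def)
   finally have "en (abs (\<Sum>i<n. D i x) powr p) <= en (real N powr p) * (\<Sum>i<n. ennreal (abs (D i x) powr p))"
   by (simp add: ennreal_mult[symmetric] sum_nonneg ennreal_leI)
   then show ?thesis using True by (simp add: sum[OF True])
   qed simp
  qed
  also have "... = en (real N powr p) * (\<Sum>i<n. NN mu (%x. ind K x * en (abs (D i x) powr p)))"
   by (subst nn_integral_cmult, measurable, subst nn_integral_sum, measurable)
  also have "... <= en (real N powr p) * (\<Sum>i<n. ennreal (C powr p * real (card E) powr p) * (of_nat (card E) * ennreal ep'))"
   by (intro mult_left_mono sum_mono step) auto
  also have "... = en (real N powr p) * (of_nat n * (en (C powr p * real (card E) powr p) * (of_nat (card E) * ennreal ep')))"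
   by simp
  also have "... <= en (real N powr p) * (of_nat N * (en (C powr p * real (card E) powr p) * (of_nat (card E) * ennreal ep')))"
   using vs(1) by (intro mult_left_mono mult_right_mono) (auto simp: n_def)
  also have "... = en (c * ep')"
   using ep'(1) by (simp add: c_def ennreal_mult ennreal_of_nat_eq_real_of_nat mult_ac)
  also have "... <= ennreal ep" by (rule ennreal_leI[OF ep'(2)])
  finally show ?thesis .
 qed
 show ?thesis using main r0(1) r2 by (intro exI[of _ "min r0 r2"]) auto
qed

end

section \<open>Derivatives and moments of the mollifier\<close>

context carnot_mollifier begin

text \<open>If the ball carrying \<open>et\<close> were a null set, the integral of
  \<open>et\<close> would be 0 instead of 1.\<close>

lemma support_measure: "0 < measure mu (cball 0 rh)" "emeasure mu (cball 0 rh) = en (measure mu (cball 0 rh))"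
proof -
 have cs: "cball 0 rh : sets mu" by (simp add: borel_closed)
 show e: "emeasure mu (cball 0 rh) = en (measure mu (cball 0 rh))"
  using emeasure_cball_finite[of 0 rh] by (intro emeasure_eq_ennreal_measure) auto
 have "measure mu (cball 0 rh) ~= 0"
 proof
  assume "measure mu (cball 0 rh) = 0"
  then have "cball 0 rh : null_sets mu" using e cs by auto
  then have "AE x in mu. x \<notin> cball 0 rh" by (rule AE_not_in)
  then have "AE x in mu. et x = 0" by (rule AE_mp) (use et_zero in auto)
  then have "(LINT x|mu. et x) = 0" by (rule integral_eq_zero_AE)
  then show False using integral_et by simp
 qed
 then show "0 < measure mu (cball 0 rh)" using measure_nonneg[of mu "cball 0 rh"] by linarith
qed

text \<open>Converts an estimate uniform in the direction into an L^p estimate of the average over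
  directions. Jensen contributes the power p - 1 of the measure of the ball, and the outer integral
  over directions one more.\<close>

lemma jensen_fubini:
 assumes [measurable]: "K : sets borel" "(%z. h (fst z) (snd z)) : borel_measurable (mu \<Otimes>\<^sub>M mu)"
  and h: "!!x ze. 0 <= h x ze" and p: "1 <= p" and M: "0 <= M"
  and F: "!!x. x : K ==> en (abs (F x)) <= ennreal M * (NN mu (%ze. ind (cball 0 rh) ze * en (h x ze)))"
  and B: "!!ze. norm ze <= rh ==> (NN mu (%x. ind K x * en (h x ze powr p))) <= B"
 shows "(NN mu (%x. ind K x * en (abs (F x) powr p))) <=
  en (M powr p * measure mu (cball 0 rh) powr p) * B"
proof -
 define S where "S = cball (0::'a) rh"
 have [measurable]: "S : sets borel" by (simp add: S_def borel_closed)
 define m where "m = measure mu S"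
 have m: "0 < m" "emeasure mu S = ennreal m" using support_measure by (simp_all add: m_def S_def)
 let ?M = "restrict_space mu S"
 have e: "(NN ?M (%s. k s)) = (NN mu (%s. ind S s * k s))" for k :: "'a => ennreal"
  by (subst nn_integral_restrict_space) (auto simp: mult.commute)
 have mM: "emeasure ?M (space ?M) = ennreal m" by (simp add: emeasure_restrict_space space_restrict_space m)
 have mh[measurable]: "h x : BM" for x
  using measurable_compose[of "%ze. (x, ze)" mu "mu \<Otimes>\<^sub>M mu" "%z. h (fst z) (snd z)" borel] assms(2) by simp
 have pw: "en (abs (F x) powr p) <= en (m powr (p - 1)) * (NN mu (%ze. ind S ze * en (M powr p * h x ze powr p)))"
  if x: "x : K" for x
 proof -
  have "en (abs (F x)) <= (NN ?M (%ze. ennreal (M * h x ze)))"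
  proof -
   have "ennreal M * (NN mu (%ze. ind S ze * en (h x ze))) = (NN mu (%ze. ennreal M * (ind S ze * en (h x ze))))"
   by (rule nn_integral_cmult[symmetric]) measurable
   also have "... = (NN ?M (%ze. ennreal (M * h x ze)))"
   unfolding e using M h by (intro nn_integral_cong) (simp add: ennreal_mult mult_ac)
   finally show ?thesis using F[OF x] by (simp add: S_def)
  qed
  then have "en (abs (F x) powr p) <= en (m powr (p - 1)) * (NN ?M (%ze. ennreal ((M * h x ze) powr p)))"
   using M h by (intro powr_le_nn_integral[OF _ _ p mM m(1)]) (auto intro!: measurable_restrict_space1)
  then show ?thesis unfolding e using M h by (simp add: powr_mult)
 qed
 have "(NN mu (%x. ind K x * en (abs (F x) powr p))) <=
   (NN mu (%x. ennreal (m powr (p - 1)) * (NN mu (%ze. ind S ze * (en (M powr p) * (ind K x * en (h x ze powr p)))))))"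
 proof (rule nn_integral_mono)
  fix x
  show "ind K x * en (abs (F x) powr p) <= en (m powr (p - 1)) *
   (NN mu (%ze. ind S ze * (en (M powr p) * (ind K x * en (h x ze powr p)))))"
   using pw[of x] by (cases "x : K") (simp_all add: ennreal_mult)
 qed
 also have "... = en (m powr (p - 1)) *
   (NN mu (%x. (NN mu (%ze. ind S ze * (en (M powr p) * (ind K x * en (h x ze powr p)))))))"
  by (rule nn_integral_cmult) measurable
 also have "... = en (m powr (p - 1)) *
   (NN mu (%ze. (NN mu (%x. ind S ze * (en (M powr p) * (ind K x * en (h x ze powr p)))))))"
  by (rule arg_cong[where f = "%t. ennreal (m powr (p - 1)) * t"], rule mumu.Fubini'[symmetric]) (simp add: case_prod_beta)
 also have "... <= en (m powr (p - 1)) * (NN mu (%ze. ind S ze * (en (M powr p) * B)))"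
 proof (intro mult_left_mono nn_integral_mono)
  fix ze
  have [measurable]: "(%x. h x ze) : BM"
   using measurable_compose[of "%x. (x, ze)" mu "mu \<Otimes>\<^sub>M mu" "%z. h (fst z) (snd z)" borel] assms(2) by simp
  have "(NN mu (%x. ind S ze * (en (M powr p) * (ind K x * en (h x ze powr p))))) =
   ind S ze * (en (M powr p) * (NN mu (%x. ind K x * en (h x ze powr p))))"
   by (simp add: nn_integral_cmult)
  also have "... <= ind S ze * (en (M powr p) * B)"
   using B[of ze] by (cases "ze : S") (auto simp: S_def intro!: mult_left_mono)
  finally show "(NN mu (%x. ind S ze * (en (M powr p) * (ind K x * en (h x ze powr p))))) <=
   ind S ze * (en (M powr p) * B)" .
 qed simp
 also have "... = en (m powr (p - 1)) * (ennreal m * (en (M powr p) * B))"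
  by (simp add: nn_integral_multc m(2))
 also have "... = en (M powr p * (m powr (p - 1) * m powr 1)) * B"
  using m(1) by (simp add: ennreal_mult mult_ac)
 also have "m powr (p - 1) * m powr 1 = m powr p"
  using powr_add[of m "p - 1" 1, symmetric] by (simp only: diff_add_cancel)
 finally show ?thesis by (simp add: m_def S_def)
qed

lemma smooth_mollifier: "smooth_on (mollifier G et r) UNIV"
proof -
 have "smooth_on (%x. et (dl (1 / r) x) * (1 / r ^ homogeneous_dim G)) UNIV"
  by (intro smooth_on_mult smooth_on_const smooth_on_compose[OF smooth_et] smooth_on_linear[OF bounded_linear_dilation])
 then show ?thesis by (simp add: mollifier_def[abs_def])
qed

text \<open>A horizontal vector is scaled by exactly 1 / r under the dilation of factor 1 / r, which
  produces the single factor 1 / r.\<close>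

lemma lie_deriv_translated_mollifier:
 assumes v: "v : layer G 1" and r: "0 < r"
 shows "lie_deriv G v (%x. mollifier G et r (mm (- y) x)) x =
  (1 / r ^ homogeneous_dim G) * ((1 / r) * lie_deriv G v et (dl (1 / r) (mm (- y) x)))"
proof -
 define z where "z = dl (1 / r) (mm (- y) x)"
 define ka where "ka = 1 / r ^ homogeneous_dim G"
 have s: "smooth_on (%x. mollifier G et r (mm (- y) x)) UNIV"
  by (intro smooth_on_compose[OF smooth_mollifier] smooth_mul smooth_ident smooth_on_const)
 have e: "mollifier G et r (mm (- y) (mm x (t *R v))) = ka * et (mm z ((t * (1 / r)) *R v))" for t
 proof -
  have "dl (1 / r) (t *R v) = (t * (1 / r)) *R v"
   using dilation_layer[of 1 "t *R v" "1 / r"] v r subspace_scale[OF subspace_layer[of 1] v] by simp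
  then show ?thesis using r by (simp add: mollifier_def z_def ka_def dilation_mult flip: assoc)
 qed
 have l: "((%t. t * (1 / r)) has_vector_derivative (1 / r)) (at 0)"
  unfolding has_vector_derivative_def using r by (auto intro!: derivative_eq_intros)
 have "((%t. et (mm z (t *R v))) has_vector_derivative lie_deriv G v et z) (at (0 * (1 / r)))"
  using line_has_vector_derivative[OF smooth_et, of z v] by simp
 from vector_diff_chain_at[OF l this]
 have "((%t. et (mm z ((t * (1 / r)) *R v))) has_vector_derivative (1 / r) *R lie_deriv G v et z) (at 0)"
  by (simp add: o_def)
 from has_vector_derivative_mult_right[OF this, of ka]
 have "((%t. mollifier G et r (mm (- y) (mm x (t *R v)))) has_vector_derivative ka * ((1 / r) *R lie_deriv G v et z)) (at 0)"
  unfolding e .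
 with line_has_vector_derivative[OF s, of x v] show ?thesis
  unfolding z_def[symmetric] ka_def[symmetric] real_scaleR_def by (rule vector_derivative_unique_at)
qed

text \<open>For \<open>x\<close> in \<open>O'\<close> only the values of \<open>f\<close> on
  \<open>K'\<close> enter, so the convolution is there a parameter integral against an integrable
  function of compact support. In the last two formulas the Jacobian of the rescaling cancels the
  normalisation of the mollifier.\<close>

lemma conv_local:
 fixes f :: "'a => 'c::euclidean_space"
 assumes r: "0 < r" and O: "open O'" and K': "compact K'" and f: "integrable mu (%x. ind K' x *R f x)"
  and supp: "!!x y. x : O' ==> y \<notin> K' ==> et (dl (1 / r) (mm (- y) x)) = 0"
 shows "x : O' ==> integrable mu (conv_integrand G f (mollifier G et r) x)" (is "_ ==> ?A")
  and "smooth_on (group_conv G mu f (mollifier G et r)) O'" (is "?B")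
  and "x : O' ==> group_conv G mu f (mollifier G et r) x =
   (LINT ze|mu. et ze *R (ind K' (mm x (- dl r ze)) *R f (mm x (- dl r ze))))" (is "_ ==> ?C")
  and "x : O' ==> v : layer G 1 ==> lie_deriv G v (group_conv G mu f (mollifier G et r)) x =
   (1 / r) *R (LINT ze|mu. lie_deriv G v et ze *R (ind K' (mm x (- dl r ze)) *R f (mm x (- dl r ze))))" (is "_ ==> _ ==> ?D")
proof -
 define f' where "f' x = ind K' x *R f x" for x
 have if': "integrable mu f'" using f by (simp add: f'_def[abs_def])
 have [measurable]: "f' : BM" using borel_measurable_integrable[OF if'] by simp
 have z: "f' y = 0" if "y \<notin> K'" for y using that by (simp add: f'_def)
 define H where "H p = mollifier G et r (mm (- snd p) (fst p))" for p :: "'a \<times> 'a"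
 have sH: "smooth_on H UNIV"
  unfolding H_def[abs_def]
  by (intro smooth_on_compose[OF smooth_mollifier] smooth_on_compose[OF smooth_mult smooth_on_Pair, simplified]
   smooth_on_linear bounded_linear_minus bounded_linear_snd bounded_linear_fst)
 have conv: "conv_integrand G f (mollifier G et r) x = (%y. H (x, y) *R f' y)" if "x : O'" for x
 proof
  fix y show "conv_integrand G f (mollifier G et r) x y = H (x, y) *R f' y"
   using supp[OF that, of y] by (cases "y : K'") (simp_all add: conv_integrand_def H_def f'_def mollifier_def)
 qed
 have cH: "continuous_on UNIV (%y. H (x, y))" for x
  by (intro continuous_on_compose2[OF smooth_on_continuous[OF sH]] continuous_intros) auto
 show ?A if "x : O'" unfolding conv[OF that] by (rule integrable_bounded_mult[OF if' z K' cH])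
 define F where "F x = (LINT y|mu. H (x, y) *R f' y)" for x
 have gF: "group_conv G mu f (mollifier G et r) x = F x" if "x : O'" for x
  by (simp add: group_conv_def F_def conv[OF that])
 have sF: "smooth_on F UNIV" unfolding F_def[abs_def] by (rule parameter_smooth[OF if' z K' sH])
 show ?B unfolding smooth_on_def
 proof
  fix k
  have "Ck_on k F O'" using sF Ck_on_subset[of k F UNIV O'] by (simp add: smooth_on_def)
  then show "Ck_on k (group_conv G mu f (mollifier G et r)) O'"
   by (rule Ck_on_cong[OF _ O gF])
 qed
 define ka where "ka = 1 / r ^ homogeneous_dim G"
 have ka: "ka * r ^ homogeneous_dim G = 1" using r by (simp add: ka_def)
 have subst: "(LINT y|mu. (ka * k (dl (1 / r) (mm (- y) x))) *R f' y) = (LINT ze|mu. k ze *R f' (mm x (- dl r ze)))"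
  if [measurable]: "k : BM" for k x
 proof -
  have "(LINT y|mu. (ka * k (dl (1 / r) (mm (- y) x))) *R f' y) =
   ka *R (LINT y|mu. k (dl (1 / r) (mm (- y) x)) *R f' y)" by (simp flip: scaleR_scaleR)
  also have "... = ka *R (r ^ homogeneous_dim G *R (LINT ze|mu. k ze *R f' (mm x (- dl r ze))))"
   by (subst conv_subst_dilation[OF _ _ r]) auto
  finally show ?thesis using ka by simp
 qed
 show ?C if "x : O'"
  using subst[OF measurable_et, of x] unfolding gF[OF that] F_def H_def mollifier_def ka_def f'_def by simp
 show ?D if x: "x : O'" and v: "v : layer G 1"
 proof -
  let ?g = "group_conv G mu f (mollifier G et r)"
  have "(F has_derivative (%w. LINT y|mu. frechet_derivative H (at (x, y)) (w, 0) *R f' y)) (at x)"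
   unfolding F_def[abs_def] by (rule parameter_has_derivative[OF if' z K' sH])
  then have "(?g has_derivative (%w. LINT y|mu. frechet_derivative H (at (x, y)) (w, 0) *R f' y)) (at x)"
   by (rule has_derivative_transform_within_open[OF _ O x]) (simp add: gF)
  then have "lie_deriv G v ?g x = (LINT y|mu. frechet_derivative H (at (x, y)) (left_field G v x, 0) *R f' y)"
   unfolding lie_deriv_def by (simp add: frechet_derivative_eqI)
  also have "... = (LINT y|mu. (ka * ((1 / r) * lie_deriv G v et (dl (1 / r) (mm (- y) x)))) *R f' y)"
  proof -
   have "frechet_derivative H (at (x, y)) (left_field G v x, 0) =
   ka * ((1 / r) * lie_deriv G v et (dl (1 / r) (mm (- y) x)))" for y
   proof -
   have "((%a. (a, y)) has_derivative (%a. (a, 0))) (at x)" by (auto intro!: derivative_eq_intros)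
   from has_derivative_compose[OF this smooth_on_has_derivative[OF sH]]
   have "((%a. H (a, y)) has_derivative (%a. frechet_derivative H (at (x, y)) (a, 0))) (at x)" .
   from frechet_derivative_eqI[OF this]
   have "lie_deriv G v (%a. H (a, y)) x = frechet_derivative H (at (x, y)) (left_field G v x, 0)"
   unfolding lie_deriv_def by simp
   then show ?thesis using lie_deriv_translated_mollifier[OF v r, of y x] by (simp add: H_def ka_def)
   qed
   then show ?thesis by simp
  qed
  also have "... = (LINT ze|mu. ((1 / r) * lie_deriv G v et ze) *R f' (mm x (- dl r ze)))"
   by (rule subst) (intro borel_measurable_times borel_measurable_const
   borel_measurable_continuous_onI[OF smooth_on_continuous[OF smooth_lie_deriv[OF smooth_et]]])
  also have "... = (1 / r) *R (LINT ze|mu. lie_deriv G v et ze *R f' (mm x (- dl r ze)))"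
   by (simp only: scaleR_scaleR[symmetric] integral_scaleR_right)
  finally show ?thesis unfolding f'_def .
 qed
qed

end

context carnot_haar begin

text \<open>Left-invariant fields are divergence free.\<close>

lemma integral_lie_deriv_0:
 fixes ps :: "'a => real"
 assumes s: "smooth_on ps UNIV" and K: "compact K" "!!x. x \<notin> K ==> ps x = 0"
 shows "(LINT y|mu. lie_deriv G v ps y) = 0"
proof -
 \<comment> \<open>Contains all points that the flow brings into \<open>K\<close> within times of
   absolute value at most 1, so its indicator can be inserted without changing the
   integrals.\<close>
 define K' where "K' = (%p. mm (fst p) (- (snd p *R v))) ` (K \<times> {-1..1::real})"
 have K': "compact K'" unfolding K'_def
  by (intro compact_continuous_image continuous_on_mul continuous_intros compact_Times K(1)) auto
 have [measurable]: "K' : sets borel" using K' by (rule borel_compact)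
 have cps: "continuous_on UNIV ps" by (rule smooth_on_continuous[OF s])
 have mps[measurable]: "ps : BM" by (rule borel_measurable_continuous_onI[OF cps])
 have in_K': "y : K'" if "mm y (t *R v) : K" "abs t <= 1" for y t
  unfolding K'_def by (rule image_eqI[of _ _ "(mm y (t *R v), t)"]) (use that in auto)
 have KK': "K <= K'" using in_K'[of _ 0] by auto
 have iu: "integrable mu (ind K' :: 'a => real)"
  using compact_finite[OF K'] by (intro integrable_real_indicator) auto
 have "(LINT y|mu. ps (mm y (t *R v)) * ind K' y) = (LINT y|mu. ps y)" if "abs t < 1" for t
 proof -
  have "ps (mm y (t *R v)) * ind K' y = ps (mm y (t *R v))" for y
   using in_K'[of y t] K(2)[of "mm y (t *R v)"] that by (cases "y : K'") auto
  then show ?thesis using integral_right[OF mps, of "t *R v"] by (simp only:)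
 qed
 then have e: "(LINT y|mu. ps y) = (LINT y|mu. ps (mm y (t *R v)) * ind K' y)" if "t : {-1<..<1}" for t
  using that by (simp add: abs_less_iff)
 have "((%_. LINT y|mu. ps y) has_vector_derivative 0) (at (0::real))" by simp
 then have "((%t. LINT y|mu. ps (mm y (t *R v)) * ind K' y) has_vector_derivative 0) (at 0)"
  by (rule has_vector_derivative_transform_within_open[where S = "{-1<..<1}"]) (auto intro: e)
 with translate_has_derivative[OF s iu _ K', where v = v]
 have "(LINT y|mu. ind K' y * lie_deriv G v ps y) = 0"
  by (rule vector_derivative_unique_at) simp
 moreover have "ind K' y * lie_deriv G v ps y = lie_deriv G v ps y" for y
 proof -
  have "lie_deriv G v ps y = 0" if "y \<notin> K" by (rule lie_deriv_support[OF K(1)]) (use K(2) that in auto)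
  then show ?thesis using KK' by (cases "y : K'") auto
 qed
 ultimately show ?thesis by simp
qed

lemma lie_deriv_mult:
 fixes ph ps :: "'a => real"
 assumes "smooth_on ph UNIV" "smooth_on ps UNIV"
 shows "lie_deriv G v (%x. ph x * ps x) x = ph x * lie_deriv G v ps x + lie_deriv G v ph x * ps x"
 using frechet_derivative_eqI[OF has_derivative_mult[OF smooth_on_has_derivative[OF assms(1)] smooth_on_has_derivative[OF assms(2)]]]
 by (simp add: lie_deriv_def)

lemma lie_deriv_coordinate:
 assumes v: "v : layer G 1" and e: "e : layer_basis 1"
 shows "lie_deriv G v (%x. x \<bullet> e) x = v \<bullet> e"
proof -
 have s: "smooth_on (%x::'a. x \<bullet> e) UNIV" by (intro smooth_on_linear bounded_linear_inner_left)
 have i: "y \<bullet> e = proj 1 y \<bullet> e" for y using proj_inner_basis[of 1 e y] e by simp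
 have "mm x (t *R v) \<bullet> e = x \<bullet> e + t *R (v \<bullet> e)" for t
 proof -
  have "proj 1 (mm x (t *R v)) = proj 1 x + proj 1 (t *R v)"
   by (rule proj_mul) (use upper_1 in auto)
  then show ?thesis using i[of "mm x (t *R v)"] i[of x] i[of "t *R v"] by (simp add: inner_add_left)
 qed
 moreover have "((%t. x \<bullet> e + t *R (v \<bullet> e)) has_vector_derivative v \<bullet> e) (at 0)"
  by (auto intro!: derivative_eq_intros)
 ultimately have "((%t. mm x (t *R v) \<bullet> e) has_vector_derivative v \<bullet> e) (at 0)" by simp
 with line_has_vector_derivative[OF s, of x v] show ?thesis by (rule vector_derivative_unique_at)
qed

end

context carnot_mollifier begin

abbreviation "XE v \<equiv> lie_deriv G v et"

lemma XE_zero: "z \<notin> cball 0 rh ==> XE v z = 0"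
 by (rule lie_deriv_support[OF compact_cball et_zero])

lemma continuous_XE: "continuous_on UNIV (XE v)"
 by (rule smooth_on_continuous[OF smooth_lie_deriv[OF smooth_et]])

lemma measurable_XE [measurable]: "XE v : BM"
 by (rule borel_measurable_continuous_onI[OF continuous_XE])

lemma kernels_bounded: "\<exists>M\<ge>0. ALL z. abs (et z) <= M & abs (XE v z) <= M"
proof -
 obtain A where "0 <= A" "!!z. abs (et z) <= A" using bounded_test[OF continuous_et compact_cball et_zero] by blast
 moreover obtain B where "0 <= B" "!!z. abs (XE v z) <= B" using bounded_test[OF continuous_XE compact_cball XE_zero] by blast
 ultimately show ?thesis by (intro exI[of _ "max A B"]) (auto simp: le_max_iff_disj)
qed

lemma integral_XE: "(LINT z|mu. XE v z) = 0"
 by (rule integral_lie_deriv_0[OF smooth_et compact_cball et_zero])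

text \<open>Integration by parts: the derivative of the coordinate along \<open>v\<close> is the
  constant \<open>v \<bullet> e\<close>, and \<open>et\<close> has integral 1. Pairing with
  \<open>XE v\<close> thus recovers the directional derivative from the linear part of a
  function.\<close>

lemma integral_XE_coordinate:
 assumes v: "v : layer G 1" and e: "e : layer_basis 1"
 shows "(LINT z|mu. XE v z * (z \<bullet> e)) = - (v \<bullet> e)"
proof -
 have s: "smooth_on (%x::'a. x \<bullet> e) UNIV" by (intro smooth_on_linear bounded_linear_inner_left)
 have "(LINT z|mu. lie_deriv G v (%z. et z * (z \<bullet> e)) z) = 0"
  by (rule integral_lie_deriv_0[OF smooth_on_mult[OF smooth_et s] compact_cball[of 0 rh]]) (simp add: et_zero del: mem_cball)
 then have "(LINT z|mu. et z * (v \<bullet> e) + XE v z * (z \<bullet> e)) = 0"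
  by (simp add: lie_deriv_mult[OF smooth_et s] lie_deriv_coordinate[OF v e])
 moreover have "integrable mu (%z. XE v z * (z \<bullet> e))"
  by (rule integrable_compact_support[OF _ compact_cball, of _ 0 rh])
   (auto intro!: continuous_on_mult continuous_XE continuous_intros simp: XE_zero simp del: mem_cball)
 ultimately show ?thesis using integrable_et integral_et by simp
qed

lemma integrable_kernel:
 fixes Z :: "'a => 'c::euclidean_space"
 assumes k: "continuous_on UNIV k" "!!z. z \<notin> cball 0 rh ==> k z = 0" and Z: "integrable mu (%z. ind (cball 0 rh) z *R Z z)"
 shows "integrable mu (%z. k z *R Z z)"
proof -
 have "integrable mu (%z. k z *R (ind (cball 0 rh) z *R Z z))"
  by (rule integrable_bounded_mult[OF Z _ compact_cball[of 0 rh] k(1)]) simp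
 moreover have "(%z. k z *R (ind (cball 0 rh) z *R Z z)) = (%z. k z *R Z z)"
 proof
  fix z show "k z *R (ind (cball 0 rh) z *R Z z) = k z *R Z z"
   using k(2)[of z] by (cases "z : cball 0 rh") auto
 qed
 ultimately show ?thesis by simp
qed

lemma kernel_integral_bound:
 fixes Z :: "'a => 'c::euclidean_space"
 assumes k: "continuous_on UNIV k" "!!z. z \<notin> cball 0 rh ==> k z = 0" "!!z. abs (k z) <= M" and M: "0 <= M"
  and Z: "integrable mu (%z. ind (cball 0 rh) z *R Z z)"
  and D: "integrable mu (%z. ind (cball 0 rh) z * D z)" and le: "!!z. norm (Z z) <= C * D z"
 shows "norm (LINT z|mu. k z *R Z z) <= M * C * (LINT z|mu. ind (cball 0 rh) z * D z)"
proof -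
 have "norm (LINT z|mu. k z *R Z z) <= (LINT z|mu. M * C * (ind (cball 0 rh) z * D z))"
 proof (rule Bochner_Integration.integral_norm_bound_integral[OF integrable_kernel[OF k(1,2) Z]])
  show "integrable mu (%z. M * C * (ind (cball 0 rh) z * D z))" using D by simp
  fix z
  show "norm (k z *R Z z) <= M * C * (ind (cball 0 rh) z * D z)"
  proof (cases "z : cball 0 rh")
   case True
   have "norm (k z *R Z z) <= M * (C * D z)" using k(3)[of z] le[of z] M by (simp add: mult_mono)
   then show ?thesis using True by (simp add: mult.assoc)
  qed (use k(2) in \<open>simp del: mem_cball\<close>)
 qed
 then show ?thesis by simp
qed

end

section \<open>The contact form of an averaged map\<close>

context sobolev_map begin

text \<open>Left translation by the inverse of \<open>a\<close> reduces to a map \<open>h\<close> whose first layer is bounded by the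
 distance and whose second layer is bounded by its square; the contact form does not see the
 translation.\<close>

lemma contact_bound:
 assumes B: "adapted_basis H B" and b: "b : B" "b : layer H 2"
 shows "\<exists>C\<ge>0. ALL a Y. Y : BM --> integrable mu (%z. ind (cball 0 rh) z *R Y z) -->
  en (abs (representation B ((LINT z|mu. XE v z *R Y z) - T.area (LINT z|mu. et z *R Y z) (LINT z|mu. XE v z *R Y z)) b)) <=
  ennreal C * (NN mu (%z. ind (cball 0 rh) z * en ((T.d a (Y z))^2)))"
proof -
 define S where "S = cball (0::'a) rh"
 have [measurable]: "S : sets borel" by (simp add: S_def borel_closed)
 define m where "m = measure mu S"
 have m: "0 < m" "emeasure mu S = ennreal m" using support_measure by (simp_all add: m_def S_def)
 have iS: "integrable mu (ind S :: 'a => real)" using m(2) by (intro integrable_real_indicator) auto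
 obtain M where M: "0 <= M" "!!z. abs (et z) <= M" "!!z. abs (XE v z) <= M" using kernels_bounded[of v] by blast
 obtain C0 where C0: "0 <= C0" "!!x k. k : {1..step H} ==> norm (T.proj k x) <= C0 * T.d 0 x ^ k" using T.proj_le_dist by blast
 obtain N where N: "0 < N" "!!x. norm (representation B x b) <= norm x * N"
  using bounded_linear.pos_bounded[OF T.bounded_linear_representation[OF B, of b]] by blast
 obtain A where A: "0 < A" "!!x y. norm (T.area x y) <= norm x * norm y * A"
  using bounded_bilinear.pos_bounded[OF T.bounded_bilinear_area] by blast
 define C where "C = N * (M * C0 + A * (M * C0) * (M * C0) * m) + 1"
 have C: "0 < C" using N(1) M(1) C0(1) A(1) m(1) unfolding C_def
  by (intro add_nonneg_pos mult_nonneg_nonneg add_nonneg_nonneg) auto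
 have "en (abs (representation B ((LINT z|mu. XE v z *R Y z) - T.area (LINT z|mu. et z *R Y z) (LINT z|mu. XE v z *R Y z)) b)) <=
   ennreal C * (NN mu (%z. ind S z * en ((T.d a (Y z))^2)))"
  if [measurable]: "Y : BM" and iY: "integrable mu (%z. ind S z *R Y z)" for a Y
 proof (cases "(NN mu (%z. ind S z * en ((T.d a (Y z))^2))) = \<infinity>")
  case True
  then show ?thesis using C by (simp add: ennreal_mult_top)
 next
  case fin: False
  define h where "h z = mult H (- a) (Y z)" for z
  define de where "de z = T.d a (Y z)" for z
  have [measurable]: "de : BM" unfolding de_def[abs_def] by measurable
  have de0: "0 <= de z" for z by (simp add: de_def)
  have dh: "T.d 0 (h z) = de z" for z by (simp add: h_def de_def T.dist_eq_0[of a])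
  have Yh: "Y z = a + h z + T.area a (h z)" for z
  proof -
   have "Y z = mult H a (h z)" unfolding h_def by (metis T.assoc T.right_inverse T.left_neutral)
   then show ?thesis by (simp add: T.mul_eq)
  qed
  have la: "bounded_linear (T.area x)" for x by (rule bounded_bilinear.bounded_linear_right[OF T.bounded_bilinear_area])
  have ih: "integrable mu (%z. ind S z *R h z)"
  proof -
   have "integrable mu (%z. ind S z *R (- a) + ind S z *R Y z + T.area (- a) (ind S z *R Y z))"
   by (intro Bochner_Integration.integrable_add iY integrable_bounded_linear[OF la iY] integrable_scaleR_left) (use iS in auto)
   then show ?thesis by (simp add: h_def T.mul_eq scaleR_add_right scaleR_diff_right T.area_simps)
  qed
  have i2: "integrable mu (%z. ind S z * (de z)^2)"
  proof (rule integrableI_bounded)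
   have "(NN mu (%z. ennreal (norm (ind S z * (de z)^2)))) = (NN mu (%z. ind S z * en ((T.d a (Y z))^2)))"
   by (rule nn_integral_cong) (auto simp: indicator_def de_def)
   then show "(NN mu (%z. ennreal (norm (ind S z * (de z)^2)))) < \<infinity>" using fin by (simp add: less_top)
  qed simp
  have i1: "integrable mu (%z. ind S z * de z)"
  proof (rule Bochner_Integration.integrable_bound[where f = "%z. ind S z + ind S z * (de z)^2"])
   show "integrable mu (%z. ind S z + ind S z * (de z)^2)" using iS i2 by (rule Bochner_Integration.integrable_add)
   have "de z <= 1 + (de z)^2" for z using two_mult_le[of 1 "de z" 1] de0[of z] by simp
   then show "AE z in mu. norm (ind S z * de z) <= norm (ind S z + ind S z * (de z)^2)"
   using de0 by (intro AE_I2) (auto simp: indicator_def abs_of_nonneg)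
  qed simp
  define Q where "Q = (LINT z|mu. ind S z * (de z)^2)"
  define s where "s = (LINT z|mu. ind S z * de z)"
  have s0: "0 <= s" unfolding s_def using de0 by (intro Bochner_Integration.integral_nonneg) auto
  \<comment> \<open>Cauchy-Schwarz on the ball, read off from the nonnegative variance of
    \<open>de\<close>.\<close>
  have cs: "s * s <= m * Q"
  proof -
   have "0 <= (LINT z|mu. ind S z * (de z - s / m)^2)" by (intro Bochner_Integration.integral_nonneg) auto
   also have "... = (LINT z|mu. ind S z * (de z)^2 - (2 * s / m) * (ind S z * de z) + (s / m)^2 * ind S z)"
   by (rule Bochner_Integration.integral_cong) (auto simp: indicator_def power2_eq_square algebra_simps)
   also have "... = Q - (2 * s / m) * s + (s / m)^2 * m"
   using i1 i2 iS m by (simp add: Q_def s_def m_def)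
   also have "... = Q - s * s / m" using m(1) by (simp add: power2_eq_square field_simps)
   finally show ?thesis using m(1) by (simp add: field_simps)
  qed
  define I1 where "I1 Z = (LINT z|mu. et z *R Z z)" for Z :: "'a => 'b"
  define I2 where "I2 Z = (LINT z|mu. XE v z *R Z z)" for Z :: "'a => 'b"
  define mh nh where "mh = I1 h" and "nh = I2 h"
  have ik1: "integrable mu (%z. et z *R Z z)" if "integrable mu (%z. ind S z *R Z z)" for Z :: "'a => 'b"
   by (rule integrable_kernel[OF continuous_et et_zero]) (use that in \<open>simp_all add: S_def\<close>)
  have ik2: "integrable mu (%z. XE v z *R Z z)" if "integrable mu (%z. ind S z *R Z z)" for Z :: "'a => 'b"
   by (rule integrable_kernel[OF continuous_XE XE_zero]) (use that in \<open>simp_all add: S_def\<close>)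
  have iL: "integrable mu (XE v)" by (rule integrable_compact_support[OF continuous_XE compact_cball XE_zero])
  \<comment> \<open>\<open>et\<close> has integral 1, so averaging keeps the constant
    \<open>a\<close>; in the next identity \<open>XE v\<close> has integral 0 and removes
    it.\<close>
  have p: "I1 Y = a + mh + T.area a mh"
  proof -
   have "I1 Y = (LINT z|mu. et z *R a + et z *R h z + T.area a (et z *R h z))"
   unfolding I1_def by (rule Bochner_Integration.integral_cong) (simp_all add: Yh scaleR_add_right T.area_simps)
   also have "... = (LINT z|mu. et z *R a) + (LINT z|mu. et z *R h z) + (LINT z|mu. T.area a (et z *R h z))"
   using ik1[OF ih] integrable_bounded_linear[OF la ik1[OF ih]] integrable_et by (simp add: integrable_scaleR_left)
   also have "(LINT z|mu. T.area a (et z *R h z)) = T.area a mh"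
   unfolding mh_def I1_def by (rule integral_bounded_linear[OF la ik1[OF ih]])
   also have "(LINT z|mu. et z *R a) = a" using integral_et integrable_et by simp
   finally show ?thesis by (simp add: mh_def I1_def)
  qed
  have \<xi>: "I2 Y = nh + T.area a nh"
  proof -
   have "I2 Y = (LINT z|mu. XE v z *R a + XE v z *R h z + T.area a (XE v z *R h z))"
   unfolding I2_def by (rule Bochner_Integration.integral_cong) (simp_all add: Yh scaleR_add_right T.area_simps)
   also have "... = (LINT z|mu. XE v z *R a) + (LINT z|mu. XE v z *R h z) + (LINT z|mu. T.area a (XE v z *R h z))"
   using ik2[OF ih] integrable_bounded_linear[OF la ik2[OF ih]] iL by (simp add: integrable_scaleR_left)
   also have "(LINT z|mu. T.area a (XE v z *R h z)) = T.area a nh"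
   unfolding nh_def I2_def by (rule integral_bounded_linear[OF la ik2[OF ih]])
   also have "(LINT z|mu. XE v z *R a) = 0" using integral_XE[of v] iL by simp
   finally show ?thesis by (simp add: nh_def I2_def)
  qed
  \<comment> \<open>Left invariance of the form in coordinates: nested areas vanish, and the two
    terms \<open>T.area a nh\<close> cancel.\<close>
  have red: "I2 Y - T.area (I1 Y) (I2 Y) = nh - T.area mh nh"
  proof -
   have "T.area (T.area x y) w = 0" "T.area w (T.area x y) = 0" for x y w
   using T.area_add_area(1)[of 0 x y w] T.area_add_area(2)[of w 0 x y]
   by (simp_all add: bounded_bilinear.zero_left[OF T.bounded_bilinear_area] bounded_bilinear.zero_right[OF T.bounded_bilinear_area])
   then show ?thesis unfolding p \<xi> by (simp add: T.area_simps)
  qed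
  have lp: "bounded_linear (T.proj k)" for k by (rule T.bounded_linear_proj)
  have ip: "integrable mu (%z. ind S z *R T.proj k (h z))" for k
   using integrable_bounded_linear[OF lp ih] by (simp add: T.proj_simps)
  have pm: "norm (T.proj 1 mh) <= M * C0 * s"
  proof -
   have "T.proj 1 mh = (LINT z|mu. et z *R T.proj 1 (h z))"
   unfolding mh_def I1_def by (subst integral_bounded_linear[OF lp ik1[OF ih], symmetric]) (simp add: T.proj_simps)
   also have "norm ... <= M * C0 * s" unfolding s_def S_def
   by (rule kernel_integral_bound[OF continuous_et et_zero M(2,1)])
   (use ip[of 1] i1 C0(2)[of 1] in \<open>simp_all add: S_def dh[symmetric] T.step2\<close>)
   finally show ?thesis .
  qed
  have pn: "norm (T.proj 1 nh) <= M * C0 * s"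
  proof -
   have "T.proj 1 nh = (LINT z|mu. XE v z *R T.proj 1 (h z))"
   unfolding nh_def I2_def by (subst integral_bounded_linear[OF lp ik2[OF ih], symmetric]) (simp add: T.proj_simps)
   also have "norm ... <= M * C0 * s" unfolding s_def S_def
   by (rule kernel_integral_bound[OF continuous_XE XE_zero M(3,1)])
   (use ip[of 1] i1 C0(2)[of 1] in \<open>simp_all add: S_def dh[symmetric] T.step2\<close>)
   finally show ?thesis .
  qed
  have pn2: "norm (T.proj 2 nh) <= M * C0 * Q"
  proof -
   have "T.proj 2 nh = (LINT z|mu. XE v z *R T.proj 2 (h z))"
   unfolding nh_def I2_def by (subst integral_bounded_linear[OF lp ik2[OF ih], symmetric]) (simp add: T.proj_simps)
   also have "norm ... <= M * C0 * Q" unfolding Q_def S_def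
   by (rule kernel_integral_bound[OF continuous_XE XE_zero M(3,1)])
   (use ip[of 2] i2 C0(2)[of 2] in \<open>simp_all add: S_def dh[symmetric] T.step2\<close>)
   finally show ?thesis .
  qed
  \<comment> \<open>\<open>area\<close> sees only first-layer parts, each bounded by the first
    moment \<open>s\<close>; Cauchy-Schwarz turns the product into the second moment.\<close>
  have ar: "norm (T.area mh nh) <= A * (M * C0) * (M * C0) * (m * Q)"
  proof -
   have "T.area mh nh = T.area (T.proj 1 mh) (T.proj 1 nh)" by (rule T.area_proj) (simp_all add: T.proj_proj)
   also have "norm ... <= norm (T.proj 1 mh) * norm (T.proj 1 nh) * A" by (rule A(2))
   also have "... <= (M * C0 * s) * (M * C0 * s) * A"
   using pm pn A(1) M(1) C0(1) s0 by (intro mult_right_mono mult_mono) auto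
   also have "... = A * (M * C0) * (M * C0) * (s * s)" by (simp add: mult_ac)
   also have "... <= A * (M * C0) * (M * C0) * (m * Q)" using cs A(1) M(1) C0(1) by (intro mult_left_mono) auto
   finally show ?thesis .
  qed
  have Q0: "0 <= Q" unfolding Q_def by (intro Bochner_Integration.integral_nonneg) auto
  have "representation B (nh - T.area mh nh) b = representation B (T.proj 2 (nh - T.area mh nh)) b"
   using T.representation_proj[OF B, of 2 b] b by simp
  also have "abs ... <= norm (T.proj 2 (nh - T.area mh nh)) * N" using N(2) by simp
  also have "T.proj 2 (nh - T.area mh nh) = T.proj 2 nh - T.area mh nh" using T.proj_area by (simp add: T.proj_simps)
  also have "norm (T.proj 2 nh - T.area mh nh) * N <= (M * C0 * Q + A * (M * C0) * (M * C0) * (m * Q)) * N"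
   using pn2 ar N(1) by (intro mult_right_mono order_trans[OF norm_triangle_ineq4]) auto
  also have "... <= C * Q" using Q0 by (simp add: C_def algebra_simps)
  finally have "abs (representation B (I2 Y - T.area (I1 Y) (I2 Y)) b) <= C * Q" unfolding red .
  then have "en (abs (representation B (I2 Y - T.area (I1 Y) (I2 Y)) b)) <= ennreal C * ennreal Q"
   using C Q0 by (simp add: ennreal_mult[symmetric] ennreal_leI)
  also have "ennreal Q = (NN mu (%z. ennreal (ind S z * (de z)^2)))"
   unfolding Q_def by (rule nn_integral_eq_integral[OF i2, symmetric]) auto
  also have "... = (NN mu (%z. ind S z * en ((T.d a (Y z))^2)))"
   by (rule nn_integral_cong) (auto simp: indicator_def de_def)
  finally show ?thesis by (simp add: I1_def I2_def)
 qed
 then show ?thesis using C unfolding S_def by (intro exI[of _ C]) auto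
qed

end

lemma weak_deriv_cong_on:
 assumes "!!x. x : Om ==> u x = u' x"
 shows "weak_deriv G mu Om v u w \<longleftrightarrow> weak_deriv G mu Om v u' w"
proof -
 have i: "ind K x *R u x = ind K x *R u' x" "ind K x *R (abs (u x)) powr p = ind K x *R (abs (u' x)) powr p"
  if "K <= Om" for K x p
  using assms[of x] that by (cases "x : K"; auto)+
 have "Lp_on mu p K u \<longleftrightarrow> Lp_on mu p K u'" if "K <= Om" for p K
  unfolding Lp_on_def set_borel_measurable_def set_integrable_def i[OF that] ..
 moreover have "(LINT x:Om|mu. u x * h x) = (LINT x:Om|mu. u' x * h x)" for h
  unfolding set_lebesgue_integral_def
  by (rule Bochner_Integration.integral_cong) (use assms in \<open>auto simp: indicator_def\<close>)
 ultimately show ?thesis by (auto simp: weak_deriv_def Lp_loc_def)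
qed

context carnot_mollifier begin

text \<open>The difference annihilates all test functions, so \<open>weak_bound\<close> applies with
  majorant 0.\<close>

lemma weak_deriv_unique:
 assumes Om: "open Om" and w: "weak_deriv G mu Om v u w" "weak_deriv G mu Om v u w'"
 shows "AE x in mu. x : Om --> w x = w' x"
proof -
 have L: "Lp_loc mu 1 Om w" "Lp_loc mu 1 Om w'" using w by (auto simp: weak_deriv_def)
 have "AE x in mu. x : Om --> abs (w x - w' x) <= Cet * 0"
 proof (rule weak_bound[OF Om])
  show "Lp_loc mu 1 Om (%x. w x - w' x)"
  proof (rule Lp_loc_1I)
   fix K assume K: "compact K" "K <= Om"
   have "integrable mu (%x. ind K x * w x - ind K x * w' x)"
   using L K by (intro Bochner_Integration.integrable_diff measurable_set_integrable_loc)
   then show "integrable mu (%x. ind K x * (w x - w' x))" by (simp add: right_diff_distrib)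
  qed
  show "Lp_loc mu 1 Om (%_. 0)" by (rule Lp_loc_1I) simp
  fix ph assume t: "test_function Om ph"
  obtain K where K: "smooth_on ph UNIV" "compact K" "K <= Om" "!!x. x \<notin> K ==> ph x = 0"
   using t by (rule test_functionE) blast
  note i = integrable_test[OF _ K(2,3,4) smooth_on_continuous[OF K(1)]]
  have "(LINT x:Om|mu. (w x - w' x) * ph x) = (LINT x|mu. ind Om x *R (w x * ph x) - ind Om x *R (w' x * ph x))"
   unfolding set_lebesgue_integral_def by (rule Bochner_Integration.integral_cong) (auto simp: algebra_simps)
  also have "... = (LINT x:Om|mu. w x * ph x) - (LINT x:Om|mu. w' x * ph x)"
   unfolding set_lebesgue_integral_def by (rule Bochner_Integration.integral_diff; rule i) (use L in auto)
  also have "(LINT x:Om|mu. w x * ph x) = (LINT x:Om|mu. w' x * ph x)"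
   using w t by (simp add: weak_deriv_def)
  finally show "abs (LINT x:Om|mu. (w x - w' x) * ph x) <= (LINT x:Om|mu. 0 * abs (ph x))" by simp
 qed auto
 then show ?thesis by (rule AE_mp) auto
qed

end

section \<open>The smoothed differential near compact sets\<close>

context sobolev_map begin

text \<open>For small scales the kernel at a point of \<open>K\<close> sees only a compact part of
  \<open>Om\<close>, where \<open>f\<close> and \<open>ft\<close> agree. In the rescaled variable
  the cutoffs disappear, because \<open>et\<close> and \<open>XE v\<close> vanish off the ball of
  radius \<open>rh\<close>.\<close>

lemma conv_near:
 assumes K: "compact K" "K <= Om"
 shows "\<exists>r0>0. ALL r x. 0 < r --> r <= r0 --> x : K -->
  integrable mu (%ze. ind (cball 0 rh) ze *R ft (mm x (dl r (- ze)))) &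
  group_conv G mu f (mollifier G et r) x = (LINT ze|mu. et ze *R ft (mm x (dl r (- ze)))) &
  (\<forall>v\<in>layer G 1. lie_deriv G v (group_conv G mu f (mollifier G et r)) x =
   (1 / r) *R (LINT ze|mu. XE v ze *R ft (mm x (dl r (- ze)))))"
proof -
 obtain ta K1 U where K1: "compact K1" "K1 <= Om" and U: "open U" "K <= U" "U <= K1"
  using small_segments[OF open_Om K] by metis
 obtain K2 r1 where K2: "compact K2" "K2 <= Om" and r1: "0 < r1"
  and ker: "!!r x y. 0 < r ==> r <= r1 ==> x : K1 ==> y \<notin> K2 ==> kernel r x y = 0"
  using test_kernel[OF open_Om K1] by blast
 obtain r2 K3 where r2: "0 < r2" and K3: "compact K3" "K3 <= Om"
  and sub: "!!r ze x. 0 < r ==> r <= r2 ==> norm ze <= rh ==> x : K ==> mm x (dl r ze) : K3"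
  using metric_difference_Lp[OF K] by (elim exE conjE) blast
 define K' where "K' = K2 \<union> K3"
 have K': "compact K'" "K' <= Om" using K2 K3 by (auto simp: K'_def)
 have [measurable]: "K' : sets borel" using K'(1) by (rule borel_compact)
 have f_ft: "ind K' y *R f y = ind K' y *R ft y" for y
  using K'(2) ft_eq[of y] by (cases "y : K'") auto
 have if': "integrable mu (%y. ind K' y *R f y)" unfolding f_ft by (rule integrable_ft[OF K'])
 have main: "integrable mu (%ze. ind (cball 0 rh) ze *R ft (mm x (dl r (- ze)))) &
  group_conv G mu f (mollifier G et r) x = (LINT ze|mu. et ze *R ft (mm x (dl r (- ze)))) &
  (\<forall>v\<in>layer G 1. lie_deriv G v (group_conv G mu f (mollifier G et r)) x =
   (1 / r) *R (LINT ze|mu. XE v ze *R ft (mm x (dl r (- ze)))))"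
  if r: "0 < r" "r <= min r1 r2" and x: "x : K" for r x
 proof -
  have xU: "x : U" using x U by blast
  define f' where "f' y = ind K' y *R ft y" for y
  have [measurable]: "f' : BM" unfolding f'_def[abs_def] by measurable
  have supp: "et (dl (1 / r) (mm (- y) x')) = 0" if "x' : U" "y \<notin> K'" for x' y
   using ker[of r x' y] r U(3) that by (auto simp: kernel_def K'_def)
  note cl3 = conv_local(3)[OF r(1) U(1) K'(1) if' _ xU] and cl4 = conv_local(4)[OF r(1) U(1) K'(1) if' _ xU]
  have f'_in: "f' (mm x (- dl r ze)) = ft (mm x (dl r (- ze)))" if "ze : cball 0 rh" for ze
   using sub[of r "- ze" x] r x that by (simp add: f'_def K'_def dilation_simps)
  have kf: "k ze *R f' (mm x (- dl r ze)) = k ze *R ft (mm x (dl r (- ze)))"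
   if "!!z. z \<notin> cball 0 rh ==> k z = 0" for k ze
   using f'_in[of ze] that[of ze] by (cases "ze : cball 0 rh") (simp_all del: mem_cball)
  have "integrable mu (%ze. ind (cball 0 rh) ze *R f' (mm x (- dl r ze)))"
  proof -
   have "integrable mu f'" using if' by (simp only: f_ft f'_def[abs_def])
   then have "integrable mu (%z. f' (mm x z))" by (subst integrable_left) auto
   then have "integrable mu (%z. f' (mm x (- z)))" by (subst integrable_uminus[of "%z. f' (mm x z)"]) auto
   then have "integrable mu (%z. f' (mm x (- dl r z)))"
   using integral_dilation(2)[of "%z. f' (mm x (- z))" r] r(1) by simp
   then show ?thesis by (intro integrable_mult_indicator) (auto simp: borel_closed)
  qed
  then have "integrable mu (%ze. ind (cball 0 rh) ze *R ft (mm x (dl r (- ze))))"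
   by (subst (asm) kf) auto
  moreover have "group_conv G mu f (mollifier G et r) x = (LINT ze|mu. et ze *R ft (mm x (dl r (- ze))))"
  proof -
   have "group_conv G mu f (mollifier G et r) x = (LINT ze|mu. et ze *R f' (mm x (- dl r ze)))"
   unfolding f'_def f_ft[symmetric] by (rule cl3) (rule supp)
   also have "... = (LINT ze|mu. et ze *R ft (mm x (dl r (- ze))))"
   by (rule Bochner_Integration.integral_cong[OF refl], rule kf, rule et_zero)
   finally show ?thesis .
  qed
  moreover have "lie_deriv G v (group_conv G mu f (mollifier G et r)) x =
   (1 / r) *R (LINT ze|mu. XE v ze *R ft (mm x (dl r (- ze))))" if "v : layer G 1" for v
  proof -
   have "lie_deriv G v (group_conv G mu f (mollifier G et r)) x = (1 / r) *R (LINT ze|mu. XE v ze *R f' (mm x (- dl r ze)))"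
   unfolding f'_def f_ft[symmetric] by (rule cl4[OF _ that]) (rule supp)
   also have "(LINT ze|mu. XE v ze *R f' (mm x (- dl r ze))) = (LINT ze|mu. XE v ze *R ft (mm x (dl r (- ze))))"
   by (rule Bochner_Integration.integral_cong[OF refl], rule kf, rule XE_zero)
   finally show ?thesis .
  qed
  ultimately show ?thesis by blast
 qed
 show ?thesis using main r1 r2 by (intro exI[of _ "min r1 r2"]) auto
qed

text \<open>For \<open>e < r\<close> the closed ball of radius \<open>r + e\<close> is a compact
  subset of \<open>Om\<close>, and by the triangle inequality it contains the support of every
  kernel centred in the ball of radius \<open>r\<close>.\<close>

lemma conv_cc_ball:
 assumes sub: "cc_ball G x0 (2 * r) <= Om" and e: "0 < e" "e < r"
 shows "x : cc_ball G x0 r ==> integrable mu (conv_integrand G f (mollifier G et e) x)"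
  and "smooth_on (group_conv G mu f (mollifier G et e)) (cc_ball G x0 r)"
proof -
 define K' where "K' = {y. d x0 y <= r + e}"
 have K': "compact K'" "K' <= Om"
  using compact_cc_cball[of x0 "r + e"] sub e by (auto simp: K'_def cc_ball_def)
 have f_ft: "ind K' y *R f y = ind K' y *R ft y" for y
  using K'(2) ft_eq[of y] by (cases "y : K'") auto
 have if': "integrable mu (%y. ind K' y *R f y)" unfolding f_ft by (rule integrable_ft[OF K'])
 have supp: "et (dl (1 / e) (mm (- y) x)) = 0" if x: "x : cc_ball G x0 r" and y: "y \<notin> K'" for x y
 proof (rule ccontr)
  assume "et (dl (1 / e) (mm (- y) x)) ~= 0"
  then have "d 0 (dl (1 / e) (mm (- y) x)) < 1" using support_et by (auto simp: cc_ball_def)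
  moreover have "d 0 (dl (1 / e) (mm (- y) x)) = (1 / e) * d 0 (mm (- y) x)"
   using dist_dilation[of "1 / e" 0 "mm (- y) x"] e by (simp add: dilation_simps)
  ultimately have "d y x < e" using e by (simp add: dist_eq_0[of y] field_simps)
  then have "d x0 y < r + e" using x dist_triangle[of x0 y x] dist_sym[of x y] by (simp add: cc_ball_def)
  then show False using y by (simp add: K'_def)
 qed
 show "x : cc_ball G x0 r ==> integrable mu (conv_integrand G f (mollifier G et e) x)"
  by (rule conv_local(1)[OF e(1) open_cc_ball K'(1) if' supp])
 show "smooth_on (group_conv G mu f (mollifier G et e)) (cc_ball G x0 r)"
  by (rule conv_local(2)[OF e(1) open_cc_ball K'(1) if' supp])
qed

text \<open>The horizontal differential of the convolution in the rescaled variable. It is expressed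
  by \<open>ft\<close> and Borel measurable on the whole space, while it represents the differential
  only near a compact set and for small r.\<close>

definition smoothed_form :: "'b set => 'a => real => 'b => 'a => real" where
 "smoothed_form B v r b x =
  (1 / r) * representation B ((LINT ze|mu. XE v ze *R ft (mm x (dl r (- ze)))) -
   T.area (LINT ze|mu. et ze *R ft (mm x (dl r (- ze)))) (LINT ze|mu. XE v ze *R ft (mm x (dl r (- ze))))) b"

lemma DH_smoothed_form:
 assumes B: "adapted_basis H B" and K: "compact K" "K <= Om" and v: "v : layer G 1"
 shows "\<exists>r0>0. ALL r x. 0 < r --> r <= r0 --> x : K -->
  (ALL b. DH G H B (group_conv G mu f (mollifier G et r)) v x b = smoothed_form B v r b x)"
proof -
 obtain r0 where r0: "0 < r0" and c: "!!r x. 0 < r ==> r <= r0 ==> x : K ==>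
  group_conv G mu f (mollifier G et r) x = (LINT ze|mu. et ze *R ft (mm x (dl r (- ze))))"
  "!!r x. 0 < r ==> r <= r0 ==> x : K ==> lie_deriv G v (group_conv G mu f (mollifier G et r)) x =
   (1 / r) *R (LINT ze|mu. XE v ze *R ft (mm x (dl r (- ze))))"
  using conv_near[OF K] v by blast
 have "DH G H B (group_conv G mu f (mollifier G et r)) v x b = smoothed_form B v r b x"
  if r: "0 < r" "r <= r0" "x : K" for r x b
 proof -
  define p \<xi> where "p = (LINT ze|mu. et ze *R ft (mm x (dl r (- ze))))"
   and "\<xi> = (LINT ze|mu. XE v ze *R ft (mm x (dl r (- ze))))"
  have "(1 / r) *R \<xi> - T.area p ((1 / r) *R \<xi>) = (1 / r) *R (\<xi> - T.area p \<xi>)"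
   by (simp only: T.area_simps scaleR_diff_right)
  then show ?thesis
   unfolding DH_def T.coframe_area c[OF r] p_def[symmetric] \<xi>_def[symmetric] smoothed_form_def
   using linear_cmul[OF T.linear_representation[OF B, of b], of "1 / r" "\<xi> - T.area p \<xi>"] by simp
 qed
 then show ?thesis using r0 by blast
qed

lemma measurable_smoothed_form:
 assumes B: "adapted_basis H B"
 shows "smoothed_form B v r b : BM"
proof -
 have [measurable]: "(%x. representation B x b) : BM"
  by (intro borel_measurable_continuous_onI linear_continuous_on T.bounded_linear_representation[OF B])
 have c: "continuous_on UNIV (%x. T.area (fst x) (snd x))"
  by (intro bounded_bilinear.continuous_on[OF T.bounded_bilinear_area] continuous_intros)
 have a: "(%x. T.area (P x) (X x)) : BM"
  if "P : BM" "X : BM" for P X :: "'a => 'b"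
  using that c by (rule borel_measurable_continuous_Pair)
 have i: "(%x. LINT ze|mu. k ze *R ft (mm x (dl r (- ze)))) : BM"
  if [measurable]: "k : BM" for k
  by measurable
 note [measurable] = a[OF i[OF measurable_et] i[OF measurable_XE[of v]]] i[OF measurable_XE[of v]]
 show ?thesis unfolding smoothed_form_def[abs_def] by measurable
qed

text \<open>With p = q/2 the p-th power of a squared distance is its q-th power, of integral at most
  r^q times a constant. Against the factor r^(-p) from the derivative this leaves r^p.\<close>

lemma contact_vanishes:
 assumes B: "adapted_basis H B" and b: "b : B" "b : layer H 2" and K: "compact K" "K <= Om" and ep: "0 < ep"
 shows "\<exists>r1>0. ALL r. 0 < r --> r <= r1 -->
  (NN mu (%x. ind K x * en (abs (smoothed_form B v r b x) powr (q / 2)))) <= ennreal ep"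
proof -
 define p where "p = q / 2"
 have p: "1 <= p" using q by (simp add: p_def)
 have [measurable]: "K : sets borel" using K(1) by (rule borel_compact)
 obtain r0 where r0: "0 < r0" and ci: "!!r x. 0 < r ==> r <= r0 ==> x : K ==>
  integrable mu (%ze. ind (cball 0 rh) ze *R ft (mm x (dl r (- ze))))"
  using conv_near[OF K] by blast
 obtain r2 A where r2: "0 < r2" and A: "A < \<infinity>"
  and md: "!!r ze. 0 < r ==> r <= r2 ==> norm ze <= rh ==>
  (NN mu (%x. ind K x * en (T.d (ft x) (ft (mm x (dl r ze))) powr q))) <= en (r powr q) * A"
 proof -
  have "q : {1..q}" using q by auto
  with metric_difference_Lp[OF K] show ?thesis using that by (elim exE conjE) blast
 qed
 obtain A' where A': "A = ennreal A'" "0 <= A'" using A by (cases A) auto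
 obtain C where C: "0 <= C" and cb: "!!a Y. Y : BM ==> integrable mu (%z. ind (cball 0 rh) z *R Y z) ==>
  en (abs (representation B ((LINT z|mu. XE v z *R Y z) - T.area (LINT z|mu. et z *R Y z) (LINT z|mu. XE v z *R Y z)) b)) <=
  ennreal C * (NN mu (%z. ind (cball 0 rh) z * en ((T.d a (Y z))^2)))"
  using contact_bound[OF B b, of v] by blast
 define c where "c = C powr p * measure mu (cball 0 rh) powr p * A'"
 have c: "0 <= c" using A'(2) by (simp add: c_def)
 \<comment> \<open>\<open>r \<le> 1\<close> gives r^p <= r, and \<open>ep / (c + 1)\<close> makes c
   times r at most \<open>ep\<close>.\<close>
 define r1 where "r1 = min (min r0 r2) (min 1 (ep / (c + 1)))"
 have r1: "0 < r1" using r0 r2 c ep by (simp add: r1_def)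
 have "(NN mu (%x. ind K x * en (abs (smoothed_form B v r b x) powr p))) <= ennreal ep"
  if r: "0 < r" "r <= r1" for r
 proof -
  have rr: "r <= r0" "r <= r2" "r <= 1" "r <= ep / (c + 1)" using r by (auto simp: r1_def)
  define h where "h x ze = (T.d (ft x) (ft (mm x (dl r (- ze)))))^2" for x ze
  have "(NN mu (%x. ind K x * en (abs (smoothed_form B v r b x) powr p))) <=
   en ((C / r) powr p * measure mu (cball 0 rh) powr p) * (en (r powr q) * A)"
  proof (rule jensen_fubini[where h = h, OF _ _ _ p])
   show "(%z. h (fst z) (snd z)) : borel_measurable (mu \<Otimes>\<^sub>M mu)" unfolding h_def by measurable
   show "0 <= h x ze" for x ze by (simp add: h_def)
   show "0 <= C / r" using C r by simp
   fix x assume x: "x : K"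
   define Y where "Y ze = ft (mm x (dl r (- ze)))" for ze
   have [measurable]: "Y : BM" unfolding Y_def[abs_def] by measurable
   define R where "R = representation B ((LINT z|mu. XE v z *R Y z) - T.area (LINT z|mu. et z *R Y z) (LINT z|mu. XE v z *R Y z)) b"
   have "en (abs R) <= ennreal C * (NN mu (%z. ind (cball 0 rh) z * en ((T.d (ft x) (Y z))^2)))"
   unfolding R_def by (rule cb) (use ci[OF r(1) rr(1) x] in \<open>simp_all add: Y_def\<close>)
   then have "en (1 / r) * en (abs R) <= en (1 / r) * (ennreal C * (NN mu (%z. ind (cball 0 rh) z * en (h x z))))"
   by (intro mult_left_mono) (simp_all add: h_def Y_def)
   moreover have "abs (smoothed_form B v r b x) = (1 / r) * abs R"
   using r by (simp add: smoothed_form_def R_def Y_def abs_mult)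
   ultimately show "en (abs (smoothed_form B v r b x)) <= en (C / r) * (NN mu (%z. ind (cball 0 rh) z * en (h x z)))"
   using r C by (simp add: ennreal_mult[symmetric] mult.assoc[symmetric] mult.commute)
  next
   fix ze :: 'a assume ze: "norm ze <= rh"
   have "h x ze powr p = T.d (ft x) (ft (mm x (dl r (- ze)))) powr q" for x
   proof -
   have "(y^2) powr p = y powr q" if "0 <= y" for y :: real
   using powr_powr[of y 2 p] that by (simp add: p_def powr_numeral)
   then show ?thesis by (simp add: h_def)
   qed
   then show "(NN mu (%x. ind K x * en (h x ze powr p))) <= en (r powr q) * A"
   using md[of r "- ze"] r rr ze by simp
  qed simp
  also have "... = en ((C / r) powr p * measure mu (cball 0 rh) powr p * (r powr q * A'))"
   using A' by (simp add: ennreal_mult)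
  also have "(C / r) powr p * measure mu (cball 0 rh) powr p * (r powr q * A') = c * r powr p"
  proof -
   have "r powr q = r powr p * r powr p" by (simp add: p_def flip: powr_add)
   then show ?thesis using r C by (simp add: c_def powr_divide)
  qed
  also have "en (c * r powr p) <= ennreal ep"
  proof (rule ennreal_leI)
   have "r powr p <= r powr 1" using r rr(3) p by (intro powr_mono') auto
   then have "c * r powr p <= c * r" using c r by (intro mult_left_mono) auto
   also have "... <= (c + 1) * r" using r by simp
   also have "... <= ep" using rr(4) c by (simp add: field_simps)
   finally show "c * r powr p <= ep" .
  qed
  finally show ?thesis .
 qed
 then show ?thesis using r1 unfolding p_def by blast
qed

end

context sobolev_coordinate begin

text \<open>\<open>XE v\<close> has integral 0 and first moments \<open>- (v \<bullet> e)\<close>.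
  Subtracting the constant and linear parts of \<open>u\<close> at \<open>x\<close> therefore leaves
  \<open>XE v\<close> integrated against the first-order remainder, which is small in L^p uniformly
  in the direction.\<close>

lemma mollified_derivative:
 assumes K: "compact K" "K <= Om" and p: "1 <= p" "p <= q" and v: "v : layer G 1" and ep: "0 < ep"
 shows "\<exists>r1>0. ALL r. 0 < r --> r <= r1 -->
  (NN mu (%x. ind K x * en (abs ((1 / r) * l (LINT ze|mu. XE v ze *R ft (mm x (dl r (- ze)))) - grad x \<bullet> v) powr p))) <= ennreal ep"
proof -
 have [measurable]: "K : sets borel" using K(1) by (rule borel_compact)
 obtain r0 where r0: "0 < r0" and ci: "!!r x. 0 < r ==> r <= r0 ==> x : K ==>
  integrable mu (%ze. ind (cball 0 rh) ze *R ft (mm x (dl r (- ze))))"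
  using conv_near[OF K] by blast
 obtain M where M: "0 <= M" "!!z. abs (XE v z) <= M" using kernels_bounded[of v] by blast
 define c where "c = M powr p * measure mu (cball 0 rh) powr p"
 have c: "0 <= c" by (simp add: c_def)
 define ep' where "ep' = ep / (c + 1)"
 have ep': "0 < ep'" "c * ep' <= ep" using c ep by (auto simp: ep'_def field_simps)
 obtain r2 where r2: "0 < r2" and fo: "!!r ze. 0 < r ==> r <= r2 ==> norm ze <= rh ==>
  (NN mu (%x. ind K x * en (abs ((u (mm x (dl r ze)) - u x) / r - grad x \<bullet> ze) powr p))) <= ennreal ep'"
  using first_order[OF K p ep'(1)] by blast
 have "(NN mu (%x. ind K x * en (abs ((1 / r) * l (LINT ze|mu. XE v ze *R ft (mm x (dl r (- ze)))) - grad x \<bullet> v) powr p))) <= ennreal ep"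
  if r: "0 < r" "r <= min r0 r2" for r
 proof -
  define h where "h x ze = abs ((u (mm x (dl r (- ze))) - u x) / r - ind K x * (grad x \<bullet> (- ze)))" for x ze
  have "(NN mu (%x. ind K x * en (abs ((1 / r) * l (LINT ze|mu. XE v ze *R ft (mm x (dl r (- ze)))) - grad x \<bullet> v) powr p))) <=
   en (M powr p * measure mu (cball 0 rh) powr p) * ennreal ep'"
  proof (rule jensen_fubini[where h = h, OF _ _ _ p(1) M(1)])
   have mp: "(%x. ind K x * partial e x) : BM" if "e : E" for e
   using borel_measurable_integrable[OF integrable_partial[OF E(2)[OF that] K]] by simp
   have "(%z. ind K (fst z) * (grad (fst z) \<bullet> (- snd z))) : borel_measurable (mu \<Otimes>\<^sub>M mu)"
   proof -
   have "(%z. \<Sum>e\<in>E. (- snd z \<bullet> e) * (ind K (fst z) * partial e (fst z))) : borel_measurable (mu \<Otimes>\<^sub>M mu)"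
   proof (rule borel_measurable_sum)
   fix e assume "e : E"
   note [measurable] = mp[OF this]
   show "(%z. (- snd z \<bullet> e) * (ind K (fst z) * partial e (fst z))) : borel_measurable (mu \<Otimes>\<^sub>M mu)" by measurable
   qed
   then show ?thesis by (simp add: grad_inner sum_distrib_left sum_negf mult_ac)
   qed
   then show "(%z. h (fst z) (snd z)) : borel_measurable (mu \<Otimes>\<^sub>M mu)" unfolding h_def by measurable
   show "0 <= h x ze" for x ze by (simp add: h_def)
   fix x assume x: "x : K"
   define Y where "Y ze = ft (mm x (dl r (- ze)))" for ze
   have iY: "integrable mu (%z. ind (cball 0 rh) z *R Y z)" unfolding Y_def by (rule ci) (use r x in auto)
   note iLY = integrable_kernel[OF continuous_XE XE_zero iY]
   have lY: "l (LINT ze|mu. XE v ze *R Y ze) = (LINT ze|mu. XE v ze * l (Y ze))"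
   using integral_bounded_linear[OF linear_l iLY] linear_cmul[OF bounded_linear.linear[OF linear_l]] by simp
   have i1: "integrable mu (%ze. XE v ze * l (Y ze))"
   using integrable_bounded_linear[OF linear_l iLY] linear_cmul[OF bounded_linear.linear[OF linear_l]] by simp
   have i2: "integrable mu (XE v)" by (rule integrable_compact_support[OF continuous_XE compact_cball XE_zero])
   have i3: "integrable mu (%ze. XE v ze * (ze \<bullet> e))" for e
   by (rule integrable_compact_support[OF _ compact_cball, of _ 0 rh])
   (auto intro!: continuous_on_mult continuous_XE continuous_intros simp: XE_zero simp del: mem_cball)
   define F where "F ze = (1 / r) * (XE v ze * l (Y ze)) - (u x / r) * XE v ze + (\<Sum>e\<in>E. partial e x * (XE v ze * (ze \<bullet> e)))" for ze
   have iF: "integrable mu F" unfolding F_def[abs_def] using i1 i2 i3 by auto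
   have "(LINT ze|mu. F ze) = (1 / r) * l (LINT ze|mu. XE v ze *R Y ze) - grad x \<bullet> v"
   proof -
   have "(LINT ze|mu. F ze) = (1 / r) * (LINT ze|mu. XE v ze * l (Y ze)) - (u x / r) * (LINT ze|mu. XE v ze) +
   (\<Sum>e\<in>E. partial e x * (LINT ze|mu. XE v ze * (ze \<bullet> e)))"
   unfolding F_def using i1 i2 i3 by simp
   also have "(\<Sum>e\<in>E. partial e x * (LINT ze|mu. XE v ze * (ze \<bullet> e))) = - (grad x \<bullet> v)"
   unfolding grad_inner sum_negf[symmetric] by (rule sum.cong) (use integral_XE_coordinate[OF v] in auto)
   finally show ?thesis by (simp add: integral_XE lY)
   qed
   moreover have "en (abs (LINT ze|mu. F ze)) <= ennreal M * (NN mu (%ze. ind (cball 0 rh) ze * en (h x ze)))"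
   proof -
   have [measurable]: "Y : BM" "l : BM"
   unfolding Y_def[abs_def] by (measurable, intro borel_measurable_continuous_onI linear_continuous_on linear_l)
   have [measurable]: "h x : BM" unfolding h_def[abs_def] by measurable
   have [measurable]: "cball (0::'a) rh : sets borel" by (simp add: borel_closed)
   have "en (abs (LINT ze|mu. F ze)) <= (NN mu (%ze. ennreal (norm (F ze))))"
   using integral_norm_bound_ennreal[OF iF] by simp
   also have "... <= (NN mu (%ze. ennreal M * (ind (cball 0 rh) ze * en (h x ze))))"
   proof (rule nn_integral_mono)
   fix ze
   have "F ze = XE v ze * ((u (mm x (dl r (- ze))) - u x) / r - ind K x * (grad x \<bullet> (- ze)))"
   using x by (simp add: F_def u_def Y_def grad_inner sum_negf sum_distrib_left algebra_simps diff_divide_distrib)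
   then have Fh: "norm (F ze) = abs (XE v ze) * h x ze" by (simp add: h_def abs_mult)
   show "en (norm (F ze)) <= ennreal M * (ind (cball 0 rh) ze * en (h x ze))"
   proof (cases "ze : cball 0 rh")
   case True
   have "abs (XE v ze) * h x ze <= M * h x ze" using M(2) by (intro mult_right_mono) (auto simp: h_def)
   then show ?thesis using True M(1) unfolding Fh by (simp add: ennreal_mult[symmetric] h_def ennreal_leI)
   next
   case False
   have "norm (F ze) = 0" unfolding Fh using XE_zero[OF False] by simp
   then show ?thesis by simp
   qed
   qed
   also have "... = ennreal M * (NN mu (%ze. ind (cball 0 rh) ze * en (h x ze)))"
   by (rule nn_integral_cmult) measurable
   finally show ?thesis .
   qed
   ultimately show "en (abs ((1 / r) * l (LINT ze|mu. XE v ze *R ft (mm x (dl r (- ze)))) - grad x \<bullet> v)) <=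
   ennreal M * (NN mu (%ze. ind (cball 0 rh) ze * en (h x ze)))"
   unfolding Y_def by simp
  next
   fix ze :: 'a assume ze: "norm ze <= rh"
   have "(NN mu (%x. ind K x * en (h x ze powr p))) =
   (NN mu (%x. ind K x * en (abs ((u (mm x (dl r (- ze))) - u x) / r - grad x \<bullet> (- ze)) powr p)))"
   by (rule nn_integral_cong) (auto simp: h_def indicator_def)
   also have "... <= ennreal ep'" using fo[of r "- ze"] r ze by simp
   finally show "(NN mu (%x. ind K x * en (h x ze powr p))) <= ennreal ep'" .
  qed simp
  also have "... = en (c * ep')" using c ep' by (simp add: c_def ennreal_mult)
  also have "... <= ennreal ep" by (rule ennreal_leI[OF ep'(2)])
  finally show ?thesis .
 qed
 then show ?thesis using r0 r2 by (intro exI[of _ "min r0 r2"]) auto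
qed

end

section \<open>Convergence of the components\<close>

context sobolev_map begin

text \<open>First-layer coordinates vanish on the values of \<open>area\<close>, so this component
  of the form is the derivative of a convolved Lipschitz coordinate. One \<open>w\<close> is
  obtained for all compact sets.\<close>

lemma first_layer_derivative:
 assumes B: "adapted_basis H B" and b: "b : B" "b : layer H 1" and v: "v : layer G 1"
 shows "EX w. weak_deriv G mu Om v (%x. representation B (f x) b) w &
  (ALL K. compact K --> K <= Om --> Lp_mass (q / 2) (%x. ind K x * w x) < \<infinity> &
   (\<forall>ep>0. \<exists>r1>0. ALL r. 0 < r --> r <= r1 -->
   (NN mu (%x. ind K x * en (abs (smoothed_form B v r b x - w x) powr (q / 2)))) <= ennreal ep))"
proof -
 define l where "l y = representation B y b" for y
 have bl: "bounded_linear l" unfolding l_def[abs_def] by (rule T.bounded_linear_representation[OF B])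
 obtain L where L: "0 <= L" "!!p p'. abs (l p - l p') <= L * T.d p p'"
  using T.coordinate_lipschitz[OF B b] unfolding l_def by blast
 interpret c: sobolev_coordinate G mu et H Om q f l L
  by (rule sobolev_coordinate.intro[OF sobolev_map_axioms sobolev_coordinate_axioms.intro[OF bl L]])
 have pq: "1 <= q / 2" "q / 2 <= q" using q by auto
 have area0: "l (T.area x y) = 0" for x y
  using T.representation_proj[OF B, of 1 b "T.area x y"] b T.proj_area linear_0[OF T.linear_representation[OF B, of b]]
  by (simp add: l_def)
 have sf: "smoothed_form B v r b x = (1 / r) * l (LINT ze|mu. XE v ze *R ft (mm x (dl r (- ze))))" for r x
  unfolding smoothed_form_def l_def[symmetric] linear_diff[OF bounded_linear.linear[OF bl]] area0 by simp
 have wd: "weak_deriv G mu Om v (%x. representation B (f x) b) (%x. c.grad x \<bullet> v)"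
 proof -
  have "weak_deriv G mu Om v c.u (%x. c.grad x \<bullet> v) \<longleftrightarrow> weak_deriv G mu Om v (%x. representation B (f x) b) (%x. c.grad x \<bullet> v)"
   by (rule weak_deriv_cong_on) (simp add: c.u_def l_def ft_eq)
  then show ?thesis using c.weak_deriv_grad[OF v] by simp
 qed
 moreover have "Lp_mass (q / 2) (%x. ind K x * (c.grad x \<bullet> v)) < \<infinity>" if K: "compact K" "K <= Om" for K
 proof -
  have mp: "(%x. ind K x * c.partial e x) : BM" if "e : c.E" for e
   using borel_measurable_integrable[OF c.integrable_partial[OF c.E(2)[OF that] K]] by simp
  have "Lp_mass (q / 2) (%x. ind K x * (c.grad x \<bullet> v)) <=
   (NN mu (%x. (\<Sum>e\<in>c.E. ennreal ((real (card c.E) * abs (v \<bullet> e)) powr (q / 2)) * en (abs (ind K x * c.partial e x) powr (q / 2)))))"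
   unfolding Lp_mass_def
  proof (rule nn_integral_mono)
   fix x
   define a where "a e = abs (v \<bullet> e) * abs (ind K x * c.partial e x)" for e
   have "abs (ind K x * (c.grad x \<bullet> v)) <= (\<Sum>e\<in>c.E. a e)"
   proof -
   have "ind K x * (c.grad x \<bullet> v) = (\<Sum>e\<in>c.E. (v \<bullet> e) * (ind K x * c.partial e x))"
   by (simp add: c.grad_inner sum_distrib_left mult_ac)
   also have "abs ... <= (\<Sum>e\<in>c.E. a e)"
   unfolding a_def abs_mult[symmetric] by (rule sum_abs)
   finally show ?thesis .
   qed
   then have "abs (ind K x * (c.grad x \<bullet> v)) powr (q / 2) <= (\<Sum>e\<in>c.E. a e) powr (q / 2)"
   using pq by (intro powr_mono2) auto
   also have "... <= real (card c.E) powr (q / 2) * (\<Sum>e\<in>c.E. a e powr (q / 2))"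
   using pq by (intro sum_powr_le c.E(1)) (auto simp: a_def)
   also have "... = (\<Sum>e\<in>c.E. (real (card c.E) * abs (v \<bullet> e)) powr (q / 2) * abs (ind K x * c.partial e x) powr (q / 2))"
   by (simp add: a_def powr_mult sum_distrib_left mult.assoc)
   finally have "en (abs (ind K x * (c.grad x \<bullet> v)) powr (q / 2)) <=
   en (\<Sum>e\<in>c.E. (real (card c.E) * abs (v \<bullet> e)) powr (q / 2) * abs (ind K x * c.partial e x) powr (q / 2))"
   by (rule ennreal_leI)
   also have "... = (\<Sum>e\<in>c.E. ennreal ((real (card c.E) * abs (v \<bullet> e)) powr (q / 2)) * en (abs (ind K x * c.partial e x) powr (q / 2)))"
   by (subst sum_ennreal[symmetric]) (simp_all only: ennreal_mult powr_ge_zero mult_nonneg_nonneg)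
   finally show "en (abs (ind K x * (c.grad x \<bullet> v)) powr (q / 2)) <= ..." .
  qed
  also have "... = (\<Sum>e\<in>c.E. ennreal ((real (card c.E) * abs (v \<bullet> e)) powr (q / 2)) * Lp_mass (q / 2) (%x. ind K x * c.partial e x))"
  proof -
   have me: "(%x. ennreal (abs (ind K x * c.partial e x) powr (q / 2))) : borel_measurable mu" if "e : c.E" for e
   proof -
   note [measurable] = mp[OF that]
   show ?thesis by measurable
   qed
   have "(NN mu (%x. (\<Sum>e\<in>c.E. ennreal ((real (card c.E) * abs (v \<bullet> e)) powr (q / 2)) * en (abs (ind K x * c.partial e x) powr (q / 2))))) =
   (\<Sum>e\<in>c.E. NN mu (%x. ennreal ((real (card c.E) * abs (v \<bullet> e)) powr (q / 2)) * en (abs (ind K x * c.partial e x) powr (q / 2))))"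
   by (rule nn_integral_sum) (rule borel_measurable_times_ennreal[OF borel_measurable_const me])
   also have "... = (\<Sum>e\<in>c.E. ennreal ((real (card c.E) * abs (v \<bullet> e)) powr (q / 2)) * Lp_mass (q / 2) (%x. ind K x * c.partial e x))"
   unfolding Lp_mass_def by (rule sum.cong[OF refl], rule nn_integral_cmult, rule me)
   finally show ?thesis .
  qed
  also have "... < \<infinity>"
  proof -
   have "en ((real (card c.E) * abs (v \<bullet> e)) powr (q / 2)) * Lp_mass (q / 2) (%x. ind K x * c.partial e x) < \<infinity>"
   if "e : c.E" for e
   using c.Lp_mass_partial[OF c.E(2)[OF that] K pq] by (simp add: ennreal_mult_less_top)
   then show ?thesis using ennreal_sum_less_top[OF c.E(1)] by simp
  qed
  finally show ?thesis .
 qed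
 moreover have "\<exists>r1>0. ALL r. 0 < r --> r <= r1 -->
   (NN mu (%x. ind K x * en (abs (smoothed_form B v r b x - c.grad x \<bullet> v) powr (q / 2)))) <= ennreal ep"
  if "compact K" "K <= Om" "0 < ep" for K ep
  unfolding sf by (rule c.mollified_derivative[OF that(1,2) pq v that(3)])
 ultimately show ?thesis by (intro exI[of _ "%x. c.grad x \<bullet> v"]) auto
qed

lemma weak_DH_exists:
 assumes B: "adapted_basis H B" and v: "v : layer G 1"
 shows "EX D. weak_DH G mu H B Om f v D"
proof -
 have "\<forall>b\<in>B \<inter> layer H 1. EX w. weak_deriv G mu Om v (%x. representation B (f x) b) w"
  using first_layer_derivative[OF B _ _ v] by blast
 from bchoice[OF this] obtain W where W: "!!b. b : B \<inter> layer H 1 ==> weak_deriv G mu Om v (%x. representation B (f x) b) (W b)"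
  by blast
 define D where "D x b = (if b : layer H 1 then W b x else 0)" for x b
 have "weak_DH G mu H B Om f v D"
  unfolding weak_DH_def
 proof (intro conjI ballI)
  fix b assume b: "b : B \<inter> layer H 1"
  then have "(%x. D x b) = W b" by (simp add: D_def fun_eq_iff)
  then show "weak_deriv G mu Om v (%x. representation B (f x) b) (%x. D x b)" using W[OF b] by simp
 next
  fix b x assume b: "b : B \<inter> layer H 2"
  then have "b \<notin> layer H 1" using T.adapted_layers_disjoint[OF B, of b 2 1] by auto
  then show "D x b = 0" by (simp add: D_def)
 qed
 then show ?thesis by blast
qed

text \<open>An arbitrary representative \<open>D\<close> agrees almost everywhere with the
  constructed derivative in the first layer, by uniqueness of weak derivatives. In the second layer
  it is 0 on \<open>Om\<close>, and the contact estimate applies.\<close>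

lemma component_convergence:
 assumes B: "adapted_basis H B" and v: "v : layer G 1" and D: "weak_DH G mu H B Om f v D"
  and K: "compact K" "K <= Om" and b: "b : B"
 shows "(%x. ind K x * D x b) : BM"
  and "Lp_mass (q / 2) (%x. ind K x * D x b) < \<infinity>"
  and "0 < ep ==> \<exists>r1>0. ALL r. 0 < r --> r <= r1 -->
   (NN mu (%x. ind K x * en (abs (smoothed_form B v r b x - D x b) powr (q / 2)))) <= ennreal ep"
proof -
 have q2: "0 < q / 2" using q by simp
 have "b : layer H 1 \<or> b : layer H 2"
 proof -
  have "b : (\<Union>k\<in>{1..step H}. layer H k)" using B b by (auto simp: adapted_basis_def)
  then obtain k where "1 <= k" "k <= 2" "b : layer H k" by (auto simp: T.step2)
  moreover from this have "k = 1 \<or> k = 2" by linarith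
  ultimately show ?thesis by auto
 qed
 then have "(%x. ind K x * D x b) : BM &
  Lp_mass (q / 2) (%x. ind K x * D x b) < \<infinity> &
  (0 < ep --> (\<exists>r1>0. ALL r. 0 < r --> r <= r1 -->
   (NN mu (%x. ind K x * en (abs (smoothed_form B v r b x - D x b) powr (q / 2)))) <= ennreal ep))"
 proof
  assume b1: "b : layer H 1"
  then have wD: "weak_deriv G mu Om v (%x. representation B (f x) b) (%x. D x b)" using D b by (simp add: weak_DH_def)
  obtain w where w1: "weak_deriv G mu Om v (%x. representation B (f x) b) w"
   and wK: "ALL K. compact K --> K <= Om --> Lp_mass (q / 2) (%x. ind K x * w x) < \<infinity> &
   (\<forall>ep>0. \<exists>r1>0. ALL r. 0 < r --> r <= r1 -->
   (NN mu (%x. ind K x * en (abs (smoothed_form B v r b x - w x) powr (q / 2)))) <= ennreal ep)"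
   using first_layer_derivative[OF B b b1 v] by (elim exE conjE) (rule that)
  note w = w1 conjunct1[OF spec[OF wK, of K, THEN mp, OF K(1), THEN mp, OF K(2)]]
   spec[OF conjunct2[OF spec[OF wK, of K, THEN mp, OF K(1), THEN mp, OF K(2)]], of ep]
  have ae: "AE x in mu. x : Om --> D x b = w x" by (rule weak_deriv_unique[OF open_Om wD w(1)])
  have "integrable mu (%x. ind K x * D x b)"
   using wD measurable_set_integrable_loc[OF _ K, of "%x. D x b"] by (simp add: weak_deriv_def)
  then have "(%x. ind K x * D x b) : BM" using borel_measurable_integrable by fastforce
  moreover have "Lp_mass (q / 2) (%x. ind K x * D x b) = Lp_mass (q / 2) (%x. ind K x * w x)"
   unfolding Lp_mass_def
   by (rule nn_integral_cong_AE, rule AE_mp[OF ae]) (use K(2) in \<open>auto simp: indicator_def\<close>)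
  moreover have "(NN mu (%x. ind K x * en (abs (smoothed_form B v r b x - D x b) powr (q / 2)))) =
   (NN mu (%x. ind K x * en (abs (smoothed_form B v r b x - w x) powr (q / 2))))" for r
   by (rule nn_integral_cong_AE, rule AE_mp[OF ae]) (use K(2) in \<open>auto simp: indicator_def\<close>)
  ultimately show ?thesis using w(2,3) by simp
 next
  assume b2: "b : layer H 2"
  then have D0: "D x b = 0" if "x : Om" for x using D b that by (simp add: weak_DH_def)
  have z: "ind K x * D x b = 0" for x using D0[of x] K(2) by (auto simp: indicator_def)
  have "(NN mu (%x. ind K x * en (abs (smoothed_form B v r b x - D x b) powr (q / 2)))) =
   (NN mu (%x. ind K x * en (abs (smoothed_form B v r b x) powr (q / 2))))" for r
   by (rule nn_integral_cong) (use D0 K(2) in \<open>auto simp: indicator_def\<close>)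
  then show ?thesis using contact_vanishes[OF B b b2 K, of ep v] by (simp add: z Lp_mass_def)
 qed
 then show "(%x. ind K x * D x b) : BM"
  and "Lp_mass (q / 2) (%x. ind K x * D x b) < \<infinity>"
  and "0 < ep ==> \<exists>r1>0. ALL r. 0 < r --> r <= r1 -->
   (NN mu (%x. ind K x * en (abs (smoothed_form B v r b x - D x b) powr (q / 2)))) <= ennreal ep"
  by blast+
qed

lemma Lp_onI:
 assumes K: "K : sets borel" and m: "(%x. ind K x * u x) : BM"
  and fin: "Lp_mass p (%x. ind K x * u x) < \<infinity>" and p: "0 < p"
 shows "Lp_on mu p K u"
proof -
 have e: "ind K x *R (abs (u x)) powr p = abs (ind K x * u x) powr p" for x
  using p by (auto simp: indicator_def)
 show ?thesis unfolding Lp_on_def set_borel_measurable_def set_integrable_def e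
 proof
  show "(%x. ind K x *R u x) : borel_measurable mu" using m by simp
  show "integrable mu (%x. abs (ind K x * u x) powr p)"
   by (rule integrableI_bounded) (use m fin in \<open>simp_all add: Lp_mass_def\<close>)
 qed
qed

theorem DH_convergence:
 assumes B: "adapted_basis H B" and v: "v : layer G 1" and D: "weak_DH G mu H B Om f v D"
 shows "Lp_loc_tendsto mu (q / 2) Om B (%ep. DH G H B (group_conv G mu f (mollifier G et ep)) v) D (at_right 0)"
 unfolding Lp_loc_tendsto_def
proof (intro allI impI conjI, goal_cases)
 have q2: "0 < q / 2" using q by simp
 have fB: "finite B" by (rule T.adapted_finite[OF B])
 {
  case (1 K)
  then have K: "compact K" "K <= Om" by auto
  then show ?case using component_convergence(1,2)[OF B v D K] q2 by (auto intro!: Lp_onI borel_compact)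
 next
  case (2 K)
  then have K: "compact K" "K <= Om" by auto
  have [measurable]: "K : sets borel" using K(1) by (rule borel_compact)
  obtain r0 where r0: "0 < r0" and DH: "!!r x b. 0 < r ==> r <= r0 ==> x : K ==>
   DH G H B (group_conv G mu f (mollifier G et r)) v x b = smoothed_form B v r b x"
   using DH_smoothed_form[OF B K v] by blast
  have "\<forall>\<^sub>F r in at_right 0. Lp_on mu (q / 2) K (%x. DH G H B (group_conv G mu f (mollifier G et r)) v x b)" if b: "b : B" for b
  proof -
   note cc = component_convergence[OF B v D K b]
   note [measurable] = cc(1) measurable_smoothed_form[OF B]
   obtain r1 where r1: "0 < r1" and c: "!!r. 0 < r ==> r <= r1 ==>
   (NN mu (%x. ind K x * en (abs (smoothed_form B v r b x - D x b) powr (q / 2)))) <= ennreal 1"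
   using cc(3)[of 1] by auto
   have "Lp_on mu (q / 2) K (%x. DH G H B (group_conv G mu f (mollifier G et r)) v x b)"
   if r: "0 < r" "r < min r0 r1" for r
   proof (rule Lp_onI[OF _ _ _ q2])
   have e: "(%x. ind K x * DH G H B (group_conv G mu f (mollifier G et r)) v x b) =
   (%x. ind K x * smoothed_form B v r b x)"
   using DH[of r] r by (auto simp: indicator_def fun_eq_iff)
   show "(%x. ind K x * DH G H B (group_conv G mu f (mollifier G et r)) v x b) : BM"
   unfolding e by measurable
   \<comment> \<open>Finiteness is inherited from \<open>D\<close>, to which the smoothed form is
     close.\<close>
   have "Lp_mass (q / 2) (%x. ind K x * smoothed_form B v r b x) =
   Lp_mass (q / 2) (%x. (ind K x * smoothed_form B v r b x - ind K x * D x b) + ind K x * D x b)" by simp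
   also have "... <= en (2 powr (q / 2)) * (Lp_mass (q / 2) (%x. ind K x * smoothed_form B v r b x - ind K x * D x b) +
   Lp_mass (q / 2) (%x. ind K x * D x b))"
   by (rule Lp_mass_add) (use q2 in \<open>measurable, simp\<close>)
   also have "Lp_mass (q / 2) (%x. ind K x * smoothed_form B v r b x - ind K x * D x b) =
   (NN mu (%x. ind K x * en (abs (smoothed_form B v r b x - D x b) powr (q / 2))))"
   unfolding Lp_mass_def by (rule nn_integral_cong) (auto simp: indicator_def)
   also have "en (2 powr (q / 2)) * ((NN mu (%x. ind K x * en (abs (smoothed_form B v r b x - D x b) powr (q / 2)))) +
   Lp_mass (q / 2) (%x. ind K x * D x b)) < \<infinity>"
   proof -
   have "(NN mu (%x. ind K x * en (abs (smoothed_form B v r b x - D x b) powr (q / 2)))) < \<infinity>"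
   by (rule le_less_trans[OF c]) (use r in auto)
   then show ?thesis using cc(2) by (simp add: ennreal_mult_less_top)
   qed
   finally show "Lp_mass (q / 2) (%x. ind K x * DH G H B (group_conv G mu f (mollifier G et r)) v x b) < \<infinity>"
   unfolding e .
   qed simp
   then show ?thesis unfolding eventually_at_right_field using r0 r1 by (intro exI[of _ "min r0 r1"]) auto
  qed
  then show ?case using fB by (intro eventually_ball_finite) auto
 next
  case (3 K)
  then have K: "compact K" "K <= Om" by auto
  have [measurable]: "K : sets borel" using K(1) by (rule borel_compact)
  obtain r0 where r0: "0 < r0" and DH: "!!r x b. 0 < r ==> r <= r0 ==> x : K ==>
   DH G H B (group_conv G mu f (mollifier G et r)) v x b = smoothed_form B v r b x"
   using DH_smoothed_form[OF B K v] by blast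
  define \<Theta> where "\<Theta> r = (LINT x:K|mu. L2_set (%b. DH G H B (group_conv G mu f (mollifier G et r)) v x b - D x b) B powr (q / 2))" for r
  have "(\<Theta> \<longlongrightarrow> 0) (at_right 0)"
  proof (rule tendstoI)
   fix ep :: real assume ep: "0 < ep"
   define c where "c = real (card B) powr (q / 2) * real (card B)"
   have c: "0 <= c" by (simp add: c_def)
   \<comment> \<open>\<open>c\<close> collects the power of a sum over \<open>B\<close> and the
     number of components; the factor 2 makes the final inequality strict.\<close>
   define ep' where "ep' = ep / (2 * (c + 1))"
   have ep': "0 < ep'" "c * ep' < ep"
   proof -
   show pos: "0 < ep'" using c ep by (simp add: ep'_def)
   have "ep' * (2 * (c + 1)) = ep" using c by (simp add: ep'_def)
   moreover have "0 < ep' * (c + 2)" using pos c by simp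
   ultimately show "c * ep' < ep" by (simp add: algebra_simps)
   qed
   have "\<forall>\<^sub>F r in at_right 0. (NN mu (%x. ind K x * en (abs (smoothed_form B v r b x - D x b) powr (q / 2)))) <= ennreal ep'"
   if b: "b : B" for b
   proof -
   obtain r1 where "0 < r1" "!!r. 0 < r ==> r <= r1 ==>
   (NN mu (%x. ind K x * en (abs (smoothed_form B v r b x - D x b) powr (q / 2)))) <= ennreal ep'"
   using component_convergence(3)[OF B v D K b ep'(1)] by blast
   then show ?thesis unfolding eventually_at_right_field by (intro exI[of _ r1]) auto
   qed
   then have "\<forall>\<^sub>F r in at_right 0. \<forall>b\<in>B. (NN mu (%x. ind K x * en (abs (smoothed_form B v r b x - D x b) powr (q / 2)))) <= ennreal ep'"
   using fB by (intro eventually_ball_finite) auto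
   moreover have "\<forall>\<^sub>F r in at_right 0. 0 < r & r <= r0"
   unfolding eventually_at_right_field using r0 by (intro exI[of _ r0]) auto
   ultimately show "\<forall>\<^sub>F r in at_right 0. dist (\<Theta> r) 0 < ep"
   proof eventually_elim
   case (elim r)
   have me: "(%x. ind K x * en (abs (smoothed_form B v r b x - D x b) powr (q / 2))) : borel_measurable mu" if b: "b : B" for b
   proof -
   note [measurable] = component_convergence(1)[OF B v D K b] measurable_smoothed_form[OF B]
   have "(%x. ennreal (abs (ind K x * smoothed_form B v r b x - ind K x * D x b) powr (q / 2))) : borel_measurable mu"
   by measurable
   moreover have "en (abs (ind K x * smoothed_form B v r b x - ind K x * D x b) powr (q / 2)) =
   ind K x * en (abs (smoothed_form B v r b x - D x b) powr (q / 2))" for x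
   by (auto simp: indicator_def)
   ultimately show ?thesis by simp
   qed
   have "(NN mu (%x. ennreal (ind K x *R L2_set (%b. DH G H B (group_conv G mu f (mollifier G et r)) v x b - D x b) B powr (q / 2)))) <=
   (NN mu (%x. ennreal (real (card B) powr (q / 2)) * (\<Sum>b\<in>B. ind K x * en (abs (smoothed_form B v r b x - D x b) powr (q / 2)))))"
   proof (rule nn_integral_mono)
   fix x
   show "en (ind K x *R L2_set (%b. DH G H B (group_conv G mu f (mollifier G et r)) v x b - D x b) B powr (q / 2)) <=
   en (real (card B) powr (q / 2)) * (\<Sum>b\<in>B. ind K x * en (abs (smoothed_form B v r b x - D x b) powr (q / 2)))"
   proof (cases "x : K")
   case True
   have "L2_set (%b. smoothed_form B v r b x - D x b) B powr (q / 2) <= (\<Sum>b\<in>B. abs (smoothed_form B v r b x - D x b)) powr (q / 2)"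
   using q2 by (intro powr_mono2 L2_set_le_sum_abs) auto
   also have "... <= real (card B) powr (q / 2) * (\<Sum>b\<in>B. abs (smoothed_form B v r b x - D x b) powr (q / 2))"
   using q2 by (intro sum_powr_le fB) auto
   finally have "en (L2_set (%b. smoothed_form B v r b x - D x b) B powr (q / 2)) <=
   en (real (card B) powr (q / 2)) * (\<Sum>b\<in>B. ennreal (abs (smoothed_form B v r b x - D x b) powr (q / 2)))"
   by (simp add: ennreal_mult[symmetric] sum_nonneg ennreal_leI)
   then show ?thesis using True DH[of r x] elim by simp
   qed simp
   qed
   also have "... = en (real (card B) powr (q / 2)) * (\<Sum>b\<in>B. NN mu (%x. ind K x * en (abs (smoothed_form B v r b x - D x b) powr (q / 2))))"
   proof -
   have ms: "(%x. \<Sum>b\<in>B. ind K x * en (abs (smoothed_form B v r b x - D x b) powr (q / 2))) : borel_measurable mu"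
   using me by (intro borel_measurable_sum)
   show ?thesis by (subst nn_integral_cmult[OF ms], subst nn_integral_sum) (simp_all only: me)
   qed
   also have "... <= en (real (card B) powr (q / 2)) * (\<Sum>b\<in>B. ennreal ep')"
   using elim by (intro mult_left_mono sum_mono) auto
   also have "... = en (c * ep')"
   using ep'(1) by (simp add: c_def ennreal_mult ennreal_of_nat_eq_real_of_nat mult_ac)
   finally have "\<Theta> r <= c * ep'"
   unfolding \<Theta>_def set_lebesgue_integral_def using c ep'(1) by (intro integral_real_bounded) auto
   moreover have "0 <= \<Theta> r" unfolding \<Theta>_def set_lebesgue_integral_def
   by (intro Bochner_Integration.integral_nonneg) auto
   ultimately show ?case using ep'(2) by (simp add: dist_real_def)
   qed
  qed
  then show ?case by (simp only: \<Theta>_def[abs_def])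
 }
qed

end

theorem theorem3p1:
  fixes G1 :: "('a::euclidean_space) carnot" and G2 :: "('b::euclidean_space) carnot"
    and \<mu> :: "'a measure" and \<Omega> :: "'a set" and q :: real and f :: "'a \<Rightarrow> 'b"
    and \<eta> :: "'a \<Rightarrow> real" and B :: "'b set"
  assumes "carnot_group G1" and "haar_measure G1 \<mu>"
    and "carnot_group G2" and "step G2 = 2" and "adapted_basis G2 B"
    and "open \<Omega>" and "2 \<le> q" and "metric_sobolev G1 \<mu> G2 q \<Omega> f"
    and "smooth_on \<eta> UNIV" and "{x. \<eta> x \<noteq> 0} \<subseteq> cc_ball G1 0 1" and "(LINT x|\<mu>. \<eta> x) = 1"
  shows
    "(\<forall>x0 r \<epsilon>. cc_ball G1 x0 (2 * r) \<subseteq> \<Omega> \<and> 0 < \<epsilon> \<and> \<epsilon> < r \<longrightarrow>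
        (\<forall>x\<in>cc_ball G1 x0 r. integrable \<mu> (conv_integrand G1 f (mollifier G1 \<eta> \<epsilon>) x)) \<and>
        smooth_on (group_conv G1 \<mu> f (mollifier G1 \<eta> \<epsilon>)) (cc_ball G1 x0 r)) \<and>
     (\<forall>v\<in>layer G1 1.
        (\<exists>D. weak_DH G1 \<mu> G2 B \<Omega> f v D) \<and>
        (\<forall>D. weak_DH G1 \<mu> G2 B \<Omega> f v D \<longrightarrow>
           Lp_loc_tendsto \<mu> (q / 2) \<Omega> B
             (\<lambda>\<epsilon>. DH G1 G2 B (group_conv G1 \<mu> f (mollifier G1 \<eta> \<epsilon>)) v) D (at_right 0)))"
proof -
  have "carnot_haar G1 \<mu>" using assms(1,2) by (simp add: carnot_haar_def carnot_haar_axioms_def)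
  then have "carnot_mollifier G1 \<mu> \<eta>" using assms(9-11) by (simp add: carnot_mollifier_def carnot_mollifier_axioms_def)
  moreover have "step2_group G2" using assms(3,4) by (simp add: step2_group_def step2_group_axioms_def)
  ultimately have "sobolev_map G1 \<mu> \<eta> G2 \<Omega> q f" using assms(6-8) by (simp add: sobolev_map_def sobolev_map_axioms_def)
  then interpret sobolev_map G1 \<mu> \<eta> G2 \<Omega> q f .
  show ?thesis
  proof (intro conjI allI ballI impI; (elim conjE)?)
    show "integrable \<mu> (conv_integrand G1 f (mollifier G1 \<eta> \<epsilon>) x)"
      if "cc_ball G1 x0 (2 * r) \<subseteq> \<Omega>" "0 < \<epsilon>" "\<epsilon> < r" "x \<in> cc_ball G1 x0 r" for x0 r \<epsilon> x
      using that by (rule conv_cc_ball(1))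
    show "smooth_on (group_conv G1 \<mu> f (mollifier G1 \<eta> \<epsilon>)) (cc_ball G1 x0 r)"
      if "cc_ball G1 x0 (2 * r) \<subseteq> \<Omega>" "0 < \<epsilon>" "\<epsilon> < r" for x0 r \<epsilon>
      using that by (rule conv_cc_ball(2))
  qed (use weak_DH_exists[OF assms(5)] DH_convergence[OF assms(5)] in simp_all)
qed

end
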